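(* There exists an absolute constant $c$ such that for every odd prime power $q$ and every set $S$ of $q+2$ points in $\mathrm{PG}(2,q)$, the number of odd secants of $S$ satisfies $o(S)\geqslant 2q-c$.
   Context: $\mathrm{PG}(2,q)$ denotes the projective plane over the finite field $\mathbb{F}_q$ with $q$ elements. For a set $S$ of points of $\mathrm{PG}(2,q)$, an odd secant of $S$ is a line of $\mathrm{PG}(2,q)$ incident with an odd number of points of $S$, and $o(S)$ denotes the number of odd secants of $S$. *)

theory Defs
  imports
    "HOL-Algebra.Algebra"
    "HOL-Number_Theory.Prime_Powers"
    "HOL-Library.Countable_Set"
begin

(* The module F^3. The record type of modules extends that of rings, but a module makes no
   use of the multiplicative ring components, so they are left unspecified. *)
definition space3 :: "('a, 'm) ring_scheme \<Rightarrow> ('a, 'a \<times> 'a \<times> 'a) module" where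
  "space3 F =
    \<lparr>carrier = carrier F \<times> carrier F \<times> carrier F,
     monoid.mult = undefined,
     one = undefined,
     ring.zero = (\<zero>\<^bsub>F\<^esub>, \<zero>\<^bsub>F\<^esub>, \<zero>\<^bsub>F\<^esub>),
     ring.add = (\<lambda>(x, y, z) (x', y', z'). (x \<oplus>\<^bsub>F\<^esub> x', y \<oplus>\<^bsub>F\<^esub> y', z \<oplus>\<^bsub>F\<^esub> z')),
     module.smult = (\<lambda>a (x, y, z). (a \<otimes>\<^bsub>F\<^esub> x, a \<otimes>\<^bsub>F\<^esub> y, a \<otimes>\<^bsub>F\<^esub> z))\<rparr>"

lemma module_space3:
  assumes "field F"
  shows "module F (space3 F)"
proof -
  interpret F: field F by fact
  show ?thesis
  proof (rule moduleI)
    show "cring F" by (rule F.is_cring)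
    show "abelian_group (space3 F)"
    proof (rule abelian_groupI)
      fix v assume "v \<in> carrier (space3 F)"
      then obtain x y z where v: "v = (x, y, z)" "x \<in> carrier F" "y \<in> carrier F" "z \<in> carrier F"
        by (auto simp: space3_def)
      then show "\<exists>w \<in> carrier (space3 F). w \<oplus>\<^bsub>space3 F\<^esub> v = \<zero>\<^bsub>space3 F\<^esub>"
        by (intro bexI[of _ "(\<ominus>\<^bsub>F\<^esub> x, \<ominus>\<^bsub>F\<^esub> y, \<ominus>\<^bsub>F\<^esub> z)"]) (auto simp: space3_def F.l_neg)
    qed (auto simp: space3_def F.a_ac)
  qed (auto simp: space3_def F.l_distr F.r_distr F.m_assoc)
qed

(* Points and lines of the projective plane over F are the subspaces of F^3 of dimension 1
   and 2, given as sets of vectors, so that incidence is inclusion. *)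
definition pg2_points :: "('a, 'm) ring_scheme \<Rightarrow> ('a \<times> 'a \<times> 'a) set set" where
  "pg2_points F =
    {{a \<odot>\<^bsub>space3 F\<^esub> v | a. a \<in> carrier F} | v.
      v \<in> carrier (space3 F) \<and> v \<noteq> \<zero>\<^bsub>space3 F\<^esub>}"

definition lin_indep2 ::
    "('a, 'm) ring_scheme \<Rightarrow> 'a \<times> 'a \<times> 'a \<Rightarrow> 'a \<times> 'a \<times> 'a \<Rightarrow> bool" where
  "lin_indep2 F u v \<longleftrightarrow>
    (\<forall>a \<in> carrier F. \<forall>b \<in> carrier F.
      a \<odot>\<^bsub>space3 F\<^esub> u \<oplus>\<^bsub>space3 F\<^esub> b \<odot>\<^bsub>space3 F\<^esub> v = \<zero>\<^bsub>space3 F\<^esub>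
        \<longrightarrow> a = \<zero>\<^bsub>F\<^esub> \<and> b = \<zero>\<^bsub>F\<^esub>)"

definition pg2_lines :: "('a, 'm) ring_scheme \<Rightarrow> ('a \<times> 'a \<times> 'a) set set" where
  "pg2_lines F =
    {{a \<odot>\<^bsub>space3 F\<^esub> u \<oplus>\<^bsub>space3 F\<^esub> b \<odot>\<^bsub>space3 F\<^esub> v | a b. a \<in> carrier F \<and> b \<in> carrier F} | u v.
      u \<in> carrier (space3 F) \<and> v \<in> carrier (space3 F) \<and> lin_indep2 F u v}"

definition odd_secants ::
    "('a, 'm) ring_scheme \<Rightarrow> ('a \<times> 'a \<times> 'a) set set \<Rightarrow> ('a \<times> 'a \<times> 'a) set set" where
  "odd_secants F S = {l \<in> pg2_lines F. odd (card {P \<in> S. P \<subseteq> l})}"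

(* A constant that is uniform in F can only be stated for fields whose elements live in one
   fixed type. Natural numbers suffice, as every finite field has an isomorphic copy there. *)
lemma finite_field_nat_copy:
  assumes "field F" "finite (carrier F)"
  shows "\<exists>G :: nat ring. field G \<and> F \<simeq> G"
proof -
  interpret F: field F by fact
  have inj: "inj_on (to_nat_on (carrier F)) (carrier F)"
    by (rule inj_on_to_nat_on) (rule countable_finite[OF assms(2)])
  show ?thesis
    using F.inj_imp_image_ring_is_field[OF inj] inj_imp_image_ring_iso[OF inj]
    unfolding is_ring_iso_def by blast
qed

end

(* Suppose that the bound fails for every constant. A point P of S lies on a number of tangents that is
   the total excess of the secants through P meeting S in at least three points. Counting odd
   secants, a counterexample with large constant has many disjoint 3-secants, each containing a point that is
   on exactly one tangent, and Segre's lemma of tangents relates the tangent and the 3-secant at any three of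
   these points. In an ultraproduct of the counterexamples these points form an infinite configuration over
   a field. Specialising a generic point of this configuration along places shows that, after rescaling and
   passing to a subsequence, either the tangents or the 3-secants are the polars of the points with
   respect to a nondegenerate symmetric bilinear form, and that every point of S on few
   tangents lies on the conic of that form. Transferring this back, all but few points of S lie on a conic; every
   point off the conic lies on about q odd secants, which gives too many of them. *)
theory Submission
  imports
    Defs
    "HOL-Algebra.Algebraic_Closure_Type"
    "HOL-Library.Product_Plus"
    "HOL-Library.Ramsey"
    "HOL-Number_Theory.Residues"
begin

section \<open>Places\<close>

text \<open>The obstacle is a sign. After scaling, the ratios t_i(v_j) / t_j(v_i) and s_i(v_j) /
  s_j(v_i) are negatives of each other, which does not decide which family of lines behaves
  symmetrically. The comparison is made on triples: if s_i(v_j) s_j(v_k) s_k(v_i) equals a fixed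
  sign times the product in the opposite direction, for all triples, a rescaling makes one family
  symmetric and the other alternating. Ramsey's theorem makes the sign uniform once every infinite
  subconfiguration has a triple with a sign. So the heart is that a configuration without such
  triples cannot exist. There the ratios \<open>H b / H j\<close> at the generic point decide: if
  all are constants, \<open>t\<close> and \<open>s\<close> depend linearly on \<open>v\<close> up to
  factors, which forces a sign; if one is not, a place sends it to 0, and the residues are then so
  degenerate that this cannot happen for every \<open>b\<close>. The ultraproduct supplies the
  infinitely many points that Ramsey's theorem and a point on no line over the base field
  require.\<close>

definition field_hom :: "('a::field \<Rightarrow> 'b::field) \<Rightarrow> bool" where
  "field_hom h \<longleftrightarrow> h 1 = 1 \<and> (\<forall>x y. h (x + y) = h x + h y \<and> h (x * y) = h x * h y)"

lemma field_hom_simps: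
  assumes "field_hom h"
  shows "h 1 = 1" "h (x + y) = h x + h y" "h (x * y) = h x * h y" "h 0 = 0" "h (- x) = - h x"
    "h (x - y) = h x - h y" "h x = 0 \<longleftrightarrow> x = 0" "h x = h y \<longleftrightarrow> x = y"
proof -
  show 1: "h 1 = 1" using assms by (simp add: field_hom_def)
  show a: "h (x + y) = h x + h y" for x y using assms by (simp add: field_hom_def)
  show m: "h (x * y) = h x * h y" for x y using assms by (simp add: field_hom_def)
  show 0: "h 0 = 0" using a[of 0 0] by (metis add.right_neutral add_left_cancel)
  show n: "h (- x) = - h x" for x using a[of x "- x"] 0 by (metis add.inverse_unique add.right_inverse)
  show d: "h (x - y) = h x - h y" for x y using a[of x "- y"] n[of y] by simp
  have z: "h x \<noteq> 0" if "x \<noteq> 0" for x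
    using m[of x "inverse x"] 1 that by auto
  show "h x = 0 \<longleftrightarrow> x = 0" using z 0 by auto
  show "h x = h y \<longleftrightarrow> x = y" using z[of "x - y"] d[of x y] by auto
qed

text \<open>A partial ring homomorphism is represented by its graph, a subring of the product ring.\<close>

definition hom_graph :: "('a::field \<Rightarrow> 'b::field) \<Rightarrow> ('b \<times> 'a) set \<Rightarrow> bool" where
  "hom_graph h G \<longleftrightarrow> (\<forall>a. (h a, a) \<in> G) \<and>
     (\<forall>x y x' y'. (x, y) \<in> G \<longrightarrow> (x', y') \<in> G \<longrightarrow> (x + x', y + y') \<in> G \<and> (x * x', y * y') \<in> G) \<and>
     (\<forall>y. (0, y) \<in> G \<longrightarrow> y = 0)"

definition graph_polys :: "('b::field \<times> 'a::field) set \<Rightarrow> 'b poly \<Rightarrow> 'a poly \<Rightarrow> bool" where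
  "graph_polys G P Q \<longleftrightarrow> (\<forall>i. (coeff P i, coeff Q i) \<in> G)"

text \<open>The extension of the partial map that sends \<open>x\<close> to \<open>w\<close>.
  Whether it is single-valued is the question that \<open>hom_graph_adjoin\<close> settles.\<close>

definition graph_adjoin :: "('b::field \<times> 'a::field) set \<Rightarrow> 'b \<Rightarrow> 'a \<Rightarrow> ('b \<times> 'a) set" where
  "graph_adjoin G x w = {(poly P x, poly Q w) | P Q. graph_polys G P Q}"

context
  fixes h :: "'a::field \<Rightarrow> 'b::field" and G
  assumes h: "field_hom h" and G: "hom_graph h G"
begin

lemma graph_const: "(h a, a) \<in> G"
  and graph_add: "(x, y) \<in> G \<Longrightarrow> (x', y') \<in> G \<Longrightarrow> (x + x', y + y') \<in> G"
  and graph_mult: "(x, y) \<in> G \<Longrightarrow> (x', y') \<in> G \<Longrightarrow> (x * x', y * y') \<in> G"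
  and graph_zero_imp: "(0, y) \<in> G \<Longrightarrow> y = 0"
  using G by (auto simp: hom_graph_def)

lemma graph_0: "(0, 0) \<in> G" and graph_1: "(1, 1) \<in> G"
  using graph_const[of 0] graph_const[of 1] by (auto simp: field_hom_simps[OF h])

lemma graph_uminus: "(x, y) \<in> G \<Longrightarrow> (- x, - y) \<in> G"
  using graph_mult[OF graph_const[of "- 1"]] by (fastforce simp: field_hom_simps[OF h])

lemma graph_diff: "(x, y) \<in> G \<Longrightarrow> (x', y') \<in> G \<Longrightarrow> (x - x', y - y') \<in> G"
  using graph_add[OF _ graph_uminus] by fastforce

lemma graph_unique: "(x, y) \<in> G \<Longrightarrow> (x, y') \<in> G \<Longrightarrow> y = y'"
  using graph_diff graph_zero_imp by fastforce

lemma graph_power: "(x, y) \<in> G \<Longrightarrow> (x ^ n, y ^ n) \<in> G"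
  by (induction n) (auto intro: graph_1 graph_mult)

lemma graph_sum: "finite A \<Longrightarrow> (\<And>i. i \<in> A \<Longrightarrow> (f i, g i) \<in> G) \<Longrightarrow> (sum f A, sum g A) \<in> G"
  by (induction A rule: finite_induct) (auto intro: graph_0 graph_add)

lemma graph_polys_const: "(a, b) \<in> G \<Longrightarrow> graph_polys G [:a:] [:b:]"
  by (auto simp: graph_polys_def coeff_pCons graph_0 split: nat.split)

lemma graph_polys_add: "graph_polys G P Q \<Longrightarrow> graph_polys G P' Q' \<Longrightarrow> graph_polys G (P + P') (Q + Q')"
  by (auto simp: graph_polys_def intro: graph_add)

lemma graph_polys_diff: "graph_polys G P Q \<Longrightarrow> graph_polys G P' Q' \<Longrightarrow> graph_polys G (P - P') (Q - Q')"
  by (auto simp: graph_polys_def intro: graph_diff)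

lemma graph_polys_mult: "graph_polys G P Q \<Longrightarrow> graph_polys G P' Q' \<Longrightarrow> graph_polys G (P * P') (Q * Q')"
  by (auto simp: graph_polys_def coeff_mult intro!: graph_sum graph_mult)

lemma graph_polys_map: "graph_polys G (map_poly h R) R"
  by (auto simp: graph_polys_def coeff_map_poly field_hom_simps[OF h] graph_const)

lemma graph_adjoin_mono: "G \<subseteq> graph_adjoin G x w"
proof
  fix p assume "p \<in> G"
  then have "graph_polys G [:fst p:] [:snd p:]" by (intro graph_polys_const) auto
  then show "p \<in> graph_adjoin G x w"
    unfolding graph_adjoin_def by (auto intro!: exI[of _ "[:fst p:]"] exI[of _ "[:snd p:]"])
qed

lemma graph_adjoin_mem: "(x, w) \<in> graph_adjoin G x w"
proof -
  have "graph_polys G [:0, 1:] [:0, 1:]"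
    by (auto simp: graph_polys_def coeff_pCons graph_0 graph_1 split: nat.split)
  then show ?thesis
    unfolding graph_adjoin_def by (auto intro!: exI[of _ "[:0, 1:]"])
qed

text \<open>Only single-valuedness is at stake: a pair (0, y) in the new graph comes from a pair of
  polynomials with \<open>P\<close> vanishing at \<open>x\<close>.\<close>

lemma hom_graph_adjoin:
  assumes "\<And>P Q. graph_polys G P Q \<Longrightarrow> poly P x = 0 \<Longrightarrow> poly Q w = 0"
  shows "hom_graph h (graph_adjoin G x w)"
  unfolding hom_graph_def
proof (intro conjI allI impI)
  show "(h a, a) \<in> graph_adjoin G x w" for a using graph_adjoin_mono graph_const by blast
next
  fix y assume "(0, y) \<in> graph_adjoin G x w"
  then show "y = 0" using assms by (auto simp: graph_adjoin_def)
next
  fix a b a' b' assume "(a, b) \<in> graph_adjoin G x w" "(a', b') \<in> graph_adjoin G x w"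
  then obtain P Q P' Q' where
    "graph_polys G P Q" "a = poly P x" "b = poly Q w" "graph_polys G P' Q'" "a' = poly P' x" "b' = poly Q' w"
    by (auto simp: graph_adjoin_def)
  then show "(a + a', b + b') \<in> graph_adjoin G x w" "(a * a', b * b') \<in> graph_adjoin G x w"
    unfolding graph_adjoin_def
    using graph_polys_add[of P Q P' Q'] graph_polys_mult[of P Q P' Q']
    by (metis (mono_tags, lifting) mem_Collect_eq poly_add poly_mult)+
qed

text \<open>Fractions whose denominators are powers of \<open>u\<close> are sent to the quotients of
  the residues. For a maximal graph it follows that the domain is a local ring.\<close>

lemma hom_graph_localize:
  assumes "(u, y) \<in> G" "y \<noteq> 0"
  shows "\<exists>G'. hom_graph h G' \<and> G \<subseteq> G' \<and> (inverse u, inverse y) \<in> G'"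
proof -
  have u: "u \<noteq> 0" using assms graph_zero_imp by auto
  define G' where "G' = {(a / u ^ k, b / y ^ k) | a b k. (a, b) \<in> G}"
  have I: "(a / u ^ k, b / y ^ k) \<in> G'" if "(a, b) \<in> G" for a b k using that by (auto simp: G'_def)
  have sub: "G \<subseteq> G'" using I[of _ _ 0] by auto
  have "(inverse u, inverse y) \<in> G'" using I[OF graph_1, of 1] by (simp add: field_simps)
  moreover have "hom_graph h G'"
    unfolding hom_graph_def
  proof (intro conjI allI impI)
    show "(h a, a) \<in> G'" for a using sub graph_const by blast
  next
    fix z assume "(0, z) \<in> G'"
    then show "z = 0" using u assms graph_zero_imp by (auto simp: G'_def)
  next
    fix a b a' b' assume "(a, b) \<in> G'" "(a', b') \<in> G'"
    then obtain c d k c' d' k' where eq: "a = c / u ^ k" "b = d / y ^ k" "(c, d) \<in> G"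
      "a' = c' / u ^ k'" "b' = d' / y ^ k'" "(c', d') \<in> G" unfolding G'_def by blast
    have "(c * u ^ k' + c' * u ^ k, d * y ^ k' + d' * y ^ k) \<in> G"
      by (rule graph_add[OF graph_mult[OF eq(3) graph_power[OF assms(1)]] graph_mult[OF eq(6) graph_power[OF assms(1)]]])
    from I[OF this, of "k + k'"] show "(a + a', b + b') \<in> G'"
      using u assms(2) by (simp add: eq field_simps power_add)
    have "(c * c', d * d') \<in> G" by (rule graph_mult[OF eq(3,6)])
    from I[OF this, of "k + k'"] show "(a * a', b * b') \<in> G'"
      using u assms(2) by (simp add: eq field_simps power_add)
  qed
  ultimately show ?thesis using sub by blast
qed

end

text \<open>An algebraically closed field has no proper algebraic extension: \<open>Q\<close> splits
  into linear factors, one of which vanishes at \<open>x\<close>. The induction splits off one root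
  at a time.\<close>

lemma alg_closed_no_new_roots:
  fixes h :: "'a::alg_closed_field \<Rightarrow> 'b::field"
  assumes "field_hom h" "poly (map_poly h Q) x = 0" "Q \<noteq> 0"
  shows "x \<in> range h"
  using assms(2,3)
proof (induction "degree Q" arbitrary: Q)
  case 0
  then obtain c where "Q = [:c:]" by (metis degree_eq_zeroE)
  with 0 assms(1) show ?case by (auto simp: map_poly_pCons field_hom_simps split: if_splits)
next
  case (Suc n)
  then obtain r where r: "poly Q r = 0" using alg_closed_imp_poly_has_root[of Q] by auto
  then obtain Q' where Q': "Q = [:- r, 1:] * Q'" by (metis dvdE poly_eq_0_iff_dvd)
  with Suc have ne: "Q' \<noteq> 0" by auto
  have deg: "degree Q = Suc (degree Q')" using ne unfolding Q' by (subst degree_mult_eq) auto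
  have "map_poly h Q = [:- h r, 1:] * map_poly h Q'"
  proof (rule poly_eqI)
    fix i
    have "[:- r, 1:] * Q' = smult (- r) Q' + pCons 0 Q'"
      "[:- h r, 1:] * map_poly h Q' = smult (- h r) (map_poly h Q') + pCons 0 (map_poly h Q')"
      by auto
    then show "coeff (map_poly h Q) i = coeff ([:- h r, 1:] * map_poly h Q') i"
      unfolding Q' using assms(1)
      by (cases i) (simp_all add: coeff_map_poly field_hom_simps)
  qed
  with Suc.prems have "x = h r \<or> poly (map_poly h Q') x = 0" by (auto simp: algebra_simps)
  then show ?case using Suc.hyps(1)[of Q'] Suc.hyps(2) deg ne by auto
qed

context
  fixes h :: "'a::alg_closed_field \<Rightarrow> 'b::field" and G
  assumes h: "field_hom h" and G: "hom_graph h G"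
    and maxG: "\<And>G'. hom_graph h G' \<Longrightarrow> G \<subseteq> G' \<Longrightarrow> G' = G"
begin

lemma max_graph_inverse: "(u, y) \<in> G \<Longrightarrow> y \<noteq> 0 \<Longrightarrow> (inverse u, inverse y) \<in> G"
  using hom_graph_localize[OF h G] maxG by metis

text \<open>The residues of the polynomials vanishing at \<open>x\<close> form an ideal. A common
  root \<open>w\<close> of this ideal would extend the graph by sending \<open>x\<close> to
  \<open>w\<close>, so over an algebraically closed field the ideal contains 1. The resulting
  equation for \<open>x\<close> has a constant term congruent to 1 and all other coefficients in the
  maximal ideal.\<close>

lemma max_graph_relation:
  assumes "\<And>w. (x, w) \<notin> G"
  shows "\<exists>P. graph_polys G P 1 \<and> poly P x = 0"
proof -
  define J where "J = {Q. \<exists>P. graph_polys G P Q \<and> poly P x = 0}"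
  have ex: "\<exists>Q \<in> J. poly Q w \<noteq> 0" for w
  proof (rule ccontr)
    assume "\<not> ?thesis"
    then have "hom_graph h (graph_adjoin G x w)"
      by (intro hom_graph_adjoin[OF h G]) (auto simp: J_def)
    then have "graph_adjoin G x w = G" using maxG graph_adjoin_mono[OF h G] by blast
    then show False using graph_adjoin_mem[OF h G] assms by blast
  qed
  \<comment> \<open>A multiplier over the residue field is lifted through \<open>h\<close>. Closure
    under this operation is what the division with remainder below uses.\<close>
  have diff: "A - R * B \<in> J" if "A \<in> J" "B \<in> J" for A B R
  proof -
    from that obtain P P' where "graph_polys G P A" "poly P x = 0" "graph_polys G P' B" "poly P' x = 0"
      by (auto simp: J_def)
    then have "graph_polys G (P - map_poly h R * P') (A - R * B) \<and> poly (P - map_poly h R * P') x = 0"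
      using graph_polys_diff[OF h G] graph_polys_mult[OF h G] graph_polys_map[OF h G] by simp
    then show ?thesis by (auto simp: J_def)
  qed
  have "\<exists>Q. Q \<in> J \<and> Q \<noteq> 0" using ex[of 0] by auto
  then obtain Q where Q: "Q \<in> J" "Q \<noteq> 0" and min: "\<And>R. R \<in> J \<Longrightarrow> R \<noteq> 0 \<Longrightarrow> degree Q \<le> degree R"
    using arg_min_nat_lemma[of "\<lambda>Q. Q \<in> J \<and> Q \<noteq> 0" _ degree] by blast
  have "degree Q = 0"
  proof (rule ccontr)
    assume d: "degree Q \<noteq> 0"
    then obtain w where w: "poly Q w = 0" using alg_closed_imp_poly_has_root[of Q] by auto
    obtain R where R: "R \<in> J" "poly R w \<noteq> 0" using ex by blast
    have "R mod Q \<in> J" using diff[OF R(1) Q(1), of "R div Q"] by (simp add: minus_div_mult_eq_mod)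
    moreover have "R mod Q = 0 \<or> degree (R mod Q) < degree Q" using Q(2) by (rule degree_mod_less)
    ultimately have "R mod Q = 0" using min by force
    then have "Q dvd R" by auto
    then show False using w R by (auto elim!: dvdE)
  qed
  then obtain c where c: "Q = [:c:]" "c \<noteq> 0" using Q(2) by (metis degree_eq_zeroE pCons_0_0)
  \<comment> \<open>Division by the constant \<open>c\<close>, written as the subtraction of a
    multiple so that \<open>diff\<close> applies.\<close>
  have "Q - ([:1 - inverse c:]) * Q \<in> J" by (rule diff) (use Q in auto)
  also have "Q - ([:1 - inverse c:]) * Q = 1" using c by (simp add: one_pCons algebra_simps)
  finally show ?thesis by (auto simp: J_def)
qed

text \<open>The descent in Chevalley's theorem. The leading coefficient of \<open>P\<close> has
  residue 0 and the constant term of \<open>R\<close> is a unit, so a multiple of the reversed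
  \<open>R\<close>, which vanishes at \<open>x\<close>, cancels the top term of \<open>P\<close>
  without changing any residue.\<close>

lemma max_graph_reduce:
  assumes P: "graph_polys G P 1" "poly P x = 0" and R: "graph_polys G R 1" "poly R (inverse x) = 0"
    and le: "degree R \<le> degree P" and x: "x \<noteq> 0"
  shows "\<exists>P'. graph_polys G P' 1 \<and> poly P' x = 0 \<and> degree P' < degree P"
proof -
  define n m where "n = degree P" and "m = degree R"
  have nz: "n \<noteq> 0"
  proof
    assume "n = 0"
    then obtain c where "P = [:c:]" unfolding n_def by (metis degree_eq_zeroE)
    with P have "(0, 1) \<in> G" by (auto simp: graph_polys_def dest: spec[of _ 0])
    then show False using graph_zero_imp[OF h G] by fastforce
  qed
  define r where "r = coeff R 0"
  have r: "(r, 1) \<in> G" using R(1) by (auto simp: graph_polys_def r_def dest: spec[of _ 0])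
  then have rnz: "r \<noteq> 0" and ri: "(inverse r, 1) \<in> G"
    using graph_zero_imp[OF h G, of 1] max_graph_inverse[of r 1] by auto
  have c: "(coeff P n, 0) \<in> G" using P(1) nz by (cases n) (auto simp: graph_polys_def dest: spec[of _ n])
  define a where "a = coeff P n * inverse r"
  have a: "(a, 0) \<in> G" using graph_mult[OF h G c ri] by (simp add: a_def)
  define P' where "P' = P - monom a (n - m) * reflect_poly R"
  have "\<forall>i. \<exists>w. (coeff (reflect_poly R) i, w) \<in> G"
  proof
    fix i
    have "(coeff R j, coeff 1 j) \<in> G" for j using R(1) by (auto simp: graph_polys_def)
    then show "\<exists>w. (coeff (reflect_poly R) i, w) \<in> G"
      using graph_0[OF h G] unfolding coeff_reflect_poly by (cases "i > degree R") auto
  qed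
  then obtain g where g: "\<And>i. (coeff (reflect_poly R) i, g i) \<in> G" by (metis (no_types))
  have "graph_polys G P' 1"
    unfolding graph_polys_def
  proof
    fix i
    have "(coeff (monom a (n - m) * reflect_poly R) i, 0) \<in> G"
      using graph_mult[OF h G a g] graph_0[OF h G] by (auto simp: coeff_monom_mult)
    moreover have "(coeff P i, coeff 1 i) \<in> G" using P(1) by (auto simp: graph_polys_def)
    ultimately show "(coeff P' i, coeff 1 i) \<in> G"
      using graph_diff[OF h G] unfolding P'_def by fastforce
  qed
  moreover have "poly (reflect_poly R) x = 0" using R(2) x by (simp add: poly_reflect_poly_nz)
  then have "poly P' x = 0" by (simp add: P'_def P)
  moreover have "degree P' < n"
  proof (rule degree_lessI)
    show "P' \<noteq> 0 \<or> n > 0" using nz by auto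
    show "\<forall>k\<ge>n. coeff P' k = 0"
    proof (intro allI impI)
      fix k assume k: "k \<ge> n"
      have dR: "degree (reflect_poly R) \<le> m" by (simp add: m_def degree_reflect_poly_le)
      have le': "m \<le> n" using le by (simp add: n_def m_def)
      show "coeff P' k = 0"
      proof (cases "k = n")
        case True
        have "coeff (reflect_poly R) m = r" by (simp add: coeff_reflect_poly m_def r_def)
        then show ?thesis using True le' rnz by (simp add: P'_def coeff_monom_mult a_def)
      next
        case False
        then have "coeff P k = 0" using k by (simp add: coeff_eq_0 n_def)
        moreover have "coeff (reflect_poly R) (k - (n - m)) = 0"
          using dR k False le' by (intro coeff_eq_0) auto
        ultimately show ?thesis by (simp add: P'_def coeff_monom_mult)
      qed
    qed
  qed
  ultimately show ?thesis by (auto simp: n_def)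
qed

text \<open>If neither \<open>x\<close> nor its inverse had a residue, both would satisfy equations
  as in \<open>max_graph_relation\<close>. With both degrees least possible,
  \<open>max_graph_reduce\<close> lowers the larger one. The residue of the inverse is 0, as
  otherwise \<open>x\<close> would have a residue too.\<close>

lemma max_graph_valuation:
  assumes "\<And>w. (x, w) \<notin> G"
  shows "x \<noteq> 0 \<and> (inverse x, 0) \<in> G"
proof -
  have x: "x \<noteq> 0" using assms graph_0[OF h G] by auto
  have "\<exists>w. (inverse x, w) \<in> G"
  proof (rule ccontr)
    assume "\<not> ?thesis"
    then have i: "(inverse x, w) \<notin> G" for w by auto
    obtain P0 where "graph_polys G P0 1 \<and> poly P0 x = 0" using max_graph_relation[OF assms] by auto
    from arg_min_nat_lemma[of "\<lambda>P. graph_polys G P 1 \<and> poly P x = 0", OF this, of degree]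
    obtain P where P: "graph_polys G P 1" "poly P x = 0"
      and Pm: "\<And>P'. graph_polys G P' 1 \<Longrightarrow> poly P' x = 0 \<Longrightarrow> degree P \<le> degree P'" by blast
    obtain R0 where "graph_polys G R0 1 \<and> poly R0 (inverse x) = 0" using max_graph_relation[OF i] by auto
    from arg_min_nat_lemma[of "\<lambda>P. graph_polys G P 1 \<and> poly P (inverse x) = 0", OF this, of degree]
    obtain R where R: "graph_polys G R 1" "poly R (inverse x) = 0"
      and Rm: "\<And>P'. graph_polys G P' 1 \<Longrightarrow> poly P' (inverse x) = 0 \<Longrightarrow> degree R \<le> degree P'" by blast
    show False
    proof (cases "degree R \<le> degree P")
      case True
      then show ?thesis using max_graph_reduce[OF P R True x] Pm by force
    next
      case False
      then show ?thesis using max_graph_reduce[OF R, of P] P x Rm by force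
    qed
  qed
  then obtain w where w: "(inverse x, w) \<in> G" by auto
  moreover have "w = 0" using max_graph_inverse[OF w] assms by fastforce
  ultimately show ?thesis using x by auto
qed

end

text \<open>Chevalley's extension theorem, for places that are trivial on an algebraically closed field.\<close>

theorem place_exists:
  fixes h :: "'a::alg_closed_field \<Rightarrow> 'b::field"
  assumes h: "field_hom h" and x: "x \<notin> range h"
  obtains G where "hom_graph h G" "(x, 0) \<in> G"
    "\<And>y. (\<exists>w. (y, w) \<in> G) \<or> y \<noteq> 0 \<and> (inverse y, 0) \<in> G"
proof -
  define K where "K = {(h a, a) | a. True}"
  have K: "hom_graph h K" unfolding hom_graph_def K_def by (auto simp: field_hom_simps[OF h])
  \<comment> \<open>\<open>x\<close> is transcendental over the algebraically closed image of
    \<open>h\<close>, so giving it the residue 0 creates no conflict.\<close>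
  have "graph_polys K P Q \<Longrightarrow> poly P x = 0 \<Longrightarrow> poly Q 0 = 0" for P Q
  proof -
    assume g: "graph_polys K P Q" and P: "poly P x = 0"
    have "P = map_poly h Q"
      using g by (intro poly_eqI) (auto simp: graph_polys_def K_def coeff_map_poly field_hom_simps[OF h])
    then have "Q = 0" using alg_closed_no_new_roots[OF h] P x by auto
    then show ?thesis by simp
  qed
  then have G0: "hom_graph h (graph_adjoin K x 0)" by (rule hom_graph_adjoin[OF h K])
  define \<F> where "\<F> = {G. hom_graph h G \<and> graph_adjoin K x 0 \<subseteq> G}"
  have "\<exists>M\<in>\<F>. \<forall>N\<in>\<F>. M \<subseteq> N \<longrightarrow> N = M"
  proof (rule subset_Zorn_nonempty)
    show "\<F> \<noteq> {}" using G0 by (auto simp: \<F>_def)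
    fix \<C> assume ne: "\<C> \<noteq> {}" and ch: "subset.chain \<F> \<C>"
    have two: "\<exists>G\<in>\<C>. p \<in> G \<and> p' \<in> G" if "p \<in> \<Union>\<C>" "p' \<in> \<Union>\<C>" for p p'
    proof -
      from that obtain A B where AB: "A \<in> \<C>" "p \<in> A" "B \<in> \<C>" "p' \<in> B" by blast
      then have "A \<subseteq> B \<or> B \<subseteq> A" using ch by (auto simp: subset_chain_def)
      then show ?thesis using AB by blast
    qed
    have hg: "hom_graph h G" if "G \<in> \<C>" for G using that ch by (auto simp: \<F>_def subset_chain_def)
    have "hom_graph h (\<Union>\<C>)"
      unfolding hom_graph_def
    proof (intro conjI allI impI)
      show "(h a, a) \<in> \<Union>\<C>" for a using ne hg by (auto simp: hom_graph_def)
      show "y = 0" if "(0, y) \<in> \<Union>\<C>" for y using that hg by (auto simp: hom_graph_def)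
      fix a b a' b' assume "(a, b) \<in> \<Union>\<C>" "(a', b') \<in> \<Union>\<C>"
      from two[OF this] obtain G where "G \<in> \<C>" "(a, b) \<in> G" "(a', b') \<in> G" by auto
      then show "(a + a', b + b') \<in> \<Union>\<C>" "(a * a', b * b') \<in> \<Union>\<C>"
        using graph_add[OF h hg] graph_mult[OF h hg] by blast+
    qed
    moreover obtain C where "C \<in> \<C>" "graph_adjoin K x 0 \<subseteq> C"
      using ne ch by (auto simp: \<F>_def subset_chain_def)
    ultimately show "\<Union>\<C> \<in> \<F>" by (auto simp: \<F>_def)
  qed
  then obtain G where G: "hom_graph h G" "graph_adjoin K x 0 \<subseteq> G"
    and "\<And>G'. hom_graph h G' \<Longrightarrow> G \<subseteq> G' \<Longrightarrow> G' = G" by (auto simp: \<F>_def)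
  note val = max_graph_valuation[OF h G(1) this(3)]
  show ?thesis
  proof (rule that[OF G(1)])
    show "(x, 0) \<in> G" using G(2) graph_adjoin_mem[OF h K] by blast
    show "(\<exists>w. (y, w) \<in> G) \<or> y \<noteq> 0 \<and> (inverse y, 0) \<in> G" for y using val by blast
  qed
qed

section \<open>Vector algebra in dimension three\<close>

type_synonym 'a vec3 = "'a \<times> 'a \<times> 'a"

definition vdot :: "'a::comm_ring_1 vec3 \<Rightarrow> 'a vec3 \<Rightarrow> 'a" where
  "vdot u w = fst u * fst w + fst (snd u) * fst (snd w) + snd (snd u) * snd (snd w)"

definition vscale :: "'a::comm_ring_1 \<Rightarrow> 'a vec3 \<Rightarrow> 'a vec3" where
  "vscale c u = (c * fst u, c * fst (snd u), c * snd (snd u))"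

definition vcross :: "'a::comm_ring_1 vec3 \<Rightarrow> 'a vec3 \<Rightarrow> 'a vec3" where
  "vcross u w = (fst (snd u) * snd (snd w) - snd (snd u) * fst (snd w),
     snd (snd u) * fst w - fst u * snd (snd w), fst u * fst (snd w) - fst (snd u) * fst w)"

definition vdet :: "'a::comm_ring_1 vec3 \<Rightarrow> 'a vec3 \<Rightarrow> 'a vec3 \<Rightarrow> 'a" where
  "vdet u v w = vdot (vcross u v) w"

definition vmap :: "('a \<Rightarrow> 'b) \<Rightarrow> 'a vec3 \<Rightarrow> 'b vec3" where
  "vmap h u = (h (fst u), h (fst (snd u)), h (snd (snd u)))"

lemmas vec_defs = vdot_def vscale_def vcross_def vdet_def vmap_def

lemma vdot_scale: "vdot (vscale c u) w = c * vdot u w" "vdot u (vscale c w) = c * vdot u w"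
  and vdot_add: "vdot (u + u') w = vdot u w + vdot u' w" "vdot u (w + w') = vdot u w + vdot u w'"
  and vdot_diff: "vdot (u - u') w = vdot u w - vdot u' w" "vdot u (w - w') = vdot u w - vdot u w'"
  and vdot_commute: "vdot u w = vdot w u"
  and vdot_0: "vdot 0 w = 0" "vdot u 0 = 0"
  by (simp_all add: vec_defs algebra_simps)

lemma vcross_orth: "vdot (vcross u w) u = 0" "vdot (vcross u w) w = 0"
  by (simp_all add: vec_defs algebra_simps)

lemma vcross_self: "vcross u u = 0"
  by (simp add: vec_defs algebra_simps zero_prod_def)

lemma vcross_scale: "vcross (vscale c u) w = vscale c (vcross u w)" "vcross u (vscale c w) = vscale c (vcross u w)"
  by (simp_all add: vec_defs algebra_simps)

lemma vcross_zero: "vcross 0 w = 0" "vcross u 0 = 0"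
  by (simp_all add: vec_defs zero_prod_def)

lemma vcross_anti: "vcross w u = 0 \<longleftrightarrow> vcross u w = 0"
  by (auto simp: vec_defs zero_prod_def algebra_simps)

lemma vscale_vscale: "vscale a (vscale b u) = vscale (a * b) u"
  and vscale_1: "vscale 1 u = u" and vscale_0: "vscale 0 u = 0" "vscale c 0 = 0"
  by (simp_all add: vec_defs zero_prod_def mult.assoc)

lemma vscale_eq_0: "vscale c u = 0 \<longleftrightarrow> c = 0 \<or> u = 0" for c :: "'a::idom"
  by (auto simp: vec_defs zero_prod_def prod_eq_iff)

lemma vdet_perm: "vdet v w u = vdet u v w" "vdet v u w = - vdet u v w" "vdet u w v = - vdet u v w"
  "vdet w v u = - vdet u v w"
  by (simp_all add: vec_defs algebra_simps)

lemma vdet_same: "vdet u u w = 0" "vdet u w w = 0" "vdet u w u = 0"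
  by (simp_all add: vec_defs algebra_simps)

lemma vdet_linear: "vdet (u + u') v w = vdet u v w + vdet u' v w" "vdet (vscale c u) v w = c * vdet u v w"
  "vdet u (v + v') w = vdet u v w + vdet u v' w" "vdet u (vscale c v) w = c * vdet u v w"
  "vdet u v (w + w') = vdet u v w + vdet u v w'" "vdet u v (vscale c w) = c * vdet u v w"
  by (simp_all add: vec_defs algebra_simps)

text \<open>Cramer's rule with the denominator cleared, so that it holds for dependent vectors as
  well.\<close>

lemma vec_cramer:
  "vscale (vdet u v w) x = vscale (vdet x v w) u + vscale (vdet u x w) v + vscale (vdet u v x) w"
  by (simp add: vec_defs algebra_simps plus_prod_def)

lemma dot_cramer:
  "vdet u v w * vdot a x = vdet x v w * vdot a u + vdet u x w * vdot a v + vdet u v x * vdot a w"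
proof -
  have "vdot a (vscale (vdet u v w) x) = vdot a (vscale (vdet x v w) u + vscale (vdet u x w) v + vscale (vdet u v x) w)"
    by (simp only: vec_cramer[symmetric])
  then show ?thesis by (simp add: vdot_add vdot_scale)
qed

lemma vec_eq_0_iff: "u = 0 \<longleftrightarrow> fst u = 0 \<and> fst (snd u) = 0 \<and> snd (snd u) = 0"
  by (auto simp: zero_prod_def prod_eq_iff)

lemma form_zero:
  fixes a :: "'a::idom vec3"
  assumes "vdet u v w \<noteq> 0" "vdot a u = 0" "vdot a v = 0" "vdot a w = 0"
  shows "a = 0"
proof -
  have "vdot a x = 0" for x using dot_cramer[of u v w a x] assms by simp
  from this[of "(1, 0, 0)"] this[of "(0, 1, 0)"] this[of "(0, 0, 1)"] show ?thesis
    by (simp add: vec_defs vec_eq_0_iff)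
qed

lemma parallel_vec:
  fixes u :: "'a::field vec3"
  assumes "vcross u w = 0" "u \<noteq> 0"
  shows "\<exists>c. w = vscale c u"
proof -
  obtain a b c x y z where u: "u = (a, b, c)" and w: "w = (x, y, z)" by (metis prod.exhaust)
  have e: "b * z = c * y" "c * x = a * z" "a * y = b * x" using assms(1) by (auto simp: vec_defs u w zero_prod_def)
  consider "a \<noteq> 0" | "b \<noteq> 0" | "c \<noteq> 0" using assms(2) by (auto simp: u zero_prod_def)
  then show ?thesis
  proof cases
    case 1 then show ?thesis using e by (intro exI[of _ "x / a"]) (auto simp: vec_defs u w field_simps)
  next
    case 2 then show ?thesis using e by (intro exI[of _ "y / b"]) (auto simp: vec_defs u w field_simps)
  next
    case 3 then show ?thesis using e by (intro exI[of _ "z / c"]) (auto simp: vec_defs u w field_simps)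
  qed
qed

lemma orth_two:
  fixes a :: "'a::field vec3"
  assumes "vcross a b \<noteq> 0" "vdot a x = 0" "vdot b x = 0"
  shows "\<exists>c. x = vscale c (vcross a b)"
proof (rule parallel_vec)
  have "vcross (vcross a b) x = vscale (vdot a x) b - vscale (vdot b x) a"
    by (simp add: vec_defs algebra_simps minus_prod_def)
  then show "vcross (vcross a b) x = 0" using assms by (simp add: vscale_0)
qed fact

lemma orth_two':
  fixes a :: "'a::field vec3"
  assumes "vcross a b \<noteq> 0" "vdot x a = 0" "vdot x b = 0"
  shows "\<exists>c. x = vscale c (vcross a b)"
  using orth_two[of a b x] assms by (simp add: vdot_commute)

lemma vscale_solve:
  fixes x :: "'a::field vec3"
  assumes "D \<noteq> 0" "vscale D x = vscale A a + vscale B b"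
  shows "x = vscale (A / D) a + vscale (B / D) b"
  using assms by (auto simp: vec_defs plus_prod_def prod_eq_iff field_simps)

text \<open>Cramer's rule with a third form \<open>p\<close> independent of \<open>a\<close> and
  \<open>b\<close>: the coefficient of \<open>p\<close> vanishes because \<open>w\<close> is
  proportional to the cross product of \<open>a\<close> and \<open>b\<close>.\<close>

lemma span_pencil:
  fixes a :: "'a::field vec3"
  assumes "vcross a b \<noteq> 0" "w \<noteq> 0" "vdot a w = 0" "vdot b w = 0" "vdot x w = 0"
  shows "\<exists>\<alpha> \<beta>. x = vscale \<alpha> a + vscale \<beta> b"
proof -
  have "\<exists>p. vdot (vcross a b) p \<noteq> 0"
  proof (rule ccontr)
    assume "\<not> ?thesis"
    then have "vdot (vcross a b) (1, 0, 0) = 0 \<and> vdot (vcross a b) (0, 1, 0) = 0 \<and> vdot (vcross a b) (0, 0, 1) = 0" by auto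
    then show False using assms(1) unfolding vec_eq_0_iff by (auto simp: vdot_def)
  qed
  then obtain p where p: "vdet a b p \<noteq> 0" by (auto simp: vdet_def)
  obtain c where c: "w = vscale c (vcross a b)" using orth_two assms by blast
  have "c \<noteq> 0" using assms c by (auto simp: vscale_0)
  then have "vdet a b x = 0" using assms(5) c by (simp add: vdet_def vdot_scale vdot_commute)
  then have "vscale (vdet a b p) x = vscale (vdet x b p) a + vscale (vdet a x p) b"
    using vec_cramer[of a b p x] by (simp add: vscale_0)
  from vscale_solve[OF p this]
  show ?thesis by blast
qed

section \<open>Ultrapowers\<close>

text \<open>Zorn's lemma for the proper filters finer than \<open>sequentially\<close>. They are
  coded as families of sets ordered by inclusion, for which the union of a chain is again such a
  family; the order on filters runs the other way.\<close>

lemma nonprincipal_ultrafilter_exists: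
  "\<exists>U :: nat filter. U \<noteq> bot \<and> U \<le> sequentially \<and> (\<forall>P. eventually P U \<or> eventually (\<lambda>n. \<not> P n) U)"
proof -
  define \<F> where "\<F> = {{A. eventually (\<lambda>n. n \<in> A) U} | U :: nat filter. U \<noteq> bot \<and> U \<le> sequentially}"
  have mem: "S \<in> \<F> \<longleftrightarrow> {} \<notin> S \<and> (\<forall>n. {n..} \<in> S) \<and> UNIV \<in> S \<and> (\<forall>A B. A \<in> S \<longrightarrow> B \<in> S \<longrightarrow> A \<inter> B \<in> S) \<and>
      (\<forall>A B. A \<in> S \<longrightarrow> A \<subseteq> B \<longrightarrow> B \<in> S)" (is "_ \<longleftrightarrow> ?R") for S
  proof
    assume "S \<in> \<F>"
    then obtain U where U: "S = {A. eventually (\<lambda>n. n \<in> A) U}" "U \<noteq> bot" "U \<le> sequentially"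
      unfolding \<F>_def by blast
    have "eventually (\<lambda>m. m \<in> {n..}) U" for n
      by (rule filter_leD[OF U(3)]) (auto simp: eventually_sequentially)
    then show ?R
      using U(1,2) by (auto simp: eventually_conj eventually_mono trivial_limit_def subset_iff)
  next
    assume R: ?R
    define U where "U = Abs_filter (\<lambda>P. {n. P n} \<in> S)"
    have "is_filter (\<lambda>P. {n. P n} \<in> S)"
    proof
      show "{n. True} \<in> S" using R by simp
      show "{n. P n \<and> Q n} \<in> S" if "{n. P n} \<in> S" "{n. Q n} \<in> S" for P Q
        using R that by (auto simp: Collect_conj_eq)
      show "{n. Q n} \<in> S" if "\<forall>n. P n \<longrightarrow> Q n" "{n. P n} \<in> S" for P Q
        using R that by (meson Collect_mono)
    qed
    then have ev: "eventually P U \<longleftrightarrow> {n. P n} \<in> S" for P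
      unfolding U_def by (rule eventually_Abs_filter)
    have "U \<noteq> bot" using R ev[of "\<lambda>_. False"] by (auto simp: trivial_limit_def)
    moreover have "U \<le> sequentially"
    proof (rule filter_leI)
      fix P :: "nat \<Rightarrow> bool" assume "eventually P sequentially"
      then obtain N where "\<forall>n\<ge>N. P n" by (auto simp: eventually_sequentially)
      then have "{N..} \<subseteq> {n. P n}" by auto
      then show "eventually P U" using R unfolding ev by blast
    qed
    moreover have "S = {A. eventually (\<lambda>n. n \<in> A) U}" unfolding ev by simp
    ultimately show "S \<in> \<F>" unfolding \<F>_def by blast
  qed
  have "\<exists>M\<in>\<F>. \<forall>N\<in>\<F>. M \<subseteq> N \<longrightarrow> N = M"
  proof (rule subset_Zorn_nonempty)
    have "{A. eventually (\<lambda>n. n \<in> A) sequentially} \<in> \<F>" unfolding \<F>_def using trivial_limit_sequentially by blast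
    then show "\<F> \<noteq> {}" by auto
    fix \<C> assume ne: "\<C> \<noteq> {}" and ch: "subset.chain \<F> \<C>"
    have in\<F>: "C \<in> \<F>" if "C \<in> \<C>" for C using that ch by (auto simp: subset_chain_def)
    have "A \<inter> B \<in> \<Union>\<C>" if "A \<in> \<Union>\<C>" "B \<in> \<Union>\<C>" for A B
    proof -
      from that obtain C D where CD: "C \<in> \<C>" "A \<in> C" "D \<in> \<C>" "B \<in> D" by blast
      then have "C \<subseteq> D \<or> D \<subseteq> C" using ch by (auto simp: subset_chain_def)
      then show ?thesis using CD in\<F>[unfolded mem] by blast
    qed
    then show "\<Union>\<C> \<in> \<F>" unfolding mem using in\<F>[unfolded mem] ne by blast
  qed
  then obtain M where M: "M \<in> \<F>" and max: "\<And>N. N \<in> \<F> \<Longrightarrow> M \<subseteq> N \<Longrightarrow> N = M" by blast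
  from M obtain U where U: "M = {A. eventually (\<lambda>n. n \<in> A) U}" "U \<noteq> bot" "U \<le> sequentially"
    unfolding \<F>_def mem_Collect_eq by (elim exE conjE) (rule that)
  have "eventually P U \<or> eventually (\<lambda>n. \<not> P n) U" for P
  proof (rule ccontr)
    assume c: "\<not> ?thesis"
    \<comment> \<open>If neither \<open>P\<close> nor its negation holds eventually, adjoining
      \<open>P\<close> still gives a proper filter, against maximality.\<close>
    define V where "V = inf U (principal {n. P n})"
    have "V \<noteq> bot" using c by (auto simp: V_def trivial_limit_def eventually_inf_principal)
    moreover have "V \<le> sequentially" using U(3) by (simp add: V_def le_infI1)
    ultimately have "{A. eventually (\<lambda>n. n \<in> A) V} \<in> \<F>" unfolding \<F>_def by blast
    moreover have "M \<subseteq> {A. eventually (\<lambda>n. n \<in> A) V}"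
      unfolding U V_def eventually_inf_principal by (auto elim: eventually_mono)
    ultimately have "{A. eventually (\<lambda>n. n \<in> A) V} = M" by (rule max)
    moreover have "{n. P n} \<in> {A. eventually (\<lambda>n. n \<in> A) V}" by (simp add: V_def eventually_inf_principal)
    ultimately show False using c U by auto
  qed
  then show ?thesis using U by blast
qed

definition ultra :: "nat filter" where
  "ultra = (SOME U. U \<noteq> bot \<and> U \<le> sequentially \<and> (\<forall>P. eventually P U \<or> eventually (\<lambda>n. \<not> P n) U))"

lemma ultra_neq_bot: "ultra \<noteq> bot"
  and ultra_le: "ultra \<le> sequentially"
  and ultra_cases: "eventually P ultra \<or> eventually (\<lambda>n. \<not> P n) ultra"
  using someI_ex[OF nonprincipal_ultrafilter_exists] unfolding ultra_def by blast+

lemma ultra_not: "eventually (\<lambda>n. \<not> P n) ultra \<longleftrightarrow> \<not> eventually P ultra"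
proof
  assume a: "eventually (\<lambda>n. \<not> P n) ultra"
  show "\<not> eventually P ultra"
  proof
    assume "eventually P ultra"
    with a have "eventually (\<lambda>n. False) ultra" by eventually_elim auto
    then show False using ultra_neq_bot by (simp add: trivial_limit_def)
  qed
qed (use ultra_cases in blast)

lemma ultra_ge: "eventually (\<lambda>n. n \<ge> N) ultra"
  by (rule filter_leD[OF ultra_le]) (rule eventually_ge_at_top)

quotient_type 'a ultrapower = "nat \<Rightarrow> 'a" / "\<lambda>f g. eventually (\<lambda>n. f n = g n) ultra"
proof (rule equivpI)
  show "reflp (\<lambda>(f :: nat \<Rightarrow> 'a) g. eventually (\<lambda>n. f n = g n) ultra)" by (simp add: reflp_def)
  show "symp (\<lambda>(f :: nat \<Rightarrow> 'a) g. eventually (\<lambda>n. f n = g n) ultra)" by (simp add: symp_def eq_commute)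
  show "transp (\<lambda>(f :: nat \<Rightarrow> 'a) g. eventually (\<lambda>n. f n = g n) ultra)"
    unfolding transp_def by (intro allI impI) (erule (1) eventually_elim2, simp)
qed

lift_definition uclass :: "(nat \<Rightarrow> 'a) \<Rightarrow> 'a ultrapower" is "\<lambda>f. f" .

lemma uclass_eq: "uclass f = uclass g \<longleftrightarrow> eventually (\<lambda>n. f n = g n) ultra"
  by transfer auto

instantiation ultrapower :: (field) field
begin
lift_definition zero_ultrapower :: "'a ultrapower" is "\<lambda>_. 0" .
lift_definition one_ultrapower :: "'a ultrapower" is "\<lambda>_. 1" .
lift_definition plus_ultrapower :: "'a ultrapower \<Rightarrow> 'a ultrapower \<Rightarrow> 'a ultrapower" is "\<lambda>f g n. f n + g n"
  by (erule (1) eventually_elim2) simp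
lift_definition times_ultrapower :: "'a ultrapower \<Rightarrow> 'a ultrapower \<Rightarrow> 'a ultrapower" is "\<lambda>f g n. f n * g n"
  by (erule (1) eventually_elim2) simp
lift_definition minus_ultrapower :: "'a ultrapower \<Rightarrow> 'a ultrapower \<Rightarrow> 'a ultrapower" is "\<lambda>f g n. f n - g n"
  by (erule (1) eventually_elim2) simp
lift_definition uminus_ultrapower :: "'a ultrapower \<Rightarrow> 'a ultrapower" is "\<lambda>f n. - f n"
  by (erule eventually_mono) simp
lift_definition inverse_ultrapower :: "'a ultrapower \<Rightarrow> 'a ultrapower" is "\<lambda>f n. inverse (f n)"
  by (erule eventually_mono) simp
definition divide_ultrapower :: "'a ultrapower \<Rightarrow> 'a ultrapower \<Rightarrow> 'a ultrapower" where
  "divide_ultrapower x y = x * inverse y"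
instance
proof
  fix a b c :: "'a ultrapower"
  show "a * b * c = a * (b * c)" by transfer (simp add: mult.assoc)
  show "a * b = b * a" by transfer (simp add: mult.commute)
  show "1 * a = a" by transfer simp
  show "a + b + c = a + (b + c)" by transfer (simp add: add.assoc)
  show "a + b = b + a" by transfer (simp add: add.commute)
  show "0 + a = a" by transfer simp
  show "- a + a = 0" by transfer simp
  show "a - b = a + - b" by transfer simp
  show "(a + b) * c = a * c + b * c" by transfer (simp add: distrib_right)
  show "(0 :: 'a ultrapower) \<noteq> 1" by transfer (simp add: ultra_neq_bot trivial_limit_def[symmetric])
  show "a \<noteq> 0 \<Longrightarrow> inverse a * a = 1" by transfer (auto simp: ultra_not[symmetric] elim: eventually_mono)
  show "a div b = a * inverse b" by (simp add: divide_ultrapower_def)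
  show "inverse (0 :: 'a ultrapower) = 0" by transfer simp
qed
end

lemma uclass_add: "uclass f + uclass g = uclass (\<lambda>n. f n + g n)"
  by transfer simp

lemma uclass_mult: "uclass f * uclass g = uclass (\<lambda>n. f n * g n)"
  by transfer simp

lemma uclass_diff: "uclass f - uclass g = uclass (\<lambda>n. f n - g n)"
  by transfer simp

lemma uclass_0: "uclass (\<lambda>_. 0) = 0"
  by transfer simp

lemma uclass_1: "uclass (\<lambda>_. 1) = 1"
  by transfer simp

section \<open>Generic points of a configuration\<close>

lemma vdot_nonzero_ex:
  fixes u :: "'a::comm_ring_1 vec3"
  assumes "u \<noteq> 0" shows "\<exists>x. vdot x u \<noteq> 0"
proof (rule ccontr)
  assume "\<not> ?thesis"
  then have "vdot (1, 0, 0) u = 0 \<and> vdot (0, 1, 0) u = 0 \<and> vdot (0, 0, 1) u = 0" by auto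
  then show False using assms unfolding vec_eq_0_iff by (auto simp: vdot_def)
qed

lemma vmap_hom:
  assumes "field_hom h"
  shows "vdot (vmap h u) (vmap h w) = h (vdot u w)" "vcross (vmap h u) (vmap h w) = vmap h (vcross u w)"
    "vdet (vmap h u) (vmap h w) (vmap h x) = h (vdet u w x)" "vmap h (vscale c u) = vscale (h c) (vmap h u)"
    "vmap h (u + w) = vmap h u + vmap h w" "vmap h (u - w) = vmap h u - vmap h w"
    "vmap h u = 0 \<longleftrightarrow> u = 0"
  by (simp_all add: vec_defs field_hom_simps[OF assms] plus_prod_def minus_prod_def vec_eq_0_iff)

lemma quadratic_three_roots:
  fixes a b c :: "'a::field"
  assumes "a \<noteq> b" "a \<noteq> c" "b \<noteq> c"
    "p * a\<^sup>2 + q * a + r = 0" "p * b\<^sup>2 + q * b + r = 0" "p * c\<^sup>2 + q * c + r = 0"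
  shows "p = 0 \<and> q = 0 \<and> r = 0"
proof -
  have "(a - b) * (p * (a + b) + q) = 0" "(a - c) * (p * (a + c) + q) = 0"
    using assms(4-6) by Groebner_Basis.algebra+
  then have 1: "p * (a + b) + q = 0" "p * (a + c) + q = 0" using assms by auto
  then have "p * (b - c) = 0" by Groebner_Basis.algebra
  then show ?thesis using 1 assms by auto
qed

section \<open>Specialising vectors along a place\<close>

locale place =
  fixes h :: "'a::field \<Rightarrow> 'b::field" and G :: "('b \<times> 'a) set"
  assumes hom: "field_hom h" and graph: "hom_graph h G"
    and val: "(\<exists>w. (y, w) \<in> G) \<or> y \<noteq> 0 \<and> (inverse y, 0) \<in> G"
begin

lemmas h_simps = field_hom_simps[OF hom]
lemmas G_const = graph_const[OF hom graph]
lemmas G_add = graph_add[OF hom graph]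
lemmas G_mult = graph_mult[OF hom graph]
lemmas G_diff = graph_diff[OF hom graph]
lemmas G_uminus = graph_uminus[OF hom graph]
lemmas G_unique = graph_unique[OF hom graph]
lemmas G_zero = graph_zero_imp[OF hom graph]
lemmas G_0 = graph_0[OF hom graph]
lemmas G_1 = graph_1[OF hom graph]

lemma G_inverse:
  assumes "(x, y) \<in> G" "y \<noteq> 0" shows "(inverse x, inverse y) \<in> G"
proof -
  have x: "x \<noteq> 0" using assms G_zero by auto
  from val[of "inverse x"] show ?thesis
  proof
    assume "\<exists>w. (inverse x, w) \<in> G"
    then obtain w where w: "(inverse x, w) \<in> G" by auto
    from G_mult[OF this assms(1)] have "(1, w * y) \<in> G" using x by simp
    then have "w * y = 1" using G_unique G_1 by blast
    then have "w = inverse y" using assms(2) by (simp add: field_simps)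
    then show ?thesis using w by simp
  next
    assume "inverse x \<noteq> 0 \<and> (inverse (inverse x), 0) \<in> G"
    then show ?thesis using G_unique[OF assms(1)] assms(2) by auto
  qed
qed

lemma G_divide: "(x, y) \<in> G \<Longrightarrow> (x', y') \<in> G \<Longrightarrow> y' \<noteq> 0 \<Longrightarrow> (x / x', y / y') \<in> G"
  unfolding divide_inverse by (intro G_mult G_inverse)

definition gvec :: "'b vec3 \<Rightarrow> 'a vec3 \<Rightarrow> bool" where
  "gvec u U \<longleftrightarrow> (fst u, fst U) \<in> G \<and> (fst (snd u), fst (snd U)) \<in> G \<and> (snd (snd u), snd (snd U)) \<in> G"

lemma gvec_dot: "gvec u U \<Longrightarrow> gvec w W \<Longrightarrow> (vdot u w, vdot U W) \<in> G"
  unfolding gvec_def vdot_def by (intro G_add G_mult) auto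

lemma gvec_cross: "gvec u U \<Longrightarrow> gvec w W \<Longrightarrow> gvec (vcross u w) (vcross U W)"
  unfolding gvec_def vcross_def by (auto intro!: G_diff G_mult)

lemma gvec_det: "gvec u U \<Longrightarrow> gvec w W \<Longrightarrow> gvec x Z \<Longrightarrow> (vdet u w x, vdet U W Z) \<in> G"
  unfolding vdet_def by (intro gvec_dot gvec_cross)

lemma gvec_scale: "(c, d) \<in> G \<Longrightarrow> gvec u U \<Longrightarrow> gvec (vscale c u) (vscale d U)"
  unfolding gvec_def vscale_def by (auto intro!: G_mult)

lemma gvec_diff: "gvec u U \<Longrightarrow> gvec w W \<Longrightarrow> gvec (u - w) (U - W)"
  unfolding gvec_def minus_prod_def by (auto intro!: G_diff)

lemma gvec_map: "gvec (vmap h x) x"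
  unfolding gvec_def vmap_def by (auto intro!: G_const)

lemma gvec_unique: "gvec u U \<Longrightarrow> gvec u W \<Longrightarrow> U = W"
  unfolding gvec_def by (auto intro!: prod_eqI dest: G_unique)

text \<open>An element of least valuation divides all others within the valuation ring. In the
  induction a new element replaces the old minimum exactly when their quotient has no
  residue.\<close>

lemma normalize_nonzero: "finite Z \<Longrightarrow> Z \<noteq> {} \<Longrightarrow> 0 \<notin> Z \<Longrightarrow> \<exists>m \<in> Z. \<forall>x \<in> Z. \<exists>w. (x / m, w) \<in> G"
proof (induction Z rule: finite_ne_induct)
  case (singleton x)
  then show ?case using G_1 by (auto intro!: exI[of _ 1])
next
  case (insert x F)
  then obtain m where m: "m \<in> F" "\<And>y. y \<in> F \<Longrightarrow> \<exists>w. (y / m, w) \<in> G" by auto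
  have nz: "x \<noteq> 0" "m \<noteq> 0" using insert m by auto
  show ?case
  proof (cases "\<exists>w. (x / m, w) \<in> G")
    case True
    then show ?thesis using m by auto
  next
    case False
    then have xm: "(m / x, 0) \<in> G" using val[of "x / m"] by auto
    have "\<exists>w. (y / x, w) \<in> G" if "y \<in> F" for y
    proof -
      obtain w where "(y / m, w) \<in> G" using m(2)[OF \<open>y \<in> F\<close>] by auto
      from G_mult[OF this xm] show ?thesis using nz by auto
    qed
    then show ?thesis using G_1 nz by (auto intro!: bexI[of _ x] exI[of _ 1])
  qed
qed

lemma normalize:
  assumes "finite Z" "\<exists>x \<in> Z. x \<noteq> 0"
  shows "\<exists>m \<in> Z. m \<noteq> 0 \<and> (\<forall>x \<in> Z. \<exists>w. (inverse m * x, w) \<in> G)"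
proof -
  have "\<exists>m \<in> Z - {0}. \<forall>x \<in> Z - {0}. \<exists>w. (x / m, w) \<in> G"
    by (rule normalize_nonzero) (use assms in auto)
  then obtain m where m: "m \<in> Z" "m \<noteq> 0" "\<And>x. x \<in> Z \<Longrightarrow> x \<noteq> 0 \<Longrightarrow> \<exists>w. (x / m, w) \<in> G" by auto
  have "\<exists>w. (inverse m * x, w) \<in> G" if "x \<in> Z" for x
    using m(3)[OF that] G_0 by (cases "x = 0") (auto simp: field_simps)
  then show ?thesis using m by blast
qed

text \<open>Dividing by a coordinate of least valuation gives every coordinate a residue, and that
  one the residue 1. The factor is common to both vectors because the relation \<open>g_rel\<close>
  below is not invariant under scaling \<open>gt\<close> and \<open>gs\<close> separately.\<close>

lemma normalize_two:
  assumes "u \<noteq> 0 \<or> w \<noteq> 0"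
  shows "\<exists>c U W. c \<noteq> 0 \<and> gvec (vscale c u) U \<and> gvec (vscale c w) W \<and> (U \<noteq> 0 \<or> W \<noteq> 0)"
proof -
  define Z where "Z = {fst u, fst (snd u), snd (snd u), fst w, fst (snd w), snd (snd w)}"
  have "\<exists>x \<in> Z. x \<noteq> 0" using assms unfolding vec_eq_0_iff Z_def by auto
  then obtain m where m: "m \<in> Z" "m \<noteq> 0" "\<And>x. x \<in> Z \<Longrightarrow> \<exists>w. (inverse m * x, w) \<in> G"
    using normalize[of Z] by (auto simp: Z_def)
  then obtain f where f: "\<And>x. x \<in> Z \<Longrightarrow> (inverse m * x, f x) \<in> G" by metis
  have "f m = 1" using f[OF m(1)] m(2) G_1 G_unique by auto
  let ?U = "(f (fst u), f (fst (snd u)), f (snd (snd u)))"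
  let ?W = "(f (fst w), f (fst (snd w)), f (snd (snd w)))"
  have "gvec (vscale (inverse m) u) ?U" "gvec (vscale (inverse m) w) ?W"
    unfolding gvec_def vscale_def by (auto intro!: f simp: Z_def)
  moreover have "?U \<noteq> 0 \<or> ?W \<noteq> 0"
    using m(1) \<open>f m = 1\<close> unfolding Z_def vec_eq_0_iff by force
  ultimately show ?thesis using m(2) by (intro exI[of _ "inverse m"] exI[of _ ?U] exI[of _ ?W]) auto
qed

lemma normalize_one:
  assumes "u \<noteq> 0"
  shows "\<exists>c U. c \<noteq> 0 \<and> gvec (vscale c u) U \<and> U \<noteq> 0"
  using normalize_two[of u u] assms gvec_unique by blast

end

text \<open>In the application \<open>t i\<close> and \<open>s i\<close> are the forms of the
  tangent and of the 3-secant at the point \<open>v i\<close>. The relation \<open>rel\<close>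
  between two indices is Segre's lemma for three points after a rescaling of the forms
  \<open>t i\<close>, see \<open>raw_conic\<close>. The hypotheses are symmetric in \<open>t\<close>
  and \<open>s\<close>.\<close>

locale config =
  fixes v t s :: "nat \<Rightarrow> 'a::field vec3"
  assumes two: "(2 :: 'a) \<noteq> 0"
    and t_self: "vdot (t i) (v i) = 0" and s_self: "vdot (s i) (v i) = 0"
    and t_nz: "i \<noteq> j \<Longrightarrow> vdot (t i) (v j) \<noteq> 0" and s_nz: "i \<noteq> j \<Longrightarrow> vdot (s i) (v j) \<noteq> 0"
    and indep: "vcross (t i) (s i) \<noteq> 0"
    and arc: "i \<noteq> j \<Longrightarrow> i \<noteq> k \<Longrightarrow> j \<noteq> k \<Longrightarrow> vdet (v i) (v j) (v k) \<noteq> 0"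
    and rel: "i \<noteq> j \<Longrightarrow> vdot (t i) (v j) * vdot (s j) (v i) + vdot (s i) (v j) * vdot (t j) (v i) = 0"
begin

lemma v_nz: "v i \<noteq> 0"
  using t_nz[of "Suc i" i] by (auto simp: vdot_0)

lemma v_eq: "\<exists>c. c \<noteq> 0 \<and> v i = vscale c (vcross (t i) (s i))"
  using orth_two[OF indep t_self s_self] v_nz vscale_0 by metis

lemma on_both: "vdot (t i) x = 0 \<Longrightarrow> vdot (s i) x = 0 \<Longrightarrow> \<exists>c. x = vscale c (v i)"
proof -
  assume "vdot (t i) x = 0" "vdot (s i) x = 0"
  then obtain c where c: "x = vscale c (vcross (t i) (s i))" using orth_two indep by blast
  obtain d where d: "d \<noteq> 0" "v i = vscale d (vcross (t i) (s i))" using v_eq by blast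
  have "x = vscale (c / d) (v i)" unfolding c d(2) using d(1) by (simp add: vscale_vscale)
  then show ?thesis by blast
qed

lemma pencil: "vdot x (v i) = 0 \<Longrightarrow> \<exists>\<alpha> \<beta>. x = vscale \<alpha> (t i) + vscale \<beta> (s i)"
  using span_pencil[OF indep v_nz t_self s_self] .

lemma finite_on_line:
  assumes "a \<noteq> 0" shows "finite {i. vdot a (v i) = 0}"
proof (rule ccontr)
  assume "infinite {i. vdot a (v i) = 0}"
  then obtain B where B: "B \<subseteq> {i. vdot a (v i) = 0}" "card B = 3" by (meson infinite_arbitrarily_large)
  then obtain i j k where "B = {i, j, k}" "i \<noteq> j" "i \<noteq> k" "j \<noteq> k" by (auto simp: card_3_iff)
  then show False using form_zero[OF arc[of i j k]] B assms by auto
qed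

text \<open>The ratio is the direction of \<open>v j\<close> in the pencil at \<open>v i\<close>;
  equal directions would put three points on a line.\<close>

lemma ratio_distinct:
  assumes "i \<noteq> j" "i \<noteq> k" "j \<noteq> k"
  shows "vdot (t i) (v j) / vdot (s i) (v j) \<noteq> vdot (t i) (v k) / vdot (s i) (v k)"
proof
  assume e: "vdot (t i) (v j) / vdot (s i) (v j) = vdot (t i) (v k) / vdot (s i) (v k)"
  define x where "x = vscale (vdot (s i) (v j)) (t i) - vscale (vdot (t i) (v j)) (s i)"
  have "vdot x (v i) = 0" "vdot x (v j) = 0" by (simp_all add: x_def vdot_diff vdot_scale t_self s_self)
  moreover have "vdot x (v k) = 0"
    using e s_nz[of i j] s_nz[of i k] assms by (simp add: x_def vdot_diff vdot_scale frac_eq_eq)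
  ultimately have "x = 0" using form_zero[OF arc[OF assms]] by blast
  then have "vcross x (s i) = 0" by (simp add: vcross_zero)
  then have "vscale (vdot (s i) (v j)) (vcross (t i) (s i)) = 0"
    by (simp add: x_def vec_defs minus_prod_def algebra_simps)
  then show False using s_nz[of i j] indep assms by (simp add: vscale_eq_0)
qed

text \<open>A binary quadratic form vanishing in three different directions is zero. Such forms
  appear whenever \<open>rel\<close> is compared with a second relation of the same shape.\<close>

lemma binary_quadratic:
  assumes inf: "infinite I"
    and z: "\<And>j. j \<in> I \<Longrightarrow> j \<noteq> i \<Longrightarrow> p * (vdot (t i) (v j))\<^sup>2 + q * (vdot (t i) (v j) * vdot (s i) (v j)) + r * (vdot (s i) (v j))\<^sup>2 = 0"
  shows "p = 0 \<and> q = 0 \<and> r = 0"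
proof -
  have "infinite (I - {i})" using inf by simp
  then obtain B where "B \<subseteq> I - {i}" "card B = 3" by (meson infinite_arbitrarily_large)
  then obtain a b c where abc: "a \<in> I - {i}" "b \<in> I - {i}" "c \<in> I - {i}" "a \<noteq> b" "a \<noteq> c" "b \<noteq> c" by (auto simp: card_3_iff)
  define f where "f j = vdot (t i) (v j) / vdot (s i) (v j)" for j
  have "p * (f j)\<^sup>2 + q * f j + r = 0" if "j \<in> I - {i}" for j
    using z[of j] s_nz[of i j] that unfolding f_def by (simp add: field_simps power2_eq_square)
  moreover have "f a \<noteq> f b" "f a \<noteq> f c" "f b \<noteq> f c" using ratio_distinct[of i] abc unfolding f_def by auto
  ultimately show ?thesis using quadratic_three_roots[of "f a" "f b" "f c"] abc by blast
qed

text \<open>A line through \<open>Z\<close> and \<open>v i\<close> has a multiple of their cross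
  product as its form, and the determinant of \<open>Z\<close>, \<open>v i\<close>,
  \<open>v j\<close> changes sign when the two points are exchanged. Three such exchanges give the
  minus sign.\<close>

lemma concurrent:
  assumes x: "\<And>i. vdot (x i) (v i) = 0" "\<And>i j. i \<noteq> j \<Longrightarrow> vdot (x i) (v j) \<noteq> 0"
    and Z: "Z \<noteq> 0" "vdot (x i) Z = 0" "vdot (x j) Z = 0" "vdot (x k) Z = 0" and d: "i \<noteq> j" "i \<noteq> k" "j \<noteq> k"
  shows "vdot (x i) (v j) * vdot (x j) (v k) * vdot (x k) (v i)
       = - (vdot (x i) (v k) * vdot (x j) (v i) * vdot (x k) (v j))"
proof -
  have nc: "vcross Z (v a) \<noteq> 0" if "vdot (x b) Z = 0" "a \<noteq> b" for a b
  proof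
    assume "vcross Z (v a) = 0"
    then obtain c where "v a = vscale c Z" using parallel_vec Z(1) by blast
    then have "vdot (x b) (v a) = 0" using that by (simp add: vdot_scale)
    then show False using x(2)[of b a] that by simp
  qed
  have "\<exists>e. x a = vscale e (vcross Z (v a))" if "a \<in> {i, j, k}" for a
    by (rule orth_two') (use nc that Z d x in auto)
  then obtain e where e: "\<And>a. a \<in> {i, j, k} \<Longrightarrow> x a = vscale (e a) (vcross Z (v a))" by metis
  have "vdot (x a) (v b) = e a * vdet Z (v a) (v b)" if "a \<in> {i, j, k}" for a b
    using e[OF that] by (simp add: vdot_scale vdet_def)
  moreover have "vdet Z (v j) (v i) = - vdet Z (v i) (v j)" "vdet Z (v k) (v i) = - vdet Z (v i) (v k)"
    "vdet Z (v k) (v j) = - vdet Z (v j) (v k)" by (rule vdet_perm)+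
  ultimately show ?thesis by simp
qed

end

text \<open>A further member of the configuration over an extension field, whose point lies on no
  line with coefficients in the base field. \<open>g_nucleus\<close> records that an equation
  between \<open>t i\<close> and \<open>s i\<close> at a constant point that is valid for almost all
  members passes to the generic one.\<close>

locale generic = config v t s for v t s :: "nat \<Rightarrow> 'a::field vec3" +
  fixes h :: "'a \<Rightarrow> 'b::field" and gv gt gs :: "'b vec3"
  assumes h: "field_hom h"
    and gt_self: "vdot gt gv = 0" and gs_self: "vdot gs gv = 0" and g_indep: "vcross gt gs \<noteq> 0"
    and gt_nz: "vdot gt (vmap h (v i)) \<noteq> 0" and gs_nz: "vdot gs (vmap h (v i)) \<noteq> 0"
    and t_gv: "vdot (vmap h (t i)) gv \<noteq> 0" and s_gv: "vdot (vmap h (s i)) gv \<noteq> 0"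
    and g_rel: "vdot gt (vmap h (v i)) * vdot (vmap h (s i)) gv + vdot gs (vmap h (v i)) * vdot (vmap h (t i)) gv = 0"
    and gv_line: "x \<noteq> 0 \<Longrightarrow> vdot (vmap h x) gv \<noteq> 0"
    and g_nucleus: "finite {i. vdot (t i) y \<noteq> \<rho> * vdot (s i) y} \<Longrightarrow>
      vdot gt (vmap h y) = h \<rho> * vdot gs (vmap h y)"
begin

text \<open>The factor between evaluating the generic form at \<open>v i\<close> and evaluating the
  form of \<open>v i\<close> at the generic point; by \<open>H_s\<close> the factor for
  \<open>s\<close> is the negative one. Quotients \<open>H i / H j\<close> do not change when the
  generic data are rescaled.\<close>

definition H :: "nat \<Rightarrow> 'b" where
  "H i = vdot gt (vmap h (v i)) / vdot (vmap h (t i)) gv"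

lemma H_s: "H i = - (vdot gs (vmap h (v i)) / vdot (vmap h (s i)) gv)"
  using g_rel[of i] t_gv[of i] s_gv[of i] unfolding H_def
  by (simp add: field_simps add_eq_0_iff)

lemma H_nz: "H i \<noteq> 0"
  using gt_nz t_gv by (simp add: H_def)

text \<open>Through a constant point there is a line with constant coefficients, and the generic
  point lies on none.\<close>

lemma gv_cross: "Y \<noteq> 0 \<Longrightarrow> vcross (vmap h Y) gv \<noteq> 0"
proof
  assume Y: "Y \<noteq> 0" and "vcross (vmap h Y) gv = 0"
  then obtain c where c: "gv = vscale c (vmap h Y)" using parallel_vec vmap_hom(7)[OF h] by blast
  have "\<exists>x. x \<noteq> 0 \<and> vdot x Y = 0"
  proof -
    obtain a b c where abc: "Y = (a, b, c)" by (metis prod.exhaust)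
    show ?thesis
    proof (cases "a = 0 \<and> b = 0")
      case True
      then show ?thesis by (intro exI[of _ "(1, 0, 0)"]) (simp add: abc vdot_def zero_prod_def)
    next
      case False
      then show ?thesis by (intro exI[of _ "(b, - a, 0)"]) (auto simp: abc vdot_def zero_prod_def)
    qed
  qed
  then obtain x where x: "x \<noteq> 0" "vdot x Y = 0" by auto
  then have "vdot (vmap h x) gv = 0" by (simp add: c vdot_scale vmap_hom[OF h] field_hom_simps[OF h])
  then show False using gv_line[OF x(1)] by simp
qed

lemma generic_scale:
  assumes "a \<noteq> 0" "b \<noteq> 0"
  shows "generic v t s h (vscale a gv) (vscale b gt) (vscale b gs)"
proof (unfold_locales, unfold vdot_scale)
  show "vcross (vscale b gt) (vscale b gs) \<noteq> 0"
    using g_indep assms by (simp add: vcross_scale vscale_eq_0)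
  show "b * vdot gt (vmap h (v i)) * (a * vdot (vmap h (s i)) gv) +
      b * vdot gs (vmap h (v i)) * (a * vdot (vmap h (t i)) gv) = 0" for i
    using g_rel[of i] by Groebner_Basis.algebra
  show "b * vdot gt (vmap h y) = h \<rho> * (b * vdot gs (vmap h y))" if "finite {i. vdot (t i) y \<noteq> \<rho> * vdot (s i) y}" for y \<rho>
    using g_nucleus[OF that] by simp
qed (use assms h gt_self gs_self gt_nz gs_nz t_gv s_gv gv_line in auto)

end

text \<open>\<open>Y\<close>, \<open>T\<close> and \<open>S\<close> are the residues of the
  normalised generic data. Since \<open>gt\<close> and \<open>gs\<close> share one scaling factor,
  one of \<open>T\<close> and \<open>S\<close> may vanish, but not both.\<close>

locale generic_place = generic v t s h gv gt gs + place h G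
  for v t s :: "nat \<Rightarrow> 'a::field vec3" and h :: "'a \<Rightarrow> 'b::field" and gv gt gs :: "'b vec3" and G +
  fixes Y T S :: "'a vec3"
  assumes gY: "gvec gv Y" and Y_nz: "Y \<noteq> 0" and gT: "gvec gt T" and gS: "gvec gs S"
    and TS_nz: "T \<noteq> 0 \<or> S \<noteq> 0"
begin

lemma TY: "vdot T Y = 0"
  using gvec_dot[OF gT gY] gt_self G_zero by simp

lemma SY: "vdot S Y = 0"
  using gvec_dot[OF gS gY] gs_self G_zero by simp

lemma rel_Y: "vdot T (v i) * vdot (s i) Y + vdot S (v i) * vdot (t i) Y = 0"
proof -
  have "(vdot gt (vmap h (v i)) * vdot (vmap h (s i)) gv + vdot gs (vmap h (v i)) * vdot (vmap h (t i)) gv,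
      vdot T (v i) * vdot (s i) Y + vdot S (v i) * vdot (t i) Y) \<in> G"
    by (intro G_add G_mult gvec_dot gT gS gY gvec_map)
  then show ?thesis using g_rel G_zero by simp
qed

text \<open>Writing the generic point as a multiple of the constant point it specialises to plus a small vector.\<close>

lemma perturbation:
  assumes Y': "Y' \<noteq> 0" and par: "Y = vscale \<kappa> Y'"
  obtains lam c d D x where "(lam, \<kappa>) \<in> G" "c \<noteq> 0" "gvec d D" "D \<noteq> 0" "vdot x Y' \<noteq> 0" "vdot x D = 0"
    "vscale c (gv - vscale lam (vmap h Y')) = d"
proof -
  obtain x where x: "vdot x Y' \<noteq> 0" using vdot_nonzero_ex Y' by blast
  define lam where "lam = vdot (vmap h x) gv / h (vdot x Y')"
  have "(lam, vdot x Y / vdot x Y') \<in> G"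
    unfolding lam_def by (intro G_divide gvec_dot gvec_map gY G_const x)
  then have lam: "(lam, \<kappa>) \<in> G" using x by (simp add: par vdot_scale)
  define \<delta> where "\<delta> = gv - vscale lam (vmap h Y')"
  have "\<delta> \<noteq> 0"
  proof
    assume "\<delta> = 0"
    then have "gv = vscale lam (vmap h Y')" by (simp add: \<delta>_def)
    then show False using gv_cross[OF Y'] by (simp add: vcross_scale vcross_self vscale_0)
  qed
  then obtain c D where c: "c \<noteq> 0" "gvec (vscale c \<delta>) D" "D \<noteq> 0" using normalize_one by blast
  have "vdot (vmap h x) (vscale c \<delta>) = 0"
    using x by (simp add: \<delta>_def lam_def vdot_scale vdot_diff vmap_hom[OF hom] h_simps)
  then have "vdot x D = 0" using gvec_dot[OF gvec_map c(2), of x] G_zero by simp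
  then show ?thesis using that[OF lam c(1) c(2) c(3) x] by (simp add: \<delta>_def)
qed

text \<open>If the generic point specialises to \<open>v j\<close>, then \<open>T\<close> and
  \<open>S\<close> are combinations of \<open>t j\<close> and \<open>s j\<close>. The residue of
  \<open>g_rel\<close> combined with \<open>rel\<close> is a quadratic relation in the direction of
  \<open>v i\<close> seen from \<open>v j\<close>. It holds for all other \<open>i\<close>, so its
  coefficients vanish.\<close>

lemma center_proportional:
  assumes "vcross (v j) Y = 0"
  shows "\<exists>p. p \<noteq> 0 \<and> T = vscale p (t j) \<and> S = vscale p (s j)"
proof -
  obtain \<kappa> where k: "Y = vscale \<kappa> (v j)" using parallel_vec assms v_nz by blast
  then have "\<kappa> \<noteq> 0" using Y_nz by (auto simp: vscale_0)
  then have "vdot T (v j) = 0" "vdot S (v j) = 0" using TY SY by (auto simp: k vdot_scale)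
  then obtain p q p' q' where T: "T = vscale p (t j) + vscale q (s j)" and S: "S = vscale p' (t j) + vscale q' (s j)"
    using pencil by metis
  have "(- p') * (vdot (t j) (v i))\<^sup>2 + (p - q') * (vdot (t j) (v i) * vdot (s j) (v i)) + q * (vdot (s j) (v i))\<^sup>2 = 0"
    if "i \<noteq> j" for i
  proof -
    define a b c d where "a = vdot (t i) (v j)" and "b = vdot (s i) (v j)" and "c = vdot (t j) (v i)" and "d = vdot (s j) (v i)"
    have "\<kappa> * ((p * c + q * d) * b + (p' * c + q' * d) * a) = 0"
      using rel_Y[of i] by (simp add: k T S vdot_scale vdot_add a_def b_def c_def d_def algebra_simps)
    then have 1: "(p * c + q * d) * b + (p' * c + q' * d) * a = 0" using \<open>\<kappa> \<noteq> 0\<close> by simp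
    have 2: "a * d + b * c = 0" and "b \<noteq> 0"
      using rel[OF that] s_nz[OF that] by (simp_all add: a_def b_def c_def d_def)
    have "b * ((- p') * c\<^sup>2 + (p - q') * (c * d) + q * d\<^sup>2) = 0"
      using 1 2 by Groebner_Basis.algebra
    then show ?thesis using \<open>b \<noteq> 0\<close> by (simp add: c_def d_def)
  qed
  then have "- p' = 0 \<and> p - q' = 0 \<and> q = 0"
    by (intro binary_quadratic[of UNIV]) auto
  then have "T = vscale p (t j)" "S = vscale p (s j)" by (auto simp: T S vscale_0)
  then show ?thesis using TS_nz by (intro exI[of _ p]) (auto simp: vscale_0)
qed

text \<open>For \<open>i\<close> different from \<open>j\<close> the numerator and the denominator
  of \<open>H i\<close> both have nonzero residues.\<close>

lemma center_other:
  assumes "vcross (v j) Y = 0" "i \<noteq> j"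
  shows "\<exists>w. w \<noteq> 0 \<and> (H i, w) \<in> G"
proof -
  obtain p where p: "p \<noteq> 0" "T = vscale p (t j)" using center_proportional[OF assms(1)] by blast
  obtain \<kappa> where k: "Y = vscale \<kappa> (v j)" using parallel_vec assms v_nz by blast
  then have "\<kappa> \<noteq> 0" using Y_nz by (auto simp: vscale_0)
  then have n: "vdot T (v i) \<noteq> 0" "vdot (t i) Y \<noteq> 0"
    using p t_nz[of i j] t_nz[of j i] assms(2) by (simp_all add: k vdot_scale)
  have "(H i, vdot T (v i) / vdot (t i) Y) \<in> G"
    unfolding H_def by (intro G_divide gvec_dot gT gvec_map gY n)
  then show ?thesis using n by (intro exI[of _ "vdot T (v i) / vdot (t i) Y"]) auto
qed

text \<open>At a center $v_j$ the branch direction lies on exactly one of the two lines through $v_j$, and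
  the other line computes the value of H there.\<close>

lemma center_self:
  assumes "vcross (v j) Y = 0"
  shows "\<exists>w. w \<noteq> 0 \<and> (H j, w) \<in> G"
proof -
  obtain p where p: "p \<noteq> 0" "T = vscale p (t j)" "S = vscale p (s j)" using center_proportional[OF assms(1)] by blast
  obtain \<kappa> where k: "Y = vscale \<kappa> (v j)" using parallel_vec assms v_nz by blast
  then have k0: "\<kappa> \<noteq> 0" using Y_nz by (auto simp: vscale_0)
  from perturbation[OF v_nz k] obtain lam c d D x where
    P: "(lam, \<kappa>) \<in> G" "c \<noteq> 0" "gvec d D" "D \<noteq> 0" "vdot x (v j) \<noteq> 0" "vdot x D = 0"
      "vscale c (gv - vscale lam (vmap h (v j))) = d" by blast
  have lam: "lam \<noteq> 0" using P(1) k0 G_zero by auto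
  have D: "vdot (t j) D \<noteq> 0 \<or> vdot (s j) D \<noteq> 0"
  proof (rule ccontr)
    assume "\<not> ?thesis"
    then obtain e where e: "D = vscale e (v j)" using on_both[of j D] by auto
    then have "e = 0" using P(5,6) by (simp add: vdot_scale)
    then show False using P(4) e by (simp add: vscale_0)
  qed
  \<comment> \<open>Directly, the residue of \<open>H j\<close> would be 0/0. As \<open>gt\<close>
    and \<open>gs\<close> vanish at \<open>gv\<close>, and \<open>t j\<close> and \<open>s j\<close>
    at \<open>v j\<close>, all four values can be read off from the perturbation \<open>d\<close>,
    whose residue \<open>D\<close> does not lie on both lines.\<close>
  have gd: "vdot gt d = - c * lam * vdot gt (vmap h (v j))" "vdot gs d = - c * lam * vdot gs (vmap h (v j))"
    unfolding P(7)[symmetric] by (simp_all add: vdot_scale vdot_diff gt_self gs_self)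
  have jd: "vdot (vmap h (t j)) d = c * vdot (vmap h (t j)) gv" "vdot (vmap h (s j)) d = c * vdot (vmap h (s j)) gv"
    unfolding P(7)[symmetric]
    by (simp_all add: vdot_scale vdot_diff vmap_hom[OF hom] t_self s_self h_simps)
  from D show ?thesis
  proof
    assume n: "vdot (t j) D \<noteq> 0"
    have "H j = - (vdot gt d / (lam * vdot (vmap h (t j)) d))"
      unfolding gd jd H_def using P(2) lam t_gv[of j] by (simp add: field_simps)
    moreover have "(- (vdot gt d / (lam * vdot (vmap h (t j)) d)), - (vdot T D / (\<kappa> * vdot (t j) D))) \<in> G"
      by (intro G_uminus G_divide G_mult gvec_dot gT P(1,3) gvec_map) (use n k0 in auto)
    ultimately have "(H j, - (vdot T D / (\<kappa> * vdot (t j) D))) \<in> G" by simp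
    then show ?thesis using n k0 p by (intro exI[of _ "- (vdot T D / (\<kappa> * vdot (t j) D))"]) (auto simp: vdot_scale)
  next
    assume n: "vdot (s j) D \<noteq> 0"
    have "H j = vdot gs d / (lam * vdot (vmap h (s j)) d)"
      unfolding gd jd H_s using P(2) lam s_gv[of j] by (simp add: field_simps)
    moreover have "(vdot gs d / (lam * vdot (vmap h (s j)) d), vdot S D / (\<kappa> * vdot (s j) D)) \<in> G"
      by (intro G_uminus G_divide G_mult gvec_dot gS P(1,3) gvec_map) (use n k0 in auto)
    ultimately have "(H j, vdot S D / (\<kappa> * vdot (s j) D)) \<in> G" by simp
    then show ?thesis using n k0 p by (intro exI[of _ "vdot S D / (\<kappa> * vdot (s j) D)"]) (auto simp: vdot_scale)
  qed
qed

text \<open>At a centre all \<open>H i\<close> have nonzero residues, so a vanishing ratio excludes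
  both \<open>v b\<close> and \<open>v j\<close> as centres. Clearing denominators, in the four ways
  that the two expressions for \<open>H\<close> allow, kills the products of \<open>T\<close> or
  \<open>S\<close> at \<open>v b\<close> with \<open>t j\<close> or \<open>s j\<close> at
  \<open>Y\<close>. As \<open>Y\<close> is not proportional to \<open>v j\<close>, one of the latter
  two values is nonzero.\<close>

lemma degenerate:
  assumes 0: "(H b / H j, 0) \<in> G" and "b \<noteq> j"
  shows "vcross (v b) Y \<noteq> 0" "vdot T (v b) = 0" "vdot S (v b) = 0"
proof -
  have unit: False if "\<exists>w. w \<noteq> 0 \<and> (H b, w) \<in> G" "\<exists>w. w \<noteq> 0 \<and> (H j, w) \<in> G"
  proof -
    from that obtain w w' where "w \<noteq> 0" "(H b, w) \<in> G" "w' \<noteq> 0" "(H j, w') \<in> G" by auto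
    then have "(H b / H j, w / w') \<in> G" "w / w' \<noteq> 0" by (auto intro: G_divide)
    then show False using G_unique 0 by blast
  qed
  show "vcross (v b) Y \<noteq> 0" using unit center_self[of b] center_other[of b j] \<open>b \<noteq> j\<close> by blast
  have nj: "vcross (v j) Y \<noteq> 0" using unit center_self[of j] center_other[of j b] \<open>b \<noteq> j\<close> by blast
  have prods: "vdot T (v b) * vdot (t j) Y = 0" "vdot T (v b) * vdot (s j) Y = 0"
    "vdot S (v b) * vdot (t j) Y = 0" "vdot S (v b) * vdot (s j) Y = 0"
  proof -
    have e: "vdot gt (vmap h (v b)) * vdot (vmap h (t j)) gv = (H b / H j) * (vdot gt (vmap h (v j)) * vdot (vmap h (t b)) gv)"
      using gt_nz[of j] t_gv[of j] t_gv[of b] by (simp add: H_def field_simps)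
    have "(vdot gt (vmap h (v b)) * vdot (vmap h (t j)) gv, vdot T (v b) * vdot (t j) Y) \<in> G"
      "((H b / H j) * (vdot gt (vmap h (v j)) * vdot (vmap h (t b)) gv), 0 * (vdot T (v j) * vdot (t b) Y)) \<in> G"
      by (intro G_mult 0 gvec_dot gT gvec_map gY)+
    then show "vdot T (v b) * vdot (t j) Y = 0" unfolding e using G_unique by fastforce
    have e: "vdot gt (vmap h (v b)) * vdot (vmap h (s j)) gv = (H b / H j) * (- vdot gs (vmap h (v j)) * vdot (vmap h (t b)) gv)"
      unfolding H_s[of j] using gs_nz[of j] s_gv[of j] t_gv[of b] by (simp add: H_def field_simps)
    have "(vdot gt (vmap h (v b)) * vdot (vmap h (s j)) gv, vdot T (v b) * vdot (s j) Y) \<in> G"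
      "((H b / H j) * (- vdot gs (vmap h (v j)) * vdot (vmap h (t b)) gv), 0 * (- vdot S (v j) * vdot (t b) Y)) \<in> G"
      by (intro G_mult G_uminus 0 gvec_dot gT gS gvec_map gY)+
    then show "vdot T (v b) * vdot (s j) Y = 0" unfolding e using G_unique by fastforce
    have e: "vdot gs (vmap h (v b)) * vdot (vmap h (t j)) gv = (H b / H j) * (- vdot gt (vmap h (v j)) * vdot (vmap h (s b)) gv)"
      unfolding H_s[of b] using gt_nz[of j] t_gv[of j] s_gv[of b] by (simp add: H_def field_simps)
    have "(vdot gs (vmap h (v b)) * vdot (vmap h (t j)) gv, vdot S (v b) * vdot (t j) Y) \<in> G"
      "((H b / H j) * (- vdot gt (vmap h (v j)) * vdot (vmap h (s b)) gv), 0 * (- vdot T (v j) * vdot (s b) Y)) \<in> G"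
      by (intro G_mult G_uminus 0 gvec_dot gT gS gvec_map gY)+
    then show "vdot S (v b) * vdot (t j) Y = 0" unfolding e using G_unique by fastforce
    have e: "vdot gs (vmap h (v b)) * vdot (vmap h (s j)) gv = (H b / H j) * (vdot gs (vmap h (v j)) * vdot (vmap h (s b)) gv)"
      unfolding H_s using gs_nz[of j] s_gv[of j] s_gv[of b] by (simp add: field_simps)
    have "(vdot gs (vmap h (v b)) * vdot (vmap h (s j)) gv, vdot S (v b) * vdot (s j) Y) \<in> G"
      "((H b / H j) * (vdot gs (vmap h (v j)) * vdot (vmap h (s b)) gv), 0 * (vdot S (v j) * vdot (s b) Y)) \<in> G"
      by (intro G_mult 0 gvec_dot gS gvec_map gY)+
    then show "vdot S (v b) * vdot (s j) Y = 0" unfolding e using G_unique by fastforce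
  qed
  have "vdot (t j) Y \<noteq> 0 \<or> vdot (s j) Y \<noteq> 0"
  proof (rule ccontr)
    assume "\<not> ?thesis"
    then obtain c where "Y = vscale c (v j)" using on_both[of j Y] by auto
    then show False using nj by (simp add: vcross_scale vcross_self vscale_0)
  qed
  then show "vdot T (v b) = 0" "vdot S (v b) = 0" using prods by auto
qed

end

text \<open>By Cramer's rule: the linear form with the values r_i det(Y, v_b, v_i)^2 at
  \<open>v i\<close>, \<open>v j\<close> and \<open>v k\<close> vanishes at
  \<open>Y\<close>.\<close>

definition star_relation :: "'a::field vec3 \<Rightarrow> (nat \<Rightarrow> 'a vec3) \<Rightarrow> (nat \<Rightarrow> 'a) \<Rightarrow> nat \<Rightarrow> nat \<Rightarrow> nat \<Rightarrow> nat \<Rightarrow> bool" where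
  "star_relation Y v r b i j k \<longleftrightarrow>
     vdet Y (v j) (v k) * (r i * (vdet Y (v b) (v i))\<^sup>2) + vdet Y (v k) (v i) * (r j * (vdet Y (v b) (v j))\<^sup>2)
     + vdet Y (v i) (v j) * (r k * (vdet Y (v b) (v k))\<^sup>2) = 0"

section \<open>Rigid configurations, in which no triple has cyclic products equal up to sign\<close>

locale rigid_config = config v t s for v t s :: "nat \<Rightarrow> 'a::field vec3" +
  assumes no_kappa: "i \<noteq> j \<Longrightarrow> i \<noteq> k \<Longrightarrow> j \<noteq> k \<Longrightarrow>
    (vdot (s i) (v j) * vdot (s j) (v k) * vdot (s k) (v i))\<^sup>2 \<noteq>
    (vdot (s i) (v k) * vdot (s j) (v i) * vdot (s k) (v j))\<^sup>2"
begin

lemma s_not_concurrent: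
  assumes "Z \<noteq> 0" "vdot (s i) Z = 0" "vdot (s j) Z = 0" "vdot (s k) Z = 0" "i \<noteq> j" "i \<noteq> k" "j \<noteq> k"
  shows False
  using concurrent[of s, OF s_self s_nz assms] no_kappa[OF assms(5-7)] by simp

text \<open>Multiplying the relations \<open>rel\<close> around the triple compares the cyclic
  products of \<open>t\<close> with those of \<open>s\<close> up to a minus sign, so concurrent
  \<open>t\<close> would make the two cyclic products of \<open>s\<close> equal.\<close>

lemma t_not_concurrent:
  assumes "Z \<noteq> 0" "vdot (t i) Z = 0" "vdot (t j) Z = 0" "vdot (t k) Z = 0" and d: "i \<noteq> j" "i \<noteq> k" "j \<noteq> k"
  shows False
proof -
  define a b c a' b' c' where "a = vdot (t i) (v j)" "b = vdot (t j) (v k)" "c = vdot (t k) (v i)"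
    "a' = vdot (t j) (v i)" "b' = vdot (t k) (v j)" "c' = vdot (t i) (v k)"
  define p q r p' q' r' where "p = vdot (s i) (v j)" "q = vdot (s j) (v k)" "r = vdot (s k) (v i)"
    "p' = vdot (s j) (v i)" "q' = vdot (s k) (v j)" "r' = vdot (s i) (v k)"
  note defs = a_b_c_a'_b'_c'_def p_q_r_p'_q'_r'_def
  have 1: "a * b * c = - (c' * a' * b')" using concurrent[of t, OF t_self t_nz assms] by (simp add: defs)
  have 2: "a * p' + p * a' = 0" "b * q' + q * b' = 0" "c * r' + r * c' = 0"
    using rel[of i j] rel[of j k] rel[of k i] d by (auto simp: defs)
  have nz: "a * b * c \<noteq> 0" using t_nz d by (simp add: defs)
  have "(a * b * c) * (p' * q' * r' - p * q * r) = 0"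
    using 1 2 by Groebner_Basis.algebra
  then have "p' * q' * r' = p * q * r" using nz by simp
  then show False using no_kappa[OF d] by (simp add: defs mult.commute mult.left_commute)
qed

end

text \<open>The situation when a ratio of the \<open>H\<close> is sent to 0. Both \<open>T\<close>
  and \<open>S\<close> then vanish at \<open>Y\<close> and at \<open>v b\<close>, so they are
  multiples of the line \<open>m\<close> joining them.\<close>

locale bad_place = generic_place v t s h gv gt gs G Y T S + rigid_config v t s
  for v t s :: "nat \<Rightarrow> 'a::field vec3" and h :: "'a \<Rightarrow> 'b::field" and gv gt gs :: "'b vec3" and G Y T S +
  fixes b j0 :: nat
  assumes zero: "(H b / H j0, 0) \<in> G" and bj: "b \<noteq> j0"
begin

definition "m = vcross Y (v b)"

lemma m_nz: "m \<noteq> 0"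
  using degenerate(1)[OF zero bj] vcross_anti unfolding m_def by blast

lemma m_dot: "vdot m x = vdet Y (v b) x"
  by (simp add: m_def vdet_def)

lemma finite_exceptional: "finite {i. vdet Y (v b) (v i) = 0}"
  using finite_on_line[OF m_nz] by (simp add: m_dot)

lemma three_regular:
  obtains i j k where "vdet Y (v b) (v i) \<noteq> 0" "vdet Y (v b) (v j) \<noteq> 0" "vdet Y (v b) (v k) \<noteq> 0"
    "i \<noteq> j" "i \<noteq> k" "j \<noteq> k"
proof -
  have "infinite (UNIV - {i. vdet Y (v b) (v i) = 0})" using finite_exceptional by simp
  then obtain B where "B \<subseteq> UNIV - {i. vdet Y (v b) (v i) = 0}" "card B = 3" by (meson infinite_arbitrarily_large)
  then show ?thesis using that by (auto simp: card_3_iff)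
qed

lemma TS_form: "\<exists>\<alpha> \<beta>. T = vscale \<alpha> m \<and> S = vscale \<beta> m"
  unfolding m_def using orth_two'[OF m_nz[unfolded m_def]] TY SY degenerate(2,3)[OF zero bj] by blast

text \<open>The residue of \<open>g_rel\<close> at \<open>v i\<close> is m(v_i) times a linear
  relation between \<open>s i\<close> and \<open>t i\<close> at \<open>Y\<close>. Neither
  coefficient vanishes, as otherwise three of the \<open>s\<close> or three of the \<open>t\<close>
  would be concurrent at \<open>Y\<close>. The relation holds for almost all \<open>i\<close>, so
  \<open>g_nucleus\<close> carries it over to the generic forms.\<close>

lemma nucleus:
  obtains \<rho> \<beta> where "\<rho> \<noteq> 0" "\<beta> \<noteq> 0" "T = vscale (- \<rho> * \<beta>) m" "S = vscale \<beta> m"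
    "\<And>i. vdet Y (v b) (v i) \<noteq> 0 \<Longrightarrow> vdot (t i) Y = \<rho> * vdot (s i) Y"
    "\<And>i. vdet Y (v b) (v i) \<noteq> 0 \<Longrightarrow> vdot (s i) Y \<noteq> 0"
    "vdot gt (vmap h Y) = h \<rho> * vdot gs (vmap h Y)"
proof -
  obtain \<alpha> \<beta> where ab: "T = vscale \<alpha> m" "S = vscale \<beta> m" using TS_form by blast
  have r: "\<alpha> * vdot (s i) Y + \<beta> * vdot (t i) Y = 0" if "vdet Y (v b) (v i) \<noteq> 0" for i
  proof -
    have "vdet Y (v b) (v i) * (\<alpha> * vdot (s i) Y + \<beta> * vdot (t i) Y) = 0"
      using rel_Y[of i] by (simp add: ab vdot_scale m_dot algebra_simps)
    then show ?thesis using that by simp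
  qed
  obtain i j k where ijk: "vdet Y (v b) (v i) \<noteq> 0" "vdet Y (v b) (v j) \<noteq> 0" "vdet Y (v b) (v k) \<noteq> 0"
    "i \<noteq> j" "i \<noteq> k" "j \<noteq> k" by (rule three_regular)
  have "\<alpha> \<noteq> 0 \<or> \<beta> \<noteq> 0" using TS_nz ab by (auto simp: vscale_0)
  have b0: "\<beta> \<noteq> 0"
  proof
    assume "\<beta> = 0"
    then have "\<alpha> \<noteq> 0" using \<open>\<alpha> \<noteq> 0 \<or> \<beta> \<noteq> 0\<close> by simp
    then show False using s_not_concurrent[OF Y_nz, of i j k] r[OF ijk(1)] r[OF ijk(2)] r[OF ijk(3)] \<open>\<beta> = 0\<close> ijk by auto
  qed
  have a0: "\<alpha> \<noteq> 0"
  proof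
    assume "\<alpha> = 0"
    then show False using t_not_concurrent[OF Y_nz, of i j k] r[OF ijk(1)] r[OF ijk(2)] r[OF ijk(3)] b0 ijk by auto
  qed
  define \<rho> where "\<rho> = - \<alpha> / \<beta>"
  have t: "vdot (t i) Y = \<rho> * vdot (s i) Y" if "vdet Y (v b) (v i) \<noteq> 0" for i
    using r[OF that] b0 by (simp add: \<rho>_def field_simps add_eq_0_iff)
  have snz: "vdot (s i) Y \<noteq> 0" if "vdet Y (v b) (v i) \<noteq> 0" for i
  proof
    assume "vdot (s i) Y = 0"
    with t[OF that] have "vdot (t i) Y = 0" by simp
    then obtain c where "Y = vscale c (v i)" using \<open>vdot (s i) Y = 0\<close> on_both[of i Y] by auto
    then show False using that by (simp add: vdet_linear vdet_same)
  qed
  have "{i. vdot (t i) Y \<noteq> \<rho> * vdot (s i) Y} \<subseteq> {i. vdet Y (v b) (v i) = 0}" using t by auto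
  then have "vdot gt (vmap h Y) = h \<rho> * vdot gs (vmap h Y)"
    by (intro g_nucleus) (rule finite_subset[OF _ finite_exceptional])
  moreover have "T = vscale (- \<rho> * \<beta>) m" using b0 by (simp add: ab \<rho>_def)
  ultimately show ?thesis using that[of \<rho> \<beta>] a0 b0 ab t snz by (simp add: \<rho>_def)
qed

text \<open>The exact relation between $v_i$ and the generic point, divided by the size of the perturbation
  before specialising, constrains how $t_i - \rho s_i$ varies with i.\<close>

lemma star:
  obtains \<rho> where "\<And>i. vdet Y (v b) (v i) \<noteq> 0 \<Longrightarrow> vdot (t i) Y = \<rho> * vdot (s i) Y"
    "\<And>i. vdet Y (v b) (v i) \<noteq> 0 \<Longrightarrow> vdot (s i) Y \<noteq> 0"
    "\<And>\<mu> i j k. vdet Y (v b) (v i) \<noteq> 0 \<Longrightarrow> vdet Y (v b) (v j) \<noteq> 0 \<Longrightarrow> vdet Y (v b) (v k) \<noteq> 0 \<Longrightarrow>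
      (\<And>a. a \<in> {i, j, k} \<Longrightarrow> t a - vscale \<rho> (s a) = vscale (\<mu> a) (vcross Y (v a))) \<Longrightarrow>
      star_relation Y v (\<lambda>i. \<mu> i / vdot (s i) Y) b i j k"
proof -
  obtain \<rho> \<beta> where rb: "\<rho> \<noteq> 0" "\<beta> \<noteq> 0" "T = vscale (- \<rho> * \<beta>) m" "S = vscale \<beta> m"
    and t: "\<And>i. vdet Y (v b) (v i) \<noteq> 0 \<Longrightarrow> vdot (t i) Y = \<rho> * vdot (s i) Y"
    and snz: "\<And>i. vdet Y (v b) (v i) \<noteq> 0 \<Longrightarrow> vdot (s i) Y \<noteq> 0"
    and gn: "vdot gt (vmap h Y) = h \<rho> * vdot gs (vmap h Y)" using nucleus by blast
  from perturbation[OF Y_nz vscale_1[symmetric]] obtain lam c d D x where P: "(lam, 1) \<in> G" "c \<noteq> 0" "gvec d D" "D \<noteq> 0" "vdot x Y \<noteq> 0" "vdot x D = 0"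
      "vscale c (gv - vscale lam (vmap h Y)) = d" by blast
  have lam: "lam \<noteq> 0" using P(1) G_zero by fastforce
  \<comment> \<open>\<open>e\<close> vanishes at both \<open>gv\<close> and \<open>Y\<close>, which
    determines it up to a factor. \<open>L\<close> has residue 0 because T = - rho S; multiplied by
    the scale \<open>c\<close> of the perturbation, its values still have residues, and these carry
    the information sought.\<close>
  define e where "e = gt - vscale (h \<rho>) gs"
  define L where "L = gt + vscale (h \<rho>) gs"
  define N where "N = vcross Y D"
  have N: "N \<noteq> 0"
  proof
    assume "N = 0"
    then obtain k where k: "D = vscale k Y" using parallel_vec Y_nz unfolding N_def by blast
    then have "k = 0" using P(5,6) by (simp add: vdot_scale)
    then show False using P(4) k by (simp add: vscale_0)
  qed
  have gN: "gvec (vcross (vmap h Y) d) N" unfolding N_def by (intro gvec_cross gvec_map P)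
  have cN: "vcross (vmap h Y) d \<noteq> 0"
  proof
    assume "vcross (vmap h Y) d = 0"
    then have "gvec 0 N" using gN by simp
    then show False using N G_zero by (auto simp: gvec_def vec_eq_0_iff)
  qed
  define E where "E = T - vscale \<rho> S"
  have E: "E = vscale (- 2 * \<rho> * \<beta>) m"
    unfolding E_def rb(3,4) by (simp add: vec_defs minus_prod_def algebra_simps)
  have gE: "gvec e E" unfolding e_def E_def by (intro gvec_diff gvec_scale gT gS G_const)
  have E_nz: "- 2 * \<rho> * \<beta> \<noteq> 0" using two rb by simp
  have egv: "vdot e gv = 0" and eY: "vdot e (vmap h Y) = 0"
    by (simp_all add: e_def vdot_diff vdot_scale gt_self gs_self gn)
  have ed: "vdot e d = 0" unfolding P(7)[symmetric] by (simp add: vdot_scale vdot_diff egv eY)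
  obtain mu where mu: "e = vscale mu (vcross (vmap h Y) d)" using orth_two'[OF cN eY ed] by blast
  obtain y where y: "vdot y N \<noteq> 0" using vdot_nonzero_ex N by blast
  have "(vdot (vmap h y) (vcross (vmap h Y) d), vdot y N) \<in> G" by (intro gvec_dot gvec_map gN)
  then have nz: "vdot (vmap h y) (vcross (vmap h Y) d) \<noteq> 0" using y G_zero by auto
  define mu0 where "mu0 = vdot y E / vdot y N"
  have "(vdot (vmap h y) e / vdot (vmap h y) (vcross (vmap h Y) d), mu0) \<in> G"
    unfolding mu0_def by (intro G_divide gvec_dot gvec_map gE gN y)
  then have gmu: "(mu, mu0) \<in> G" using nz unfolding mu by (simp add: vdot_scale)
  then have "gvec e (vscale mu0 N)" unfolding mu by (intro gvec_scale gN)
  then have "E = vscale mu0 N" using gE gvec_unique by blast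
  then have mu0: "mu0 \<noteq> 0" using E E_nz m_nz by (auto simp: vscale_0 vscale_eq_0)
  have mu_nz: "mu \<noteq> 0" using gmu mu0 G_zero by auto
  \<comment> \<open>The residue of c L(v_i). It comes from \<open>g_rel\<close>, with t_i - rho s_i
    at the generic point replaced by its value at the perturbation. Up to a factor common to all
    \<open>i\<close> it is the quantity in \<open>star_relation\<close>.\<close>
  define w where "w \<mu> i = (\<beta> * vdet Y (v b) (v i)) * \<mu> i * ((- 2 * \<rho> * \<beta>) * vdet Y (v b) (v i)) / (mu0 * vdot (s i) Y)" for \<mu> :: "nat \<Rightarrow> 'a" and i
  have gL: "(c * vdot L (vmap h (v i)), w \<mu> i) \<in> G"
    if i: "vdet Y (v b) (v i) \<noteq> 0" and mui: "t i - vscale \<rho> (s i) = vscale (\<mu> i) (vcross Y (v i))" for i \<mu>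
  proof -
    have "vdot (vmap h (t i)) gv - h \<rho> * vdot (vmap h (s i)) gv = vdot (vmap h (t i - vscale \<rho> (s i))) gv"
      by (simp add: vmap_hom[OF hom] vdot_diff vdot_scale)
    also have "\<dots> = h (\<mu> i) * vdet (vmap h Y) (vmap h (v i)) gv"
      unfolding mui by (simp add: vmap_hom[OF hom, symmetric] vdet_def vdot_scale vmap_hom(4)[OF hom])
    also have "c * \<dots> = h (\<mu> i) * vdet (vmap h Y) (vmap h (v i)) d"
      unfolding P(7)[symmetric] by (simp add: vdet_def vdot_scale vdot_diff vcross_orth)
    also have "vdet (vmap h Y) (vmap h (v i)) d = - vdot (vcross (vmap h Y) d) (vmap h (v i))"
      unfolding vdet_def[symmetric] by (rule vdet_perm)
    finally have 1: "mu * (c * (vdot (vmap h (t i)) gv - h \<rho> * vdot (vmap h (s i)) gv)) = - (h (\<mu> i) * vdot e (vmap h (v i)))"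
      unfolding mu by (simp add: vdot_scale mult_ac)
    have "c * vdot L (vmap h (v i)) * (mu * vdot (vmap h (s i)) gv) = vdot gs (vmap h (v i)) * h (\<mu> i) * vdot e (vmap h (v i))"
    proof -
      have "vdot L (vmap h (v i)) = vdot gt (vmap h (v i)) + h \<rho> * vdot gs (vmap h (v i))"
        by (simp add: L_def vdot_add vdot_scale)
      then show ?thesis using 1 g_rel[of i] by Groebner_Basis.algebra
    qed
    then have "c * vdot L (vmap h (v i)) = vdot gs (vmap h (v i)) * h (\<mu> i) * vdot e (vmap h (v i)) / (mu * vdot (vmap h (s i)) gv)"
      using mu_nz s_gv[of i] by (simp add: field_simps)
    moreover have "(vdot gs (vmap h (v i)) * h (\<mu> i) * vdot e (vmap h (v i)) / (mu * vdot (vmap h (s i)) gv),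
       vdot S (v i) * \<mu> i * vdot E (v i) / (mu0 * vdot (s i) Y)) \<in> G"
      by (intro G_divide G_mult gvec_dot gS gE gvec_map G_const gmu gY) (use mu0 snz i in auto)
    moreover have "vdot S (v i) * \<mu> i * vdot E (v i) / (mu0 * vdot (s i) Y) = w \<mu> i"
      unfolding w_def rb(4) E by (simp add: vdot_scale m_dot)
    ultimately show ?thesis by simp
  qed
  \<comment> \<open>\<open>S\<close> is proportional to \<open>E\<close>, which contains the
    direction \<open>D\<close>; hence c gs(Y), and with it c L(Y), has residue 0.\<close>
  have "vdot E D = 0" using gvec_dot[OF gE P(3)] ed G_zero by simp
  then have "vdot S D = 0" using E_nz unfolding rb(4) E by (simp add: vdot_scale)
  have "vdot gs d = - c * lam * vdot gs (vmap h Y)"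
    unfolding P(7)[symmetric] by (simp add: vdot_scale vdot_diff gs_self)
  then have "c * vdot gs (vmap h Y) = - (vdot gs d / lam)" using lam by (simp add: field_simps)
  moreover have "(- (vdot gs d / lam), - (vdot S D / 1)) \<in> G"
    by (intro G_uminus G_divide gvec_dot gS P) auto
  ultimately have "(c * vdot gs (vmap h Y), 0) \<in> G" using \<open>vdot S D = 0\<close> by simp
  from G_mult[OF G_const[of "2 * \<rho>"] this] have "(h (2 * \<rho>) * (c * vdot gs (vmap h Y)), 0) \<in> G" by simp
  also have "h (2 * \<rho>) * (c * vdot gs (vmap h Y)) = c * vdot L (vmap h Y)"
  proof -
    have 2: "h (2 * \<rho>) = h \<rho> + h \<rho>" unfolding mult_2 by (rule h_simps)
    show ?thesis unfolding 2 L_def vdot_add vdot_scale gn by Groebner_Basis.algebra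
  qed
  finally have LY: "(c * vdot L (vmap h Y), 0) \<in> G" .
  show ?thesis
  proof (rule that[OF t snz])
    fix \<mu> i j k
    assume ijk: "vdet Y (v b) (v i) \<noteq> 0" "vdet Y (v b) (v j) \<noteq> 0" "vdet Y (v b) (v k) \<noteq> 0"
      and mu': "\<And>a. a \<in> {i, j, k} \<Longrightarrow> t a - vscale \<rho> (s a) = vscale (\<mu> a) (vcross Y (v a))"
    have gLs: "(c * vdot L (vmap h (v i)), w \<mu> i) \<in> G" "(c * vdot L (vmap h (v j)), w \<mu> j) \<in> G"
      "(c * vdot L (vmap h (v k)), w \<mu> k) \<in> G" using gL ijk mu' by auto
    have "vdet (vmap h (v i)) (vmap h (v j)) (vmap h (v k)) * (c * vdot L (vmap h Y)) =
      vdet (vmap h Y) (vmap h (v j)) (vmap h (v k)) * (c * vdot L (vmap h (v i)))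
      + vdet (vmap h (v i)) (vmap h Y) (vmap h (v k)) * (c * vdot L (vmap h (v j)))
      + vdet (vmap h (v i)) (vmap h (v j)) (vmap h Y) * (c * vdot L (vmap h (v k)))"
      using dot_cramer[of "vmap h (v i)" "vmap h (v j)" "vmap h (v k)" L "vmap h Y"] by (simp add: algebra_simps)
    moreover have "(vdet (vmap h (v i)) (vmap h (v j)) (vmap h (v k)) * (c * vdot L (vmap h Y)), vdet (v i) (v j) (v k) * 0) \<in> G"
      by (intro G_mult gvec_det gvec_map LY)
    moreover have "(vdet (vmap h Y) (vmap h (v j)) (vmap h (v k)) * (c * vdot L (vmap h (v i)))
      + vdet (vmap h (v i)) (vmap h Y) (vmap h (v k)) * (c * vdot L (vmap h (v j)))
      + vdet (vmap h (v i)) (vmap h (v j)) (vmap h Y) * (c * vdot L (vmap h (v k))),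
      vdet Y (v j) (v k) * w \<mu> i + vdet (v i) Y (v k) * w \<mu> j + vdet (v i) (v j) Y * w \<mu> k) \<in> G"
      by (intro G_add G_mult gvec_det gvec_map gLs)
    ultimately have "vdet Y (v j) (v k) * w \<mu> i + vdet (v i) Y (v k) * w \<mu> j + vdet (v i) (v j) Y * w \<mu> k = 0"
      using G_unique by fastforce
    moreover have "vdet (v i) Y (v k) = vdet Y (v k) (v i)" "vdet (v i) (v j) Y = vdet Y (v i) (v j)"
      by (simp_all add: vec_defs algebra_simps)
    ultimately have "vdet Y (v j) (v k) * w \<mu> i + vdet Y (v k) (v i) * w \<mu> j + vdet Y (v i) (v j) * w \<mu> k = 0" by simp
    moreover have "w \<mu> i = (- 2 * \<rho> * \<beta>) * \<beta> / mu0 * (\<mu> i / vdot (s i) Y * (vdet Y (v b) (v i))\<^sup>2)" for i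
      by (simp add: w_def power2_eq_square)
    ultimately have "(- 2 * \<rho> * \<beta>) * \<beta> / mu0 * (vdet Y (v j) (v k) * (\<mu> i / vdot (s i) Y * (vdet Y (v b) (v i))\<^sup>2)
        + vdet Y (v k) (v i) * (\<mu> j / vdot (s j) Y * (vdet Y (v b) (v j))\<^sup>2)
        + vdet Y (v i) (v j) * (\<mu> k / vdot (s k) Y * (vdet Y (v b) (v k))\<^sup>2)) = 0"
      by (simp add: algebra_simps)
    then show "star_relation Y v (\<lambda>i. \<mu> i / vdot (s i) Y) b i j k"
      unfolding star_relation_def using E_nz rb mu0 by simp
  qed
qed

end

context rigid_config
begin

text \<open>What remains of a place once it is forgotten. Only the configuration over the base field
  occurs, so that different indices \<open>b\<close>, which come from different places, can be
  compared.\<close>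

definition bad :: "nat \<Rightarrow> 'a vec3 \<Rightarrow> 'a \<Rightarrow> bool" where
  "bad b Y \<rho> \<longleftrightarrow> Y \<noteq> 0 \<and> vcross Y (v b) \<noteq> 0 \<and>
     (\<forall>i. vdet Y (v b) (v i) \<noteq> 0 \<longrightarrow> vdot (t i) Y = \<rho> * vdot (s i) Y \<and> vdot (s i) Y \<noteq> 0) \<and>
     (\<forall>\<mu> i j k. vdet Y (v b) (v i) \<noteq> 0 \<longrightarrow> vdet Y (v b) (v j) \<noteq> 0 \<longrightarrow> vdet Y (v b) (v k) \<noteq> 0 \<longrightarrow>
        (\<forall>a \<in> {i, j, k}. t a - vscale \<rho> (s a) = vscale (\<mu> a) (vcross Y (v a))) \<longrightarrow>
        star_relation Y v (\<lambda>i. \<mu> i / vdot (s i) Y) b i j k)"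

lemma bad_star:
  assumes "bad b Y \<rho>" "vdet Y (v b) (v i) \<noteq> 0" "vdet Y (v b) (v j) \<noteq> 0" "vdet Y (v b) (v k) \<noteq> 0"
    and "\<forall>a \<in> {i, j, k}. t a - vscale \<rho> (s a) = vscale (\<mu> a) (vcross Y (v a))"
  shows "star_relation Y v (\<lambda>i. \<mu> i / vdot (s i) Y) b i j k"
  by (rule assms(1)[unfolded bad_def, THEN conjunct2, THEN conjunct2, THEN conjunct2, THEN spec[where x = \<mu>],
      THEN spec, THEN spec, THEN spec, THEN mp, THEN mp, THEN mp, THEN mp, OF assms(2-5)])

lemma bad_scale:
  assumes "bad b Y \<rho>" "c \<noteq> 0"
  shows "bad b (vscale c Y) \<rho>"
  unfolding bad_def
proof (intro conjI allI impI)
  note B = assms(1)[unfolded bad_def]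
  show "vscale c Y \<noteq> 0" using B assms(2) by (simp add: vscale_eq_0)
  show "vcross (vscale c Y) (v b) \<noteq> 0" using B assms(2) by (simp add: vcross_scale vscale_eq_0)
  fix i assume "vdet (vscale c Y) (v b) (v i) \<noteq> 0"
  then have "vdet Y (v b) (v i) \<noteq> 0" by (simp add: vdet_linear)
  then show "vdot (t i) (vscale c Y) = \<rho> * vdot (s i) (vscale c Y)" "vdot (s i) (vscale c Y) \<noteq> 0"
    using B assms(2) by (auto simp: vdot_scale)
next
  note B = assms(1)[unfolded bad_def]
  fix \<mu> i j k
  assume ijk: "vdet (vscale c Y) (v b) (v i) \<noteq> 0" "vdet (vscale c Y) (v b) (v j) \<noteq> 0" "vdet (vscale c Y) (v b) (v k) \<noteq> 0"
    and m: "\<forall>a \<in> {i, j, k}. t a - vscale \<rho> (s a) = vscale (\<mu> a) (vcross (vscale c Y) (v a))"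
  have m': "\<forall>a \<in> {i, j, k}. t a - vscale \<rho> (s a) = vscale (c * \<mu> a) (vcross Y (v a))"
    using m by (simp add: vcross_scale vscale_vscale mult.commute)
  have ijk': "vdet Y (v b) (v i) \<noteq> 0" "vdet Y (v b) (v j) \<noteq> 0" "vdet Y (v b) (v k) \<noteq> 0"
    using ijk by (auto simp: vdet_linear)
  have nz: "vdot (s i) Y \<noteq> 0" "vdot (s j) Y \<noteq> 0" "vdot (s k) Y \<noteq> 0" using B ijk' by blast+
  have "star_relation Y v (\<lambda>i. c * \<mu> i / vdot (s i) Y) b i j k"
    by (rule bad_star[OF assms(1) ijk' m'])
  moreover have "c * d * (m / (c * \<sigma>) * (c * y)\<^sup>2) = c * (d * (c * m / \<sigma> * y\<^sup>2))" if "\<sigma> \<noteq> 0" for d m \<sigma> y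
    using that assms(2) by (simp add: power2_eq_square)
  ultimately show "star_relation (vscale c Y) v (\<lambda>i. \<mu> i / vdot (s i) (vscale c Y)) b i j k"
    unfolding star_relation_def vdet_linear vdot_scale
    using nz by (simp only: distrib_left[symmetric] mult_zero_right simp_thms)
qed

lemma t_not_parallel: "i \<noteq> j \<Longrightarrow> vcross (t i) (t j) \<noteq> 0"
proof
  assume d: "i \<noteq> j" and "vcross (t i) (t j) = 0"
  moreover have "t i \<noteq> 0" using indep[of i] by (auto simp: vcross_zero)
  ultimately obtain c where c: "t j = vscale c (t i)" using parallel_vec by blast
  then have "c * vdot (t i) (v j) = 0" using t_self[of j] by (simp add: vdot_scale)
  then have "c = 0" using t_nz d by auto
  then show False using c indep[of j] by (simp add: vscale_0 vcross_zero)
qed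

lemma t_det_nz:
  assumes "i \<noteq> j" "i \<noteq> k" "j \<noteq> k"
  shows "vdet (t i) (t j) (t k) \<noteq> 0"
proof
  assume z: "vdet (t i) (t j) (t k) = 0"
  have "vdot (t k) (vcross (t i) (t j)) = 0" using z by (simp add: vdet_def vdot_commute)
  moreover have "vdot (t i) (vcross (t i) (t j)) = 0" "vdot (t j) (vcross (t i) (t j)) = 0"
    using vcross_orth by (simp_all add: vdot_commute)
  ultimately show False using t_not_concurrent t_not_parallel assms by blast
qed

text \<open>The determinant is a polynomial in rho of degree at most 3, with nonzero constant term
  because the \<open>t\<close> are not concurrent.\<close>

lemma finite_rho:
  assumes "i \<noteq> j" "i \<noteq> k" "j \<noteq> k"
  shows "finite {\<rho>. vdet (t i - vscale \<rho> (s i)) (t j - vscale \<rho> (s j)) (t k - vscale \<rho> (s k)) = 0}"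
proof -
  define P where "P = [: vdet (t i) (t j) (t k),
    - (vdet (s i) (t j) (t k) + vdet (t i) (s j) (t k) + vdet (t i) (t j) (s k)),
    vdet (s i) (s j) (t k) + vdet (s i) (t j) (s k) + vdet (t i) (s j) (s k), - vdet (s i) (s j) (s k) :]"
  have "vdet (t i - vscale \<rho> (s i)) (t j - vscale \<rho> (s j)) (t k - vscale \<rho> (s k)) = poly P \<rho>" for \<rho>
    by (simp add: P_def vec_defs algebra_simps)
  moreover have "P \<noteq> 0" using t_det_nz[OF assms] by (simp add: P_def)
  ultimately show ?thesis using poly_roots_finite by simp
qed

text \<open>For regular indices the lines t - rho s pass through \<open>Y\<close>, and two of them
  are never equal. So rho is a root of the polynomial in \<open>finite_rho\<close>, and it
  determines \<open>Y\<close> up to a factor.\<close>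

lemma bad_determined:
  assumes B: "bad b Y \<rho>" and d: "i \<noteq> j" "i \<noteq> k" "j \<noteq> k"
    and n: "vdet Y (v b) (v i) \<noteq> 0" "vdet Y (v b) (v j) \<noteq> 0" "vdet Y (v b) (v k) \<noteq> 0"
  shows "vdet (t i - vscale \<rho> (s i)) (t j - vscale \<rho> (s j)) (t k - vscale \<rho> (s k)) = 0"
    "bad b (vcross (t i - vscale \<rho> (s i)) (t j - vscale \<rho> (s j))) \<rho>"
proof -
  define e where "e a = t a - vscale \<rho> (s a)" for a
  have eY: "vdot (e i) Y = 0" "vdot (e j) Y = 0" "vdot (e k) Y = 0"
    using B n unfolding bad_def e_def by (auto simp: vdot_diff vdot_scale)
  have e_nz: "e a \<noteq> 0" for a
  proof
    assume "e a = 0"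
    then have "t a = vscale \<rho> (s a)" by (simp add: e_def)
    then show False using indep[of a] by (simp add: vcross_scale vcross_self vscale_0)
  qed
  have c: "vcross (e i) (e j) \<noteq> 0"
  proof
    assume "vcross (e i) (e j) = 0"
    then obtain k where k: "e j = vscale k (e i)" using parallel_vec e_nz by blast
    then have "k \<noteq> 0" using e_nz[of j] by (auto simp: vscale_0)
    have "vdot (e j) (v j) = 0" "vdot (e i) (v i) = 0" by (simp_all add: e_def vdot_diff vdot_scale t_self s_self)
    then have "vdot (e i) (v j) = 0" "vdot (e j) (v i) = 0" using k \<open>k \<noteq> 0\<close> by (simp_all add: vdot_scale)
    then have tt: "vdot (t i) (v j) = \<rho> * vdot (s i) (v j)" "vdot (t j) (v i) = \<rho> * vdot (s j) (v i)"
      by (simp_all add: e_def vdot_diff vdot_scale)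
    \<comment> \<open>If the two lines were equal, the two terms of \<open>rel\<close> would
      coincide and add up instead of cancelling.\<close>
    then have "2 * \<rho> * (vdot (s i) (v j) * vdot (s j) (v i)) = 0"
      using rel[OF d(1)] by (simp add: algebra_simps)
    then have "\<rho> = 0" using two s_nz d by auto
    then show False using tt t_nz d by simp
  qed
  obtain a where a: "Y = vscale a (vcross (e i) (e j))" using orth_two[OF c] eY by blast
  then have a0: "a \<noteq> 0" using B by (auto simp: bad_def vscale_0)
  have "a * vdet (e i) (e j) (e k) = 0" using eY(3) unfolding a by (simp add: vdot_scale vdet_def vdot_commute)
  then show "vdet (t i - vscale \<rho> (s i)) (t j - vscale \<rho> (s j)) (t k - vscale \<rho> (s k)) = 0"
    using a0 by (simp add: e_def)
  have "bad b (vscale (1 / a) Y) \<rho>" using bad_scale[OF B] a0 by simp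
  then show "bad b (vcross (t i - vscale \<rho> (s i)) (t j - vscale \<rho> (s j))) \<rho>"
    using a0 unfolding a by (simp add: vscale_vscale vscale_1 e_def)
qed

text \<open>The line joining \<open>Y\<close> and \<open>v b\<close> contains at most one further
  point of the arc.\<close>

lemma exceptional_unique:
  assumes "bad b Y \<rho>" "b \<noteq> i" "b \<noteq> j" "i \<noteq> j" "vdet Y (v b) (v i) = 0"
  shows "vdet Y (v b) (v j) \<noteq> 0"
proof
  assume "vdet Y (v b) (v j) = 0"
  then have "vcross Y (v b) = 0"
    using form_zero[OF arc[OF assms(2-4)], of "vcross Y (v b)"] assms(5) by (simp add: vdet_def vcross_orth)
  then show False using assms(1) by (simp add: bad_def)
qed

text \<open>Two disjoint test triples suffice: besides \<open>b\<close> at most one index is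
  exceptional, so one of the triples is regular and leaves only finitely many pairs of
  \<open>Y\<close> and rho. By the pigeonhole principle infinitely many \<open>b\<close> share a
  pair.\<close>

lemma common_bad:
  assumes "\<And>b. \<exists>Y \<rho>. bad b Y \<rho>"
  shows "\<exists>Y \<rho>. infinite {b. bad b Y \<rho>}"
proof -
  define W where "W = (\<lambda>(i, \<rho>). vcross (t i - vscale \<rho> (s i)) (t (Suc i) - vscale \<rho> (s (Suc i))))"
  define R where "R i = {\<rho>. vdet (t i - vscale \<rho> (s i)) (t (Suc i) - vscale \<rho> (s (Suc i)))
    (t (Suc (Suc i)) - vscale \<rho> (s (Suc (Suc i)))) = 0}" for i
  have fin: "finite ({0} \<times> R 0 \<union> {3} \<times> R 3)" unfolding R_def by (intro finite_UnI finite_cartesian_product finite_rho) auto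
  \<comment> \<open>From 6 on, \<open>b\<close> belongs to neither of the test triples 0, 1, 2 and
    3, 4, 5.\<close>
  have "\<exists>p \<in> {0} \<times> R 0 \<union> {3} \<times> R 3. bad b (W p) (snd p)" if "b \<in> {6..}" for b
  proof -
    obtain Y \<rho> where B: "bad b Y \<rho>" using assms by blast
    have ex: "vdet Y (v b) (v j) \<noteq> 0" if "vdet Y (v b) (v i) = 0" "b \<noteq> i" "b \<noteq> j" "i \<noteq> j" for i j
      using exceptional_unique[OF B] that by blast
    have b: "b \<ge> 6" using that by simp
    have "(\<forall>i \<in> {0, 1, 2}. vdet Y (v b) (v i) \<noteq> 0) \<or> (\<forall>i \<in> {3, 4, 5}. vdet Y (v b) (v i) \<noteq> 0)"
    proof (rule ccontr)
      assume "\<not> ?thesis"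
      then obtain i j where ij: "i \<in> {0, 1, 2}" "j \<in> {3, 4, 5}" "vdet Y (v b) (v i) = 0" "vdet Y (v b) (v j) = 0" by blast
      then have "b \<noteq> i" "b \<noteq> j" "i \<noteq> j" using b by auto
      then show False using ex ij by blast
    qed
    then obtain i where i: "i \<in> {0, 3}" "vdet Y (v b) (v i) \<noteq> 0" "vdet Y (v b) (v (Suc i)) \<noteq> 0" "vdet Y (v b) (v (Suc (Suc i))) \<noteq> 0"
    proof
      assume "\<forall>i \<in> {0, 1, 2}. vdet Y (v b) (v i) \<noteq> 0"
      then show ?thesis by (intro that[of 0]) (auto simp: numeral_2_eq_2)
    next
      assume "\<forall>i \<in> {3, 4, 5}. vdet Y (v b) (v i) \<noteq> 0"
      then show ?thesis by (intro that[of 3]) auto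
    qed
    have "\<rho> \<in> R i" "bad b (W (i, \<rho>)) \<rho>"
      unfolding R_def W_def using bad_determined[OF B _ _ _ i(2-4)] by auto
    then show ?thesis using i(1) by (intro bexI[of _ "(i, \<rho>)"]) auto
  qed
  then have "\<exists>p \<in> {0} \<times> R 0 \<union> {3} \<times> R 3. infinite {b \<in> {6..}. bad b (W p) (snd p)}"
    by (intro pigeonhole_infinite_rel fin) (auto simp: infinite_Ici)
  then obtain p where "infinite {b \<in> {6..}. bad b (W p) (snd p)}" by blast
  then have "infinite {b. bad b (W p) (snd p)}" by (rule infinite_super[rotated]) auto
  then show ?thesis by blast
qed

lemma cubic_four_roots:
  fixes u :: "nat \<Rightarrow> 'a"
  assumes "inj_on u {..<4}" "\<And>i. i < 4 \<Longrightarrow> c0 + c1 * u i + c2 * (u i)\<^sup>2 + c3 * (u i) ^ 3 = 0"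
  shows "c0 = 0 \<and> c1 = 0 \<and> c2 = 0 \<and> c3 = 0"
proof (rule ccontr)
  assume n: "\<not> ?thesis"
  define P where "P = [:c0, c1, c2, c3:]"
  have P: "P \<noteq> 0" using n by (auto simp: P_def)
  have "u ` {..<4} \<subseteq> {x. poly P x = 0}"
    using assms(2) by (auto simp: P_def algebra_simps power2_eq_square power3_eq_cube)
  then have "card (u ` {..<4}) \<le> card {x. poly P x = 0}" by (intro card_mono poly_roots_finite P)
  also have "\<dots> \<le> degree P" by (rule card_poly_roots_bound[OF P])
  also have "\<dots> \<le> 3" by (auto simp: P_def degree_pCons_eq_if)
  finally show False using card_image[OF assms(1)] by simp
qed

text \<open>Take \<open>x\<close> and \<open>z\<close> as coordinates in the pencil at
  \<open>Y\<close>. The star relations for \<open>b1\<close> and \<open>b2\<close>, with the same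
  factors r, say that r x^2 and r z^2 are linear in (x, z). Eliminating r gives a cubic form with
  four different zeros, so its coefficients vanish and r = 0, although r is nonzero.\<close>

lemma not_two_bad:
  assumes B1: "bad b1 Y \<rho>" and B2: "bad b2 Y \<rho>" and w: "vdet Y (v b1) (v b2) \<noteq> 0"
  shows False
proof -
  define x z where "x i = vdet Y (v b1) (v i)" and "z i = vdet Y (v b2) (v i)" for i
  have c1: "vcross Y (v b1) \<noteq> 0" "vcross Y (v b2) \<noteq> 0" using B1 B2 by (auto simp: bad_def)
  have fx: "finite {i. x i = 0}" "finite {i. z i = 0}"
    using finite_on_line[OF c1(1)] finite_on_line[OF c1(2)] by (auto simp: x_def z_def vdet_def)
  have cr: "vcross Y (v i) \<noteq> 0" if "x i \<noteq> 0" for i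
    using that vdet_perm(3)[of Y "v i" "v b1"] by (auto simp: x_def vdet_def vdot_0)
  \<comment> \<open>Regular indices in pairwise different directions from \<open>Y\<close> are
    picked one after another; each choice excludes finitely many indices.\<close>
  have next_: "\<exists>k. x k \<noteq> 0 \<and> z k \<noteq> 0 \<and> (\<forall>i \<in> F. vdet Y (v i) (v k) \<noteq> 0)"
    if "finite F" "\<forall>i \<in> F. x i \<noteq> 0" for F
  proof -
    have "finite {k. vdet Y (v i) (v k) = 0}" if "i \<in> F" for i
      using finite_on_line[OF cr[of i]] \<open>\<forall>i \<in> F. x i \<noteq> 0\<close> that by (auto simp: vdet_def)
    define E where "E = {i. x i = 0} \<union> {i. z i = 0} \<union> (\<Union>i \<in> F. {k. vdet Y (v i) (v k) = 0})"
    have "finite E" unfolding E_def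
      using fx \<open>finite F\<close> \<open>\<And>i. i \<in> F \<Longrightarrow> finite {k. vdet Y (v i) (v k) = 0}\<close> by simp
    then obtain k where "k \<notin> E" using ex_new_if_finite[OF infinite_UNIV_nat] by blast
    then show ?thesis unfolding E_def by (intro exI[of _ k]) simp
  qed
  obtain i0 where i0: "x i0 \<noteq> 0" "z i0 \<noteq> 0" using next_[of "{}"] by auto
  obtain i1 where i1: "x i1 \<noteq> 0" "z i1 \<noteq> 0" "vdet Y (v i0) (v i1) \<noteq> 0" using next_[of "{i0}"] i0 by auto
  obtain i2 where i2: "x i2 \<noteq> 0" "z i2 \<noteq> 0" "vdet Y (v i0) (v i2) \<noteq> 0" "vdet Y (v i1) (v i2) \<noteq> 0"
    using next_[of "{i0, i1}"] i0 i1 by auto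
  obtain i3 where i3: "x i3 \<noteq> 0" "z i3 \<noteq> 0" "vdet Y (v i0) (v i3) \<noteq> 0" "vdet Y (v i1) (v i3) \<noteq> 0" "vdet Y (v i2) (v i3) \<noteq> 0"
    using next_[of "{i0, i1, i2}"] i0 i1 i2 by auto
  have "\<exists>\<mu>. t i - vscale \<rho> (s i) = vscale \<mu> (vcross Y (v i))" if "x i \<noteq> 0" for i
  proof (rule orth_two'[OF cr[OF that]])
    show "vdot (t i - vscale \<rho> (s i)) Y = 0"
      using B1 that by (auto simp: bad_def x_def vdot_diff vdot_scale)
    show "vdot (t i - vscale \<rho> (s i)) (v i) = 0" by (simp add: vdot_diff vdot_scale t_self s_self)
  qed
  then obtain \<mu> where mu: "\<And>i. x i \<noteq> 0 \<Longrightarrow> t i - vscale \<rho> (s i) = vscale (\<mu> i) (vcross Y (v i))" by metis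
  define r where "r i = \<mu> i / vdot (s i) Y" for i
  have r: "r i \<noteq> 0" if "x i \<noteq> 0" for i
  proof -
    have "\<mu> i \<noteq> 0"
    proof
      assume "\<mu> i = 0"
      then have "t i = vscale \<rho> (s i)" using mu[OF that] by (simp add: vscale_0)
      then show False using indep[of i] by (simp add: vcross_scale vcross_self vscale_0)
    qed
    then show ?thesis using B1 that by (auto simp: bad_def x_def r_def)
  qed
  have pl: "vdet Y (v b1) (v b2) * vdet Y (v i) (v j) = x i * z j - x j * z i" for i j
    by (simp add: x_def z_def vec_defs algebra_simps)
  have st: "(x j * z k - x k * z j) * (r i * (x i)\<^sup>2) + (x k * z i - x i * z k) * (r j * (x j)\<^sup>2) + (x i * z j - x j * z i) * (r k * (x k)\<^sup>2) = 0"
    "(x j * z k - x k * z j) * (r i * (z i)\<^sup>2) + (x k * z i - x i * z k) * (r j * (z j)\<^sup>2) + (x i * z j - x j * z i) * (r k * (z k)\<^sup>2) = 0"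
    if "x i \<noteq> 0" "x j \<noteq> 0" "x k \<noteq> 0" "z i \<noteq> 0" "z j \<noteq> 0" "z k \<noteq> 0" for i j k
  proof -
    have "star_relation Y v r b1 i j k" "star_relation Y v r b2 i j k"
      unfolding r_def using that mu
      by (auto intro!: bad_star[OF B1] bad_star[OF B2] simp: x_def z_def)
    then have *: "vdet Y (v j) (v k) * (r i * (x i)\<^sup>2) + vdet Y (v k) (v i) * (r j * (x j)\<^sup>2) + vdet Y (v i) (v j) * (r k * (x k)\<^sup>2) = 0"
      "vdet Y (v j) (v k) * (r i * (z i)\<^sup>2) + vdet Y (v k) (v i) * (r j * (z j)\<^sup>2) + vdet Y (v i) (v j) * (r k * (z k)\<^sup>2) = 0"
      unfolding star_relation_def x_def z_def by auto
    show "(x j * z k - x k * z j) * (r i * (x i)\<^sup>2) + (x k * z i - x i * z k) * (r j * (x j)\<^sup>2) + (x i * z j - x j * z i) * (r k * (x k)\<^sup>2) = 0"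
      using *(1) pl[of j k] pl[of k i] pl[of i j] by Groebner_Basis.algebra
    show "(x j * z k - x k * z j) * (r i * (z i)\<^sup>2) + (x k * z i - x i * z k) * (r j * (z j)\<^sup>2) + (x i * z j - x j * z i) * (r k * (z k)\<^sup>2) = 0"
      using *(2) pl[of j k] pl[of k i] pl[of i j] by Groebner_Basis.algebra
  qed
  define D where "D = x i0 * z i1 - x i1 * z i0"
  have D: "D \<noteq> 0" unfolding D_def pl[symmetric] using i1(3) w by simp
  \<comment> \<open>The coefficients are solved from the values at \<open>i0\<close> and
    \<open>i1\<close>; the star relation for \<open>i0\<close>, \<open>i1\<close>, \<open>k\<close>
    extends the linear formula to every regular \<open>k\<close>.\<close>
  define A where "A = (r i0 * (x i0)\<^sup>2 * z i1 - r i1 * (x i1)\<^sup>2 * z i0) / D"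
  define B where "B = (x i0 * (r i1 * (x i1)\<^sup>2) - x i1 * (r i0 * (x i0)\<^sup>2)) / D"
  define A' where "A' = (r i0 * (z i0)\<^sup>2 * z i1 - r i1 * (z i1)\<^sup>2 * z i0) / D"
  define B' where "B' = (x i0 * (r i1 * (z i1)\<^sup>2) - x i1 * (r i0 * (z i0)\<^sup>2)) / D"
  have AD: "A * D = r i0 * (x i0)\<^sup>2 * z i1 - r i1 * (x i1)\<^sup>2 * z i0" "B * D = x i0 * (r i1 * (x i1)\<^sup>2) - x i1 * (r i0 * (x i0)\<^sup>2)"
    "A' * D = r i0 * (z i0)\<^sup>2 * z i1 - r i1 * (z i1)\<^sup>2 * z i0" "B' * D = x i0 * (r i1 * (z i1)\<^sup>2) - x i1 * (r i0 * (z i0)\<^sup>2)"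
    using D by (simp_all add: A_def B_def A'_def B'_def)
  have lin: "r k * (x k)\<^sup>2 = A * x k + B * z k" "r k * (z k)\<^sup>2 = A' * x k + B' * z k" if "x k \<noteq> 0" "z k \<noteq> 0" for k
  proof -
    have "D * (r k * (x k)\<^sup>2 - (A * x k + B * z k)) = 0"
      using st(1)[of i0 i1 k] i0 i1 that AD(1,2) D_def by Groebner_Basis.algebra
    then show "r k * (x k)\<^sup>2 = A * x k + B * z k" using D by simp
    have "D * (r k * (z k)\<^sup>2 - (A' * x k + B' * z k)) = 0"
      using st(2)[of i0 i1 k] i0 i1 that AD(3,4) D_def by Groebner_Basis.algebra
    then show "r k * (z k)\<^sup>2 = A' * x k + B' * z k" using D by simp
  qed
  define I where "I n = [i0, i1, i2, i3] ! n" for n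
  have I: "x (I n) \<noteq> 0" "z (I n) \<noteq> 0" if "n < 4" for n
    using that i0 i1 i2 i3 by (auto simp: I_def less_Suc_eq numeral_eq_Suc)
  define u where "u n = z (I n) / x (I n)" for n
  have "inj_on u {..<4}"
  proof (rule linorder_inj_onI)
    fix n m :: nat assume nm: "n < m" "n \<in> {..<4}" "m \<in> {..<4}"
    then have "vdet Y (v (I n)) (v (I m)) \<noteq> 0"
      using i0 i1 i2 i3 by (auto simp: I_def less_Suc_eq numeral_eq_Suc)
    then have "x (I n) * z (I m) - x (I m) * z (I n) \<noteq> 0" unfolding pl[symmetric] using w by simp
    then show "u n \<noteq> u m" using I[of n] I[of m] nm by (auto simp: u_def field_simps)
  qed auto
  moreover have "- A' + (- B') * u n + A * (u n)\<^sup>2 + B * (u n) ^ 3 = 0" if "n < 4" for n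
  proof -
    define U Z where "U = x (I n)" and "Z = z (I n)"
    have nz: "U \<noteq> 0" "Z \<noteq> 0" using I[OF that] by (auto simp: U_def Z_def)
    have l: "r (I n) * U\<^sup>2 = A * U + B * Z" "r (I n) * Z\<^sup>2 = A' * U + B' * Z"
      using lin[of "I n"] nz by (auto simp: U_def Z_def)
    have uU: "Z = u n * U" using nz by (simp add: u_def U_def Z_def)
    have "U ^ 3 * (- A' + (- B') * u n + A * (u n)\<^sup>2 + B * (u n) ^ 3) = 0"
      using l uU by Groebner_Basis.algebra
    then show ?thesis using nz by simp
  qed
  ultimately have "A = 0" "B = 0" using cubic_four_roots[of u] by blast+
  then show False using lin(1)[of i0] r[of i0] i0 by simp
qed

text \<open>If all indices were bad, infinitely many would share one pair, and among them are two
  whose points are not collinear with \<open>Y\<close>.\<close>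

lemma not_all_bad: "\<exists>b. \<forall>Y \<rho>. \<not> bad b Y \<rho>"
proof (rule ccontr)
  assume "\<not> ?thesis"
  then obtain Y \<rho> where inf: "infinite {b. bad b Y \<rho>}" using common_bad by blast
  then obtain b1 where b1: "bad b1 Y \<rho>" using not_finite_existsD by blast
  have "finite {i. vdet Y (v b1) (v i) = 0}" using finite_on_line[of "vcross Y (v b1)"] b1 by (auto simp: bad_def vdet_def)
  then have "infinite ({b. bad b Y \<rho>} - {i. vdet Y (v b1) (v i) = 0})" using inf by simp
  then obtain b2 where "b2 \<in> {b. bad b Y \<rho>} - {i. vdet Y (v b1) (v i) = 0}" using infinite_imp_nonempty by blast
  then have "bad b2 Y \<rho>" "vdet Y (v b1) (v b2) \<noteq> 0" by auto
  then show False using not_two_bad b1 by blast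
qed

end

section \<open>The generic member in the ultrapower, and the exclusion of rigid
  configurations\<close>

definition vclass :: "(nat \<Rightarrow> 'a vec3) \<Rightarrow> 'a ultrapower vec3" where
  "vclass f = (uclass (\<lambda>n. fst (f n)), uclass (\<lambda>n. fst (snd (f n))), uclass (\<lambda>n. snd (snd (f n))))"

lemma field_hom_const: "field_hom (\<lambda>a::'a::field. uclass (\<lambda>_. a))"
  by (simp add: field_hom_def uclass_add uclass_mult uclass_1)

lemma vclass_dot: "vdot (vclass f) (vclass g) = uclass (\<lambda>n. vdot (f n) (g n))" for f g :: "nat \<Rightarrow> 'a::field vec3"
  by (simp add: vdot_def vclass_def uclass_add uclass_mult)

lemma vclass_cross: "vcross (vclass f) (vclass g) = vclass (\<lambda>n. vcross (f n) (g n))" for f g :: "nat \<Rightarrow> 'a::field vec3"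
  by (simp add: vcross_def vclass_def uclass_diff uclass_mult)

lemma vclass_const: "vmap (\<lambda>a. uclass (\<lambda>_. a)) x = vclass (\<lambda>_. x)"
  by (simp add: vmap_def vclass_def)

lemma uclass_eq_0: "uclass f = 0 \<longleftrightarrow> eventually (\<lambda>n. f n = 0) ultra"
  unfolding uclass_0[symmetric] uclass_eq ..

lemma uclass_neq_0: "uclass f \<noteq> 0 \<longleftrightarrow> eventually (\<lambda>n. f n \<noteq> 0) ultra"
  unfolding uclass_eq_0 ultra_not ..

lemma vclass_neq_0: "eventually (\<lambda>n. f n \<noteq> 0) ultra \<Longrightarrow> vclass f \<noteq> 0" for f :: "nat \<Rightarrow> 'a::field vec3"
proof
  assume e: "eventually (\<lambda>n. f n \<noteq> 0) ultra" and z: "vclass f = 0"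
  then have "eventually (\<lambda>n. fst (f n) = 0) ultra" "eventually (\<lambda>n. fst (snd (f n)) = 0) ultra"
    "eventually (\<lambda>n. snd (snd (f n)) = 0) ultra"
    by (auto simp: vclass_def vec_eq_0_iff uclass_eq_0)
  then have "eventually (\<lambda>n. f n = 0) ultra" unfolding vec_eq_0_iff by (intro eventually_conj)
  then show False using e ultra_not[of "\<lambda>n. f n = 0"] by simp
qed

lemma ultra_cofinite: "finite {i. \<not> P i} \<Longrightarrow> eventually P ultra"
proof -
  assume "finite {i. \<not> P i}"
  then obtain N where "\<forall>i \<in> {i. \<not> P i}. i < N" using finite_nat_set_iff_bounded by blast
  then show ?thesis by (intro eventually_mono[OF ultra_ge[of N]]) (use not_le in blast)
qed

lemma ultra_neq: "eventually (\<lambda>n. n \<noteq> i) ultra"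
  by (rule ultra_cofinite) simp

context config
begin

text \<open>The generic member is the class of the sequence of all members. Relations and
  inequalities with a fixed \<open>v i\<close> fail for at most the index \<open>i\<close>, and by
  \<open>finite_on_line\<close> a fixed line contains only finitely many points.\<close>

lemma generic_ultrapower:
  "generic v t s (\<lambda>a. uclass (\<lambda>_. a)) (vclass v) (vclass t) (vclass s)"
proof (unfold_locales, unfold vclass_const vclass_dot)
  show "field_hom (\<lambda>a::'a. uclass (\<lambda>_. a))" by (rule field_hom_const)
  show "uclass (\<lambda>n. vdot (t n) (v n)) = 0" "uclass (\<lambda>n. vdot (s n) (v n)) = 0"
    by (simp_all add: t_self s_self uclass_0)
  show "vcross (vclass t) (vclass s) \<noteq> 0"
    unfolding vclass_cross by (rule vclass_neq_0) (simp add: indep)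
  show "uclass (\<lambda>n. vdot (t n) (v i)) \<noteq> 0" "uclass (\<lambda>n. vdot (s n) (v i)) \<noteq> 0"
    "uclass (\<lambda>n. vdot (t i) (v n)) \<noteq> 0" "uclass (\<lambda>n. vdot (s i) (v n)) \<noteq> 0" for i
    unfolding uclass_neq_0 by (rule eventually_mono[OF ultra_neq[of i]]; simp add: t_nz s_nz)+
  show "uclass (\<lambda>n. vdot (t n) (v i)) * uclass (\<lambda>n. vdot (s i) (v n)) +
     uclass (\<lambda>n. vdot (s n) (v i)) * uclass (\<lambda>n. vdot (t i) (v n)) = 0" for i
    unfolding uclass_mult uclass_add uclass_eq_0
    by (rule eventually_mono[OF ultra_neq[of i]]) (rule rel)
  show "uclass (\<lambda>n. vdot x (v n)) \<noteq> 0" if "x \<noteq> 0" for x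
    unfolding uclass_neq_0 by (rule ultra_cofinite) (simp add: finite_on_line[OF that])
  show "uclass (\<lambda>n. vdot (t n) y) = uclass (\<lambda>_. \<rho>) * uclass (\<lambda>n. vdot (s n) y)"
    if "finite {i. vdot (t i) y \<noteq> \<rho> * vdot (s i) y}" for y \<rho>
    unfolding uclass_mult uclass_eq by (rule ultra_cofinite) (rule that)
qed

end

context rigid_config
begin

lemma bad_of_place:
  fixes h :: "'a \<Rightarrow> 'b::field"
  assumes g: "generic v t s h gv gt gs" and p: "place h G"
    and z: "(generic.H v t h gv gt b / generic.H v t h gv gt j, 0) \<in> G" and "b \<noteq> j"
  shows "\<exists>Y \<rho>. bad b Y \<rho>"
proof -
  interpret generic v t s h gv gt gs by (rule g)
  interpret place h G by (rule p)
  have "gv \<noteq> 0" using gt_self gv_cross[of "v 0"] v_nz by (auto simp: vcross_zero)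
  then obtain c Y where c: "c \<noteq> 0" "gvec (vscale c gv) Y" "Y \<noteq> 0" using normalize_one by blast
  have "gt \<noteq> 0" using g_indep by (auto simp: vcross_zero)
  then obtain d T S where d: "d \<noteq> 0" "gvec (vscale d gt) T" "gvec (vscale d gs) S" "T \<noteq> 0 \<or> S \<noteq> 0"
    using normalize_two by blast
  interpret S: generic v t s h "vscale c gv" "vscale d gt" "vscale d gs"
    by (rule generic_scale[OF c(1) d(1)])
  have "S.H i = d / c * H i" for i
    unfolding S.H_def H_def vdot_scale by simp
  then have "S.H b / S.H j = H b / H j" using c d by simp
  then interpret B: bad_place v t s h "vscale c gv" "vscale d gt" "vscale d gs" G Y T S b j
    by unfold_locales (use c d z \<open>b \<noteq> j\<close> in auto)
  obtain \<rho> where "\<And>i. vdet Y (v b) (v i) \<noteq> 0 \<Longrightarrow> vdot (t i) Y = \<rho> * vdot (s i) Y"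
    "\<And>i. vdet Y (v b) (v i) \<noteq> 0 \<Longrightarrow> vdot (s i) Y \<noteq> 0"
    "\<And>\<mu> i j k. vdet Y (v b) (v i) \<noteq> 0 \<Longrightarrow> vdet Y (v b) (v j) \<noteq> 0 \<Longrightarrow> vdet Y (v b) (v k) \<noteq> 0 \<Longrightarrow>
      (\<And>a. a \<in> {i, j, k} \<Longrightarrow> t a - vscale \<rho> (s a) = vscale (\<mu> a) (vcross Y (v a))) \<Longrightarrow>
      star_relation Y v (\<lambda>i. \<mu> i / vdot (s i) Y) b i j k" using B.star by blast
  moreover have "vcross Y (v b) \<noteq> 0" using B.m_nz by (simp add: B.m_def)
  ultimately have "bad b Y \<rho>" unfolding bad_def using \<open>Y \<noteq> 0\<close> by blast
  then show ?thesis by blast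
qed

text \<open>Up to the scaling by \<open>k\<close>, exchanging the two arguments of \<open>s\<close>
  multiplies by a factor - p_i, and any two of the p_i have product 1. Around the triple 0, 1, 2 the
  cyclic products differ by p_0 p_1 p_2 and a sign; the square of that product is 1.\<close>

lemma not_linear:
  assumes k: "\<And>j. k j \<noteq> 0" and "\<And>i j. vdot (t j) (v i) = k j * (g i * vdot (t i) (v j))"
    "\<And>i j. vdot (s j) (v i) = - (k j * (g i * vdot (s i) (v j)))"
  shows False
proof -
  define p where "p i = g i * k i" for i
  have eq: "vdot (s j) (v i) / k j = - (p i * (vdot (s i) (v j) / k i))" for i j
    using assms(3)[where j = j and i = i] k[of i] k[of j] by (simp add: p_def)
  have pp: "p i * p j = 1" if "i \<noteq> j" for i j
  proof -
    have "vdot (s j) (v i) / k j = p i * p j * (vdot (s j) (v i) / k j)"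
      using eq[of j i] eq[of i j] by simp
    then show ?thesis using s_nz[of j i] k[of j] that by simp
  qed
  define a b c where "a = vdot (s 0) (v 1) / k 0" and "b = vdot (s 1) (v 2) / k 1" and "c = vdot (s 2) (v 0) / k 2"
  have 1: "(vdot (s 0) (v 1) * vdot (s 1) (v 2) * vdot (s 2) (v 0)) = k 0 * k 1 * k 2 * (a * b * c)"
    using k by (simp add: a_def b_def c_def)
  have "vdot (s 0) (v 2) = k 0 * (- (p 2 * c))" "vdot (s 1) (v 0) = k 1 * (- (p 0 * a))" "vdot (s 2) (v 1) = k 2 * (- (p 1 * b))"
    using eq[of 0 2] eq[of 1 0] eq[of 2 1] k by (simp_all add: a_def b_def c_def field_simps)
  then have 2: "vdot (s 0) (v 2) * vdot (s 1) (v 0) * vdot (s 2) (v 1) = - (k 0 * k 1 * k 2 * (p 0 * p 1 * p 2) * (a * b * c))"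
    by simp
  have "(p 0 * p 1 * p 2)\<^sup>2 = (p 0 * p 1) * (p 1 * p 2) * (p 0 * p 2)" by (simp add: power2_eq_square)
  then have "(p 0 * p 1 * p 2)\<^sup>2 = 1" using pp[of 0 1] pp[of 1 2] pp[of 0 2] by simp
  then show False using no_kappa[of 0 1 2] unfolding 1 2 by (simp add: power_mult_distrib)
qed

text \<open>With constant ratios, \<open>gt\<close> at \<open>v j\<close> agrees up to a constant of
  the base field and a common factor with \<open>t j\<close> at the generic point. Expanding
  \<open>v j\<close> in \<open>v 0\<close>, \<open>v 1\<close>, \<open>v 2\<close> gives a constant
  linear relation between the \<open>t\<close> at the generic point. That point lies on no constant
  line, so the relation holds between the forms: t_j / k_j depends linearly on \<open>v j\<close>,
  and so does s_j / k_j.\<close>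

lemma H_not_all_const:
  fixes h :: "'a \<Rightarrow> 'b::field"
  assumes g: "generic v t s h gv gt gs" and r: "\<And>j. generic.H v t h gv gt b / generic.H v t h gv gt j \<in> range h"
  shows False
proof -
  interpret generic v t s h gv gt gs by (rule g)
  note hs = field_hom_simps[OF h] and vh = vmap_hom[OF h]
  have "\<exists>k. H b / H j = h k" for j using r[of j] by auto
  then obtain k where k: "\<And>j. H b / H j = h (k j)" by metis
  have k0: "k j \<noteq> 0" for j using k[of j] H_nz hs(7)[of "k j"] by (metis divide_eq_0_iff)
  have hk0: "h (k j) \<noteq> 0" for j using k0 hs(7) by simp
  have gt: "vdot gt (vmap h (v j)) * h (k j) = H b * vdot (vmap h (t j)) gv" for j
    unfolding k[symmetric] using t_gv[of j] H_nz[of j] by (simp add: H_def[of j])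
  have gs: "vdot gs (vmap h (v j)) * h (k j) = - (H b * vdot (vmap h (s j)) gv)" for j
    unfolding k[symmetric] using s_gv[of j] gs_nz[of j] by (simp add: H_s[of j])
  define D where "D = vdet (v 0) (v 1) (v 2)"
  have D: "D \<noteq> 0" unfolding D_def by (rule arc) auto
  define co where "co a = [vcross (v 1) (v 2), vcross (v 2) (v 0), vcross (v 0) (v 1)] ! a" for a :: nat
  define lin where "lin x j = vscale (vdot (co 0) (v j) / k 0) (x 0) + vscale (vdot (co 1) (v j) / k 1) (x 1)
     + vscale (vdot (co 2) (v j) / k 2) (x 2)" for x :: "nat \<Rightarrow> 'a vec3" and j
  have cr: "vscale D (v j) = vscale (vdot (co 0) (v j)) (v 0) + vscale (vdot (co 1) (v j)) (v 1) + vscale (vdot (co 2) (v j)) (v 2)" for j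
    using vec_cramer[of "v 0" "v 1" "v 2" "v j"] by (simp add: D_def co_def vec_defs algebra_simps)
  \<comment> \<open>The factor \<open>e\<close> is 1 for \<open>t\<close> and - 1 for
    \<open>s\<close>, so one argument serves both.\<close>
  have key: "vscale (D / k j) (x j) = lin x j"
    if "\<And>j. vdot y (vmap h (v j)) * h (k j) = H b * (e * vdot (vmap h (x j)) gv)" "e \<noteq> 0" for x y e j
  proof -
    have y: "vdot y (vmap h (v j)) = H b * e * vdot (vmap h (x j)) gv / h (k j)" for j
      using that(1)[of j] hk0[of j] by (simp add: field_simps)
    have q: "h (c / k a) = h c / h (k a)" for c a
      using hs(3)[of "c / k a" "k a"] hk0[of a] k0[of a] by (simp add: field_simps)
    have "vdot y (vmap h (vscale D (v j))) = h (vdot (co 0) (v j)) * vdot y (vmap h (v 0)) +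
       h (vdot (co 1) (v j)) * vdot y (vmap h (v 1)) + h (vdot (co 2) (v j)) * vdot y (vmap h (v 2))"
      unfolding cr by (simp add: vh vdot_add vdot_scale)
    then have "h D * vdot y (vmap h (v j)) = h (vdot (co 0) (v j)) * vdot y (vmap h (v 0)) +
       h (vdot (co 1) (v j)) * vdot y (vmap h (v 1)) + h (vdot (co 2) (v j)) * vdot y (vmap h (v 2))"
      by (simp add: vh vdot_scale)
    then have "H b * e * (h D / h (k j) * vdot (vmap h (x j)) gv - (h (vdot (co 0) (v j)) / h (k 0) * vdot (vmap h (x 0)) gv
      + h (vdot (co 1) (v j)) / h (k 1) * vdot (vmap h (x 1)) gv + h (vdot (co 2) (v j)) / h (k 2) * vdot (vmap h (x 2)) gv)) = 0"
      unfolding y by (simp add: algebra_simps)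
    then have "vdot (vmap h (vscale (D / k j) (x j) - lin x j)) gv = 0"
      using H_nz[of b] that(2) by (simp add: lin_def vh vdot_diff vdot_add vdot_scale q)
    then have "vscale (D / k j) (x j) - lin x j = 0" using gv_line by blast
    then show ?thesis by simp
  qed
  have tl: "vscale (D / k j) (t j) = lin t j" for j
    by (rule key[where y = gt and e = 1]) (use gt in auto)
  have sl: "vscale (D / k j) (s j) = lin s j" for j
    by (rule key[where y = gs and e = "- 1"]) (use gs in auto)
  \<comment> \<open>The transposed map: for fixed \<open>i\<close>, the value t_j(v_i) / k_j as a
    linear form in \<open>v j\<close>.\<close>
  define tr where "tr x i = vscale (1 / D) (vscale (vdot (x 0) (v i) / k 0) (co 0) + vscale (vdot (x 1) (v i) / k 1) (co 1)
    + vscale (vdot (x 2) (v i) / k 2) (co 2))" for x :: "nat \<Rightarrow> 'a vec3" and i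
  have tr: "vdot (x j) (v i) = k j * vdot (tr x i) (v j)" if "vscale (D / k j) (x j) = lin x j" for x i j
  proof -
    have "D / k j * vdot (x j) (v i) = vdot (lin x j) (v i)" unfolding that[symmetric] by (simp add: vdot_scale)
    also have "\<dots> = D * vdot (tr x i) (v j)" using D by (simp add: lin_def tr_def vdot_add vdot_scale algebra_simps)
    finally show ?thesis using D k0[of j] by (simp add: field_simps)
  qed
  have "\<exists>g. \<forall>j. vdot (tr t i) (v j) = g * vdot (t i) (v j) \<and> vdot (tr s i) (v j) = - (g * vdot (s i) (v j))" for i
  proof -
    have "vdot (tr t i) (v i) = 0" "vdot (tr s i) (v i) = 0"
      using tr[OF tl, of i i] tr[OF sl, of i i] t_self s_self k0 by auto
    then obtain \<alpha> \<beta> \<gamma> \<delta> where e: "tr t i = vscale \<alpha> (t i) + vscale \<beta> (s i)" "tr s i = vscale \<gamma> (t i) + vscale \<delta> (s i)"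
      using pencil by metis
    \<comment> \<open>The transposed forms lie in the pencil at \<open>v i\<close>. Comparison with
      \<open>rel\<close> forces them to be multiples of \<open>t i\<close> and \<open>s i\<close>,
      with opposite factors.\<close>
    have "\<gamma> * (vdot (t i) (v j))\<^sup>2 + (\<alpha> + \<delta>) * (vdot (t i) (v j) * vdot (s i) (v j)) + \<beta> * (vdot (s i) (v j))\<^sup>2 = 0"
      if "j \<noteq> i" for j
    proof -
      have "k j * (vdot (t i) (v j) * vdot (tr s i) (v j) + vdot (s i) (v j) * vdot (tr t i) (v j)) = 0"
        using rel[of i j] that unfolding tr[OF tl] tr[OF sl] by (simp add: algebra_simps)
      then have "vdot (t i) (v j) * vdot (tr s i) (v j) + vdot (s i) (v j) * vdot (tr t i) (v j) = 0" using k0[of j] by simp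
      then show ?thesis
        by (simp add: e vdot_add vdot_scale algebra_simps power2_eq_square)
    qed
    then have "\<gamma> = 0 \<and> \<alpha> + \<delta> = 0 \<and> \<beta> = 0" by (intro binary_quadratic[of UNIV]) auto
    then have "\<gamma> = 0" "\<delta> = - \<alpha>" "\<beta> = 0" by (auto simp: add_eq_0_iff)
    then show ?thesis unfolding e by (intro exI[of _ \<alpha>]) (simp add: vdot_add vdot_scale vscale_0)
  qed
  then obtain g where g: "\<And>i j. vdot (tr t i) (v j) = g i * vdot (t i) (v j)"
    "\<And>i j. vdot (tr s i) (v j) = - (g i * vdot (s i) (v j))" by metis
  have T: "vdot (t j) (v i) = k j * (g i * vdot (t i) (v j))" for i j
    unfolding g[symmetric] by (rule tr[OF tl])
  have S: "vdot (s j) (v i) = - (k j * (g i * vdot (s i) (v j)))" for i j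
    using tr[OF sl, of j i] unfolding g mult_minus_right .
  show False by (rule not_linear[OF k0 T S])
qed

end

text \<open>For an index \<open>b\<close> that is not bad, no place sends a ratio H b / H j to 0.
  Over an algebraically closed field every nonconstant ratio is sent to 0 by some place, so all
  these ratios are constant, against \<open>H_not_all_const\<close>.\<close>

theorem no_rigid_config:
  fixes v t s :: "nat \<Rightarrow> 'a::alg_closed_field vec3"
  shows "\<not> rigid_config v t s"
proof
  assume "rigid_config v t s"
  then interpret rigid_config v t s .
  let ?h = "\<lambda>a::'a. uclass (\<lambda>_. a)"
  note g = generic_ultrapower
  interpret generic v t s ?h "vclass v" "vclass t" "vclass s" by (rule g)
  obtain b where b: "\<And>Y \<rho>. \<not> bad b Y \<rho>" using not_all_bad by blast
  have "H b / H j \<in> range ?h" for j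
  proof (cases "b = j")
    case True
    then have "H b / H j = ?h 1" using H_nz by (simp add: uclass_1)
    then show ?thesis by blast
  next
    case False
    show ?thesis
    proof (rule ccontr)
      assume "H b / H j \<notin> range ?h"
      then obtain G where G: "hom_graph ?h G" "(H b / H j, 0) \<in> G"
        "\<And>y. (\<exists>w. (y, w) \<in> G) \<or> y \<noteq> 0 \<and> (inverse y, 0) \<in> G" by (rule place_exists[OF h]) blast
      then have "place ?h G" using h by unfold_locales
      then show False using bad_of_place[OF g _ G(2) False] b by blast
    qed
  qed
  then show False using H_not_all_const[OF g] by blast
qed

section \<open>The conic of a configuration\<close>

definition mulv :: "'a::comm_ring_1 vec3 vec3 \<Rightarrow> 'a vec3 \<Rightarrow> 'a vec3" where
  "mulv M u = (vdot (fst M) u, vdot (fst (snd M)) u, vdot (snd (snd M)) u)"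

definition bil :: "'a::comm_ring_1 vec3 vec3 \<Rightarrow> 'a vec3 \<Rightarrow> 'a vec3 \<Rightarrow> 'a" where
  "bil M u w = vdot u (mulv M w)"

lemma bil_linear:
  "bil M (u + u') w = bil M u w + bil M u' w" "bil M u (w + w') = bil M u w + bil M u w'"
  "bil M (u - u') w = bil M u w - bil M u' w" "bil M u (w - w') = bil M u w - bil M u w'"
  "bil M (vscale c u) w = c * bil M u w" "bil M u (vscale c w) = c * bil M u w"
  by (simp_all add: bil_def mulv_def vdot_def vscale_def algebra_simps)

lemma orth_exists: "\<exists>x :: 'a::field vec3. x \<noteq> 0 \<and> vdot x u = 0"
proof -
  obtain a b c where abc: "u = (a, b, c)" by (metis prod.exhaust)
  show ?thesis
  proof (cases "a = 0 \<and> b = 0")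
    case True
    then show ?thesis by (intro exI[of _ "(1, 0, 0)"]) (simp add: abc vdot_def zero_prod_def)
  next
    case False
    then show ?thesis by (intro exI[of _ "(b, - a, 0)"]) (auto simp: abc vdot_def zero_prod_def)
  qed
qed

lemma det_zero_kernel:
  fixes u :: "'a::field vec3"
  assumes "vdet u v w = 0"
  shows "\<exists>z. z \<noteq> 0 \<and> vdot u z = 0 \<and> vdot v z = 0 \<and> vdot w z = 0"
proof -
  have k: "vdot (vcross a b) a = 0" "vdot (vcross a b) b = 0" for a b :: "'a vec3" by (rule vcross_orth)+
  consider "vcross u v \<noteq> 0" | "vcross u w \<noteq> 0" | "vcross v w \<noteq> 0"
    | "vcross u v = 0" "vcross u w = 0" "vcross v w = 0" by blast
  then show ?thesis
  proof cases
    case 1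
    then show ?thesis using assms k by (intro exI[of _ "vcross u v"]) (auto simp: vdet_def vdot_commute)
  next
    case 2
    have "vdot v (vcross u w) = 0" using assms vdet_perm(3)[of u w v] by (simp add: vdet_def vdot_commute)
    then show ?thesis using 2 k by (intro exI[of _ "vcross u w"]) (auto simp: vdot_commute)
  next
    case 3
    have "vdot u (vcross v w) = 0" using assms vdet_perm(1)[of v w u] by (simp add: vdet_def vdot_commute)
    then show ?thesis using 3 k by (intro exI[of _ "vcross v w"]) (auto simp: vdot_commute)
  next
    case 4
    have par: ?thesis if "a \<noteq> 0" "vcross a u = 0" "vcross a v = 0" "vcross a w = 0" for a
    proof -
      obtain z where z: "z \<noteq> 0" "vdot z a = 0" using orth_exists by blast
      have "vdot b z = 0" if "vcross a b = 0" for b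
        using parallel_vec[OF that \<open>a \<noteq> 0\<close>] z by (auto simp: vdot_scale vdot_commute)
      then show ?thesis using z that by blast
    qed
    show ?thesis
    proof (cases "u = 0 \<and> v = 0 \<and> w = 0")
      case True
      then show ?thesis by (intro exI[of _ "(1, 0, 0)"]) (auto simp: vdot_def zero_prod_def)
    next
      case False
      moreover have "vcross v u = 0" "vcross w u = 0" "vcross w v = 0" using 4 vcross_anti by blast+
      ultimately show ?thesis using par[of u] par[of v] par[of w] 4 vcross_self by blast
    qed
  qed
qed

section \<open>Configurations with \<open>t\<close> symmetric and \<open>s\<close>
  alternating\<close>

locale sym_config = config v t s for v t s :: "nat \<Rightarrow> 'a::field vec3" +
  assumes t_sym: "vdot (t i) (v j) = vdot (t j) (v i)" and s_anti: "vdot (s i) (v j) = - vdot (s j) (v i)"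
begin

definition "D = vdet (v 0) (v 1) (v 2)"
definition "c0 = vcross (v 1) (v 2)"
definition "c1 = vcross (v 2) (v 0)"
definition "c2 = vcross (v 0) (v 1)"

lemma D_nz: "D \<noteq> 0"
  unfolding D_def by (rule arc) auto

lemma expand: "D * vdot a z = vdot c0 z * vdot a (v 0) + vdot c1 z * vdot a (v 1) + vdot c2 z * vdot a (v 2)"
  using dot_cramer[of "v 0" "v 1" "v 2" a z]
  by (simp add: D_def c0_def c1_def c2_def vec_defs algebra_simps)

lemma expand_vec: "vscale D z = vscale (vdot c0 z) (v 0) + vscale (vdot c1 z) (v 1) + vscale (vdot c2 z) (v 2)"
  using vec_cramer[of "v 0" "v 1" "v 2" z]
  by (simp add: D_def c0_def c1_def c2_def vec_defs algebra_simps)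

definition row :: "('a vec3 \<Rightarrow> 'a) \<Rightarrow> 'a vec3" where
  "row f = vscale (1 / D) (vscale (f (t 0)) c0 + vscale (f (t 1)) c1 + vscale (f (t 2)) c2)"

text \<open>The form is prescribed by pairing \<open>t 0\<close>, \<open>t 1\<close>,
  \<open>t 2\<close> with the coordinates relative to \<open>v 0\<close>, \<open>v 1\<close>,
  \<open>v 2\<close>. The symmetry of \<open>t\<close> then makes every \<open>t i\<close> the polar
  of \<open>v i\<close>.\<close>

definition "M = (row fst, row (\<lambda>u. fst (snd u)), row (\<lambda>u. snd (snd u)))"

lemma bil_M: "D * bil M u z = vdot (t 0) u * vdot c0 z + vdot (t 1) u * vdot c1 z + vdot (t 2) u * vdot c2 z"
  using D_nz by (simp add: bil_def mulv_def M_def row_def vdot_def vscale_def plus_prod_def field_simps)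

lemma bil_v: "bil M (v i) z = vdot (t i) z"
proof -
  have "D * bil M (v i) z = D * vdot (t i) z"
    unfolding bil_M expand using t_sym[of 0 i] t_sym[of 1 i] t_sym[of 2 i] by (simp add: mult.commute)
  then show ?thesis using D_nz by simp
qed

lemma bil_sym: "bil M u z = bil M z u"
proof -
  have "D * bil M u z = bil M (vscale D u) z" by (simp add: bil_linear)
  also have "\<dots> = D * bil M z u" unfolding expand_vec bil_linear bil_v bil_M by (simp add: mult.commute)
  finally show ?thesis using D_nz by simp
qed

text \<open>A kernel vector would lie on all lines \<open>t i\<close>. For symmetric
  \<open>t\<close> the identity in \<open>concurrent\<close> becomes 2 t_0(v_1) t_1(v_2) t_2(v_0) =
  0.\<close>

lemma det_M: "vdet (fst M) (fst (snd M)) (snd (snd M)) \<noteq> 0"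
proof
  assume "vdet (fst M) (fst (snd M)) (snd (snd M)) = 0"
  from det_zero_kernel[OF this] obtain z where z: "z \<noteq> 0" "vdot (fst M) z = 0" "vdot (fst (snd M)) z = 0"
    "vdot (snd (snd M)) z = 0" by (elim exE conjE) (rule that)
  then have "mulv M z = 0" by (simp add: mulv_def zero_prod_def)
  then have "vdot (t i) z = 0" for i using bil_v[of i z] by (simp add: bil_def vdot_0)
  then have "vdot (t 0) (v 1) * vdot (t 1) (v 2) * vdot (t 2) (v 0)
     = - (vdot (t 0) (v 2) * vdot (t 1) (v 0) * vdot (t 2) (v 1))"
    using concurrent[of t, OF t_self t_nz z(1), of 0 1 2] by simp
  then have "2 * (vdot (t 0) (v 1) * vdot (t 1) (v 2) * vdot (t 2) (v 0)) = 0"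
    using t_sym[of 1 0] t_sym[of 2 1] t_sym[of 2 0] by (simp add: algebra_simps)
  then show False using two t_nz by simp
qed

text \<open>The alternating bilinear form with the values s_i(v_j), with one argument fixed at
  \<open>p\<close>. The minus sign makes its value at \<open>v i\<close> equal to s_i(p).\<close>

definition "sform p = vscale (- 1 / D) (vscale (vdot c0 p) (s 0) + vscale (vdot c1 p) (s 1) + vscale (vdot c2 p) (s 2))"

lemma sform_v: "vdot (sform p) (v i) = vdot (s i) p"
proof -
  have "D * vdot (sform p) (v i) = D * vdot (s i) p"
    unfolding expand[of "s i"] sform_def using D_nz s_anti[of 0 i] s_anti[of 1 i] s_anti[of 2 i]
    by (simp add: vdot_scale vdot_add algebra_simps)
  then show ?thesis using D_nz by simp
qed

lemma sform_self: "vdot (sform p) p = 0"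
proof -
  have "D * vdot (sform p) p = vdot c0 p * vdot (s 0) p + vdot c1 p * vdot (s 1) p + vdot c2 p * vdot (s 2) p"
    unfolding expand[of "sform p"] sform_v ..
  then have "D * (D * vdot (sform p) p) = vdot c0 p * (D * vdot (s 0) p) + vdot c1 p * (D * vdot (s 1) p) + vdot c2 p * (D * vdot (s 2) p)"
    by (simp add: algebra_simps)
  also have "\<dots> = 0"
    unfolding expand s_self using s_anti[of 1 0] s_anti[of 2 0] s_anti[of 2 1] by (simp add: algebra_simps)
  finally show ?thesis using D_nz by simp
qed

text \<open>The conic parametrised by the lines through its point \<open>v 0\<close>:
  \<open>y\<close> runs over the line of \<open>v 1\<close> and \<open>v 2\<close>, and the vector
  is the second zero of the quadratic form on the line of \<open>v 0\<close> and
  \<open>y\<close>.\<close>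

definition "conic_point \<xi> = (let y = v 1 + vscale \<xi> (v 2) in vscale (bil M y y) (v 0) - vscale (2 * bil M (v 0) y) y)"

text \<open>Two positions are excluded: the line of \<open>v 0\<close> and \<open>v 2\<close>, which
  has parameter infinity, and the tangent \<open>t 0\<close>, where the formula degenerates to the
  zero vector.\<close>

lemma conic_point:
  assumes iso: "bil M u u = 0" and n: "vdot c1 u \<noteq> 0" "vdot (t 0) u \<noteq> 0"
  shows "\<exists>k. k \<noteq> 0 \<and> conic_point (vdot c2 u / vdot c1 u) = vscale k u"
proof -
  define a b e where "a = vdot c0 u" and "b = vdot c1 u" and "e = vdot c2 u"
  define y where "y = v 1 + vscale (e / b) (v 2)"
  have b: "b \<noteq> 0" using n by (simp add: b_def)
  have "vscale D u = vscale a (v 0) + vscale b (v 1) + vscale e (v 2)"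
    using expand_vec[of u] by (simp add: a_def b_def e_def)
  then have y: "y = vscale (D / b) u - vscale (a / b) (v 0)"
    using b by (simp add: y_def vscale_def plus_prod_def minus_prod_def prod_eq_iff field_simps)
  have t0: "bil M (v 0) u = vdot (t 0) u" "bil M u (v 0) = vdot (t 0) u" "bil M (v 0) (v 0) = 0"
    using bil_v bil_sym t_self by metis+
  define q where "q = vdot (t 0) u"
  have yy: "bil M y y = - 2 * (D / b) * (a / b) * q" "bil M (v 0) y = (D / b) * q"
    unfolding y bil_linear t0 iso q_def by (simp_all add: algebra_simps)
  have "conic_point (e / b) = vscale (- 2 * (D / b) * (a / b) * q) (v 0) - vscale (2 * ((D / b) * q)) y"
    unfolding conic_point_def Let_def y_def[symmetric] yy ..
  also have "\<dots> = vscale (- 2 * (D / b)\<^sup>2 * q) u"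
    unfolding y by (simp add: vscale_def minus_prod_def algebra_simps power2_eq_square)
  finally show ?thesis using two D_nz n by (intro exI[of _ "- 2 * (D / b)\<^sup>2 * q"]) (auto simp: b_def e_def q_def)
qed

text \<open>Hypothesis \<open>r\<close> says that a form of degree d + 1 vanishes at almost all
  \<open>v i\<close>: the product of the \<open>g\<close> times \<open>sform p\<close>, minus a
  constant times the product of the \<open>k\<close> times the polar of \<open>p\<close>. So it
  vanishes on the whole conic; if \<open>p\<close> were off the conic, the two summands would have
  to vanish separately, which they do not.\<close>

lemma low_point_on_conic:
  fixes g k :: "nat \<Rightarrow> 'a vec3"
  assumes E: "finite E" and gk: "\<And>j. j < d \<Longrightarrow> vdot (g j) p = 0" "\<And>j. j < d \<Longrightarrow> vdot (k j) p = 0"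
    and nz: "\<And>i. i \<notin> E \<Longrightarrow> (\<Prod>j<d. vdot (k j) (v i)) \<noteq> 0"
      "\<And>i. i \<notin> E \<Longrightarrow> (\<Prod>j<d. vdot (g j) (v i)) \<noteq> 0"
      "\<And>i. i \<notin> E \<Longrightarrow> vdot (t i) p \<noteq> 0" "\<And>i. i \<notin> E \<Longrightarrow> vdot (s i) p \<noteq> 0"
    and r: "\<And>i l. i \<notin> E \<Longrightarrow> l \<notin> E \<Longrightarrow> i \<noteq> l \<Longrightarrow>
      (\<Prod>j<d. vdot (g j) (v i)) * (\<Prod>j<d. vdot (k j) (v l)) * (vdot (t l) p * vdot (s i) p) =
      (\<Prod>j<d. vdot (g j) (v l)) * (\<Prod>j<d. vdot (k j) (v i)) * (vdot (t i) p * vdot (s l) p)"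
  shows "bil M p p = 0"
proof (rule ccontr)
  assume q: "bil M p p \<noteq> 0"
  define gg where "gg u = (\<Prod>j<d. vdot (g j) u)" for u
  define kk where "kk u = (\<Prod>j<d. vdot (k j) u)" for u
  define x where "x = mulv M p"
  define y where "y = sform p"
  have xv: "vdot x u = bil M u p" for u by (simp add: x_def bil_def vdot_commute)
  obtain l where l: "l \<notin> E" using E ex_new_if_finite infinite_UNIV_nat by blast
  \<comment> \<open>Fixing one regular index \<open>l\<close> turns the relation between two indices
    into an equation in \<open>v i\<close> alone.\<close>
  define c where "c = (gg (v l) * vdot (s l) p) / (kk (v l) * vdot (t l) p)"
  have c: "c \<noteq> 0" using nz[OF l] by (simp add: c_def gg_def kk_def)
  define \<Phi> where "\<Phi> u = gg u * vdot y u - c * (kk u * vdot x u)" for u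
  have zero: "\<Phi> (v i) = 0" if "i \<notin> E" for i
  proof -
    have "gg (v i) * kk (v l) * (vdot (t l) p * vdot (s i) p) = gg (v l) * kk (v i) * (vdot (t i) p * vdot (s l) p)"
      using r[OF that l] by (cases "i = l") (auto simp: gg_def kk_def)
    then show ?thesis using nz[OF l]
      by (simp add: \<Phi>_def y_def sform_v xv bil_v c_def gg_def kk_def field_simps)
  qed
  have scale: "\<Phi> (vscale e u) = e ^ Suc d * \<Phi> u" for e u
    by (simp add: \<Phi>_def gg_def kk_def vdot_scale prod.distrib algebra_simps)
  text \<open>The polynomial obtained by restricting the form to the parametrised conic.\<close>
  define cst where "cst = vmap (\<lambda>a::'a. [:a:])"
  define yp where "yp = cst (v 1) + vscale [:0, 1:] (cst (v 2))"
  define Mp where "Mp = vmap cst M"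
  define wp where "wp = vscale (bil Mp yp yp) (cst (v 0)) - vscale (2 * bil Mp (cst (v 0)) yp) yp"
  define P where "P = (\<Prod>j<d. vdot (cst (g j)) wp) * vdot (cst y) wp - [:c:] * ((\<Prod>j<d. vdot (cst (k j)) wp) * vdot (cst x) wp)"
  have pd: "poly (vdot a b) \<xi> = vdot (vmap (\<lambda>p. poly p \<xi>) a) (vmap (\<lambda>p. poly p \<xi>) b)" for a b and \<xi> :: 'a
    by (simp add: vec_defs)
  have pc: "vmap (\<lambda>p. poly p \<xi>) (cst a) = a" for a \<xi> by (simp add: cst_def vmap_def)
  have py: "vmap (\<lambda>p. poly p \<xi>) yp = v 1 + vscale \<xi> (v 2)" for \<xi>
    by (simp add: yp_def cst_def vec_defs plus_prod_def)
  have pb: "poly (bil Mp a b) \<xi> = bil M (vmap (\<lambda>p. poly p \<xi>) a) (vmap (\<lambda>p. poly p \<xi>) b)" for a b \<xi>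
    by (simp add: bil_def mulv_def Mp_def cst_def vec_defs)
  have pw: "vmap (\<lambda>p. poly p \<xi>) wp = conic_point \<xi>" for \<xi>
  proof -
    have "vmap (\<lambda>p. poly p \<xi>) wp = vscale (poly (bil Mp yp yp) \<xi>) (vmap (\<lambda>p. poly p \<xi>) (cst (v 0)))
       - vscale (2 * poly (bil Mp (cst (v 0)) yp) \<xi>) (vmap (\<lambda>p. poly p \<xi>) yp)"
      by (simp add: wp_def vmap_def vscale_def minus_prod_def)
    then show ?thesis by (simp add: pb py pc conic_point_def Let_def)
  qed
  have pP: "poly P \<xi> = \<Phi> (conic_point \<xi>)" for \<xi>
    by (simp add: P_def \<Phi>_def gg_def kk_def poly_prod pd pc pw)
  define J where "J = UNIV - (E \<union> {i. vdot c1 (v i) = 0} \<union> {0})"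
  have "vdot c1 (v 1) = D" by (simp add: c1_def D_def vec_defs algebra_simps)
  then have c1_nz: "c1 \<noteq> 0" using D_nz by (auto simp: vdot_0)
  have J: "infinite J" unfolding J_def using E finite_on_line[OF c1_nz] by simp
  define \<xi> where "\<xi> i = vdot c2 (v i) / vdot c1 (v i)" for i
  have root: "poly P (\<xi> i) = 0" if "i \<in> J" for i
  proof -
    have "bil M (v i) (v i) = 0" "vdot c1 (v i) \<noteq> 0" "vdot (t 0) (v i) \<noteq> 0" "i \<notin> E"
      using that bil_v t_self t_nz by (auto simp: J_def)
    then obtain e where "conic_point (\<xi> i) = vscale e (v i)" using conic_point unfolding \<xi>_def by blast
    then show ?thesis using zero \<open>i \<notin> E\<close> by (simp add: pP scale)
  qed
  \<comment> \<open>Points with equal parameter lie on one line through \<open>v 0\<close>, so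
    infinitely many points yield infinitely many roots.\<close>
  have fib: "finite {i \<in> J. \<xi> i = r}" for r
  proof -
    have "c2 - vscale r c1 \<noteq> 0"
    proof
      assume "c2 - vscale r c1 = 0"
      then have "vdot (c2 - vscale r c1) (v 2) = 0" by (simp add: vdot_0)
      then have "vdot c2 (v 2) = 0" by (simp add: c1_def vdot_diff vdot_scale vcross_orth)
      then show False using D_nz by (simp add: c2_def D_def vdet_def)
    qed
    from finite_on_line[OF this] show ?thesis
      by (rule rev_finite_subset) (auto simp: J_def \<xi>_def vdot_diff vdot_scale)
  qed
  have "P = 0"
  proof (rule ccontr)
    assume "P \<noteq> 0"
    then have "finite {r. poly P r = 0}" by (rule poly_roots_finite)
    then have "finite (\<xi> ` J)" by (rule rev_finite_subset) (use root in auto)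
    moreover have "J \<subseteq> (\<Union>r \<in> \<xi> ` J. {i \<in> J. \<xi> i = r})" by blast
    ultimately have "finite J" using fib by (meson finite_UN_I finite_subset)
    then show False using J by simp
  qed
  then have all0: "\<Phi> (conic_point r) = 0" for r using pP[of r] by simp
  text \<open>The reflection in p preserves the conic and the form built from s, but changes the sign of the polar of p.\<close>
  define qp where "qp = bil M p p"
  define refl where "refl u = vscale qp u - vscale (2 * bil M u p) p" for u
  have refl_form: "vdot f (refl u) = vdot (vscale qp f - vscale (2 * vdot f p) x) u" for f u
    by (simp add: refl_def vdot_diff vdot_scale xv)
  have refl_nz: "vscale qp f - vscale (2 * vdot f p) x \<noteq> 0" if "f \<noteq> 0" for f
  proof
    assume z: "vscale qp f - vscale (2 * vdot f p) x = 0"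
    then have "vdot (vscale qp f - vscale (2 * vdot f p) x) p = 0" by (simp add: vdot_0)
    then have "qp * vdot f p = 0" by (simp add: vdot_diff vdot_scale xv qp_def algebra_simps)
    then have "vdot f p = 0" using q by (simp add: qp_def)
    then show False using z q that by (simp add: vscale_0 vscale_eq_0 qp_def)
  qed
  have t0_nz: "t 0 \<noteq> 0" using t_nz[of 0 1] by (auto simp: vdot_0)
  have "finite (E \<union> {i. vdot (vscale qp c1 - vscale (2 * vdot c1 p) x) (v i) = 0} \<union>
      {i. vdot (vscale qp (t 0) - vscale (2 * vdot (t 0) p) x) (v i) = 0})"
    using E finite_on_line[OF refl_nz[OF c1_nz]] finite_on_line[OF refl_nz[OF t0_nz]] by simp
  from ex_new_if_finite[OF infinite_UNIV_nat this] obtain i where "i \<notin> E \<union> {i. vdot (vscale qp c1 - vscale (2 * vdot c1 p) x) (v i) = 0} \<union>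
      {i. vdot (vscale qp (t 0) - vscale (2 * vdot (t 0) p) x) (v i) = 0}"
    by (elim exE) (rule that)
  then have i: "i \<notin> E" "vdot c1 (refl (v i)) \<noteq> 0" "vdot (t 0) (refl (v i)) \<noteq> 0" unfolding refl_form by auto
  have "bil M (refl (v i)) (refl (v i)) = 0"
    unfolding refl_def bil_linear bil_sym[of p "v i"] using bil_v[of i "v i"] t_self[of i]
    by (simp add: qp_def algebra_simps)
  then obtain e r where e: "e \<noteq> 0" "conic_point r = vscale e (refl (v i))" using conic_point i by blast
  then have "\<Phi> (refl (v i)) = 0" using all0[of r] by (simp add: scale)
  moreover have "gg (refl (v i)) = qp ^ d * gg (v i)" "kk (refl (v i)) = qp ^ d * kk (v i)"
    unfolding gg_def kk_def using gk by (simp_all add: refl_def vdot_diff vdot_scale prod.distrib)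
  moreover have "vdot y (refl (v i)) = qp * vdot y (v i)"
    by (simp add: refl_def vdot_diff vdot_scale y_def sform_self)
  moreover have "vdot x (refl (v i)) = - qp * vdot x (v i)"
    by (simp add: refl_def xv bil_linear qp_def algebra_simps)
  ultimately have "qp ^ Suc d * (gg (v i) * vdot y (v i) + c * (kk (v i) * vdot x (v i))) = 0"
    by (simp add: \<Phi>_def algebra_simps)
  then have "gg (v i) * vdot y (v i) + c * (kk (v i) * vdot x (v i)) = 0" using q by (simp add: qp_def)
  then have "2 * (c * (kk (v i) * vdot x (v i))) = 0" using zero[OF i(1)] by (simp add: \<Phi>_def)
  then show False using two c nz[OF i(1)] by (simp add: xv bil_v kk_def)
qed

end

text \<open>Segre's lemma for \<open>p\<close> and two members of the configuration, in the scaling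
  of \<open>config\<close>. In the application \<open>g\<close> lists the tangents at
  \<open>p\<close> and \<open>k\<close> as many surplus lines through it, counted with multiplicity;
  \<open>E\<close> collects the indices whose 3-secant passes through \<open>p\<close>.\<close>

definition low_point_data ::
    "(nat \<Rightarrow> 'a::field vec3) \<Rightarrow> (nat \<Rightarrow> 'a vec3) \<Rightarrow> (nat \<Rightarrow> 'a vec3) \<Rightarrow> 'a vec3 \<Rightarrow>
      nat set \<Rightarrow> nat \<Rightarrow> (nat \<Rightarrow> 'a vec3) \<Rightarrow> (nat \<Rightarrow> 'a vec3) \<Rightarrow> bool" where
  "low_point_data v t s p E d g k \<longleftrightarrow> finite E \<and> (\<forall>j<d. vdot (g j) p = 0 \<and> vdot (k j) p = 0) \<and>
     (\<forall>i. i \<notin> E \<longrightarrow> (\<Prod>j<d. vdot (k j) (v i)) \<noteq> 0 \<and> (\<Prod>j<d. vdot (g j) (v i)) \<noteq> 0 \<and>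
        vdot (t i) p \<noteq> 0 \<and> vdot (s i) p \<noteq> 0) \<and>
     (\<forall>i l. i \<notin> E \<longrightarrow> l \<notin> E \<longrightarrow> i \<noteq> l \<longrightarrow>
        (\<Prod>j<d. vdot (g j) (v i)) * (\<Prod>j<d. vdot (k j) (v l)) * (vdot (t l) p * vdot (s i) p) =
        (\<Prod>j<d. vdot (g j) (v l)) * (\<Prod>j<d. vdot (k j) (v i)) * (vdot (t i) p * vdot (s l) p))"

definition low_point :: "(nat \<Rightarrow> 'a::field vec3) \<Rightarrow> (nat \<Rightarrow> 'a vec3) \<Rightarrow> (nat \<Rightarrow> 'a vec3) \<Rightarrow> 'a vec3 \<Rightarrow> bool" where
  "low_point v t s p \<longleftrightarrow> (\<exists>E d g k. low_point_data v t s p E d g k)"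

lemma low_point_swap:
  assumes "low_point v t s p" shows "low_point v s t p"
proof -
  obtain E d g k where L: "low_point_data v t s p E d g k" using assms low_point_def by blast
  have "low_point_data v s t p E d k g"
    unfolding low_point_data_def
  proof (intro conjI allI impI)
    fix i l assume "i \<notin> E" "l \<notin> E" "i \<noteq> l"
    then show "(\<Prod>j<d. vdot (k j) (v i)) * (\<Prod>j<d. vdot (g j) (v l)) * (vdot (s l) p * vdot (t i) p) =
        (\<Prod>j<d. vdot (k j) (v l)) * (\<Prod>j<d. vdot (g j) (v i)) * (vdot (s i) p * vdot (t l) p)"
      using L unfolding low_point_data_def by (simp add: mult_ac)
  qed (use L in \<open>auto simp: low_point_data_def\<close>)
  then show ?thesis using low_point_def by blast
qed

lemma low_point_subseq:
  assumes "inj f" "low_point v t s p" "\<And>i. c i \<noteq> 0"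
  shows "low_point (\<lambda>i. v (f i)) (\<lambda>i. vscale (c i) (t (f i))) (\<lambda>i. vscale (c i) (s (f i))) p"
proof -
  obtain E d g k where L: "low_point_data v t s p E d g k" using assms low_point_def by blast
  have "low_point_data (\<lambda>i. v (f i)) (\<lambda>i. vscale (c i) (t (f i))) (\<lambda>i. vscale (c i) (s (f i))) p (f -` E) d g k"
    unfolding low_point_data_def vdot_scale
  proof (intro conjI allI impI)
    show "finite (f -` E)" using L assms(1) by (auto simp: low_point_data_def intro: finite_vimageI)
    fix i l assume il: "i \<notin> f -` E" "l \<notin> f -` E" "i \<noteq> l"
    then have "f i \<noteq> f l" using assms(1) by (auto dest: injD)
    then have "(\<Prod>j<d. vdot (g j) (v (f i))) * (\<Prod>j<d. vdot (k j) (v (f l))) * (vdot (t (f l)) p * vdot (s (f i)) p) =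
        (\<Prod>j<d. vdot (g j) (v (f l))) * (\<Prod>j<d. vdot (k j) (v (f i))) * (vdot (t (f i)) p * vdot (s (f l)) p)"
      using L il unfolding low_point_data_def by simp
    then show "(\<Prod>j<d. vdot (g j) (v (f i))) * (\<Prod>j<d. vdot (k j) (v (f l))) * (c l * vdot (t (f l)) p * (c i * vdot (s (f i)) p)) =
        (\<Prod>j<d. vdot (g j) (v (f l))) * (\<Prod>j<d. vdot (k j) (v (f i))) * (c i * vdot (t (f i)) p * (c l * vdot (s (f l)) p))"
      by Groebner_Basis.algebra
  qed (use L assms(3) in \<open>auto simp: low_point_data_def\<close>)
  then show ?thesis using low_point_def by blast
qed

definition conic_conclusion :: "(nat \<Rightarrow> 'a::field vec3) \<Rightarrow> (nat \<Rightarrow> 'a vec3) \<Rightarrow> (nat \<Rightarrow> 'a vec3) \<Rightarrow> bool" where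
  "conic_conclusion v t s \<longleftrightarrow> (\<exists>M. (\<forall>u w. bil M u w = bil M w u) \<and>
     vdet (fst M) (fst (snd M)) (snd (snd M)) \<noteq> 0 \<and> (\<forall>p. low_point v t s p \<longrightarrow> bil M p p = 0))"

lemma conic_conclusion_mono:
  assumes "conic_conclusion v' t' s'" "\<And>p. low_point v t s p \<Longrightarrow> low_point v' t' s' p"
  shows "conic_conclusion v t s"
  using assms unfolding conic_conclusion_def by blast

lemma (in sym_config) sym_conclusion: "conic_conclusion v t s"
  unfolding conic_conclusion_def
proof (rule exI[of _ M], intro conjI allI impI)
  show "bil M u w = bil M w u" for u w by (rule bil_sym)
  show "vdet (fst M) (fst (snd M)) (snd (snd M)) \<noteq> 0" by (rule det_M)
  fix p assume "low_point v t s p"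
  then obtain E d g k where L: "low_point_data v t s p E d g k" using low_point_def by blast
  show "bil M p p = 0"
    by (rule low_point_on_conic[of E d g p k]) (use L in \<open>simp_all add: low_point_data_def\<close>)
qed

section \<open>Reduction to symmetric configurations by scaling and Ramsey's theorem\<close>

context config
begin

definition cyc :: "nat \<Rightarrow> nat \<Rightarrow> nat \<Rightarrow> 'a" where
  "cyc i j k = vdot (s i) (v j) * vdot (s j) (v k) * vdot (s k) (v i)"

lemma cyc_rotate: "cyc j k i = cyc i j k"
  by (simp add: cyc_def mult_ac)

lemma config_subseq: "inj f \<Longrightarrow> config (\<lambda>i. v (f i)) (\<lambda>i. t (f i)) (\<lambda>i. s (f i))"
  by unfold_locales (auto simp: two t_self s_self t_nz s_nz indep arc rel inj_eq)

lemma config_swap: "config v s t"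
proof
  show "vcross (s i) (t i) \<noteq> 0" for i using indep[of i] vcross_anti by blast
  show "vdot (s i) (v j) * vdot (t j) (v i) + vdot (t i) (v j) * vdot (s j) (v i) = 0" if "i \<noteq> j" for i j
    using rel[OF that] by (simp add: add.commute)
qed (auto simp: two t_self s_self t_nz s_nz arc)

lemma config_scale:
  assumes "\<And>i. c i \<noteq> 0"
  shows "config v (\<lambda>i. vscale (c i) (t i)) (\<lambda>i. vscale (c i) (s i))"
proof (unfold_locales, unfold vdot_scale)
  show "vcross (vscale (c i) (t i)) (vscale (c i) (s i)) \<noteq> 0" for i
    using indep[of i] assms by (simp add: vcross_scale vscale_eq_0)
  show "c i * vdot (t i) (v j) * (c j * vdot (s j) (v i)) + c i * vdot (s i) (v j) * (c j * vdot (t j) (v i)) = 0" if "i \<noteq> j" for i j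
    using rel[OF that] by Groebner_Basis.algebra
qed (use two t_self s_self t_nz s_nz arc assms in auto)

lemma conclusion_of_scaled:
  assumes "\<And>i. c i \<noteq> 0" "conic_conclusion v (\<lambda>i. vscale (c i) (t i)) (\<lambda>i. vscale (c i) (s i))"
  shows "conic_conclusion v t s"
  by (rule conic_conclusion_mono[OF assms(2)]) (use low_point_subseq[of id v t s _ c] assms(1) in simp)

text \<open>The scaling that makes \<open>s\<close> alternating against index 0 makes it alternating
  throughout, by the sign condition on triples containing 0. Then \<open>rel\<close> forces the
  equally scaled \<open>t\<close> to be symmetric.\<close>

lemma conclusion_antisym:
  assumes k: "\<And>i j k. i \<noteq> j \<Longrightarrow> i \<noteq> k \<Longrightarrow> j \<noteq> k \<Longrightarrow> cyc i j k = - cyc i k j"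
  shows "conic_conclusion v t s"
proof -
  define c where "c i = (if i = 0 then 1 else - (vdot (s 0) (v i) / vdot (s i) (v 0)))" for i
  have c: "c i \<noteq> 0" for i using s_nz by (auto simp: c_def)
  define s' where "s' i = vscale (c i) (s i)" for i
  define t' where "t' i = vscale (c i) (t i)" for i
  interpret C: config v t' s' unfolding s'_def t'_def by (rule config_scale[OF c])
  have 0: "vdot (s' i) (v 0) = - vdot (s' 0) (v i)" if "i \<noteq> 0" for i
    using that s_nz[of i 0] by (simp add: s'_def c_def vdot_scale)
  have anti: "vdot (s' i) (v j) = - vdot (s' j) (v i)" for i j
  proof (cases "i = j \<or> i = 0 \<or> j = 0")
    case True
    then show ?thesis using 0[of i] 0[of j] C.s_self by (cases "i = j") auto
  next
    case False
    define p q x y where "p = vdot (s 0) (v i)" "q = vdot (s 0) (v j)" "x = vdot (s i) (v j)" "y = vdot (s j) (v i)"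
    note d = p_q_x_y_def
    have "p * x * vdot (s j) (v 0) = - (q * y * vdot (s i) (v 0))"
      using k[of 0 i j] False by (simp add: cyc_def d mult_ac)
    then show ?thesis using False s_nz[of i 0] s_nz[of j 0]
      by (simp add: s'_def c_def vdot_scale d[symmetric] field_simps)
  qed
  have sym: "vdot (t' i) (v j) = vdot (t' j) (v i)" for i j
  proof (cases "i = j")
    case False
    have "vdot (s' j) (v i) * (vdot (t' i) (v j) - vdot (t' j) (v i)) = 0"
      using C.rel[OF False] unfolding anti[of i j] by (simp add: algebra_simps)
    then show ?thesis using C.s_nz[of j i] False by simp
  qed simp
  interpret S: sym_config v t' s' by unfold_locales (fact sym, fact anti)
  show ?thesis by (rule conclusion_of_scaled[of c, OF c S.sym_conclusion[unfolded s'_def t'_def]])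
qed

text \<open>If the cyclic products of \<open>s\<close> agree, \<open>rel\<close> makes those of
  \<open>t\<close> opposite, so the previous case applies with \<open>t\<close> and \<open>s\<close>
  exchanged.\<close>

lemma conclusion_sym:
  assumes k: "\<And>i j k. i \<noteq> j \<Longrightarrow> i \<noteq> k \<Longrightarrow> j \<noteq> k \<Longrightarrow> cyc i j k = cyc i k j"
  shows "conic_conclusion v t s"
proof -
  interpret S: config v s t by (rule config_swap)
  have "conic_conclusion v s t"
  proof (rule S.conclusion_antisym)
    fix i j k :: nat assume d: "i \<noteq> j" "i \<noteq> k" "j \<noteq> k"
    define a b c a' b' c' where "a = vdot (t i) (v j)" "b = vdot (t j) (v k)" "c = vdot (t k) (v i)"
      "a' = vdot (t j) (v i)" "b' = vdot (t k) (v j)" "c' = vdot (t i) (v k)"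
    define p q r p' q' r' where "p = vdot (s i) (v j)" "q = vdot (s j) (v k)" "r = vdot (s k) (v i)"
      "p' = vdot (s j) (v i)" "q' = vdot (s k) (v j)" "r' = vdot (s i) (v k)"
    note defs = a_b_c_a'_b'_c'_def p_q_r_p'_q'_r'_def
    have 1: "p * q * r = r' * q' * p'" using k[OF d] by (simp add: defs cyc_def)
    have 2: "a * p' + p * a' = 0" "b * q' + q * b' = 0" "c * r' + r * c' = 0"
      using rel[of i j] rel[of j k] rel[of k i] d by (auto simp: defs)
    have nz: "p * q * r \<noteq> 0" using s_nz d by (simp add: defs)
    have "(p * q * r) * (a * b * c + c' * b' * a') = 0" using 1 2 by Groebner_Basis.algebra
    then have "a * b * c = - (c' * b' * a')" using nz by (simp add: add_eq_0_iff)
    then show "S.cyc i j k = - S.cyc i k j" by (simp add: S.cyc_def defs)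
  qed
  then show ?thesis by (rule conic_conclusion_mono) (rule low_point_swap)
qed

lemma config_map:
  assumes "field_hom h"
  shows "config (\<lambda>i. vmap h (v i)) (\<lambda>i. vmap h (t i)) (\<lambda>i. vmap h (s i))"
proof (unfold_locales, unfold vmap_hom[OF assms])
  have h2: "(2 :: 'b) = h 2" using field_hom_simps(2)[OF assms, of 1 1] field_hom_simps(1)[OF assms] by simp
  show "(2 :: 'b) \<noteq> 0" unfolding h2 field_hom_simps(7)[OF assms] by (rule two)
  show "h (vdot (t i) (v j)) * h (vdot (s j) (v i)) + h (vdot (s i) (v j)) * h (vdot (t j) (v i)) = 0" if "i \<noteq> j" for i j
    using arg_cong[OF rel[OF that], of h] by (simp add: field_hom_simps[OF assms])
qed (auto simp: field_hom_simps[OF assms] t_self s_self t_nz s_nz indep arc)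

text \<open>Places call for an algebraically closed base field, so the configuration is moved to the
  algebraic closure; the inequality of the squares survives the embedding.\<close>

lemma exists_kappa:
  "\<exists>i j k. i \<noteq> j \<and> i \<noteq> k \<and> j \<noteq> k \<and> (cyc i j k = - cyc i k j \<or> cyc i j k = cyc i k j)"
proof (rule ccontr)
  assume n: "\<not> ?thesis"
  let ?h = "to_ac :: 'a \<Rightarrow> 'a alg_closure"
  have h: "field_hom ?h" by (simp add: field_hom_def)
  interpret C: config "\<lambda>i. vmap ?h (v i)" "\<lambda>i. vmap ?h (t i)" "\<lambda>i. vmap ?h (s i)" by (rule config_map[OF h])
  have "rigid_config (\<lambda>i. vmap ?h (v i)) (\<lambda>i. vmap ?h (t i)) (\<lambda>i. vmap ?h (s i))"
  proof
    fix i j k :: nat assume d: "i \<noteq> j" "i \<noteq> k" "j \<noteq> k"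
    have "(cyc i j k)\<^sup>2 \<noteq> (cyc i k j)\<^sup>2" using n d by (auto simp: power2_eq_iff)
    then have "?h ((cyc i j k)\<^sup>2) \<noteq> ?h ((cyc i k j)\<^sup>2)" using field_hom_simps(8)[OF h] by blast
    then show "(vdot (vmap ?h (s i)) (vmap ?h (v j)) * vdot (vmap ?h (s j)) (vmap ?h (v k)) * vdot (vmap ?h (s k)) (vmap ?h (v i)))\<^sup>2 \<noteq>
      (vdot (vmap ?h (s i)) (vmap ?h (v k)) * vdot (vmap ?h (s j)) (vmap ?h (v i)) * vdot (vmap ?h (s k)) (vmap ?h (v j)))\<^sup>2"
      by (simp add: vmap_hom[OF h] cyc_def mult_ac)
  qed
  then show False using no_rigid_config by blast
qed

text \<open>Triples are coloured by the sign relating their cyclic products, with a third colour for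
  no sign. By \<open>exists_kappa\<close> an infinite homogeneous set cannot have the third
  colour.\<close>

theorem conic_exists: "conic_conclusion v t s"
proof -
  define kap where "kap e A \<longleftrightarrow> (\<exists>i j k. A = {i, j, k} \<and> i \<noteq> j \<and> i \<noteq> k \<and> j \<noteq> k \<and> cyc i j k = e * cyc i k j)"
    for e :: 'a and A :: "nat set"
  \<comment> \<open>The property depends only on the set of three indices: reversing the orientation
    inverts the factor, and a sign is its own inverse.\<close>
  have kap: "cyc i j k = e * cyc i k j" if "kap e {i, j, k}" "e = 1 \<or> e = - 1" "i \<noteq> j" "i \<noteq> k" "j \<noteq> k" for e i j k
  proof -
    obtain a b c where abc: "{i, j, k} = {a, b, c}" "a \<noteq> b" "a \<noteq> c" "b \<noteq> c" "cyc a b c = e * cyc a c b"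
      using \<open>kap e {i, j, k}\<close> unfolding kap_def by blast
    have "i \<in> {a, b, c}" "j \<in> {a, b, c}" "k \<in> {a, b, c}" using abc(1) by blast+
    moreover have "cyc b c a = cyc a b c" "cyc c a b = cyc a b c" "cyc b a c = cyc a c b" "cyc c b a = cyc a c b"
      using cyc_rotate by metis+
    moreover have "cyc a b c = e * cyc a c b" by (rule abc(5))
    ultimately show ?thesis
      using that(2-5) by (elim insertE emptyE disjE) simp_all
  qed
  define col where "col A = (if kap (- 1) A then 0 else if kap 1 A then 1 else 2 :: nat)" for A
  have "\<exists>Y c. Y \<subseteq> (UNIV :: nat set) \<and> infinite Y \<and> c < 3 \<and> (\<forall>A. A \<subseteq> Y \<and> finite A \<and> card A = 3 \<longrightarrow> col A = c)"
    by (rule Ramsey) (auto simp: col_def)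
  then obtain Y c where Y: "infinite Y" and Yc: "\<forall>A. A \<subseteq> Y \<and> finite A \<and> card A = 3 \<longrightarrow> col A = c"
    by (elim exE conjE) (rule that)
  define f where "f = enumerate Y"
  have f: "inj f" "range f \<subseteq> Y" unfolding f_def using enumerate_in_set[OF Y] strict_mono_enumerate[OF Y]
    by (auto intro: strict_mono_imp_inj_on)
  interpret F: config "\<lambda>i. v (f i)" "\<lambda>i. t (f i)" "\<lambda>i. s (f i)" by (rule config_subseq[OF f(1)])
  have Fc: "F.cyc i j k = cyc (f i) (f j) (f k)" for i j k by (simp add: F.cyc_def cyc_def)
  have colf: "col {f i, f j, f k} = c" if "i \<noteq> j" "i \<noteq> k" "j \<noteq> k" for i j k
    using f that by (intro Yc[rule_format]) (auto simp: inj_eq)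
  obtain i j k where ijk: "i \<noteq> j" "i \<noteq> k" "j \<noteq> k" "F.cyc i j k = - F.cyc i k j \<or> F.cyc i j k = F.cyc i k j"
    using F.exists_kappa by blast
  have "conic_conclusion (\<lambda>i. v (f i)) (\<lambda>i. t (f i)) (\<lambda>i. s (f i))"
  proof (cases "c = 0")
    case True
    have "F.cyc i j k = - F.cyc i k j" if "i \<noteq> j" "i \<noteq> k" "j \<noteq> k" for i j k
    proof -
      have "kap (- 1) {f i, f j, f k}" using colf[OF that] True by (auto simp: col_def split: if_splits)
      then have "cyc (f i) (f j) (f k) = - 1 * cyc (f i) (f k) (f j)" using that f(1) by (intro kap) (auto simp: inj_eq)
      then show ?thesis unfolding Fc by simp
    qed
    then show ?thesis by (rule F.conclusion_antisym)
  next
    case False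
    have ne: "f i \<noteq> f j" "f i \<noteq> f k" "f j \<noteq> f k" using ijk f(1) by (auto simp: inj_eq)
    have "kap (- 1) {f i, f j, f k} \<or> kap 1 {f i, f j, f k}"
      using ijk(4) ne unfolding kap_def Fc by (metis mult_1 mult_minus1)
    then have "c = 1" using colf[OF ijk(1-3)] False by (auto simp: col_def split: if_splits)
    have "F.cyc i j k = F.cyc i k j" if "i \<noteq> j" "i \<noteq> k" "j \<noteq> k" for i j k
    proof -
      have c1: "col {f i, f j, f k} = 1" using colf[OF that] \<open>c = 1\<close> by (rule trans)
      have "kap 1 {f i, f j, f k}"
        by (rule ccontr) (use c1 in \<open>simp add: col_def split: if_split_asm\<close>)
      then have "cyc (f i) (f j) (f k) = 1 * cyc (f i) (f k) (f j)" using that f(1) by (intro kap) (auto simp: inj_eq)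
      then show ?thesis unfolding Fc by simp
    qed
    then show ?thesis by (rule F.conclusion_sym)
  qed
  moreover have "low_point (\<lambda>i. v (f i)) (\<lambda>i. t (f i)) (\<lambda>i. s (f i)) p" if "low_point v t s p" for p
    using low_point_subseq[OF f(1) that, of "\<lambda>_. 1"] by (simp add: vscale_1)
  ultimately show ?thesis by (rule conic_conclusion_mono)
qed

end

section \<open>The projective plane over a finite field\<close>

context cring
begin

text \<open>The fields of the theorem are records with a carrier, so the vector operations are
  repeated for them. The results on configurations concern fields given by types, and the two worlds
  meet in the ultraproduct.\<close>

definition rdot :: "'a vec3 \<Rightarrow> 'a vec3 \<Rightarrow> 'a" where
  "rdot u w = fst u \<otimes> fst w \<oplus> fst (snd u) \<otimes> fst (snd w) \<oplus> snd (snd u) \<otimes> snd (snd w)"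

definition rcross :: "'a vec3 \<Rightarrow> 'a vec3 \<Rightarrow> 'a vec3" where
  "rcross u w = (fst (snd u) \<otimes> snd (snd w) \<ominus> snd (snd u) \<otimes> fst (snd w),
     snd (snd u) \<otimes> fst w \<ominus> fst u \<otimes> snd (snd w), fst u \<otimes> fst (snd w) \<ominus> fst (snd u) \<otimes> fst w)"

definition rscale :: "'a \<Rightarrow> 'a vec3 \<Rightarrow> 'a vec3" where
  "rscale c u = (c \<otimes> fst u, c \<otimes> fst (snd u), c \<otimes> snd (snd u))"

definition rplus :: "'a vec3 \<Rightarrow> 'a vec3 \<Rightarrow> 'a vec3" where
  "rplus u w = (fst u \<oplus> fst w, fst (snd u) \<oplus> fst (snd w), snd (snd u) \<oplus> snd (snd w))"

definition rdet :: "'a vec3 \<Rightarrow> 'a vec3 \<Rightarrow> 'a vec3 \<Rightarrow> 'a" where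
  "rdet u v w = rdot (rcross u v) w"

definition V3 :: "'a vec3 set" where "V3 = carrier R \<times> carrier R \<times> carrier R"

definition zero3 :: "'a vec3" where "zero3 = (\<zero>, \<zero>, \<zero>)"

lemmas rvec_defs = rdot_def rcross_def rscale_def rplus_def rdet_def V3_def zero3_def

lemma rvec_closed [simp]:
  "u \<in> V3 \<Longrightarrow> w \<in> V3 \<Longrightarrow> rdot u w \<in> carrier R" "u \<in> V3 \<Longrightarrow> w \<in> V3 \<Longrightarrow> rcross u w \<in> V3"
  "c \<in> carrier R \<Longrightarrow> u \<in> V3 \<Longrightarrow> rscale c u \<in> V3" "u \<in> V3 \<Longrightarrow> w \<in> V3 \<Longrightarrow> rplus u w \<in> V3"
  "u \<in> V3 \<Longrightarrow> w \<in> V3 \<Longrightarrow> x \<in> V3 \<Longrightarrow> rdet u w x \<in> carrier R" "zero3 \<in> V3"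
  by (auto simp: rvec_defs)

lemma space3_conv:
  "carrier (space3 R) = V3" "\<zero>\<^bsub>space3 R\<^esub> = zero3" "a \<odot>\<^bsub>space3 R\<^esub> u = rscale a u"
  "u \<oplus>\<^bsub>space3 R\<^esub> w = rplus u w"
  by (auto simp: space3_def rvec_defs split: prod.splits)

lemma rdot_linear:
  "a \<in> V3 \<Longrightarrow> u \<in> V3 \<Longrightarrow> c \<in> carrier R \<Longrightarrow> rdot a (rscale c u) = c \<otimes> rdot a u"
  "a \<in> V3 \<Longrightarrow> u \<in> V3 \<Longrightarrow> w \<in> V3 \<Longrightarrow> rdot a (rplus u w) = rdot a u \<oplus> rdot a w"
  "a \<in> V3 \<Longrightarrow> u \<in> V3 \<Longrightarrow> c \<in> carrier R \<Longrightarrow> rdot (rscale c u) a = c \<otimes> rdot u a"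
  "a \<in> V3 \<Longrightarrow> u \<in> V3 \<Longrightarrow> w \<in> V3 \<Longrightarrow> rdot (rplus u w) a = rdot u a \<oplus> rdot w a"
  by (auto simp: rvec_defs; algebra)+

lemma rdot_commute: "u \<in> V3 \<Longrightarrow> w \<in> V3 \<Longrightarrow> rdot u w = rdot w u"
  by (auto simp: rvec_defs m_comm)

lemma rcross_orth:
  assumes "u \<in> V3" "w \<in> V3"
  shows "rdot (rcross u w) u = \<zero>" "rdot (rcross u w) w = \<zero>"
  using assms by (auto simp: rvec_defs; algebra)+

lemma rdet_swap:
  assumes "u \<in> V3" "w \<in> V3" "x \<in> V3"
  shows "rdet w u x = \<ominus> rdet u w x" "rdet w x u = rdet u w x" "rdet u x w = \<ominus> rdet u w x"
  using assms by (auto simp: rvec_defs; algebra)+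

text \<open>One coordinate of Cramer's rule; the cyclic rotation \<open>rot\<close>, which preserves
  determinants, gives the other two.\<close>

lemma cramer_component:
  assumes "u1 \<in> carrier R" "u2 \<in> carrier R" "u3 \<in> carrier R" "v1 \<in> carrier R" "v2 \<in> carrier R" "v3 \<in> carrier R"
    "w1 \<in> carrier R" "w2 \<in> carrier R" "w3 \<in> carrier R" "x1 \<in> carrier R" "x2 \<in> carrier R" "x3 \<in> carrier R"
  shows "((u2 \<otimes> v3 \<ominus> u3 \<otimes> v2) \<otimes> w1 \<oplus> (u3 \<otimes> v1 \<ominus> u1 \<otimes> v3) \<otimes> w2 \<oplus> (u1 \<otimes> v2 \<ominus> u2 \<otimes> v1) \<otimes> w3) \<otimes> x1 =
    ((x2 \<otimes> v3 \<ominus> x3 \<otimes> v2) \<otimes> w1 \<oplus> (x3 \<otimes> v1 \<ominus> x1 \<otimes> v3) \<otimes> w2 \<oplus> (x1 \<otimes> v2 \<ominus> x2 \<otimes> v1) \<otimes> w3) \<otimes> u1 \<oplus>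
    ((u2 \<otimes> x3 \<ominus> u3 \<otimes> x2) \<otimes> w1 \<oplus> (u3 \<otimes> x1 \<ominus> u1 \<otimes> x3) \<otimes> w2 \<oplus> (u1 \<otimes> x2 \<ominus> u2 \<otimes> x1) \<otimes> w3) \<otimes> v1 \<oplus>
    ((u2 \<otimes> v3 \<ominus> u3 \<otimes> v2) \<otimes> x1 \<oplus> (u3 \<otimes> v1 \<ominus> u1 \<otimes> v3) \<otimes> x2 \<oplus> (u1 \<otimes> v2 \<ominus> u2 \<otimes> v1) \<otimes> x3) \<otimes> w1"
  using assms by algebra

definition rot :: "'a vec3 \<Rightarrow> 'a vec3" where "rot u = (fst (snd u), snd (snd u), fst u)"

lemma rdet_rot:
  assumes "u \<in> V3" "v \<in> V3" "w \<in> V3"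
  shows "rdet (rot u) (rot v) (rot w) = rdet u v w"
proof -
  obtain u1 u2 u3 v1 v2 v3 w1 w2 w3 where e: "u = (u1, u2, u3)" "v = (v1, v2, v3)" "w = (w1, w2, w3)"
    by (metis prod.exhaust)
  have c: "u1 \<in> carrier R" "u2 \<in> carrier R" "u3 \<in> carrier R" "v1 \<in> carrier R" "v2 \<in> carrier R" "v3 \<in> carrier R"
    "w1 \<in> carrier R" "w2 \<in> carrier R" "w3 \<in> carrier R"
    using assms by (auto simp: e V3_def)
  have "p \<oplus> q \<oplus> r = r \<oplus> p \<oplus> q" if "p \<in> carrier R" "q \<in> carrier R" "r \<in> carrier R" for p q r
    using that a_comm[of "p \<oplus> q" r] by (simp add: a_assoc)
  then show ?thesis using c by (simp add: e rdet_def rdot_def rcross_def rot_def)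
qed

lemma fst_cramer:
  assumes "u \<in> V3" "v \<in> V3" "w \<in> V3" "x \<in> V3"
  shows "rdet u v w \<otimes> fst x = rdet x v w \<otimes> fst u \<oplus> rdet u x w \<otimes> fst v \<oplus> rdet u v x \<otimes> fst w"
proof -
  obtain u1 u2 u3 v1 v2 v3 w1 w2 w3 x1 x2 x3 where e: "u = (u1, u2, u3)" "v = (v1, v2, v3)" "w = (w1, w2, w3)" "x = (x1, x2, x3)"
    by (metis prod.exhaust)
  have c: "u1 \<in> carrier R" "u2 \<in> carrier R" "u3 \<in> carrier R" "v1 \<in> carrier R" "v2 \<in> carrier R" "v3 \<in> carrier R"
    "w1 \<in> carrier R" "w2 \<in> carrier R" "w3 \<in> carrier R" "x1 \<in> carrier R" "x2 \<in> carrier R" "x3 \<in> carrier R"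
    using assms by (auto simp: e V3_def)
  show ?thesis unfolding e rdet_def rdot_def rcross_def fst_conv snd_conv by (rule cramer_component[OF c])
qed

lemma rvec_cramer:
  assumes "u \<in> V3" "v \<in> V3" "w \<in> V3" "x \<in> V3"
  shows "rscale (rdet u v w) x = rplus (rplus (rscale (rdet x v w) u) (rscale (rdet u x w) v)) (rscale (rdet u v x) w)"
proof -
  have r: "rot y \<in> V3" "fst (rot y) = fst (snd y)" "fst (snd (rot y)) = snd (snd y)" if "y \<in> V3" for y
    using that by (auto simp: rot_def V3_def)
  have "rdet u v w \<otimes> fst (snd x) = rdet x v w \<otimes> fst (snd u) \<oplus> rdet u x w \<otimes> fst (snd v) \<oplus> rdet u v x \<otimes> fst (snd w)"
    using fst_cramer[of "rot u" "rot v" "rot w" "rot x"] assms by (simp only: r rdet_rot)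
  moreover have "rdet u v w \<otimes> snd (snd x) = rdet x v w \<otimes> snd (snd u) \<oplus> rdet u x w \<otimes> snd (snd v) \<oplus> rdet u v x \<otimes> snd (snd w)"
    using fst_cramer[of "rot (rot u)" "rot (rot v)" "rot (rot w)" "rot (rot x)"] assms by (simp only: r rdet_rot)
  ultimately show ?thesis using fst_cramer[OF assms] by (simp only: rscale_def rplus_def fst_conv snd_conv)
qed

lemma rdot_cramer:
  assumes "u \<in> V3" "v \<in> V3" "w \<in> V3" "x \<in> V3" "a \<in> V3"
  shows "rdet u v w \<otimes> rdot a x = rdet x v w \<otimes> rdot a u \<oplus> rdet u x w \<otimes> rdot a v \<oplus> rdet u v x \<otimes> rdot a w"
proof -
  have "rdet u v w \<otimes> rdot a x = rdot a (rscale (rdet u v w) x)" using assms by (simp add: rdot_linear(1))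
  also have "\<dots> = rdot a (rplus (rplus (rscale (rdet x v w) u) (rscale (rdet u x w) v)) (rscale (rdet u v x) w))"
    by (rule arg_cong[OF rvec_cramer[OF assms(1-4)]])
  also have "\<dots> = rdet x v w \<otimes> rdot a u \<oplus> rdet u x w \<otimes> rdot a v \<oplus> rdet u v x \<otimes> rdot a w"
    using assms by (simp add: rdot_linear(1,2))
  finally show ?thesis .
qed

end

context field
begin

lemma rdot_zero3: "a \<in> V3 \<Longrightarrow> rdot a zero3 = \<zero>" "a \<in> V3 \<Longrightarrow> rdot zero3 a = \<zero>"
  by (auto simp: rvec_defs)

lemma rform_zero:
  assumes V: "u \<in> V3" "v \<in> V3" "w \<in> V3" "a \<in> V3"
    and d: "rdet u v w \<noteq> \<zero>" and z: "rdot a u = \<zero>" "rdot a v = \<zero>" "rdot a w = \<zero>"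
  shows "a = zero3"
proof -
  have "rdot a x = \<zero>" if "x \<in> V3" for x
  proof -
    have "rdet u v w \<otimes> rdot a x = \<zero>" unfolding rdot_cramer[OF V(1-3) that V(4)] z using V that by simp
    then show ?thesis using integral[of "rdet u v w" "rdot a x"] d V that by auto
  qed
  from this[of "(\<one>, \<zero>, \<zero>)"] this[of "(\<zero>, \<one>, \<zero>)"] this[of "(\<zero>, \<zero>, \<one>)"] show ?thesis
    using V(4) by (auto simp: rvec_defs)
qed

lemma rdot_nonzero_ex:
  assumes "a \<in> V3" "a \<noteq> zero3"
  shows "\<exists>x \<in> V3. rdot a x \<noteq> \<zero>"
proof (rule ccontr)
  assume n: "\<not> ?thesis"
  have "(\<one>, \<zero>, \<zero>) \<in> V3" "(\<zero>, \<one>, \<zero>) \<in> V3" "(\<zero>, \<zero>, \<one>) \<in> V3" by (auto simp: V3_def)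
  then have "rdot a (\<one>, \<zero>, \<zero>) = \<zero>" "rdot a (\<zero>, \<one>, \<zero>) = \<zero>" "rdot a (\<zero>, \<zero>, \<one>) = \<zero>" using n by auto
  then show False using assms by (auto simp: rvec_defs)
qed

definition span2 :: "'a vec3 \<Rightarrow> 'a vec3 \<Rightarrow> 'a vec3 set" where
  "span2 u v = {rplus (rscale a u) (rscale b v) | a b. a \<in> carrier R \<and> b \<in> carrier R}"

lemma span2I: "a \<in> carrier R \<Longrightarrow> b \<in> carrier R \<Longrightarrow> rplus (rscale a u) (rscale b v) \<in> span2 u v"
  unfolding span2_def by blast

definition kern :: "'a vec3 \<Rightarrow> 'a vec3 set" where
  "kern a = {x \<in> V3. rdot a x = \<zero>}"

lemma rscale_inv:
  assumes "c \<in> carrier R" "c \<noteq> \<zero>" "x \<in> V3"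
  shows "rscale (inv c) (rscale c x) = x"
proof -
  have c: "inv c \<in> carrier R" "inv c \<otimes> c = \<one>" using assms by (auto simp: field_Units)
  have "inv c \<otimes> (c \<otimes> y) = y" if "y \<in> carrier R" for y
    using that c assms by (simp flip: m_assoc)
  then show ?thesis using assms by (auto simp: rscale_def V3_def)
qed

lemma rscale_rplus:
  assumes "c \<in> carrier R" "a \<in> carrier R" "u \<in> V3" "v \<in> V3"
  shows "rscale c (rplus u v) = rplus (rscale c u) (rscale c v)" "rscale c (rscale a u) = rscale (c \<otimes> a) u"
  using assms by (auto simp: rvec_defs r_distr m_assoc)

text \<open>The bridge between lines as spans, as they are defined, and lines as zero sets of linear
  forms, as they are evaluated in Segre's lemma.\<close>

lemma kern_cross:
  assumes V: "u \<in> V3" "v \<in> V3" and n: "rcross u v \<noteq> zero3"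
  shows "kern (rcross u v) = span2 u v"
proof
  show "span2 u v \<subseteq> kern (rcross u v)"
    using V by (auto simp: span2_def kern_def rdot_linear rcross_orth)
  show "kern (rcross u v) \<subseteq> span2 u v"
  proof
    fix x assume "x \<in> kern (rcross u v)"
    then have x: "x \<in> V3" "rdet u v x = \<zero>" by (auto simp: kern_def rdet_def)
    obtain p where p: "p \<in> V3" "rdet u v p \<noteq> \<zero>" using rdot_nonzero_ex[OF _ n] V by (auto simp: rdet_def)
    define d where "d = rdet u v p"
    have d: "d \<in> carrier R" "d \<noteq> \<zero>" using p V by (auto simp: d_def)
    have di: "inv d \<in> carrier R" using d by (simp add: field_Units)
    have "rscale d x = rplus (rplus (rscale (rdet x v p) u) (rscale (rdet u x p) v)) (rscale (rdet u v x) p)"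
      unfolding d_def by (rule rvec_cramer[OF V p(1) x(1)])
    also have "\<dots> = rplus (rscale (rdet x v p) u) (rscale (rdet u x p) v)"
      unfolding x(2) using V p x by (auto simp: rvec_defs)
    finally have "rscale (inv d) (rscale d x) = rscale (inv d) (rplus (rscale (rdet x v p) u) (rscale (rdet u x p) v))" by simp
    then have "x = rscale (inv d) (rplus (rscale (rdet x v p) u) (rscale (rdet u x p) v))"
      by (simp only: rscale_inv[OF d x(1)])
    then have e: "x = rplus (rscale (inv d \<otimes> rdet x v p) u) (rscale (inv d \<otimes> rdet u x p) v)"
      using V p x di by (simp add: rscale_rplus)
    have "inv d \<otimes> rdet x v p \<in> carrier R" "inv d \<otimes> rdet u x p \<in> carrier R" using V p x di by simp_all
    from span2I[OF this, of u v] show "x \<in> span2 u v" by (simp only: e[symmetric])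
  qed
qed

lemma rcross_zero_parallel:
  assumes V: "u \<in> V3" "v \<in> V3" and z: "rcross u v = zero3" and u: "u \<noteq> zero3"
  shows "\<exists>c \<in> carrier R. v = rscale c u"
proof -
  obtain a b c x y z where e: "u = (a, b, c)" "v = (x, y, z)" by (metis prod.exhaust)
  have cc: "a \<in> carrier R" "b \<in> carrier R" "c \<in> carrier R" "x \<in> carrier R" "y \<in> carrier R" "z \<in> carrier R"
    using V by (auto simp: e V3_def)
  have r: "b \<otimes> z = c \<otimes> y" "c \<otimes> x = a \<otimes> z" "a \<otimes> y = b \<otimes> x"
    using z cc by (auto simp: e rvec_defs r_right_minus_eq)
  have di: "q = (p' \<otimes> inv p) \<otimes> q'" if "p \<in> carrier R" "p \<noteq> \<zero>" "q \<in> carrier R" "q' \<in> carrier R" "p' \<in> carrier R" "p \<otimes> q = p' \<otimes> q'" for p q p' q'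
  proof -
    have i: "inv p \<in> carrier R" "inv p \<otimes> p = \<one>" using that by (auto simp: field_Units)
    have "q = inv p \<otimes> (p \<otimes> q)" using i that(1,3) by (simp flip: m_assoc)
    also have "\<dots> = (p' \<otimes> inv p) \<otimes> q'" unfolding that(6) using i that by (simp add: m_ac)
    finally show ?thesis .
  qed
  have iv: "inv p \<in> carrier R" if "p \<in> carrier R" "p \<noteq> \<zero>" for p using that by (simp add: field_Units)
  consider "a \<noteq> \<zero>" | "b \<noteq> \<zero>" | "c \<noteq> \<zero>" using u by (auto simp: e zero3_def)
  then show ?thesis
  proof cases
    case 1
    then show ?thesis using di[of a x a x] di[of a y b x] di[of a z c x] r cc iv[of a]
      by (intro bexI[of _ "x \<otimes> inv a"]) (auto simp: e rscale_def m_comm)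
  next
    case 2
    then show ?thesis using di[of b y b y] di[of b x a y] di[of b z c y] r cc iv[of b]
      by (intro bexI[of _ "y \<otimes> inv b"]) (auto simp: e rscale_def m_comm)
  next
    case 3
    then show ?thesis using di[of c z c z] di[of c x a z] di[of c y b z] r cc iv[of c]
      by (intro bexI[of _ "z \<otimes> inv c"]) (auto simp: e rscale_def m_comm)
  qed
qed

end

section \<open>Counting odd secants of q + 2 points by weights\<close>

locale secant_system =
  fixes L :: "'l set" and S :: "'p set" and inc :: "'p \<Rightarrow> 'l \<Rightarrow> bool" and q :: nat
  assumes finL: "finite L" and finS: "finite S" and cardS: "card S = q + 2"
    and line_ex1: "P \<in> S \<Longrightarrow> Q \<in> S \<Longrightarrow> P \<noteq> Q \<Longrightarrow> \<exists>!l. l \<in> L \<and> inc P l \<and> inc Q l"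
    and lines_through: "P \<in> S \<Longrightarrow> card {l \<in> L. inc P l} = q + 1"
begin

definition line_deg :: "'l \<Rightarrow> nat" where "line_deg l = card {P \<in> S. inc P l}"
definition pencil :: "'p \<Rightarrow> 'l set" where "pencil P = {l \<in> L. inc P l}"
definition tangents :: "'p \<Rightarrow> 'l set" where "tangents P = {l \<in> L. inc P l \<and> line_deg l = 1}"
definition threes :: "'p \<Rightarrow> 'l set" where "threes P = {l \<in> L. inc P l \<and> line_deg l = 3}"
definition line_through :: "'p \<Rightarrow> 'p \<Rightarrow> 'l" where "line_through P Q = (THE l. l \<in> L \<and> inc P l \<and> inc Q l)"

lemma line_through:
  assumes "P \<in> S" "Q \<in> S" "P \<noteq> Q"
  shows "line_through P Q \<in> L" "inc P (line_through P Q)" "inc Q (line_through P Q)"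
  using theI'[OF line_ex1[OF assms]] unfolding line_through_def by auto

lemma line_through_unique: "P \<in> S \<Longrightarrow> Q \<in> S \<Longrightarrow> P \<noteq> Q \<Longrightarrow> l \<in> L \<Longrightarrow> inc P l \<Longrightarrow> inc Q l \<Longrightarrow> l = line_through P Q"
  unfolding line_through_def by (rule the1_equality[symmetric, OF line_ex1]) simp_all

lemma line_through_commute: "P \<in> S \<Longrightarrow> Q \<in> S \<Longrightarrow> P \<noteq> Q \<Longrightarrow> line_through P Q = line_through Q P"
  by (rule line_through_unique) (use line_through[of P Q] in auto)

lemma finite_sets [simp]: "finite (pencil P)" "finite (tangents P)" "finite (threes P)" "finite {P \<in> S. inc P l}"
  using finL finS by (auto simp: pencil_def tangents_def threes_def)

lemma deg_pos: "P \<in> S \<Longrightarrow> inc P l \<Longrightarrow> line_deg l \<ge> 1"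
  unfolding line_deg_def by (metis (mono_tags, lifting) One_nat_def Suc_leI card_gt_0_iff empty_iff finite_sets(4) mem_Collect_eq)

text \<open>The q + 1 other points of \<open>S\<close> are distributed over the q + 1 lines through
  \<open>P\<close>, each line receiving its degree minus 1.\<close>

lemma sum_deg:
  assumes P: "P \<in> S"
  shows "(\<Sum>l\<in>pencil P. int (line_deg l) - 2) = 0"
proof -
  have "\<exists>l \<in> pencil P. inc Q l" if "Q \<in> S - {P}" for Q
    using line_through[of P Q] P that by (intro bexI[of _ "line_through P Q"]) (auto simp: pencil_def)
  then have eq: "S - {P} = (\<Union>l\<in>pencil P. {Q \<in> S - {P}. inc Q l})" by auto
  have c1: "card (\<Union>l\<in>pencil P. {Q \<in> S - {P}. inc Q l}) = (\<Sum>l\<in>pencil P. card {Q \<in> S - {P}. inc Q l})"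
  proof (rule card_UN_disjoint)
    show "\<forall>l\<in>pencil P. \<forall>l'\<in>pencil P. l \<noteq> l' \<longrightarrow> {Q \<in> S - {P}. inc Q l} \<inter> {Q \<in> S - {P}. inc Q l'} = {}"
      using P line_through_unique[of P] unfolding pencil_def by blast
  qed (use finS in auto)
  have c2: "card {Q \<in> S - {P}. inc Q l} = line_deg l - 1" if "l \<in> pencil P" for l
  proof -
    have "{Q \<in> S - {P}. inc Q l} = {Q \<in> S. inc Q l} - {P}" by auto
    then show ?thesis using that P by (simp add: line_deg_def pencil_def)
  qed
  have "card (S - {P}) = (\<Sum>l\<in>pencil P. line_deg l - 1)"
    by (subst eq, subst c1) (rule sum.cong[OF refl c2])
  moreover have "card (S - {P}) = q + 1" using P cardS finS by simp
  ultimately have "int (q + 1) = (\<Sum>l\<in>pencil P. int (line_deg l - 1))" by (metis of_nat_sum)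
  also have "\<dots> = (\<Sum>l\<in>pencil P. int (line_deg l) - 1)"
    using deg_pos[OF P] by (intro sum.cong) (auto simp: pencil_def of_nat_diff)
  finally have "(\<Sum>l\<in>pencil P. (int (line_deg l) - 2) + 1) = int (q + 1)" by simp
  then have "(\<Sum>l\<in>pencil P. int (line_deg l) - 2) + int (card (pencil P)) = int (q + 1)" by (simp only: sum.distrib) simp
  then show ?thesis using lines_through[OF P] by (simp add: pencil_def)
qed

lemma tangents_eq:
  assumes P: "P \<in> S"
  shows "card (tangents P) = (\<Sum>l\<in>{l \<in> pencil P. line_deg l \<ge> 3}. line_deg l - 2)"
proof -
  have "pencil P = tangents P \<union> {l \<in> pencil P. line_deg l = 2} \<union> {l \<in> pencil P. line_deg l \<ge> 3}"
    using deg_pos[OF P] unfolding pencil_def tangents_def by fastforce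
  moreover have "(\<Sum>l\<in>tangents P \<union> {l \<in> pencil P. line_deg l = 2} \<union> {l \<in> pencil P. line_deg l \<ge> 3}. int (line_deg l) - 2) =
    (\<Sum>l\<in>tangents P. int (line_deg l) - 2) + (\<Sum>l\<in>{l \<in> pencil P. line_deg l = 2}. int (line_deg l) - 2) + (\<Sum>l\<in>{l \<in> pencil P. line_deg l \<ge> 3}. int (line_deg l) - 2)"
    by (subst sum.union_disjoint; (subst sum.union_disjoint)?) (auto simp: tangents_def finL)
  ultimately have "0 = (\<Sum>l\<in>tangents P. int (line_deg l) - 2) + (\<Sum>l\<in>{l \<in> pencil P. line_deg l = 2}. int (line_deg l) - 2) + (\<Sum>l\<in>{l \<in> pencil P. line_deg l \<ge> 3}. int (line_deg l) - 2)"
    using sum_deg[OF P] by simp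
  also have "(\<Sum>l\<in>tangents P. int (line_deg l) - 2) = - int (card (tangents P))" by (simp add: tangents_def)
  also have "(\<Sum>l\<in>{l \<in> pencil P. line_deg l \<ge> 3}. int (line_deg l) - 2) = int (\<Sum>l\<in>{l \<in> pencil P. line_deg l \<ge> 3}. line_deg l - 2)"
    unfolding of_nat_sum by (intro sum.cong) auto
  finally have "int (card (tangents P)) = int (\<Sum>l\<in>{l \<in> pencil P. line_deg l \<ge> 3}. line_deg l - 2)"
    by (simp del: of_nat_sum)
  then show ?thesis by (simp only: of_nat_eq_iff)
qed

lemma threes_le: "P \<in> S \<Longrightarrow> card (threes P) \<le> card (tangents P)"
proof -
  assume P: "P \<in> S"
  have "card (threes P) = (\<Sum>l\<in>threes P. line_deg l - 2)" by (simp add: threes_def)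
  also have "\<dots> \<le> (\<Sum>l\<in>{l \<in> pencil P. line_deg l \<ge> 3}. line_deg l - 2)"
    by (rule sum_mono2) (auto simp: threes_def pencil_def finL)
  finally show ?thesis using tangents_eq[OF P] by simp
qed

definition T :: "'p set" where "T = {P \<in> S. card (tangents P) = 1}"
definition nuclei :: "'p set" where "nuclei = {P \<in> S. card (tangents P) = 0}"

text \<open>By \<open>tangents_eq\<close> the excesses of the lines through \<open>P\<close> add up
  to 1, so just one line contributes, and it has degree 3.\<close>

lemma T_three:
  assumes "P \<in> T"
  obtains l where "threes P = {l}" "\<And>l'. l' \<in> pencil P \<Longrightarrow> line_deg l' \<ge> 3 \<Longrightarrow> l' = l"
proof -
  have P: "P \<in> S" and 1: "(\<Sum>l\<in>{l \<in> pencil P. line_deg l \<ge> 3}. line_deg l - 2) = 1"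
    using assms tangents_eq by (auto simp: T_def)
  let ?A = "{l \<in> pencil P. line_deg l \<ge> 3}"
  have "card ?A = (\<Sum>l\<in>?A. 1)" by simp
  also have "\<dots> \<le> (\<Sum>l\<in>?A. line_deg l - 2)" by (rule sum_mono) auto
  finally have "card ?A \<le> (\<Sum>l\<in>?A. line_deg l - 2)" .
  moreover have "?A \<noteq> {}" using 1 by force
  ultimately have "card ?A = 1" using 1 by (simp add: card_gt_0_iff Suc_leI le_antisym)
  then obtain l where l: "?A = {l}" by (rule card_1_singletonE)
  then have "line_deg l = 3" using 1 by simp
  have "threes P = {l' \<in> ?A. line_deg l' = 3}" by (auto simp: threes_def pencil_def)
  then have "threes P = {l}" unfolding l using \<open>line_deg l = 3\<close> by auto
  then show ?thesis using that l by blast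
qed

definition odd_lines :: "'l set" where "odd_lines = {l \<in> L. odd (line_deg l)}"

lemma card_by_points:
  assumes "k > 0"
  shows "k * card {l \<in> L. line_deg l = k} = (\<Sum>P\<in>S. card {l \<in> L. inc P l \<and> line_deg l = k})"
proof -
  have "(\<Sum>P\<in>S. card {l \<in> L. inc P l \<and> line_deg l = k}) = (\<Sum>P\<in>S. \<Sum>l\<in>{l \<in> L. line_deg l = k}. if inc P l then 1 else 0)"
  proof (rule sum.cong)
    fix P
    have "{l \<in> L. inc P l \<and> line_deg l = k} = {l \<in> {l \<in> L. line_deg l = k}. inc P l}" by auto
    then show "card {l \<in> L. inc P l \<and> line_deg l = k} = (\<Sum>l\<in>{l \<in> L. line_deg l = k}. if inc P l then 1 else 0)"
      using finL by (simp add: sum.If_cases Int_def)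
  qed simp
  also have "\<dots> = (\<Sum>l\<in>{l \<in> L. line_deg l = k}. \<Sum>P\<in>S. if inc P l then 1 else 0)" by (rule sum.swap)
  also have "\<dots> = (\<Sum>l\<in>{l \<in> L. line_deg l = k}. k)"
    using finS by (intro sum.cong) (auto simp: line_deg_def sum.If_cases Int_def)
  finally show ?thesis by simp
qed

text \<open>Only lines of degree 1 and 3 are counted; each 3-secant gives one third to each of its
  points.\<close>

lemma odd_lines_ge: "real (card odd_lines) \<ge> (\<Sum>P\<in>S. real (card (tangents P)) + real (card (threes P)) / 3)"
proof -
  have "card {l \<in> L. line_deg l = 1} = (\<Sum>P\<in>S. card (tangents P))"
    using card_by_points[of 1] by (simp add: tangents_def)
  moreover have "3 * card {l \<in> L. line_deg l = 3} = (\<Sum>P\<in>S. card (threes P))"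
    using card_by_points[of 3] by (simp add: threes_def)
  ultimately have "(\<Sum>P\<in>S. real (card (tangents P)) + real (card (threes P)) / 3) = real (card {l \<in> L. line_deg l = 1} + card {l \<in> L. line_deg l = 3})"
    by (simp add: sum.distrib flip: sum_divide_distrib of_nat_sum)
  also have "card {l \<in> L. line_deg l = 1} + card {l \<in> L. line_deg l = 3} = card ({l \<in> L. line_deg l = 1} \<union> {l \<in> L. line_deg l = 3})"
    by (rule card_Un_disjoint[symmetric]) (simp_all add: finL disjoint_iff)
  also have "\<dots> \<le> card odd_lines"
  proof (rule card_mono)
    show "finite odd_lines" by (simp add: odd_lines_def finL)
    show "{l \<in> L. line_deg l = 1} \<union> {l \<in> L. line_deg l = 3} \<subseteq> odd_lines"
    proof
      fix l assume "l \<in> {l \<in> L. line_deg l = 1} \<union> {l \<in> L. line_deg l = 3}"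
      then have "l \<in> L \<and> (line_deg l = 1 \<or> line_deg l = 3)" by blast
      then have "l \<in> L" "line_deg l = 1 \<or> line_deg l = 3" by simp_all
      then show "l \<in> odd_lines" unfolding odd_lines_def by (elim disjE) simp_all
    qed
  qed
  finally show ?thesis by simp
qed

definition special :: "'l set" where "special = {l \<in> L. line_deg l = 3 \<and> (\<exists>P\<in>T. inc P l)}"
text \<open>Disjointness within \<open>S\<close>; as lines of the plane they still meet, at points
  outside \<open>S\<close>.\<close>

definition disjoint_lines :: "'l set \<Rightarrow> bool" where
  "disjoint_lines M \<longleftrightarrow> (\<forall>l\<in>M. \<forall>l'\<in>M. l \<noteq> l' \<longrightarrow> (\<forall>P\<in>S. \<not> (inc P l \<and> inc P l')))"

text \<open>A largest disjoint family \<open>M\<close> covers a set \<open>Q\<close> of at most 3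
  |M| points. A point of \<open>T\<close> outside \<open>Q\<close> has weight 4/3 and its 3-secant
  meets \<open>Q\<close>; the weight of \<open>Q\<close> can give each such point the missing 2/3.
  So every point outside \<open>Q\<close> that is no nucleus accounts for 2 odd secants. At most two
  of the q + 2 points are nuclei, which leaves at least 2 q - 6 |M| odd secants.\<close>

lemma matching:
  assumes "card nuclei \<le> 2" and o: "real (card odd_lines) < 2 * real q - 6 * real m"
  shows "\<exists>M \<subseteq> special. card M \<ge> m \<and> disjoint_lines M"
proof -
  let ?\<M> = "{M. M \<subseteq> special \<and> disjoint_lines M}"
  have fs: "finite special" using finL by (auto simp: special_def)
  then have fM: "finite ?\<M>" by (rule rev_finite_subset[OF finite_Pow_iff[THEN iffD2]]) auto
  moreover have "{} \<in> ?\<M>" by (simp add: disjoint_lines_def)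
  ultimately have "Max (card ` ?\<M>) \<in> card ` ?\<M>" by (intro Max_in) auto
  then obtain M where M: "M \<subseteq> special" "disjoint_lines M" and MM: "card M = Max (card ` ?\<M>)" by auto
  have max: "card M' \<le> card M" if "M' \<subseteq> special" "disjoint_lines M'" for M'
    unfolding MM by (rule Max_ge) (use fM that in auto)
  have finM: "finite M" using M(1) fs by (rule finite_subset)
  define Q where "Q = (\<Union>l\<in>M. {P \<in> S. inc P l})"
  have finQ: "finite Q" and QS: "Q \<subseteq> S" using finM by (auto simp: Q_def)
  have "card Q \<le> (\<Sum>l\<in>M. card {P \<in> S. inc P l})" unfolding Q_def by (rule card_UN_le[OF finM])
  also have "\<dots> = (\<Sum>l\<in>M. 3)" using M(1) by (intro sum.cong) (auto simp: special_def line_deg_def)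
  finally have cQ: "card Q \<le> 3 * card M" by simp
  have TQ: "T - Q \<subseteq> (\<Union>P\<in>Q. \<Union>l\<in>threes P. {A \<in> S. inc A l} - {P})"
  proof
    fix A assume A: "A \<in> T - Q"
    then have AT: "A \<in> T" by simp
    obtain l where l: "threes A = {l}" using T_three[OF AT] by blast
    then have l': "l \<in> L" "inc A l" "line_deg l = 3" "l \<in> special" using AT by (auto simp: threes_def special_def)
    have "\<exists>P\<in>Q. inc P l"
    proof (rule ccontr)
      assume n: "\<not> ?thesis"
      have "l \<notin> M" using A l' by (auto simp: Q_def T_def)
      have "disjoint_lines (insert l M)" using M(2) n by (auto simp: disjoint_lines_def Q_def)
      then have "card (insert l M) \<le> card M" using max M(1) l' by auto
      then show False using \<open>l \<notin> M\<close> finM by simp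
    qed
    then obtain P where "P \<in> Q" "inc P l" by blast
    then show "A \<in> (\<Union>P\<in>Q. \<Union>l\<in>threes P. {A \<in> S. inc A l} - {P})"
      using A l' by (auto simp: threes_def T_def)
  qed
  have "card (T - Q) \<le> card (\<Union>P\<in>Q. \<Union>l\<in>threes P. {A \<in> S. inc A l} - {P})"
    by (rule card_mono[OF _ TQ]) (use finQ in auto)
  also have "\<dots> \<le> (\<Sum>P\<in>Q. card (\<Union>l\<in>threes P. {A \<in> S. inc A l} - {P}))" by (rule card_UN_le[OF finQ])
  also have "\<dots> \<le> (\<Sum>P\<in>Q. 2 * card (threes P))"
  proof (rule sum_mono)
    fix P assume "P \<in> Q"
    have "card (\<Union>l\<in>threes P. {A \<in> S. inc A l} - {P}) \<le> (\<Sum>l\<in>threes P. card ({A \<in> S. inc A l} - {P}))"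
      by (rule card_UN_le) simp
    also have "\<dots> = (\<Sum>l\<in>threes P. 2)"
      using \<open>P \<in> Q\<close> QS by (intro sum.cong) (auto simp: threes_def line_deg_def)
    finally show "card (\<Union>l\<in>threes P. {A \<in> S. inc A l} - {P}) \<le> 2 * card (threes P)" by simp
  qed
  finally have cT: "real (card (T - Q)) \<le> (\<Sum>P\<in>Q. 2 * real (card (threes P)))"
    by (metis (mono_tags, lifting) of_nat_le_iff of_nat_mult of_nat_numeral of_nat_sum sum.cong)
  define w where "w P = real (card (tangents P)) + real (card (threes P)) / 3" for P
  have wQ: "(\<Sum>P\<in>Q. w P) \<ge> 2 / 3 * real (card (T - Q))"
  proof -
    \<comment> \<open>A point of \<open>Q\<close> on k 3-secants lies on at least k tangents, so it
      has weight at least 4 k / 3; at most 2 k points of \<open>T\<close> are charged to it.\<close>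
    have "w P \<ge> 2 / 3 * (2 * real (card (threes P)))" if "P \<in> Q" for P
      using threes_le[of P] that QS by (auto simp: w_def)
    then have "(\<Sum>P\<in>Q. w P) \<ge> (\<Sum>P\<in>Q. 2 / 3 * (2 * real (card (threes P))))" by (rule sum_mono)
    also have "(\<Sum>P\<in>Q. 2 / 3 * (2 * real (card (threes P)))) = 2 / 3 * (\<Sum>P\<in>Q. 2 * real (card (threes P)))"
      by (rule sum_distrib_left[symmetric])
    finally show ?thesis using cT by linarith
  qed
  have wT: "w P = 4 / 3" if PT: "P \<in> T" for P
  proof -
    obtain l where "threes P = {l}" by (rule T_three[OF PT])
    then show ?thesis using PT by (simp add: w_def T_def)
  qed
  have w0: "w P \<ge> 0" for P by (simp add: w_def)
  have w2: "w P \<ge> 2" if "P \<in> S - T - nuclei" for P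
  proof -
    have "card (tangents P) \<noteq> 0" "card (tangents P) \<noteq> 1" using that by (auto simp: T_def nuclei_def)
    then have "card (tangents P) \<ge> 2" by linarith
    then show ?thesis by (simp add: w_def)
  qed
  let ?O = "S - T - nuclei - Q"
  have TS: "T \<subseteq> S" "nuclei \<subseteq> S" by (auto simp: T_def nuclei_def)
  have fin: "finite T" "finite nuclei" using finS TS finite_subset by blast+
  have "S \<subseteq> Q \<union> (T - Q) \<union> nuclei \<union> ?O" by auto
  then have "card S \<le> card (Q \<union> (T - Q) \<union> nuclei \<union> ?O)" using finS finQ fin by (intro card_mono) auto
  also have "\<dots> \<le> card Q + card (T - Q) + card nuclei + card ?O"
    by (meson card_Un_le add_le_mono le_refl le_trans)
  finally have cS: "q \<le> card Q + card (T - Q) + card ?O" using cardS assms(1) by simp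
  have "(\<Sum>P\<in>S. w P) \<ge> (\<Sum>P\<in>Q \<union> (T - Q) \<union> ?O. w P)"
    by (rule sum_mono2) (use finS QS TS w0 in auto)
  also have "(\<Sum>P\<in>Q \<union> (T - Q) \<union> ?O. w P) = (\<Sum>P\<in>Q. w P) + (\<Sum>P\<in>T - Q. w P) + (\<Sum>P\<in>?O. w P)"
    using finS finQ fin by (subst sum.union_disjoint; (subst sum.union_disjoint)?) auto
  finally have "(\<Sum>P\<in>S. w P) \<ge> (\<Sum>P\<in>Q. w P) + (\<Sum>P\<in>T - Q. w P) + (\<Sum>P\<in>?O. w P)" .
  moreover have "(\<Sum>P\<in>T - Q. w P) = 4 / 3 * real (card (T - Q))"
  proof -
    have "(\<Sum>P\<in>T - Q. w P) = (\<Sum>P\<in>T - Q. 4 / 3)" by (rule sum.cong) (auto simp: wT)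
    then show ?thesis by simp
  qed
  moreover have "(\<Sum>P\<in>?O. w P) \<ge> 2 * real (card ?O)"
    using sum_mono[of ?O "\<lambda>_. 2" w] w2 by force
  ultimately have "(\<Sum>P\<in>S. w P) \<ge> 2 * real (card (T - Q)) + 2 * real (card ?O)" using wQ by linarith
  then have "real (card odd_lines) \<ge> 2 * real (card (T - Q)) + 2 * real (card ?O)"
    using odd_lines_ge by (simp add: w_def)
  then have "2 * real q - 2 * real (card Q) \<le> real (card odd_lines)" using cS by linarith
  then have "6 * real m < 6 * real (card M)" using o cQ by linarith
  then show ?thesis using M by (intro exI[of _ M]) auto
qed

text \<open>Each point counted uses up 17 tangents. The bound 16 makes the degrees in the
  ultraproduct bounded, and for the r points above it 17 r < 2 q gives the inequality 6 r < q behind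
  \<open>odd_lines_large\<close>.\<close>

lemma low_points:
  assumes "card odd_lines < 2 * q"
  shows "17 * card {P \<in> S. card (tangents P) > 16} < 2 * q"
proof -
  have "17 * card {P \<in> S. card (tangents P) > 16} = (\<Sum>P\<in>{P \<in> S. card (tangents P) > 16}. 17)" by simp
  also have "\<dots> \<le> (\<Sum>P\<in>{P \<in> S. card (tangents P) > 16}. card (tangents P))" by (rule sum_mono) auto
  also have "\<dots> \<le> (\<Sum>P\<in>S. card (tangents P))" by (rule sum_mono2) (use finS in auto)
  also have "\<dots> = card {l \<in> L. line_deg l = 1}" using card_by_points[of 1] by (simp add: tangents_def)
  also have "\<dots> \<le> card odd_lines" using finL by (intro card_mono) (auto simp: odd_lines_def)
  finally show ?thesis using assms by simp
qed

text \<open>A transversal of the non-tangent lines through P; the remaining points of S list each line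
  of degree k through P exactly k - 2 times.\<close>

lemma surplus_exists:
  assumes P: "P \<in> S"
  shows "\<exists>U \<subseteq> S - {P}. card U = card (tangents P) \<and> bij_betw (line_through P) (S - {P} - U) (pencil P - tangents P)"
proof -
  have "line_through P ` (S - {P}) = pencil P - tangents P"
  proof (intro equalityI subsetI)
    fix l assume "l \<in> line_through P ` (S - {P})"
    then obtain Q where Q: "Q \<in> S" "Q \<noteq> P" "l = line_through P Q" by auto
    then have "{P, Q} \<subseteq> {P \<in> S. inc P l}" using P line_through[OF P Q(1)] by auto
    from card_mono[OF _ this] have "line_deg l \<ge> 2" using Q(2) unfolding line_deg_def by simp
    then show "l \<in> pencil P - tangents P" using line_through[OF P Q(1)] Q by (auto simp: pencil_def tangents_def)
  next
    fix l assume l: "l \<in> pencil P - tangents P"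
    then have "line_deg l \<noteq> 1" "line_deg l \<ge> 1" using deg_pos[OF P] by (auto simp: pencil_def tangents_def)
    then have "\<not> {Q \<in> S. inc Q l} \<subseteq> {P}" unfolding line_deg_def
      by (metis (no_types, lifting) One_nat_def card_1_singleton_iff card.empty not_one_le_zero subset_singletonD)
    then obtain Q where "Q \<in> S" "inc Q l" "Q \<noteq> P" by auto
    then show "l \<in> line_through P ` (S - {P})" using line_through_unique[OF P] l by (auto simp: pencil_def)
  qed
  then obtain Z where Z: "Z \<subseteq> S - {P}" "bij_betw (line_through P) Z (pencil P - tangents P)"
    by (metis subset_image_inj bij_betw_def order_refl)
  have "card Z = card (pencil P - tangents P)" using Z(2) by (rule bij_betw_same_card)
  also have "\<dots> = q + 1 - card (tangents P)"
    using lines_through[OF P] by (subst card_Diff_subset) (auto simp: tangents_def pencil_def finL)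
  finally have "card (S - {P} - Z) = card (S - {P}) - (q + 1 - card (tangents P))"
    using Z(1) finS by (simp add: card_Diff_subset finite_subset)
  moreover have "card (tangents P) \<le> q + 1"
    using lines_through[OF P] card_mono[of "pencil P" "tangents P"] by (auto simp: tangents_def pencil_def finL)
  ultimately have "card (S - {P} - Z) = card (tangents P)" using cardS P finS by simp
  moreover have "S - {P} - (S - {P} - Z) = Z" using Z(1) by auto
  ultimately show ?thesis using Z by (intro exI[of _ "S - {P} - Z"]) auto
qed

end

section \<open>Points, lines and linear forms over a finite field of odd order\<close>

locale fin_field = field R for R (structure) +
  assumes finR: "finite (carrier R)" and oddR: "odd (card (carrier R))"
begin

definition pt :: "'a vec3 \<Rightarrow> 'a vec3 set" where "pt u = {rscale a u | a. a \<in> carrier R}"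
definition rep :: "'a vec3 set \<Rightarrow> 'a vec3" where "rep P = (SOME u. u \<in> V3 \<and> u \<noteq> zero3 \<and> P = pt u)"
text \<open>The form of a line is determined only up to a factor; one is fixed so that values of the
  same line at different points can be compared.\<close>

definition lform :: "'a vec3 set \<Rightarrow> 'a vec3" where "lform l = (SOME a. a \<in> V3 \<and> a \<noteq> zero3 \<and> l = kern a)"

lemma pg2_points_conv: "pg2_points R = {pt u | u. u \<in> V3 \<and> u \<noteq> zero3}"
  unfolding pg2_points_def pt_def space3_conv by blast

lemma rep:
  assumes "P \<in> pg2_points R"
  shows "rep P \<in> V3" "rep P \<noteq> zero3" "P = pt (rep P)"
proof -
  have "\<exists>u. u \<in> V3 \<and> u \<noteq> zero3 \<and> P = pt u" using assms unfolding pg2_points_conv by blast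
  from someI_ex[OF this] show "rep P \<in> V3" "rep P \<noteq> zero3" "P = pt (rep P)" unfolding rep_def by blast+
qed

lemma minus_eq_0 [simp]: "x \<in> carrier R \<Longrightarrow> \<ominus> x = \<zero> \<longleftrightarrow> x = \<zero>"
  by (metis minus_minus minus_zero)

lemma invR: "p \<in> carrier R \<Longrightarrow> p \<noteq> \<zero> \<Longrightarrow> inv p \<in> carrier R" "p \<in> carrier R \<Longrightarrow> p \<noteq> \<zero> \<Longrightarrow> p \<otimes> inv p = \<one>"
  "p \<in> carrier R \<Longrightarrow> p \<noteq> \<zero> \<Longrightarrow> inv p \<otimes> p = \<one>" "p \<in> carrier R \<Longrightarrow> p \<noteq> \<zero> \<Longrightarrow> inv p \<noteq> \<zero>"
proof -
  show 1: "inv p \<in> carrier R" "p \<otimes> inv p = \<one>" "inv p \<otimes> p = \<one>" if "p \<in> carrier R" "p \<noteq> \<zero>" for p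
    using that by (auto simp: field_Units)
  show "inv p \<noteq> \<zero>" if "p \<in> carrier R" "p \<noteq> \<zero>" using 1[OF that] that by auto
qed

lemma pt_scale:
  assumes "c \<in> carrier R" "c \<noteq> \<zero>" "u \<in> V3"
  shows "pt (rscale c u) = pt u"
proof
  show "pt (rscale c u) \<subseteq> pt u"
    unfolding pt_def using assms by (auto simp: rscale_rplus)
  show "pt u \<subseteq> pt (rscale c u)"
  proof
    fix x assume "x \<in> pt u"
    then obtain a where a: "a \<in> carrier R" "x = rscale a u" unfolding pt_def by blast
    have "x = rscale (a \<otimes> inv c) (rscale c u)"
      using a assms invR[of c] by (simp add: rscale_rplus m_assoc)
    then show "x \<in> pt (rscale c u)" unfolding pt_def using a assms invR[of c] by blast
  qed
qed

lemma pt_kern: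
  assumes "u \<in> V3" "a \<in> V3" "rdot a u = \<zero>"
  shows "pt u \<subseteq> kern a"
proof
  fix x assume "x \<in> pt u"
  then obtain c where "c \<in> carrier R" "x = rscale c u" unfolding pt_def by blast
  then show "x \<in> kern a" using assms by (simp add: kern_def rdot_linear)
qed

lemma span2_mem:
  assumes "u \<in> V3" "v \<in> V3"
  shows "u \<in> span2 u v" "v \<in> span2 u v"
proof -
  have "rplus (rscale \<one> u) (rscale \<zero> v) = u" "rplus (rscale \<zero> u) (rscale \<one> v) = v"
    using assms by (auto simp: rvec_defs)
  then show "u \<in> span2 u v" "v \<in> span2 u v" using span2I[of \<one> \<zero> u v] span2I[of \<zero> \<one> u v] by simp_all
qed

lemma points_indep:
  assumes "P \<in> pg2_points R" "Q \<in> pg2_points R" "P \<noteq> Q"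
  shows "rcross (rep P) (rep Q) \<noteq> zero3"
proof
  assume "rcross (rep P) (rep Q) = zero3"
  then obtain c where c: "c \<in> carrier R" "rep Q = rscale c (rep P)"
    using rcross_zero_parallel rep[OF assms(1)] rep[OF assms(2)] by blast
  have "c \<noteq> \<zero>"
  proof
    assume "c = \<zero>"
    then have "rep Q = zero3" using c rep[OF assms(1)] by (auto simp: rvec_defs)
    then show False using rep[OF assms(2)] by simp
  qed
  then have "pt (rep Q) = pt (rep P)" using c pt_scale rep[OF assms(1)] by simp
  then show False using rep[OF assms(1)] rep[OF assms(2)] assms(3) by simp
qed

lemma line_ex: "l \<in> pg2_lines R \<Longrightarrow> \<exists>u v. u \<in> V3 \<and> v \<in> V3 \<and> rcross u v \<noteq> zero3 \<and> l = span2 u v"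
proof -
  assume "l \<in> pg2_lines R"
  then obtain u v where uv: "u \<in> V3" "v \<in> V3" "lin_indep2 R u v" "l = span2 u v"
    unfolding pg2_lines_def space3_conv span2_def by blast
  have li: "a = \<zero> \<and> b = \<zero>" if "a \<in> carrier R" "b \<in> carrier R" "rplus (rscale a u) (rscale b v) = zero3" for a b
    using uv(3) that unfolding lin_indep2_def space3_conv by blast
  have "rcross u v \<noteq> zero3"
  proof
    assume z: "rcross u v = zero3"
    have "u \<noteq> zero3"
    proof
      assume "u = zero3"
      then have "rplus (rscale \<one> u) (rscale \<zero> v) = zero3" using uv by (auto simp: rvec_defs)
      then show False using li[of \<one> \<zero>] by simp
    qed
    then obtain c where "c \<in> carrier R" "v = rscale c u" using rcross_zero_parallel z uv by blast
    then have "rplus (rscale c u) (rscale (\<ominus> \<one>) v) = zero3" using uv by (auto simp: rvec_defs l_minus r_neg)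
    then show False using li[of c "\<ominus> \<one>"] \<open>c \<in> carrier R\<close> by (metis a_inv_closed minus_minus minus_zero one_closed one_not_zero)
  qed
  then show ?thesis using uv by blast
qed

lemma lform:
  assumes "l \<in> pg2_lines R"
  shows "lform l \<in> V3" "lform l \<noteq> zero3" "l = kern (lform l)"
proof -
  obtain u v where "u \<in> V3" "v \<in> V3" "rcross u v \<noteq> zero3" "l = span2 u v" using line_ex[OF assms] by blast
  then have "rcross u v \<in> V3 \<and> rcross u v \<noteq> zero3 \<and> l = kern (rcross u v)" using kern_cross by simp
  then have "\<exists>a. a \<in> V3 \<and> a \<noteq> zero3 \<and> l = kern a" by blast
  from someI_ex[OF this] show "lform l \<in> V3" "lform l \<noteq> zero3" "l = kern (lform l)" unfolding lform_def by blast+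
qed

lemma span2_line:
  assumes V: "u \<in> V3" "v \<in> V3" and n: "rcross u v \<noteq> zero3"
  shows "span2 u v \<in> pg2_lines R"
proof -
  obtain p where p: "p \<in> V3" "rdet u v p \<noteq> \<zero>" using rdot_nonzero_ex[OF _ n] V by (auto simp: rdet_def)
  have "a = \<zero> \<and> b = \<zero>" if ab: "a \<in> carrier R" "b \<in> carrier R" "rplus (rscale a u) (rscale b v) = zero3" for a b
  proof -
    have "rdet u p v \<noteq> \<zero>" "rdet v p u \<noteq> \<zero>"
      using p V rdet_swap(3)[of u v p] rdet_swap(2)[of u v p] by simp_all
    moreover have "rdot (rcross u p) (rplus (rscale a u) (rscale b v)) = b \<otimes> rdet u p v"
      "rdot (rcross v p) (rplus (rscale a u) (rscale b v)) = a \<otimes> rdet v p u"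
      using V p ab(1,2) by (simp_all add: rdot_linear rcross_orth rdet_def)
    moreover have "rdot (rcross u p) zero3 = \<zero>" "rdot (rcross v p) zero3 = \<zero>" using V p by (simp_all add: rdot_zero3)
    ultimately show ?thesis using ab V p integral[of b "rdet u p v"] integral[of a "rdet v p u"] by auto
  qed
  then have "lin_indep2 R u v" unfolding lin_indep2_def space3_conv by blast
  then show ?thesis unfolding pg2_lines_def space3_conv span2_def using V by blast
qed

lemma line_unique:
  assumes l: "l \<in> pg2_lines R" and V: "u \<in> V3" "v \<in> V3" and n: "rcross u v \<noteq> zero3"
    and z: "rdot (lform l) u = \<zero>" "rdot (lform l) v = \<zero>"
  shows "l = span2 u v"
proof -
  note a = lform[OF l]
  have "kern (lform l) \<subseteq> kern (rcross u v)"
  proof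
    fix x assume "x \<in> kern (lform l)"
    then have x: "x \<in> V3" "rdot (lform l) x = \<zero>" by (auto simp: kern_def)
    have "rdet u v x = \<zero>" using rform_zero[OF V x(1) a(1) _ z x(2)] a(2) by blast
    then show "x \<in> kern (rcross u v)" using x by (simp add: kern_def rdet_def)
  qed
  moreover have "span2 u v \<subseteq> kern (lform l)"
    using V a(1) z by (auto simp: span2_def kern_def rdot_linear)
  ultimately show ?thesis using a(3) kern_cross[OF V n] by blast
qed

lemma inc_iff:
  assumes "P \<in> pg2_points R" "l \<in> pg2_lines R"
  shows "P \<subseteq> l \<longleftrightarrow> rdot (lform l) (rep P) = \<zero>"
proof -
  note p = rep[OF assms(1)] and a = lform[OF assms(2)]
  have "rep P \<in> pt (rep P)" unfolding pt_def using p by (auto intro!: exI[of _ \<one>] simp: rvec_defs)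
  then have "P \<subseteq> l \<Longrightarrow> rep P \<in> kern (lform l)" using p(3) a(3) by blast
  moreover have "P \<subseteq> l" if "rdot (lform l) (rep P) = \<zero>"
    by (rule ord_eq_le_trans[OF p(3) ord_le_eq_trans[OF pt_kern[OF p(1) a(1) that] a(3)[symmetric]]])
  ultimately show ?thesis by (auto simp: kern_def)
qed

lemma two_points_line:
  assumes "P \<in> pg2_points R" "Q \<in> pg2_points R" "P \<noteq> Q"
  shows "\<exists>!l. l \<in> pg2_lines R \<and> P \<subseteq> l \<and> Q \<subseteq> l"
proof (rule ex1I[of _ "span2 (rep P) (rep Q)"])
  note p = rep[OF assms(1)] and q = rep[OF assms(2)] and n = points_indep[OF assms]
  show "span2 (rep P) (rep Q) \<in> pg2_lines R \<and> P \<subseteq> span2 (rep P) (rep Q) \<and> Q \<subseteq> span2 (rep P) (rep Q)"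
  proof (intro conjI)
    show L: "span2 (rep P) (rep Q) \<in> pg2_lines R" by (rule span2_line[OF p(1) q(1) n])
    have "pt (rep P) \<subseteq> span2 (rep P) (rep Q)" "pt (rep Q) \<subseteq> span2 (rep P) (rep Q)"
      unfolding kern_cross[OF p(1) q(1) n, symmetric] using pt_kern[OF p(1), of "rcross (rep P) (rep Q)"] pt_kern[OF q(1), of "rcross (rep P) (rep Q)"]
        rcross_orth[OF p(1) q(1)] rvec_closed(2)[OF p(1) q(1)] by simp_all
    then show "P \<subseteq> span2 (rep P) (rep Q)" "Q \<subseteq> span2 (rep P) (rep Q)" by (simp_all only: p(3)[symmetric] q(3)[symmetric])
  qed
  show "l = span2 (rep P) (rep Q)" if "l \<in> pg2_lines R \<and> P \<subseteq> l \<and> Q \<subseteq> l" for l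
    using line_unique[OF _ p(1) q(1) n] inc_iff that assms by blast
qed

definition slope :: "'a vec3 \<Rightarrow> 'a vec3 \<Rightarrow> 'a vec3 set \<Rightarrow> 'a" where
  "slope b c l = rdot (lform l) c \<otimes> inv (rdot (lform l) b)"

text \<open>A form vanishing at \<open>p\<close> is determined up to a factor by its values at
  \<open>b\<close> and \<open>c\<close>, so their ratio determines the line. Every nonzero ratio
  occurs, on the line joining \<open>p\<close> to a suitable combination of \<open>b\<close> and
  \<open>c\<close>.\<close>

lemma slope_bij:
  assumes V: "p \<in> V3" "b \<in> V3" "c \<in> V3" and d: "rdet p b c \<noteq> \<zero>"
  shows "bij_betw (slope b c) {l \<in> pg2_lines R. rdot (lform l) p = \<zero> \<and> rdot (lform l) b \<noteq> \<zero> \<and> rdot (lform l) c \<noteq> \<zero>}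
    (carrier R - {\<zero>})"
proof -
  have pxn: "rcross p (rplus (rscale e b) (rscale f c)) \<noteq> zero3"
    if ef: "e \<in> carrier R" "f \<in> carrier R" "e \<noteq> \<zero>" for e f
  proof
    let ?x = "rplus (rscale e b) (rscale f c)"
    assume "rcross p ?x = zero3"
    then have "rdet p ?x c = \<zero>" using V by (simp add: rdet_def rdot_zero3)
    moreover have "rdet p ?x c = rdot (rcross c p) ?x" using rdet_swap(2)[of c p ?x] V ef by (simp add: rdet_def)
    moreover have "\<dots> = e \<otimes> rdet c p b" using V ef by (simp add: rdot_linear rcross_orth rdet_def)
    moreover have "rdet c p b = rdet p b c" using rdet_swap(2)[of c p b] V by simp
    ultimately show False using integral[of e "rdet p b c"] ef d V by auto
  qed
  show ?thesis
  proof (rule bij_betwI')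
    fix l l' assume "l \<in> {l \<in> pg2_lines R. rdot (lform l) p = \<zero> \<and> rdot (lform l) b \<noteq> \<zero> \<and> rdot (lform l) c \<noteq> \<zero>}"
      "l' \<in> {l \<in> pg2_lines R. rdot (lform l) p = \<zero> \<and> rdot (lform l) b \<noteq> \<zero> \<and> rdot (lform l) c \<noteq> \<zero>}"
    then have L: "l \<in> pg2_lines R" "rdot (lform l) p = \<zero>" "rdot (lform l) b \<noteq> \<zero>" "rdot (lform l) c \<noteq> \<zero>"
      and L': "l' \<in> pg2_lines R" "rdot (lform l') p = \<zero>" "rdot (lform l') b \<noteq> \<zero>" "rdot (lform l') c \<noteq> \<zero>" by auto
    define B C B' C' where "B = rdot (lform l) b" "C = rdot (lform l) c" "B' = rdot (lform l') b" "C' = rdot (lform l') c"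
    have cl: "B \<in> carrier R" "C \<in> carrier R" "B' \<in> carrier R" "C' \<in> carrier R" "B \<noteq> \<zero>" "C \<noteq> \<zero>" "B' \<noteq> \<zero>" "C' \<noteq> \<zero>"
      unfolding B_C_B'_C'_def using lform[OF L(1)] lform[OF L'(1)] V L L' by auto
    show "slope b c l = slope b c l' \<longleftrightarrow> l = l'"
    proof
      assume "slope b c l = slope b c l'"
      then have e: "C \<otimes> inv B = C' \<otimes> inv B'" by (simp add: slope_def B_C_B'_C'_def)
      have "C \<otimes> B' = (C \<otimes> inv B) \<otimes> (B \<otimes> B')" using cl invR[of B] by (simp add: m_ac)
      also have "\<dots> = C' \<otimes> B \<otimes> (inv B' \<otimes> B')" unfolding e using cl invR(1)[of B'] by (simp add: m_ac)
      also have "\<dots> = C' \<otimes> B" using cl invR[of B'] by simp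
      finally have e': "C \<otimes> B' = C' \<otimes> B" .
      let ?x = "rplus (rscale C b) (rscale (\<ominus> B) c)"
      have x: "?x \<in> V3" using V cl by simp
      have "rdot (lform l) ?x = \<zero>" "rdot (lform l') ?x = \<zero>"
        using V cl lform[OF L(1)] lform[OF L'(1)] e'
        by (simp_all add: rdot_linear B_C_B'_C'_def[symmetric] l_minus r_minus m_comm r_neg)
      then show "l = l'"
        using line_unique[OF L(1) V(1) x pxn L(2)] line_unique[OF L'(1) V(1) x pxn L'(2)] cl by simp
    qed simp
  next
    fix l assume "l \<in> {l \<in> pg2_lines R. rdot (lform l) p = \<zero> \<and> rdot (lform l) b \<noteq> \<zero> \<and> rdot (lform l) c \<noteq> \<zero>}"
    then have L: "l \<in> pg2_lines R" "rdot (lform l) b \<noteq> \<zero>" "rdot (lform l) c \<noteq> \<zero>" by auto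
    then show "slope b c l \<in> carrier R - {\<zero>}"
      unfolding slope_def using lform[OF L(1)] V invR[of "rdot (lform l) b"] integral[of "rdot (lform l) c" "inv (rdot (lform l) b)"] by auto
  next
    fix m assume "m \<in> carrier R - {\<zero>}"
    then have m: "m \<in> carrier R" "m \<noteq> \<zero>" by auto
    \<comment> \<open>A form vanishing at m b - c takes at \<open>c\<close> the value m times its
      value at \<open>b\<close>.\<close>
    let ?x = "rplus (rscale m b) (rscale (\<ominus> \<one>) c)"
    have x: "?x \<in> V3" using V m by simp
    define l where "l = span2 p ?x"
    have n: "rcross p ?x \<noteq> zero3" using pxn m by simp
    have l: "l \<in> pg2_lines R" unfolding l_def by (rule span2_line[OF V(1) x n])
    note a = lform[OF l]
    have "p \<in> span2 p ?x" by (rule span2_mem[OF V(1) x])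
    then have lp: "rdot (lform l) p = \<zero>" using a(3) unfolding l_def[symmetric] kern_def by blast
    have "?x \<in> span2 p ?x" by (rule span2_mem[OF V(1) x])
    then have "rdot (lform l) ?x = \<zero>" using a(3) unfolding l_def[symmetric] kern_def by blast
    then have e: "m \<otimes> rdot (lform l) b \<oplus> \<ominus> rdot (lform l) c = \<zero>" using V a m by (simp add: rdot_linear l_minus)
    then have e: "rdot (lform l) c = m \<otimes> rdot (lform l) b"
      using V a m by (metis m_closed minus_equality minus_minus rvec_closed(1) a_inv_closed)
    have b: "rdot (lform l) b \<noteq> \<zero>"
    proof
      assume z: "rdot (lform l) b = \<zero>"
      then have "rdot (lform l) c = \<zero>" using e m by simp
      then show False using rform_zero[OF V a(1) d lp z] a(2) by blast
    qed
    have "rdot (lform l) c \<noteq> \<zero>" unfolding e using integral[of m "rdot (lform l) b"] m b V a by auto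
    moreover have "m = slope b c l" unfolding slope_def e using b m V a invR[of "rdot (lform l) b"] by (simp add: m_assoc)
    ultimately show "\<exists>l\<in>{l \<in> pg2_lines R. rdot (lform l) p = \<zero> \<and> rdot (lform l) b \<noteq> \<zero> \<and> rdot (lform l) c \<noteq> \<zero>}. m = slope b c l"
      using l lp b by blast
  qed
qed

text \<open>The order of the additive group is odd and annihilates 1, whereas 1 + 1 = 0 would make
  every odd multiple of 1 equal to 1.\<close>

lemma one_neq_minus_one: "\<one> \<noteq> \<ominus> \<one>"
proof
  assume "\<one> = \<ominus> \<one>"
  then have two: "\<one> \<oplus> \<one> = \<zero>" using r_neg[of \<one>] by simp
  have "add_pow R (card (carrier R)) \<one> = \<zero>"
    using group.pow_order_eq_1[OF a_group, of \<one>] finR by (simp add: add_pow_def Coset.order_def)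
  moreover obtain k where k: "card (carrier R) = 2 * k + 1" using oddR by (auto elim: oddE)
  moreover have "add_pow R (2 * k + 1) \<one> = \<one>" for k :: nat
  proof (induction k)
    case (Suc k)
    have "add_pow R (2 * Suc k + 1) \<one> = add_pow R (2 * k + 1) \<one> \<oplus> \<one> \<oplus> \<one>" by (simp add: add.nat_pow_Suc)
    then show ?case using Suc two by (simp add: a_assoc)
  qed simp
  ultimately show False by simp
qed

lemma prod_inverse_closed:
  assumes "finite A" "A \<subseteq> carrier R - {\<zero>}" "\<And>x. x \<in> A \<Longrightarrow> inv x \<in> A \<and> inv x \<noteq> x"
  shows "finprod R (\<lambda>x. x) A = \<one>"
  using assms
proof (induction "card A" arbitrary: A rule: less_induct)
  case less
  show ?case
  proof (cases "A = {}")
    case False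
    then obtain x where x: "x \<in> A" by blast
    have xc: "x \<in> carrier R" "x \<noteq> \<zero>" and ix: "inv x \<in> A" "inv x \<noteq> x" "inv x \<in> carrier R" using x less.prems by auto
    have ii: "inv (inv y) = y" if "y \<in> carrier R" "y \<noteq> \<zero>" for y
      using comm_inv_char[of "inv y" y] invR[OF that] that by simp
    define B where "B = A - {x, inv x}"
    have B: "A = insert x (insert (inv x) B)" "x \<notin> insert (inv x) B" "inv x \<notin> B" using x ix by (auto simp: B_def)
    have fB: "finite B" using less.prems by (simp add: B_def)
    have "card B < card A" using less.prems(1) x by (intro psubset_card_mono) (auto simp: B_def)
    moreover have "inv y \<in> B \<and> inv y \<noteq> y" if "y \<in> B" for y
    proof -
      have y: "y \<in> A" "y \<noteq> x" "y \<noteq> inv x" "y \<in> carrier R" "y \<noteq> \<zero>" using that less.prems by (auto simp: B_def)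
      have "inv y \<noteq> x" "inv y \<noteq> inv x" using ii[OF y(4,5)] ii[OF xc] y by metis+
      then show ?thesis using less.prems(3)[OF y(1)] by (simp add: B_def)
    qed
    ultimately have "finprod R (\<lambda>x. x) B = \<one>" using less.prems fB by (intro less.hyps) (auto simp: B_def)
    moreover have "B \<subseteq> carrier R" using less.prems by (auto simp: B_def)
    ultimately show ?thesis using B fB xc ix invR[of x]
      by (subst B(1)) (simp add: Pi_def subset_iff flip: m_assoc)
  qed simp
qed

text \<open>Pairing elements with their inverses leaves only 1 and - 1, the roots of x^2 =
  1.\<close>

lemma wilson: "finprod R (\<lambda>x. x) (carrier R - {\<zero>}) = \<ominus> \<one>"
proof -
  define B where "B = carrier R - {\<zero>, \<one>, \<ominus> \<one>}"
  have m0: "\<ominus> \<one> \<noteq> \<zero>" using one_not_zero minus_minus[of \<one>] minus_zero by (metis one_closed)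
  have "inv x \<in> B \<and> inv x \<noteq> x" if "x \<in> B" for x
  proof -
    have x: "x \<in> carrier R" "x \<noteq> \<zero>" "x \<noteq> \<one>" "x \<noteq> \<ominus> \<one>" using that by (auto simp: B_def)
    note i = invR[OF x(1,2)]
    have "inv x \<noteq> \<one>" using i(2) x by (metis r_one)
    moreover have "inv x \<noteq> \<ominus> \<one>"
    proof
      assume "inv x = \<ominus> \<one>"
      then have "\<ominus> x = \<one>" using i(2) x by (simp add: r_minus)
      then show False using x minus_minus[of x] by simp
    qed
    moreover have "inv x \<noteq> x"
    proof
      assume "inv x = x"
      then have e: "x \<otimes> x = \<one>" using i by simp
      have "(x \<ominus> \<one>) \<otimes> (x \<oplus> \<one>) = x \<otimes> x \<ominus> \<one>" using x by algebra
      then have "(x \<ominus> \<one>) \<otimes> (x \<oplus> \<one>) = \<zero>" using e by (simp add: minus_eq r_neg)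
      then have "x \<ominus> \<one> = \<zero> \<or> x \<oplus> \<one> = \<zero>" using integral[of "x \<ominus> \<one>" "x \<oplus> \<one>"] x by simp
      then show False using x minus_equality[of x \<one>] by (auto simp: r_right_minus_eq)
    qed
    ultimately show ?thesis using i by (auto simp: B_def)
  qed
  then have "finprod R (\<lambda>x. x) B = \<one>" using finR by (intro prod_inverse_closed) (auto simp: B_def)
  moreover have "carrier R - {\<zero>} = insert \<one> (insert (\<ominus> \<one>) B)" using m0 by (auto simp: B_def)
  moreover have "\<one> \<notin> insert (\<ominus> \<one>) B" "\<ominus> \<one> \<notin> B" "B \<subseteq> carrier R" "finite B" using one_neq_minus_one finR by (auto simp: B_def)
  ultimately show ?thesis by (simp add: Pi_def subset_iff)
qed

text \<open>The q - 1 lines of \<open>slope_bij\<close>, together with the lines to the two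
  auxiliary points \<open>b\<close> and \<open>c\<close>.\<close>

lemma card_lines_through:
  assumes "P \<in> pg2_points R"
  shows "card {l \<in> pg2_lines R. P \<subseteq> l} = card (carrier R) + 1"
proof -
  note p = rep[OF assms]
  obtain b where b: "b \<in> V3" "rcross (rep P) b \<noteq> zero3"
  proof -
    obtain x y z where e: "rep P = (x, y, z)" "x \<in> carrier R" "y \<in> carrier R" "z \<in> carrier R" using p by (auto simp: V3_def)
    consider "x \<noteq> \<zero>" | "y \<noteq> \<zero>" | "z \<noteq> \<zero>" using p e by (auto simp: zero3_def)
    then show ?thesis
    proof cases
      case 1
      then show ?thesis using that[of "(\<zero>, \<one>, \<zero>)"] e by (auto simp: rvec_defs minus_eq)
    next
      case 2
      then show ?thesis using that[of "(\<zero>, \<zero>, \<one>)"] e by (auto simp: rvec_defs minus_eq)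
    next
      case 3
      then show ?thesis using that[of "(\<one>, \<zero>, \<zero>)"] e by (auto simp: rvec_defs minus_eq)
    qed
  qed
  obtain c where c: "c \<in> V3" "rdet (rep P) b c \<noteq> \<zero>" using rdot_nonzero_ex[OF _ b(2)] p b by (auto simp: rdet_def)
  have n: "rcross (rep P) c \<noteq> zero3"
  proof
    assume "rcross (rep P) c = zero3"
    then have "rdet (rep P) c b = \<zero>" using b by (simp add: rdet_def rdot_zero3)
    then show False using c rdet_swap(3)[of "rep P" b c] p b by simp
  qed
  define l1 where "l1 = span2 (rep P) b"
  define l2 where "l2 = span2 (rep P) c"
  define A where "A = {l \<in> pg2_lines R. rdot (lform l) (rep P) = \<zero> \<and> rdot (lform l) b \<noteq> \<zero> \<and> rdot (lform l) c \<noteq> \<zero>}"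
  have L: "l1 \<in> pg2_lines R" "l2 \<in> pg2_lines R" unfolding l1_def l2_def using span2_line p b c n by auto
  have z: "rdot (lform l1) (rep P) = \<zero>" "rdot (lform l1) b = \<zero>" "rdot (lform l2) (rep P) = \<zero>" "rdot (lform l2) c = \<zero>"
    using span2_mem[of "rep P" b] span2_mem[of "rep P" c] p b c lform(3)[OF L(1)] lform(3)[OF L(2)] unfolding l1_def[symmetric] l2_def[symmetric]
    by (auto simp: kern_def)
  have "l1 \<noteq> l2"
    using rform_zero[OF p(1) b(1) c(1) lform(1)[OF L(1)] c(2) z(1,2)] lform(2)[OF L(1)] z by auto
  have "{l \<in> pg2_lines R. P \<subseteq> l} = insert l1 (insert l2 A)"
  proof (intro equalityI subsetI)
    fix l assume "l \<in> {l \<in> pg2_lines R. P \<subseteq> l}"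
    then have l: "l \<in> pg2_lines R" "rdot (lform l) (rep P) = \<zero>" using inc_iff assms by auto
    show "l \<in> insert l1 (insert l2 A)"
      using line_unique[OF l(1) p(1) b(1) b(2) l(2)] line_unique[OF l(1) p(1) c(1) n l(2)] l
      by (auto simp: A_def l1_def l2_def)
  next
    fix l assume "l \<in> insert l1 (insert l2 A)"
    then show "l \<in> {l \<in> pg2_lines R. P \<subseteq> l}" using L z inc_iff[OF assms] by (auto simp: A_def)
  qed
  moreover have "card A = card (carrier R - {\<zero>})"
    using slope_bij[OF p(1) b(1) c(1) c(2)] unfolding A_def by (rule bij_betw_same_card)
  moreover have "finite A"
    using slope_bij[OF p(1) b(1) c(1) c(2)] finR bij_betw_finite unfolding A_def by blast
  moreover have "l1 \<notin> A" "l2 \<notin> A" using z by (auto simp: A_def)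
  moreover have "card (carrier R) > 0" using finR zero_closed card_gt_0_iff by blast
  ultimately show ?thesis using \<open>l1 \<noteq> l2\<close> finR by simp
qed

lemma finite_lines: "finite (pg2_lines R)"
proof -
  have "l \<subseteq> V3" if "l \<in> pg2_lines R" for l by (subst lform(3)[OF that]) (simp add: kern_def)
  then have "pg2_lines R \<subseteq> Pow V3" by blast
  moreover have "finite V3" using finR by (simp add: V3_def)
  ultimately show ?thesis using finite_subset by blast
qed

lemma secant_system:
  assumes "S \<subseteq> pg2_points R" "card S = card (carrier R) + 2"
  shows "secant_system (pg2_lines R) S (\<subseteq>) (card (carrier R))"
proof
  show "finite S" by (rule card_ge_0_finite) (simp add: assms(2))
  show "\<exists>!l. l \<in> pg2_lines R \<and> P \<subseteq> l \<and> Q \<subseteq> l" if "P \<in> S" "Q \<in> S" "P \<noteq> Q" for P Q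
    by (rule two_points_line) (use assms that in auto)
  show "card {l \<in> pg2_lines R. P \<subseteq> l} = card (carrier R) + 1" if "P \<in> S" for P
    by (rule card_lines_through) (use assms that in auto)
qed (use assms finite_lines in auto)

end

section \<open>Segre's lemma of tangents with surplus points\<close>

lemma (in domain) finprod_nonzero:
  assumes "finite A" "\<And>y. y \<in> A \<Longrightarrow> f y \<in> carrier R \<and> f y \<noteq> \<zero>"
  shows "finprod R f A \<noteq> \<zero>"
  using assms
proof (induction A rule: finite_induct)
  case (insert a A)
  then have "f \<in> A \<rightarrow> carrier R" "f a \<in> carrier R" "f a \<noteq> \<zero>" "finprod R f A \<noteq> \<zero>" by auto
  then show ?case using insert(1,2) integral[of "f a" "finprod R f A"] by auto
qed simp

lemma (in cring) finprod_minus: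
  assumes "finite A" "f \<in> A \<rightarrow> carrier R"
  shows "finprod R (\<lambda>y. \<ominus> f y) A = (if even (card A) then finprod R f A else \<ominus> finprod R f A)"
  using assms
proof (induction A rule: finite_induct)
  case (insert a A)
  then have c: "f \<in> A \<rightarrow> carrier R" "f a \<in> carrier R" "(\<lambda>y. \<ominus> f y) \<in> A \<rightarrow> carrier R" by auto
  then show ?case using insert by (simp add: l_minus r_minus)
qed simp

lemma (in domain) cancel_minus:
  assumes "n1 \<in> carrier R" "n2 \<in> carrier R" "d1 \<in> carrier R" "d2 \<in> carrier R" "p1 \<in> carrier R" "p2 \<in> carrier R"
    "e1 \<in> carrier R" "e2 \<in> carrier R" and nz: "p2 \<noteq> \<zero>"
    and 1: "n2 \<otimes> p2 = \<ominus> (n1 \<otimes> p1)" and 2: "(d2 \<otimes> p2) \<otimes> e1 = (d1 \<otimes> p1) \<otimes> e2"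
  shows "n2 \<otimes> d1 \<otimes> e2 = \<ominus> (n1 \<otimes> d2 \<otimes> e1)"
proof -
  have "p2 \<otimes> (n2 \<otimes> d1 \<otimes> e2) = (n2 \<otimes> p2) \<otimes> (d1 \<otimes> e2)" using assms(1-8) by (simp add: m_ac)
  also have "\<dots> = \<ominus> (n1 \<otimes> ((d1 \<otimes> p1) \<otimes> e2))" unfolding 1 using assms(1-8) by (simp add: m_ac l_minus r_minus)
  also have "\<dots> = p2 \<otimes> (\<ominus> (n1 \<otimes> d2 \<otimes> e1))" unfolding 2[symmetric] using assms(1-8) by (simp add: m_ac r_minus)
  finally show ?thesis using m_lcancel[OF nz] assms(1-8) by simp
qed

lemma (in domain) cancel_cycle:
  assumes c: "x1 \<in> carrier R" "x2 \<in> carrier R" "x3 \<in> carrier R" "y1 \<in> carrier R" "y2 \<in> carrier R" "y3 \<in> carrier R"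
    "ea \<in> carrier R" "eb \<in> carrier R" "ec \<in> carrier R" and nz: "ea \<noteq> \<zero>" "eb \<noteq> \<zero>" "ec \<noteq> \<zero>"
    and 1: "x1 \<otimes> eb = \<ominus> (y1 \<otimes> ec)" and 2: "x2 \<otimes> ec = \<ominus> (y2 \<otimes> ea)" and 3: "x3 \<otimes> ea = \<ominus> (y3 \<otimes> eb)"
  shows "x1 \<otimes> x2 \<otimes> x3 = \<ominus> (y1 \<otimes> y2 \<otimes> y3)"
proof -
  have "(ea \<otimes> eb \<otimes> ec) \<otimes> (x1 \<otimes> x2 \<otimes> x3) = (x1 \<otimes> eb) \<otimes> (x2 \<otimes> ec) \<otimes> (x3 \<otimes> ea)" using c by (simp add: m_ac)
  also have "\<dots> = (ea \<otimes> eb \<otimes> ec) \<otimes> (\<ominus> (y1 \<otimes> y2 \<otimes> y3))" unfolding 1 2 3 using c by (simp add: m_ac l_minus r_minus)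
  finally have e: "(ea \<otimes> eb \<otimes> ec) \<otimes> (x1 \<otimes> x2 \<otimes> x3) = (ea \<otimes> eb \<otimes> ec) \<otimes> (\<ominus> (y1 \<otimes> y2 \<otimes> y3))" .
  have "ea \<otimes> eb \<otimes> ec \<noteq> \<zero>" using nz c integral[of "ea \<otimes> eb" ec] integral[of ea eb] by auto
  then show ?thesis using e m_lcancel[of "ea \<otimes> eb \<otimes> ec" "x1 \<otimes> x2 \<otimes> x3" "\<ominus> (y1 \<otimes> y2 \<otimes> y3)"] c by simp
qed

locale segre = fin_field +
  fixes S
  assumes SP: "S \<subseteq> pg2_points R" and cS: "card S = card (carrier R) + 2"

sublocale segre \<subseteq> secant_system "pg2_lines R" S "(\<subseteq>)" "card (carrier R)"
  by (rule secant_system[OF SP cS])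

context segre
begin

definition lval :: "'a vec3 set \<Rightarrow> 'a vec3 set \<Rightarrow> 'a" where "lval l P = rdot (lform l) (rep P)"

lemma repS: "P \<in> S \<Longrightarrow> rep P \<in> V3" "P \<in> S \<Longrightarrow> rep P \<noteq> zero3"
  and pt_repS: "P \<in> S \<Longrightarrow> pt (rep P) = P"
  using rep SP by blast+

lemma lval_0: "P \<in> S \<Longrightarrow> l \<in> pg2_lines R \<Longrightarrow> lval l P = \<zero> \<longleftrightarrow> P \<subseteq> l"
  using inc_iff SP unfolding lval_def by blast

lemma lval_closed [simp]: "P \<in> S \<Longrightarrow> l \<in> pg2_lines R \<Longrightarrow> lval l P \<in> carrier R"
  unfolding lval_def using lform(1) repS by simp

definition U :: "'a vec3 set \<Rightarrow> 'a vec3 set set" where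
  "U P = (SOME U. U \<subseteq> S - {P} \<and> card U = card (tangents P) \<and>
    bij_betw (line_through P) (S - {P} - U) (pencil P - tangents P))"

lemma U:
  assumes "P \<in> S"
  shows "U P \<subseteq> S - {P}" "card (U P) = card (tangents P)"
    "bij_betw (line_through P) (S - {P} - U P) (pencil P - tangents P)"
  using someI_ex[OF surplus_exists[OF assms]] unfolding U_def by blast+

lemma U_surj:
  assumes "P \<in> S" "l \<in> pencil P" "l \<notin> tangents P"
  shows "\<exists>Z. Z \<in> S \<and> Z \<noteq> P \<and> Z \<notin> U P \<and> l = line_through P Z"
proof -
  have "l \<in> line_through P ` (S - {P} - U P)"
    unfolding bij_betw_imp_surj_on[OF U(3)[OF assms(1)]] using assms by simp
  then show ?thesis by (elim imageE) auto
qed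

lemma finite_U: "P \<in> S \<Longrightarrow> finite (U P)"
  by (rule finite_subset[OF U(1)]) (use finS in auto)

definition bis :: "'a vec3 set \<Rightarrow> 'a vec3 set \<Rightarrow> bool" where
  "bis P Q \<longleftrightarrow> P \<in> S \<and> Q \<in> S \<and> P \<noteq> Q \<and> line_deg (line_through P Q) = 2"

lemma bis_sym: "bis P Q \<Longrightarrow> bis Q P"
  unfolding bis_def using line_through_commute by metis

lemma bis_only:
  assumes "bis P Q" "Y \<in> S" "Y \<subseteq> line_through P Q"
  shows "Y = P \<or> Y = Q"
proof -
  have b: "P \<in> S" "Q \<in> S" "P \<noteq> Q" "card {Z \<in> S. Z \<subseteq> line_through P Q} = 2"
    using assms(1) by (auto simp: bis_def line_deg_def)
  have "{P, Q} = {Z \<in> S. Z \<subseteq> line_through P Q}"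
    by (rule card_seteq) (use b line_through[OF b(1-3)] finS in auto)
  then show ?thesis using assms by blast
qed

text \<open>The transversal meets the line of \<open>P\<close> and \<open>Q\<close>, and
  \<open>Q\<close> is the only point of \<open>S\<close> on it besides \<open>P\<close>.\<close>

lemma bis_notin_U:
  assumes "bis P Q"
  shows "Q \<notin> U P"
proof
  assume "Q \<in> U P"
  have b: "P \<in> S" "Q \<in> S" "P \<noteq> Q" "line_deg (line_through P Q) = 2" using assms by (auto simp: bis_def)
  note j = line_through[OF b(1-3)]
  have "line_through P Q \<in> pencil P" "line_through P Q \<notin> tangents P" using j b by (simp_all add: pencil_def tangents_def)
  from U_surj[OF b(1) this] obtain Z where Z: "Z \<in> S" "Z \<noteq> P" "Z \<notin> U P" "line_through P Q = line_through P Z" by (elim exE conjE)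
  have "Z \<subseteq> line_through P Q" unfolding Z(4) by (rule line_through(3)[OF b(1) Z(1) Z(2)[symmetric]])
  from bis_only[OF assms Z(1) this] show False using Z(2,3) \<open>Q \<in> U P\<close> by auto
qed

lemma tangent_val:
  assumes "P \<in> S" "Q \<in> S" "P \<noteq> Q" "l \<in> tangents P"
  shows "lval l Q \<noteq> \<zero>"
proof
  assume "lval l Q = \<zero>"
  then have "Q \<subseteq> l" "P \<subseteq> l" "card {Z \<in> S. Z \<subseteq> l} = 1" using assms lval_0 by (auto simp: tangents_def line_deg_def)
  moreover have "card {P, Q} \<le> card {Z \<in> S. Z \<subseteq> l}" by (rule card_mono) (use finS calculation assms in auto)
  ultimately show False using assms by simp
qed

lemma line_val:
  assumes "bis P Q" "Y \<in> S" "Y \<noteq> P" "Y \<noteq> Q"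
  shows "lval (line_through P Y) Q \<noteq> \<zero>"
proof
  assume z: "lval (line_through P Y) Q = \<zero>"
  have b: "P \<in> S" "Q \<in> S" "P \<noteq> Q" using assms by (auto simp: bis_def)
  note j = line_through[OF b(1) assms(2) assms(3)[symmetric]]
  have "Q \<subseteq> line_through P Y" using z lval_0 b j by blast
  then have "line_through P Y = line_through P Q" using line_through_unique[OF b j(1,2)] by blast
  then show False using bis_only[OF assms(1,2)] j(3) assms(3,4) by auto
qed

text \<open>\<open>N\<close> is the product of tangents in Segre's lemma for arcs. When lines
  through \<open>P\<close> contain several further points, \<open>D\<close> corrects the count: each
  surplus point contributes its line through \<open>P\<close>.\<close>

definition N :: "'a vec3 set \<Rightarrow> 'a vec3 set \<Rightarrow> 'a" where "N P Q = finprod R (\<lambda>l. lval l Q) (tangents P)"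
definition D :: "'a vec3 set \<Rightarrow> 'a vec3 set \<Rightarrow> 'a" where "D P Q = finprod R (\<lambda>Y. lval (line_through P Y) Q) (U P)"
definition E :: "'a vec3 set \<Rightarrow> 'a vec3 set \<Rightarrow> 'a vec3 set set \<Rightarrow> 'a" where
  "E P Q W = finprod R (\<lambda>Y. rdet (rep P) (rep Q) (rep Y)) W"

lemma tangents_lines: "l \<in> tangents P \<Longrightarrow> l \<in> pg2_lines R"
  by (simp add: tangents_def)

lemma U_lines: "P \<in> S \<Longrightarrow> Y \<in> U P \<Longrightarrow> line_through P Y \<in> pg2_lines R"
  using U(1)[of P] line_through(1)[of P Y] by blast

lemma ND_closed [simp]: "Q \<in> S \<Longrightarrow> N P Q \<in> carrier R" "P \<in> S \<Longrightarrow> Q \<in> S \<Longrightarrow> D P Q \<in> carrier R"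
  unfolding N_def D_def using tangents_lines U_lines by (auto intro!: finprod_closed)

lemma N_nz: "P \<in> S \<Longrightarrow> Q \<in> S \<Longrightarrow> P \<noteq> Q \<Longrightarrow> N P Q \<noteq> \<zero>"
  unfolding N_def by (rule finprod_nonzero) (use tangent_val tangents_lines in auto)

lemma U_val:
  assumes "bis P Q" "Y \<in> U P"
  shows "lval (line_through P Y) Q \<noteq> \<zero>"
proof (rule line_val[OF assms(1)])
  have "P \<in> S" using assms by (simp add: bis_def)
  then show "Y \<in> S" "Y \<noteq> P" using U(1)[of P] assms by auto
  show "Y \<noteq> Q" using bis_notin_U[OF assms(1)] assms(2) by auto
qed

lemma D_nz: "bis P Q \<Longrightarrow> D P Q \<noteq> \<zero>"
  unfolding D_def by (rule finprod_nonzero) (use finite_U U_val U_lines in \<open>auto simp: bis_def\<close>)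

lemma det_nz:
  assumes "P \<in> S" "Q \<in> S" "Y \<in> S" "P \<noteq> Q" "\<not> Y \<subseteq> line_through P Q"
  shows "rdet (rep P) (rep Q) (rep Y) \<noteq> \<zero>"
proof
  assume z: "rdet (rep P) (rep Q) (rep Y) = \<zero>"
  have PQ: "P \<in> pg2_points R" "Q \<in> pg2_points R" using assms SP by auto
  note j = line_through[OF assms(1,2,4)] and n = points_indep[OF PQ assms(4)]
  have "line_through P Q = span2 (rep P) (rep Q)"
    by (rule line_unique[OF j(1) repS(1)[OF assms(1)] repS(1)[OF assms(2)] n])
      (use inc_iff[OF PQ(1) j(1)] inc_iff[OF PQ(2) j(1)] j in auto)
  also have "\<dots> = kern (rcross (rep P) (rep Q))" using kern_cross[OF _ _ n] repS assms by simp
  finally have "pt (rep Y) \<subseteq> line_through P Q" using pt_kern[of "rep Y"] z repS assms by (simp add: rdet_def)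
  then show False using assms(5) by (simp only: pt_repS[OF assms(3)])
qed

lemma E_closed [simp]: "P \<in> S \<Longrightarrow> Q \<in> S \<Longrightarrow> W \<subseteq> S \<Longrightarrow> E P Q W \<in> carrier R"
  unfolding E_def using repS by (auto intro!: finprod_closed)

lemma E_nz:
  assumes "bis P Q" "W \<subseteq> S - {P, Q}"
  shows "E P Q W \<noteq> \<zero>"
  unfolding E_def
proof (rule finprod_nonzero)
  have b: "P \<in> S" "Q \<in> S" "P \<noteq> Q" using assms by (auto simp: bis_def)
  show "finite W" using assms finS finite_subset by blast
  fix Y assume "Y \<in> W"
  then have Y: "Y \<in> S" "Y \<noteq> P" "Y \<noteq> Q" using assms by auto
  then have "\<not> Y \<subseteq> line_through P Q" using bis_only[OF assms(1)] by auto
  then show "rdet (rep P) (rep Q) (rep Y) \<in> carrier R \<and> rdet (rep P) (rep Q) (rep Y) \<noteq> \<zero>"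
    using det_nz b Y repS by simp
qed

lemma E_sym:
  assumes "P \<in> S" "Q \<in> S" "W \<subseteq> S" "even (card W)"
  shows "E P Q W = E Q P W"
proof -
  have f: "finite W" using assms finS finite_subset by blast
  have c: "(\<lambda>Y. rdet (rep Q) (rep P) (rep Y)) \<in> W \<rightarrow> carrier R" using assms repS by auto
  have "E P Q W = finprod R (\<lambda>Y. \<ominus> rdet (rep Q) (rep P) (rep Y)) W"
    unfolding E_def
  proof (rule finprod_cong')
    fix Y assume "Y \<in> W"
    then show "rdet (rep P) (rep Q) (rep Y) = \<ominus> rdet (rep Q) (rep P) (rep Y)"
      using rdet_swap(1)[of "rep Q" "rep P" "rep Y"] assms repS by auto
  qed (use c in auto)
  then show ?thesis using finprod_minus[OF f c] assms(4) by (simp add: E_def)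
qed

text \<open>By \<open>slope_bij\<close> and \<open>wilson\<close>, the ratios of the values at
  \<open>C\<close> and \<open>B\<close>, over all lines through \<open>A\<close> other than those to
  \<open>B\<close> and \<open>C\<close>, have product - 1. These lines are the tangents at
  \<open>A\<close> and one line for each point of \<open>Z\<close>. Passing from \<open>Z\<close> to
  all of \<open>W\<close> introduces \<open>D\<close>, and over \<open>W\<close> the ratio for the
  line through \<open>Y\<close> is a ratio of determinants, collected in \<open>E\<close>.\<close>

lemma step:
  assumes AB: "bis A B" and AC: "bis A C" and BC: "B \<noteq> C" and W: "W = S - {A, B, C}"
  shows "N A C \<otimes> D A B \<otimes> E A C W = \<ominus> (N A B \<otimes> D A C \<otimes> E A B W)"
proof -
  have b: "A \<in> S" "B \<in> S" "C \<in> S" "A \<noteq> B" "A \<noteq> C" using AB AC by (auto simp: bis_def)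
  define Z where "Z = S - {A} - U A - {B, C}"
  define \<Lambda> where "\<Lambda> = {l \<in> pg2_lines R. rdot (lform l) (rep A) = \<zero> \<and> rdot (lform l) (rep B) \<noteq> \<zero> \<and> rdot (lform l) (rep C) \<noteq> \<zero>}"
  define PP where "PP Q = finprod R (\<lambda>Y. lval (line_through A Y) Q) Z" for Q
  have \<Lambda>_iff: "l \<in> \<Lambda> \<longleftrightarrow> l \<in> pg2_lines R \<and> A \<subseteq> l \<and> lval l B \<noteq> \<zero> \<and> lval l C \<noteq> \<zero>" for l
    unfolding \<Lambda>_def using lval_0[OF b(1), of l] by (auto simp: lval_def)
  have Zin: "Y \<in> S" "Y \<noteq> A" "Y \<noteq> B" "Y \<noteq> C" "line_through A Y \<in> pg2_lines R" "line_through A Y \<in> pencil A - tangents A" if "Y \<in> Z" for Y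
    using that line_through(1)[OF b(1), of Y] U(3)[OF b(1)] unfolding Z_def by (auto simp: bij_betw_def)
  have finZ: "finite Z" using finS by (simp add: Z_def)
  have injZ: "inj_on (line_through A) Z"
    using U(3)[OF b(1)] unfolding bij_betw_def Z_def by (auto intro: inj_on_subset)
  have \<Lambda>: "\<Lambda> = tangents A \<union> line_through A ` Z"
  proof (intro equalityI subsetI)
    fix l assume l: "l \<in> \<Lambda>"
    show "l \<in> tangents A \<union> line_through A ` Z"
    proof (cases "l \<in> tangents A")
      case False
      moreover have "l \<in> pencil A" using l by (simp add: pencil_def \<Lambda>_iff)
      ultimately obtain Y where Y: "Y \<in> S" "Y \<noteq> A" "Y \<notin> U A" "l = line_through A Y"
        using U_surj[OF b(1)] by blast
      have "Y \<subseteq> l" unfolding Y(4) by (rule line_through(3)[OF b(1) Y(1) Y(2)[symmetric]])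
      moreover have "\<not> B \<subseteq> l" "\<not> C \<subseteq> l" using l lval_0[OF b(2), of l] lval_0[OF b(3), of l] unfolding \<Lambda>_iff by blast+
      ultimately have "Y \<noteq> B" "Y \<noteq> C" by blast+
      then have "Y \<in> Z" using Y by (simp add: Z_def)
      then show ?thesis unfolding Y(4) by blast
    qed simp
  next
    fix l assume "l \<in> tangents A \<union> line_through A ` Z"
    then consider "l \<in> tangents A" | Y where "Y \<in> Z" "l = line_through A Y" by auto
    then show "l \<in> \<Lambda>"
    proof cases
      case 1
      then show ?thesis using tangent_val b by (auto simp: \<Lambda>_iff tangents_def)
    next
      case 2
      then show ?thesis using line_val[OF AB Zin(1-3)] line_val[OF AC Zin(1,2,4)] Zin(5,6)[of Y]
        by (auto simp: \<Lambda>_iff pencil_def)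
    qed
  qed
  have prod\<Lambda>: "finprod R (\<lambda>l. lval l Q) \<Lambda> = N A Q \<otimes> PP Q" if "Q \<in> S" for Q
  proof -
    have "finprod R (\<lambda>l. lval l Q) \<Lambda> = N A Q \<otimes> finprod R (\<lambda>l. lval l Q) (line_through A ` Z)"
      unfolding \<Lambda> N_def by (rule finprod_Un_disjoint) (use finZ Zin that tangents_lines in auto)
    also have "finprod R (\<lambda>l. lval l Q) (line_through A ` Z) = PP Q"
      unfolding PP_def by (rule finprod_reindex) (use Zin that injZ in auto)
    finally show ?thesis .
  qed
  have WZ: "W = U A \<union> Z" "U A \<inter> Z = {}" "W \<subseteq> S"
    using U(1)[OF b(1)] bis_notin_U[OF AB] bis_notin_U[OF AC] by (auto simp: W Z_def)
  have Wl: "line_through A Y \<in> pg2_lines R" if "Y \<in> W" for Y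
    using line_through(1)[OF b(1), of Y] that by (auto simp: W)
  have prodW: "finprod R (\<lambda>Y. lval (line_through A Y) Q) W = D A Q \<otimes> PP Q" if "Q \<in> S" for Q
    unfolding WZ(1) D_def PP_def
    by (rule finprod_Un_disjoint) (use finZ finite_U[OF b(1)] WZ(2) Zin that U_lines[OF b(1)] in auto)
  have PPc: "PP Q \<in> carrier R" if "Q \<in> S" for Q unfolding PP_def using Zin that by (auto intro!: finprod_closed)
  have PPnz: "PP C \<noteq> \<zero>" unfolding PP_def
    by (rule finprod_nonzero[OF finZ]) (use Zin line_val[OF AC] b in auto)
  have nc: "rdet (rep A) (rep B) (rep C) \<noteq> \<zero>"
    using det_nz[OF b(1,2,3,4)] bis_only[OF AB b(3)] b BC by blast
  note sl = slope_bij[OF repS(1)[OF b(1)] repS(1)[OF b(2)] repS(1)[OF b(3)] nc, folded \<Lambda>_def]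
  have finL: "finite \<Lambda>" using \<Lambda> finZ by simp
  have slc: "slope (rep B) (rep C) l \<in> carrier R" if "l \<in> \<Lambda>" for l using sl that by (auto simp: bij_betw_def)
  have "finprod R (slope (rep B) (rep C)) \<Lambda> = finprod R (\<lambda>x. x) (slope (rep B) (rep C) ` \<Lambda>)"
    by (rule finprod_reindex[symmetric]) (use slc sl in \<open>auto simp: bij_betw_def\<close>)
  also have "\<dots> = \<ominus> \<one>" using sl wilson by (simp add: bij_betw_def)
  finally have s1: "finprod R (slope (rep B) (rep C)) \<Lambda> = \<ominus> \<one>" .
  have lc: "lval l B \<in> carrier R" "lval l C \<in> carrier R" if "l \<in> \<Lambda>" for l using that b by (auto simp: \<Lambda>_iff)
  have "finprod R (\<lambda>l. lval l C) \<Lambda> = finprod R (\<lambda>l. slope (rep B) (rep C) l \<otimes> lval l B) \<Lambda>"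
  proof (rule finprod_cong')
    fix l assume l: "l \<in> \<Lambda>"
    have "slope (rep B) (rep C) l = lval l C \<otimes> inv (lval l B)" by (simp add: slope_def lval_def)
    moreover have "lval l B \<noteq> \<zero>" using l by (simp add: \<Lambda>_iff)
    ultimately show "lval l C = slope (rep B) (rep C) l \<otimes> lval l B" using lc[OF l] invR[of "lval l B"] by (simp add: m_assoc)
  qed (use slc lc in auto)
  also have "\<dots> = \<ominus> \<one> \<otimes> finprod R (\<lambda>l. lval l B) \<Lambda>"
    unfolding s1[symmetric] by (rule finprod_multf) (use slc lc in auto)
  finally have 1: "N A C \<otimes> PP C = \<ominus> (N A B \<otimes> PP B)" unfolding prod\<Lambda>[OF b(2)] prod\<Lambda>[OF b(3)] using PPc b by (simp add: l_minus)
  have dc: "rdet (rep A) (rep Q) (rep Y) \<in> carrier R" if "Q \<in> S" "Y \<in> W" for Q Y using that WZ(3) b repS by auto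
  have "(D A C \<otimes> PP C) \<otimes> E A B W = finprod R (\<lambda>Y. lval (line_through A Y) C \<otimes> rdet (rep A) (rep B) (rep Y)) W"
    unfolding prodW[OF b(3), symmetric] E_def by (rule finprod_multf[symmetric]) (use Wl dc b in auto)
  also have "\<dots> = finprod R (\<lambda>Y. lval (line_through A Y) B \<otimes> rdet (rep A) (rep C) (rep Y)) W"
  proof (rule finprod_cong')
    fix Y assume Y: "Y \<in> W"
    then have Y': "Y \<in> S" "A \<noteq> Y" by (auto simp: W)
    have z: "rdot (lform (line_through A Y)) (rep A) = \<zero>" "rdot (lform (line_through A Y)) (rep Y) = \<zero>"
      using line_through[OF b(1) Y'] lval_0 b(1) Y'(1) unfolding lval_def by blast+
    have a: "lform (line_through A Y) \<in> V3" by (rule lform(1)[OF Wl[OF Y]])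
    \<comment> \<open>Cramer's rule for \<open>C\<close> in terms of \<open>A\<close>,
      \<open>B\<close>, \<open>Y\<close>, evaluated by the form of the line of \<open>A\<close> and
      \<open>Y\<close>, which vanishes at both.\<close>
    show "lval (line_through A Y) C \<otimes> rdet (rep A) (rep B) (rep Y) = lval (line_through A Y) B \<otimes> rdet (rep A) (rep C) (rep Y)"
      using rdot_cramer[OF repS(1)[OF b(1)] repS(1)[OF b(2)] repS(1)[OF Y'(1)] repS(1)[OF b(3)] a] a repS Y'(1) b
      unfolding lval_def z by (simp add: m_comm)
  qed (use Wl dc b in auto)
  also have "\<dots> = (D A B \<otimes> PP B) \<otimes> E A C W"
    unfolding prodW[OF b(2), symmetric] E_def by (rule finprod_multf) (use Wl dc b in auto)
  finally have 2: "(D A C \<otimes> PP C) \<otimes> E A B W = (D A B \<otimes> PP B) \<otimes> E A C W" .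
  show ?thesis by (rule cancel_minus[OF _ _ _ _ _ _ _ _ PPnz 1 2]) (use b PPc WZ(3) in simp_all)
qed

text \<open>The product of three instances of \<open>step\<close>. The determinant products cancel
  because the determinant is alternating and \<open>W\<close> has an even number q - 1 of
  points.\<close>

theorem segre:
  assumes "bis A B" "bis B C" "bis C A"
  shows "(N A C \<otimes> D A B) \<otimes> (N B A \<otimes> D B C) \<otimes> (N C B \<otimes> D C A) =
    \<ominus> ((N A B \<otimes> D A C) \<otimes> (N B C \<otimes> D B A) \<otimes> (N C A \<otimes> D C B))"
proof -
  have b: "A \<in> S" "B \<in> S" "C \<in> S" "A \<noteq> B" "B \<noteq> C" "C \<noteq> A" using assms by (auto simp: bis_def)
  define W where "W = S - {A, B, C}"
  have W: "W \<subseteq> S" "W = S - {A, B, C}" "W = S - {B, C, A}" "W = S - {C, A, B}"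
    "W \<subseteq> S - {A, B}" "W \<subseteq> S - {B, C}" "W \<subseteq> S - {C, A}" by (auto simp: W_def)
  have "card W = card S - card {A, B, C}" unfolding W_def by (rule card_Diff_subset) (use b in auto)
  then have "card W = card (carrier R) - 1" using b cS by simp
  then have ev: "even (card W)" using oddR by auto
  have s: "E B A W = E A B W" "E C B W = E B C W" "E A C W = E C A W" using E_sym ev W(1) b by metis+
  note bs = assms[THEN bis_sym]
  show ?thesis
    by (rule cancel_cycle[OF _ _ _ _ _ _ _ _ _ E_nz[OF assms(2) W(6)] E_nz[OF assms(3) W(7)] E_nz[OF assms(1) W(5)]
        step[OF assms(1) bs(3) b(5) W(2), unfolded s] step[OF assms(2) bs(1) b(6) W(3), unfolded s]
        step[OF assms(3) bs(2) b(4) W(4), unfolded s]])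
      (use b W(1) in simp_all)
qed

text \<open>A nucleus lies on no line with more than two points of \<open>S\<close>. For three
  nuclei all products in \<open>segre\<close> are therefore empty, and it reads 1 = - 1.\<close>

lemma card_nuclei: "card nuclei \<le> 2"
proof (rule ccontr)
  assume "\<not> ?thesis"
  then have "3 \<le> card nuclei" by simp
  then obtain M where "M \<subseteq> nuclei" "card M = 3" by (rule obtain_subset_with_card_n)
  then obtain A B C where n: "A \<in> nuclei" "B \<in> nuclei" "C \<in> nuclei" "A \<noteq> B" "B \<noteq> C" "C \<noteq> A" by (auto simp: card_3_iff)
  have b: "bis P Q" if "P \<in> nuclei" "Q \<in> nuclei" "P \<noteq> Q" for P Q
  proof -
    have PQ: "P \<in> S" "Q \<in> S" "card (tangents P) = 0" using that by (auto simp: nuclei_def)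
    note j = line_through[OF PQ(1,2) that(3)]
    have "card {P, Q} \<le> card {Z \<in> S. Z \<subseteq> line_through P Q}" by (rule card_mono) (use finS PQ j in auto)
    then have "line_deg (line_through P Q) \<ge> 2" using that by (simp add: line_deg_def)
    moreover have "\<not> line_deg (line_through P Q) \<ge> 3"
    proof
      assume "line_deg (line_through P Q) \<ge> 3"
      moreover have "line_through P Q \<in> pencil P" using j by (simp add: pencil_def)
      moreover have "(\<Sum>l\<in>{l \<in> pencil P. line_deg l \<ge> 3}. line_deg l - 2) = 0" using tangents_eq[OF PQ(1)] PQ(3) by simp
      ultimately show False by auto
    qed
    ultimately show ?thesis using PQ that by (simp add: bis_def)
  qed
  have "N P Q = \<one>" "D P Q = \<one>" if "P \<in> nuclei" for P Q
  proof -
    have P: "P \<in> S" "tangents P = {}" using that by (auto simp: nuclei_def)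
    then have "U P = {}" using U(2)[OF P(1)] finite_U[OF P(1)] by simp
    then show "N P Q = \<one>" "D P Q = \<one>" using P by (simp_all add: N_def D_def)
  qed
  then have "\<one> = \<ominus> \<one>" using segre[OF b[OF n(1,2,4)] b[OF n(2,3,5)] b[OF n(3,1,6)]] n by simp
  then show False using one_neq_minus_one by simp
qed

text \<open>The single surplus point of \<open>A\<close> lies on its 3-secant, since a point joined
  to \<open>A\<close> by a bisecant is never surplus. So the product \<open>D\<close> is the form of
  the 3-secant.\<close>

lemma T_line:
  assumes "A \<in> T"
  shows "\<exists>t s. A \<in> S \<and> threes A = {s} \<and> t \<in> pg2_lines R \<and> s \<in> pg2_lines R \<and> A \<subseteq> t \<and> A \<subseteq> s \<and> t \<noteq> s \<and>
    (\<forall>Q\<in>S. N A Q = lval t Q \<and> D A Q = lval s Q) \<and> (\<forall>Q\<in>S. Q \<noteq> A \<longrightarrow> \<not> Q \<subseteq> s \<longrightarrow> bis A Q)"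
proof -
  have A: "A \<in> S" "card (tangents A) = 1" using assms by (auto simp: T_def)
  obtain t where t: "tangents A = {t}" using A(2) card_1_singletonE by blast
  obtain s where s: "threes A = {s}" "\<And>l'. l' \<in> pencil A \<Longrightarrow> line_deg l' \<ge> 3 \<Longrightarrow> l' = s"
    using T_three[OF assms] by metis
  have ts: "t \<in> tangents A" "s \<in> threes A" using t s(1) by auto
  then have ts': "t \<in> pg2_lines R" "s \<in> pg2_lines R" "A \<subseteq> t" "A \<subseteq> s" "line_deg t = 1" "line_deg s = 3"
    by (auto simp: tangents_def threes_def)
  have ge2: "line_deg (line_through A Q) \<ge> 2" if "Q \<in> S" "Q \<noteq> A" for Q
  proof -
    note j = line_through[OF A(1) that(1) that(2)[symmetric]]
    have "card {A, Q} \<le> card {Z \<in> S. Z \<subseteq> line_through A Q}" by (rule card_mono) (use finS A that j in auto)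
    then show ?thesis using that by (simp add: line_deg_def)
  qed
  have bis: "bis A Q" if "Q \<in> S" "Q \<noteq> A" "\<not> Q \<subseteq> s" for Q
  proof -
    note j = line_through[OF A(1) that(1) that(2)[symmetric]]
    have "\<not> line_deg (line_through A Q) \<ge> 3" using s(2)[of "line_through A Q"] j that(3) by (auto simp: pencil_def)
    then show ?thesis using ge2[OF that(1,2)] A that by (simp add: bis_def)
  qed
  have N: "N A Q = lval t Q" if "Q \<in> S" for Q using ts' that by (simp add: N_def t)
  have D: "D A Q = lval s Q" if Q: "Q \<in> S" for Q
  proof -
    obtain Y where Y: "U A = {Y}" using U(2)[OF A(1)] A(2) card_1_singletonE by metis
    have YS: "Y \<in> S" "Y \<noteq> A" using U(1)[OF A(1)] Y by auto
    have "Y \<subseteq> s"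
    proof (rule ccontr)
      assume "\<not> Y \<subseteq> s"
      then show False using bis[OF YS] bis_notin_U[of A Y] Y by auto
    qed
    then have "s = line_through A Y" using line_through_unique[OF A(1) YS(1) YS(2)[symmetric] ts'(2,4)] by blast
    then show ?thesis using Y Q ts'(2) by (simp add: D_def)
  qed
  have "t \<noteq> s" using ts' by auto
  show ?thesis
    by (rule exI[of _ t], rule exI[of _ s], intro conjI ballI impI) (simp_all add: A(1) s(1) ts'(1-4) \<open>t \<noteq> s\<close> N D bis)
qed

end

context cring
begin

definition rmulv :: "'a vec3 \<times> 'a vec3 \<times> 'a vec3 \<Rightarrow> 'a vec3 \<Rightarrow> 'a vec3" where
  "rmulv M u = (rdot (fst M) u, rdot (fst (snd M)) u, rdot (snd (snd M)) u)"

definition rbil :: "'a vec3 \<times> 'a vec3 \<times> 'a vec3 \<Rightarrow> 'a vec3 \<Rightarrow> 'a vec3 \<Rightarrow> 'a" where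
  "rbil M u w = rdot u (rmulv M w)"

end

context segre
begin

definition cert :: "nat \<Rightarrow> (nat \<Rightarrow> 'a vec3 set \<times> 'a vec3 set \<times> 'a vec3 set) \<Rightarrow> bool" where
  "cert m c \<longleftrightarrow>
    (\<forall>i<m. case c i of (A, t, s) \<Rightarrow> A \<in> S \<and> t \<in> pg2_lines R \<and> s \<in> pg2_lines R \<and> A \<subseteq> t \<and> A \<subseteq> s \<and> t \<noteq> s \<and>
      (\<forall>Q\<in>S. N A Q = lval t Q \<and> D A Q = lval s Q) \<and> (\<forall>Q\<in>S. Q \<noteq> A \<longrightarrow> \<not> Q \<subseteq> s \<longrightarrow> bis A Q)) \<and>
    (\<forall>i<m. \<forall>j<m. i \<noteq> j \<longrightarrow> (\<forall>Q\<in>S. \<not> (Q \<subseteq> snd (snd (c i)) \<and> Q \<subseteq> snd (snd (c j)))))"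

text \<open>Each disjoint 3-secant costs 6 in the bound of \<open>matching\<close>, which leaves n
  div 6 of them.\<close>

lemma certificate:
  assumes "real (card odd_lines) < 2 * real (card (carrier R)) - real n"
  shows "\<exists>c. cert (n div 6) c"
proof -
  have "6 * real (n div 6) \<le> real n" by linarith
  then have "real (card odd_lines) < 2 * real (card (carrier R)) - 6 * real (n div 6)" using assms by linarith
  from matching[OF card_nuclei this] obtain M where M: "M \<subseteq> special" "card M \<ge> n div 6" "disjoint_lines M" by blast
  have "finite M" by (rule finite_subset[OF M(1)]) (simp add: special_def finL)
  then obtain f where f: "bij_betw f {0..<card M} M" using ex_bij_betw_nat_finite by blast
  have fM: "f i \<in> M" if "i < n div 6" for i using f that M(2) by (auto simp: bij_betw_def)
  have inj: "f i \<noteq> f j" if "i < n div 6" "j < n div 6" "i \<noteq> j" for i j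
    using f that M(2) by (auto simp: bij_betw_def inj_on_def)
  have ex: "\<exists>x. case x of (A, t, s) \<Rightarrow> s = f i \<and> A \<in> S \<and> t \<in> pg2_lines R \<and> s \<in> pg2_lines R \<and> A \<subseteq> t \<and> A \<subseteq> s \<and> t \<noteq> s \<and>
      (\<forall>Q\<in>S. N A Q = lval t Q \<and> D A Q = lval s Q) \<and> (\<forall>Q\<in>S. Q \<noteq> A \<longrightarrow> \<not> Q \<subseteq> s \<longrightarrow> bis A Q)" if i: "i < n div 6" for i
  proof -
    have "f i \<in> special" using fM[OF i] M(1) by blast
    then obtain A where A: "A \<in> T" "A \<subseteq> f i" "f i \<in> pg2_lines R" "line_deg (f i) = 3" by (auto simp: special_def)
    obtain t s where ts: "A \<in> S" "threes A = {s}" "t \<in> pg2_lines R" "s \<in> pg2_lines R" "A \<subseteq> t" "A \<subseteq> s" "t \<noteq> s"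
      "\<forall>Q\<in>S. N A Q = lval t Q \<and> D A Q = lval s Q" "\<forall>Q\<in>S. Q \<noteq> A \<longrightarrow> \<not> Q \<subseteq> s \<longrightarrow> bis A Q"
      using T_line[OF A(1)] by (elim exE conjE) (rule that)
    have "f i \<in> threes A" using A by (simp add: threes_def)
    then have e: "s = f i" using ts(2) by simp
    show ?thesis
      by (rule exI[of _ "(A, t, s)"], unfold prod.case, intro conjI) (rule e ts)+
  qed
  define c where "c i = (SOME x. case x of (A, t, s) \<Rightarrow> s = f i \<and> A \<in> S \<and> t \<in> pg2_lines R \<and> s \<in> pg2_lines R \<and> A \<subseteq> t \<and> A \<subseteq> s \<and> t \<noteq> s \<and>
      (\<forall>Q\<in>S. N A Q = lval t Q \<and> D A Q = lval s Q) \<and> (\<forall>Q\<in>S. Q \<noteq> A \<longrightarrow> \<not> Q \<subseteq> s \<longrightarrow> bis A Q))" for i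
  have c: "case c i of (A, t, s) \<Rightarrow> s = f i \<and> A \<in> S \<and> t \<in> pg2_lines R \<and> s \<in> pg2_lines R \<and> A \<subseteq> t \<and> A \<subseteq> s \<and> t \<noteq> s \<and>
      (\<forall>Q\<in>S. N A Q = lval t Q \<and> D A Q = lval s Q) \<and> (\<forall>Q\<in>S. Q \<noteq> A \<longrightarrow> \<not> Q \<subseteq> s \<longrightarrow> bis A Q)" if "i < n div 6" for i
    unfolding c_def by (rule someI_ex[OF ex[OF that]])
  have cf: "snd (snd (c i)) = f i" if "i < n div 6" for i using c[OF that] by (simp add: case_prod_beta)
  have "cert (n div 6) c"
    unfolding cert_def
  proof (intro conjI allI impI ballI)
    fix i assume "i < n div 6"
    from c[OF this] show "case c i of (A, t, s) \<Rightarrow> A \<in> S \<and> t \<in> pg2_lines R \<and> s \<in> pg2_lines R \<and> A \<subseteq> t \<and> A \<subseteq> s \<and> t \<noteq> s \<and>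
      (\<forall>Q\<in>S. N A Q = lval t Q \<and> D A Q = lval s Q) \<and> (\<forall>Q\<in>S. Q \<noteq> A \<longrightarrow> \<not> Q \<subseteq> s \<longrightarrow> bis A Q)"
      unfolding case_prod_beta by (rule conjunct2)
  next
    fix i j Q assume ij: "i < n div 6" "j < n div 6" "i \<noteq> j" and Q: "Q \<in> S"
    have "\<not> (Q \<subseteq> f i \<and> Q \<subseteq> f j)"
      using M(3)[unfolded disjoint_lines_def, rule_format, OF fM[OF ij(1)] fM[OF ij(2)] inj[OF ij] Q] by simp
    then show "\<not> (Q \<subseteq> snd (snd (c i)) \<and> Q \<subseteq> snd (snd (c j)))" unfolding cf[OF ij(1)] cf[OF ij(2)] .
  qed
  then show ?thesis by blast
qed

text \<open>Products over sets of lines become products over an initial segment of the natural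
  numbers, so that in the ultraproduct only the degree \<open>d\<close> has to be made
  constant.\<close>

lemma enumerate_forms:
  assumes P: "P \<in> S" and fin: "finite I" and c: "card I = d"
    and l: "\<And>y. y \<in> I \<Longrightarrow> l y \<in> pg2_lines R \<and> P \<subseteq> l y"
  shows "\<exists>g. (\<forall>j. g j \<in> V3) \<and> (\<forall>j<d. rdot (g j) (rep P) = \<zero>) \<and>
    (\<forall>Q\<in>S. finprod R (\<lambda>y. lval (l y) Q) I = finprod R (\<lambda>j. rdot (g j) (rep Q)) {..<d})"
proof -
  obtain f where f: "bij_betw f {0..<d} I" using ex_bij_betw_nat_finite[OF fin] c by blast
  then have f: "f ` {..<d} = I" "inj_on f {..<d}" by (auto simp: bij_betw_def atLeast0LessThan)
  define g where "g j = (if j < d then lform (l (f j)) else zero3)" for j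
  have fl: "l (f j) \<in> pg2_lines R" "P \<subseteq> l (f j)" if "j < d" for j using l[of "f j"] f(1) that by auto
  show ?thesis
  proof (rule exI[of _ g], intro conjI allI impI ballI)
    show "g j \<in> V3" for j using lform(1) fl by (simp add: g_def)
    show "rdot (g j) (rep P) = \<zero>" if "j < d" for j using lval_0[OF P fl(1)[OF that]] fl(2)[OF that] that by (simp add: g_def lval_def)
    fix Q assume Q: "Q \<in> S"
    have "finprod R (\<lambda>y. lval (l y) Q) (f ` {..<d}) = finprod R (\<lambda>j. lval (l (f j)) Q) {..<d}"
      by (rule finprod_reindex) (use Q f fl in auto)
    also have "\<dots> = finprod R (\<lambda>j. rdot (g j) (rep Q)) {..<d}"
      by (rule finprod_cong') (use Q fl lform(1) repS in \<open>auto simp: g_def lval_def\<close>)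
    finally show "finprod R (\<lambda>y. lval (l y) Q) I = finprod R (\<lambda>j. rdot (g j) (rep Q)) {..<d}" using f(1) by simp
  qed
qed

lemma two_neq_zero: "\<one> \<oplus> \<one> \<noteq> \<zero>"
proof
  assume "\<one> \<oplus> \<one> = \<zero>"
  then have "\<ominus> \<one> = \<one>" by (rule minus_equality) auto
  then show False using one_neq_minus_one by simp
qed

lemma forms_independent:
  assumes "l \<in> pg2_lines R" "l' \<in> pg2_lines R" "l \<noteq> l'"
  shows "rcross (lform l) (lform l') \<noteq> zero3"
proof
  assume "rcross (lform l) (lform l') = zero3"
  then obtain c where c: "c \<in> carrier R" "lform l' = rscale c (lform l)"
    using rcross_zero_parallel[OF lform(1)[OF assms(1)] lform(1)[OF assms(2)]] lform(2)[OF assms(1)] by blast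
  have "c \<noteq> \<zero>"
  proof
    assume "c = \<zero>"
    then have "lform l' = zero3" using c lform(1)[OF assms(1)] by (auto simp: rvec_defs)
    then show False using lform(2)[OF assms(2)] by simp
  qed
  then have "kern (lform l') = kern (lform l)"
    unfolding c(2) kern_def using c(1) lform(1)[OF assms(1)] integral[of c] by (auto simp: rdot_linear)
  then show False using lform(3)[OF assms(1)] lform(3)[OF assms(2)] assms(3) by metis
qed

end

section \<open>A set whose points on few tangents all lie on a conic\<close>

locale conic_cover = segre +
  fixes M
  assumes MV: "fst M \<in> V3" "fst (snd M) \<in> V3" "snd (snd M) \<in> V3"
    and sym: "u \<in> V3 \<Longrightarrow> w \<in> V3 \<Longrightarrow> rbil M u w = rbil M w u"
    and det: "rdet (fst M) (fst (snd M)) (snd (snd M)) \<noteq> \<zero>"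
    and low: "P \<in> S \<Longrightarrow> card (tangents P) \<le> 16 \<Longrightarrow> rbil M (rep P) (rep P) = \<zero>"
begin

lemma mulv_closed [simp]: "u \<in> V3 \<Longrightarrow> rmulv M u \<in> V3"
  using MV by (simp add: rmulv_def V3_def[of] rvec_closed)

lemma bil_closed [simp]: "u \<in> V3 \<Longrightarrow> w \<in> V3 \<Longrightarrow> rbil M u w \<in> carrier R"
  by (simp add: rbil_def)

lemma bil_lin:
  "u \<in> V3 \<Longrightarrow> w \<in> V3 \<Longrightarrow> c \<in> carrier R \<Longrightarrow> rbil M (rscale c u) w = c \<otimes> rbil M u w"
  "u \<in> V3 \<Longrightarrow> u' \<in> V3 \<Longrightarrow> w \<in> V3 \<Longrightarrow> rbil M (rplus u u') w = rbil M u w \<oplus> rbil M u' w"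
  by (simp_all add: rbil_def rdot_linear)

lemma bil_lin':
  "u \<in> V3 \<Longrightarrow> w \<in> V3 \<Longrightarrow> c \<in> carrier R \<Longrightarrow> rbil M w (rscale c u) = c \<otimes> rbil M w u"
  "u \<in> V3 \<Longrightarrow> u' \<in> V3 \<Longrightarrow> w \<in> V3 \<Longrightarrow> rbil M w (rplus u u') = rbil M w u \<oplus> rbil M w u'"
proof -
  show "rbil M w (rscale c u) = c \<otimes> rbil M w u" if h: "u \<in> V3" "w \<in> V3" "c \<in> carrier R"
    unfolding sym[OF h(2) rvec_closed(3)[OF h(3,1)]] sym[OF h(2,1)] by (rule bil_lin(1)[OF h])
  show "rbil M w (rplus u u') = rbil M w u \<oplus> rbil M w u'" if h: "u \<in> V3" "u' \<in> V3" "w \<in> V3"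
    unfolding sym[OF h(3) rvec_closed(4)[OF h(1,2)]] sym[OF h(3,1)] sym[OF h(3,2)] by (rule bil_lin(2)[OF h])
qed

lemma mulv_zero:
  assumes "u \<in> V3" "rmulv M u = zero3" shows "u = zero3"
proof -
  have "rdot (fst M) u = \<zero>" "rdot (fst (snd M)) u = \<zero>" "rdot (snd (snd M)) u = \<zero>"
    using assms(2) by (auto simp: rmulv_def zero3_def)
  then have "rdot u (fst M) = \<zero>" "rdot u (fst (snd M)) = \<zero>" "rdot u (snd (snd M)) = \<zero>"
    using MV assms(1) rdot_commute by auto
  then show ?thesis using rform_zero[OF MV assms(1) det] by blast
qed

lemma mulv_killed:
  assumes "x \<in> V3" "y \<in> V3" "p \<in> V3" "rdet x y p \<noteq> \<zero>" "u \<in> V3"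
    and "rbil M x u = \<zero>" "rbil M y u = \<zero>" "rbil M p u = \<zero>"
  shows "u = zero3"
proof (rule mulv_zero[OF assms(5)])
  have "rdot (rmulv M u) x = \<zero>" "rdot (rmulv M u) y = \<zero>" "rdot (rmulv M u) p = \<zero>"
    using assms(6-8) rdot_commute[of "rmulv M u"] assms(1-3,5) by (auto simp: rbil_def)
  then show "rmulv M u = zero3" using rform_zero[OF assms(1-3) mulv_closed[OF assms(5)] assms(4)] by blast
qed

text \<open>\<open>x\<close> and \<open>y\<close> would span a plane on which the form is zero. With
  \<open>p\<close> completing them to a basis, the combination \<open>w\<close> of \<open>x\<close>
  and \<open>y\<close> that is orthogonal to \<open>p\<close> as well would lie in the kernel of the
  form.\<close>

lemma no_isotropic_pair:
  assumes V: "x \<in> V3" "y \<in> V3" and n: "rcross x y \<noteq> zero3"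
    and z: "rbil M x x = \<zero>" "rbil M y y = \<zero>" "rbil M x y = \<zero>"
  shows False
proof -
  obtain p where p: "p \<in> V3" "rdet x y p \<noteq> \<zero>" using rdot_nonzero_ex[OF _ n] V by (auto simp: rdet_def)
  have yx: "rbil M y x = \<zero>" using sym V z by simp
  have x0: "x \<noteq> zero3"
  proof
    assume "x = zero3"
    then have "rcross x y = zero3" using V by (auto simp: rvec_defs minus_eq)
    then show False using n by simp
  qed
  define e f where "e = rbil M y p" "f = rbil M x p"
  have ef: "e \<in> carrier R" "f \<in> carrier R" using V p by (simp_all add: e_f_def)
  have f0: "f \<noteq> \<zero>"
  proof
    assume "f = \<zero>"
    then have "rbil M p x = \<zero>" using sym V p by (simp add: e_f_def)
    then show False using mulv_killed[OF V p V(1) z(1) yx] x0 by blast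
  qed
  define w where "w = rplus (rscale e x) (rscale (\<ominus> f) y)"
  have w: "w \<in> V3" using V ef by (simp add: w_def)
  have s: "rbil M p x = f" "rbil M p y = e" using sym V p by (simp_all add: e_f_def)
  have "rbil M p w = \<zero>" using V p ef by (simp add: w_def bil_lin' s l_minus r_minus m_comm r_neg)
  moreover have "rbil M x w = \<zero>" "rbil M y w = \<zero>" using V ef z yx by (simp_all add: w_def bil_lin')
  ultimately have "w = zero3" using mulv_killed[OF V p w] by blast
  then have "rdot (rcross p x) w = \<zero>" using V p by (simp add: rdot_zero3)
  moreover have "rdot (rcross p x) w = \<ominus> f \<otimes> rdet p x y" using V p ef by (simp add: w_def rdot_linear rcross_orth rdet_def)
  moreover have "rdet p x y \<noteq> \<zero>" using rdet_swap(2)[of p x y] p V by simp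
  ultimately show False using integral[of "\<ominus> f" "rdet p x y"] f0 ef V p by auto
qed

lemma double_zero: "x \<in> carrier R \<Longrightarrow> x \<oplus> x = \<zero> \<Longrightarrow> x = \<zero>"
proof -
  assume x: "x \<in> carrier R" "x \<oplus> x = \<zero>"
  have "(\<one> \<oplus> \<one>) \<otimes> x = \<zero>" using x by (simp add: l_distr)
  then show ?thesis using integral[of "\<one> \<oplus> \<one>" x] x two_neq_zero by auto
qed

text \<open>At c x + d y the form takes the value 2 c d B(x, y), so a third zero on the line makes
  B(x, y) vanish.\<close>

lemma three_isotropic:
  assumes V: "x \<in> V3" "y \<in> V3" "z \<in> V3" "a \<in> V3" and a: "a \<noteq> zero3"
    and k: "rdot a x = \<zero>" "rdot a y = \<zero>" "rdot a z = \<zero>"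
    and q: "rbil M x x = \<zero>" "rbil M y y = \<zero>" "rbil M z z = \<zero>"
    and n: "rcross x y \<noteq> zero3" "rcross x z \<noteq> zero3" "rcross y z \<noteq> zero3"
  shows False
proof -
  have "rdet x y z = \<zero>" using rform_zero[OF V(1-4) _ k] a by blast
  then have "z \<in> kern (rcross x y)" using V by (simp add: kern_def rdet_def)
  then have "z \<in> span2 x y" using kern_cross[OF V(1,2) n(1)] by simp
  then obtain c d where cd: "c \<in> carrier R" "d \<in> carrier R" "z = rplus (rscale c x) (rscale d y)"
    unfolding span2_def by blast
  define b where "b = rbil M x y"
  have b: "b \<in> carrier R" "rbil M y x = b" using V sym by (simp_all add: b_def)
  have c0: "c \<noteq> \<zero>"
  proof
    assume "c = \<zero>"
    then have "rcross y z = zero3" unfolding cd(3) using V cd(1,2) by (auto simp: rvec_defs minus_eq m_ac r_neg)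
    then show False using n by simp
  qed
  have d0: "d \<noteq> \<zero>"
  proof
    assume "d = \<zero>"
    then have "rcross x z = zero3" unfolding cd(3) using V cd(1,2) by (auto simp: rvec_defs minus_eq m_ac r_neg)
    then show False using n by simp
  qed
  have "rbil M z z = c \<otimes> (d \<otimes> b) \<oplus> d \<otimes> (c \<otimes> b)"
    unfolding cd(3) using V cd(1,2) b q by (simp add: bil_lin bil_lin' b_def[symmetric])
  also have "\<dots> = c \<otimes> d \<otimes> b \<oplus> c \<otimes> d \<otimes> b" using cd(1,2) b by (simp add: m_ac)
  finally have e: "rbil M z z = c \<otimes> d \<otimes> b \<oplus> c \<otimes> d \<otimes> b" .
  have "c \<otimes> d \<otimes> b = \<zero>" by (rule double_zero[OF _ trans[OF e[symmetric] q(3)]]) (use cd(1,2) b in simp)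
  then have "b = \<zero>" using integral[of "c \<otimes> d" b] integral[of c d] cd(1,2) b c0 d0 by auto
  then show False using no_isotropic_pair[OF V(1,2) n(1) q(1,2)] by (simp add: b_def)
qed

definition CC :: "'a vec3 set set" where "CC = {P \<in> pg2_points R. rbil M (rep P) (rep P) = \<zero>}"

lemma repC: "P \<in> CC \<Longrightarrow> P \<in> pg2_points R" "P \<in> CC \<Longrightarrow> rep P \<in> V3" "P \<in> CC \<Longrightarrow> rbil M (rep P) (rep P) = \<zero>"
  using rep(1)[of P] by (simp_all add: CC_def)

lemma three_conic_points:
  assumes "P \<in> CC" "Q \<in> CC" "Y \<in> CC" "P \<noteq> Q" "P \<noteq> Y" "Q \<noteq> Y" "a \<in> V3" "a \<noteq> zero3"
    "rdot a (rep P) = \<zero>" "rdot a (rep Q) = \<zero>" "rdot a (rep Y) = \<zero>"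
  shows False
  by (rule three_isotropic[OF repC(2)[OF assms(1)] repC(2)[OF assms(2)] repC(2)[OF assms(3)] assms(7-11)
    repC(3)[OF assms(1)] repC(3)[OF assms(2)] repC(3)[OF assms(3)]
    points_indep[OF repC(1)[OF assms(1)] repC(1)[OF assms(2)] assms(4)]
    points_indep[OF repC(1)[OF assms(1)] repC(1)[OF assms(3)] assms(5)]
    points_indep[OF repC(1)[OF assms(2)] repC(1)[OF assms(3)] assms(6)]])

lemma three_on_line:
  assumes "P \<in> CC" "Q \<in> CC" "Y \<in> CC" "P \<noteq> Q" "P \<noteq> Y" "Q \<noteq> Y" "l \<in> pg2_lines R" "P \<subseteq> l" "Q \<subseteq> l" "Y \<subseteq> l"
  shows False
  by (rule three_conic_points[OF assms(1-6) lform(1)[OF assms(7)] lform(2)[OF assms(7)]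
    iffD1[OF inc_iff[OF repC(1)[OF assms(1)] assms(7)] assms(8)]
    iffD1[OF inc_iff[OF repC(1)[OF assms(2)] assms(7)] assms(9)]
    iffD1[OF inc_iff[OF repC(1)[OF assms(3)] assms(7)] assms(10)]])

lemma line_eq:
  assumes "P \<in> pg2_points R" "Q \<in> pg2_points R" "P \<noteq> Q"
    and "l \<in> pg2_lines R" "P \<subseteq> l" "Q \<subseteq> l" and "k \<in> pg2_lines R" "P \<subseteq> k" "Q \<subseteq> k"
  shows "l = k"
proof -
  have e: "m = span2 (rep P) (rep Q)" if "m \<in> pg2_lines R" "P \<subseteq> m" "Q \<subseteq> m" for m
    by (rule line_unique[OF that(1) rep(1)[OF assms(1)] rep(1)[OF assms(2)] points_indep[OF assms(1-3)]
      iffD1[OF inc_iff[OF assms(1) that(1)] that(2)] iffD1[OF inc_iff[OF assms(2) that(1)] that(3)]])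
  show ?thesis using e[OF assms(4-6)] e[OF assms(7-9)] by simp
qed

lemma card_le2:
  assumes "\<And>x y z. x \<in> A \<Longrightarrow> y \<in> A \<Longrightarrow> z \<in> A \<Longrightarrow> x \<noteq> y \<Longrightarrow> x \<noteq> z \<Longrightarrow> y \<noteq> z \<Longrightarrow> False"
  shows "card A \<le> 2"
proof (rule ccontr)
  assume "\<not> ?thesis"
  then have "3 \<le> card A" by simp
  then obtain B where B: "B \<subseteq> A" "card B = 3" by (rule obtain_subset_with_card_n)
  then obtain x y z where "B = {x, y, z}" "x \<noteq> y" "y \<noteq> z" "x \<noteq> z" by (auto simp: card_3_iff)
  then show False using assms[of x y z] B by simp
qed

lemma card_line_le2:
  assumes l: "l \<in> pg2_lines R" and A: "\<And>x. x \<in> A \<Longrightarrow> x \<in> CC \<and> x \<subseteq> l"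
  shows "card A \<le> 2"
proof (rule card_le2)
  fix x y z assume h: "x \<in> A" "y \<in> A" "z \<in> A" "x \<noteq> y" "x \<noteq> z" "y \<noteq> z"
  show False
    by (rule three_on_line[OF conjunct1[OF A[OF h(1)]] conjunct1[OF A[OF h(2)]] conjunct1[OF A[OF h(3)]] h(4-6) l
      conjunct2[OF A[OF h(1)]] conjunct2[OF A[OF h(2)]] conjunct2[OF A[OF h(3)]]])
qed

lemma card_form_le2:
  assumes a: "a \<in> V3" "a \<noteq> zero3" and A: "\<And>x. x \<in> A \<Longrightarrow> x \<in> CC \<and> rdot a (rep x) = \<zero>"
  shows "card A \<le> 2"
proof (rule card_le2)
  fix x y z assume h: "x \<in> A" "y \<in> A" "z \<in> A" "x \<noteq> y" "x \<noteq> z" "y \<noteq> z"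
  show False
    by (rule three_conic_points[OF conjunct1[OF A[OF h(1)]] conjunct1[OF A[OF h(2)]] conjunct1[OF A[OF h(3)]] h(4-6) a
      conjunct2[OF A[OF h(1)]] conjunct2[OF A[OF h(2)]] conjunct2[OF A[OF h(3)]]])
qed

lemma finite_CC: "finite CC"
proof -
  have "P \<subseteq> V3" if "P \<in> pg2_points R" for P
  proof -
    have "pt (rep P) \<subseteq> V3" unfolding pt_def using rvec_closed(3)[OF _ rep(1)[OF that]] by blast
    then show ?thesis by (rule ord_eq_le_trans[OF rep(3)[OF that]])
  qed
  then have "CC \<subseteq> Pow V3" by (auto simp: CC_def)
  moreover have "finite V3" using finR by (simp add: V3_def)
  ultimately show ?thesis using finite_subset by blast
qed

text \<open>The lines from \<open>P\<close> to the other points of the conic are distinct, as no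
  three of its points are collinear. The bound is matched with the size of \<open>S\<close> in
  \<open>card_solo\<close>.\<close>

lemma card_CC:
  assumes "P \<in> CC"
  shows "card CC \<le> card (carrier R) + 2"
proof -
  define f where "f Q = (SOME l. l \<in> pg2_lines R \<and> P \<subseteq> l \<and> Q \<subseteq> l)" for Q
  have f: "f Q \<in> pg2_lines R" "P \<subseteq> f Q" "Q \<subseteq> f Q" if "Q \<in> CC - {P}" for Q
  proof -
    have "\<exists>l. l \<in> pg2_lines R \<and> P \<subseteq> l \<and> Q \<subseteq> l"
      using two_points_line[OF repC(1)[OF assms] repC(1)[of Q]] that by blast
    from someI_ex[OF this] show "f Q \<in> pg2_lines R" "P \<subseteq> f Q" "Q \<subseteq> f Q" unfolding f_def by blast+
  qed
  have "inj_on f (CC - {P})"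
  proof (rule inj_onI, rule ccontr)
    fix Q Y assume h: "Q \<in> CC - {P}" "Y \<in> CC - {P}" "f Q = f Y" "Q \<noteq> Y"
    show False by (rule three_on_line[of P Q Y "f Q"]) (use assms h f[OF h(1)] f(3)[OF h(2)] in auto)
  qed
  moreover have "f ` (CC - {P}) \<subseteq> {l \<in> pg2_lines R. P \<subseteq> l}" using f by blast
  moreover have "finite {l \<in> pg2_lines R. P \<subseteq> l}" using finite_lines by simp
  ultimately have "card (CC - {P}) \<le> card {l \<in> pg2_lines R. P \<subseteq> l}" using card_inj_on_le by blast
  also have "\<dots> = card (carrier R) + 1" by (rule card_lines_through[OF repC(1)[OF assms]])
  finally show ?thesis using card_Diff_singleton[OF assms] finite_CC assms by simp
qed

text \<open>\<open>Z\<close> is the reflection of \<open>Y\<close> in \<open>P\<close>, with the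
  vector B(p, p) y - 2 B(y, p) p. It is isotropic, lies on every line through \<open>P\<close> and
  \<open>Y\<close>, and differs from \<open>Y\<close> because \<open>Y\<close> is not on the polar
  of \<open>P\<close>.\<close>

lemma second_point:
  assumes Y: "Y \<in> CC" and P: "P \<in> pg2_points R" "P \<notin> CC" and nz: "rbil M (rep Y) (rep P) \<noteq> \<zero>"
  shows "\<exists>Z \<in> CC. Z \<noteq> Y \<and> (\<forall>l \<in> pg2_lines R. P \<subseteq> l \<longrightarrow> Y \<subseteq> l \<longrightarrow> Z \<subseteq> l)"
proof -
  define p y b h where "p = rep P" "y = rep Y" "b = rbil M y p" "h = rbil M p p"
  have V: "p \<in> V3" "y \<in> V3" unfolding p_y_b_h_def using rep(1)[OF P(1)] repC(2)[OF Y] by auto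
  have bh: "b \<in> carrier R" "h \<in> carrier R" "rbil M p y = b" "rbil M y p = b" "rbil M p p = h" "rbil M y y = \<zero>" "b \<noteq> \<zero>"
    using V sym repC(3)[OF Y] nz by (auto simp: p_y_b_h_def)
  define c where "c = \<ominus> (b \<oplus> b)"
  have c: "c \<in> carrier R" "c \<noteq> \<zero>" using bh double_zero[of b] by (auto simp: c_def)
  define z where "z = rplus (rscale h y) (rscale c p)"
  have z: "z \<in> V3" using V bh c by (simp add: z_def)
  have "rbil M z z = h \<otimes> (c \<otimes> b) \<oplus> (c \<otimes> (h \<otimes> b) \<oplus> c \<otimes> (c \<otimes> h))"
    using V bh(1-6) c(1) by (simp add: z_def bil_lin bil_lin' r_distr a_assoc)
  also have "\<dots> = \<zero>" unfolding c_def using bh(1,2) by algebra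
  finally have qz: "rbil M z z = \<zero>" .
  have "Y \<noteq> P" using P Y by auto
  then have "rcross y p \<noteq> zero3" using points_indep[OF repC(1)[OF Y] P(1)] by (simp add: p_y_b_h_def)
  then obtain x where x: "x \<in> V3" "rdet y p x \<noteq> \<zero>" using rdot_nonzero_ex[of "rcross y p"] V by (auto simp: rdet_def)
  have "rdot (rcross x y) z = c \<otimes> rdet x y p" using V x bh(1,2) c by (simp add: z_def rdot_linear rcross_orth rdet_def)
  moreover have "rdet x y p = rdet y p x" using rdet_swap(2)[of x y p] V x by simp
  ultimately have az: "rdot (rcross x y) z \<noteq> \<zero>" using integral[of c "rdet y p x"] c x V by auto
  have z0: "z \<noteq> zero3" using az x V by (auto simp: rdot_zero3)
  define Z where "Z = pt z"
  have Zp: "Z \<in> pg2_points R" unfolding Z_def pg2_points_conv using z z0 by blast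
  have "rep Z \<in> pt (rep Z)" unfolding pt_def using rep(1)[OF Zp] by (auto intro!: exI[of _ \<one>] simp: rvec_defs)
  then have "rep Z \<in> pt z" by (simp only: rep(3)[OF Zp, symmetric] Z_def[symmetric])
  then obtain e where e: "e \<in> carrier R" "rep Z = rscale e z" unfolding pt_def by blast
  have "Z \<in> CC" unfolding CC_def using Zp z e qz by (simp add: bil_lin bil_lin')
  moreover have "Z \<noteq> Y"
  proof
    assume "Z = Y"
    have "z \<in> pt z" unfolding pt_def using z by (auto intro!: exI[of _ \<one>] simp: rvec_defs)
    moreover have "pt y = pt z" unfolding p_y_b_h_def(2) rep(3)[OF repC(1)[OF Y], symmetric] using \<open>Z = Y\<close> by (simp add: Z_def)
    ultimately have "z \<in> pt y" by simp
    then obtain d where "d \<in> carrier R" "z = rscale d y" unfolding pt_def by blast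
    then have "rdot (rcross x y) z = \<zero>" using V x by (simp add: rdot_linear rcross_orth)
    then show False using az by simp
  qed
  moreover have "Z \<subseteq> l" if l: "l \<in> pg2_lines R" "P \<subseteq> l" "Y \<subseteq> l" for l
  proof -
    have "rdot (lform l) p = \<zero>" "rdot (lform l) y = \<zero>"
      using inc_iff[OF P(1) l(1)] inc_iff[OF repC(1)[OF Y] l(1)] l by (auto simp: p_y_b_h_def)
    then have "rdot (lform l) z = \<zero>" using V lform(1)[OF l(1)] bh(1,2) c by (simp add: z_def rdot_linear)
    from pt_kern[OF z lform(1)[OF l(1)] this] show ?thesis unfolding Z_def by (rule ord_le_eq_trans[OF _ lform(3)[OF l(1), symmetric]])
  qed
  ultimately show ?thesis by (intro bexI[of _ Z] conjI ballI impI) simp_all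
qed

definition Off :: "'a vec3 set set" where "Off = S - CC"

definition solo :: "'a vec3 set \<Rightarrow> 'a vec3 set set" where
  "solo P = {l \<in> pencil P. odd (line_deg l) \<and> {Q \<in> Off. Q \<subseteq> l} = {P}}"

text \<open>At most |Off| - 1 of the q + 1 lines through \<open>P\<close> contain another point of
  \<open>Off\<close>. If a remaining line has exactly one point of \<open>S\<close> on the conic,
  either this point is on the polar of \<open>P\<close>, which happens at most twice, or the second
  conic point is missing from \<open>S\<close>, which happens at most |Off| times since |CC| is at
  most q + 2 = |S|. All other lines have 0 or 2 points of \<open>S\<close> besides \<open>P\<close>,
  so their degree is odd; this leaves q - 2 |Off| lines.\<close>

lemma card_solo:
  assumes P: "P \<in> Off" and ne: "S \<inter> CC \<noteq> {}"
  shows "card (carrier R) \<le> card (solo P) + 2 * card Off"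
proof -
  have PS: "P \<in> S" "P \<notin> CC" "P \<in> pg2_points R" using P SP by (auto simp: Off_def)
  have finO: "finite Off" using finS by (simp add: Off_def)
  define Bad where "Bad = {Y \<in> S \<inter> CC. \<forall>Z \<in> S \<inter> CC. Z \<subseteq> line_through P Y \<longrightarrow> Z = Y}"
  have lP: "line_through P Y \<in> pg2_lines R" "P \<subseteq> line_through P Y" "Y \<subseteq> line_through P Y" if "Y \<in> S" "Y \<noteq> P" for Y
    using line_through[OF PS(1) that(1) that(2)[symmetric]] by blast+
  have cover: "pencil P \<subseteq> solo P \<union> (line_through P ` (Off - {P}) \<union> line_through P ` Bad)"
  proof
    fix l assume l: "l \<in> pencil P"
    then have lL: "l \<in> pg2_lines R" "P \<subseteq> l" by (auto simp: pencil_def)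
    have eq: "l = line_through P Y" if "Y \<in> S" "Y \<noteq> P" "Y \<subseteq> l" for Y
      using line_through_unique[OF PS(1) that(1) that(2)[symmetric] lL that(3)] .
    show "l \<in> solo P \<union> (line_through P ` (Off - {P}) \<union> line_through P ` Bad)"
    proof (cases "\<exists>Y \<in> Off - {P}. Y \<subseteq> l")
      case True
      then obtain Y where "Y \<in> Off - {P}" "Y \<subseteq> l" by blast
      then have "l \<in> line_through P ` (Off - {P})" using eq[of Y] by (auto simp: Off_def)
      then show ?thesis by blast
    next
      case False
      then have only: "{Q \<in> Off. Q \<subseteq> l} = {P}" using P lL by blast
      define K where "K = {Q \<in> S \<inter> CC. Q \<subseteq> l}"
      have finK: "finite K" using finS by (simp add: K_def)
      have "card K \<le> 2"
        by (rule card_line_le2[OF lL(1)]) (simp add: K_def)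
      have "{Q \<in> S. p Q} = {Q \<in> S - CC. p Q} \<union> {Q \<in> S \<inter> CC. p Q}" for p by blast
      from this[of "\<lambda>Q. Q \<subseteq> l"] have "{Q \<in> S. Q \<subseteq> l} = insert P K"
        unfolding only[unfolded Off_def] K_def by simp
      then have d: "line_deg l = card K + 1" using finK PS by (simp add: line_deg_def K_def)
      show ?thesis
      proof (cases "card K = 1")
        case True
        then obtain Y where Y: "K = {Y}" using card_1_singletonE by blast
        then have YK: "Y \<in> S \<inter> CC" "Y \<subseteq> l" by (auto simp: K_def)
        then have e: "l = line_through P Y" using eq[of Y] PS by auto
        have uniq: "Z = Y" if "Z \<in> S \<inter> CC" "Z \<subseteq> l" for Z
        proof -
          have "Z \<in> K" using that by (simp add: K_def)
          then show ?thesis by (simp add: Y)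
        qed
        have "Y \<in> Bad" unfolding Bad_def mem_Collect_eq e[symmetric]
        proof (intro conjI ballI impI)
          show "Y \<in> S \<inter> CC" by (rule YK(1))
          show "Z = Y" if "Z \<in> S \<inter> CC" "Z \<subseteq> l" for Z by (rule uniq[OF that])
        qed
        then show ?thesis using e by blast
      next
        case False
        then have "card K = 0 \<or> card K = 2" using \<open>card K \<le> 2\<close> by linarith
        then have "odd (line_deg l)" using d by auto
        then show ?thesis using l only by (simp add: solo_def)
      qed
    qed
  qed
  define B0 where "B0 = {Y \<in> CC. rdot (rmulv M (rep P)) (rep Y) = \<zero>}"
  have "rmulv M (rep P) \<noteq> zero3" using mulv_zero rep(1,2)[OF PS(3)] by blast
  then have B0: "card B0 \<le> 2"
    by (rule card_form_le2[OF mulv_closed[OF rep(1)[OF PS(3)]]]) (simp add: B0_def)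
  have second: "\<exists>Z. Z \<in> CC - S \<and> Z \<noteq> Y \<and> Z \<subseteq> line_through P Y" if Y: "Y \<in> Bad - B0" for Y
  proof -
    have YC: "Y \<in> CC" "Y \<in> S" "Y \<noteq> P" using Y PS by (auto simp: Bad_def)
    have "rbil M (rep Y) (rep P) \<noteq> \<zero>"
      using Y YC rdot_commute[OF mulv_closed[OF rep(1)[OF PS(3)]] repC(2)[OF YC(1)]] by (auto simp: B0_def rbil_def)
    from second_point[OF YC(1) PS(3,2) this] obtain Z where Z: "Z \<in> CC" "Z \<noteq> Y"
      and sub: "\<forall>l\<in>pg2_lines R. P \<subseteq> l \<longrightarrow> Y \<subseteq> l \<longrightarrow> Z \<subseteq> l" by (elim bexE conjE) (rule that)
    have Zl: "Z \<subseteq> line_through P Y" by (rule sub[rule_format, OF lP[OF YC(2,3)]])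
    have bad: "W = Y" if "W \<in> S \<inter> CC" "W \<subseteq> line_through P Y" for W using Y that by (simp add: Bad_def)
    have "Z \<notin> S"
    proof
      assume "Z \<in> S"
      then have "Z \<in> S \<inter> CC" using Z(1) by (rule IntI)
      from bad[OF this Zl] Z(2) show False by simp
    qed
    then show ?thesis by (intro exI[of _ Z] conjI DiffI Z Zl)
  qed
  define g where "g Y = (SOME Z. Z \<in> CC - S \<and> Z \<noteq> Y \<and> Z \<subseteq> line_through P Y)" for Y
  have g: "g Y \<in> CC" "g Y \<notin> S" "g Y \<noteq> Y" "g Y \<subseteq> line_through P Y" if "Y \<in> Bad - B0" for Y
    using someI_ex[OF second[OF that], folded g_def] by simp_all
  have "inj_on g (Bad - B0)"
  proof (rule inj_onI, rule ccontr)
    fix Y Y' assume h: "Y \<in> Bad - B0" "Y' \<in> Bad - B0" "g Y = g Y'" "Y \<noteq> Y'"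
    have Y: "Y \<in> CC" "Y \<in> S" "Y \<noteq> P" "Y' \<in> CC" "Y' \<in> S" "Y' \<noteq> P" using h PS by (auto simp: Bad_def)
    have gp: "P \<noteq> g Y" using PS g(2)[OF h(1)] by auto
    have "line_through P Y = line_through P Y'"
      by (rule line_eq[OF PS(3) repC(1)[OF g(1)[OF h(1)]] gp lP(1,2)[OF Y(2,3)] g(4)[OF h(1)] lP(1,2)[OF Y(5,6)]])
        (use g(4)[OF h(2)] h(3) in simp)
    then have "Y' \<subseteq> line_through P Y" using lP(3)[OF Y(5,6)] by simp
    moreover have "Y' \<noteq> g Y" using g(3)[OF h(2)] h(3) by auto
    ultimately show False
      by (intro three_on_line[OF Y(1) Y(4) g(1)[OF h(1)] h(4) g(3)[OF h(1), symmetric] _ lP(1)[OF Y(2,3)] lP(3)[OF Y(2,3)] _ g(4)[OF h(1)]])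
  qed
  moreover have "g ` (Bad - B0) \<subseteq> CC - S" by (rule image_subsetI) (simp add: g)
  ultimately have "card (Bad - B0) \<le> card (CC - S)" by (rule card_inj_on_le) (simp add: finite_CC)
  moreover have "card CC = card (CC - S) + card (S \<inter> CC)"
    using card_Int_Diff[OF finite_CC, of S] by (simp add: Int_commute)
  moreover have "card S = card Off + card (S \<inter> CC)"
    using card_Int_Diff[OF finS, of CC] by (simp add: Off_def)
  moreover obtain V where "V \<in> CC" using ne by blast
  then have "card CC \<le> card (carrier R) + 2" by (rule card_CC)
  ultimately have B1: "card (Bad - B0) \<le> card Off" using cS by linarith
  have finB: "finite Bad" "finite B0" using finS finite_CC by (auto simp: Bad_def B0_def)
  have "card Bad \<le> card ((Bad - B0) \<union> B0)" by (rule card_mono) (use finB in auto)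
  also have "\<dots> \<le> card (Bad - B0) + card B0" by (rule card_Un_le)
  finally have B: "card Bad \<le> card Off + 2" using B0 B1 by linarith
  have "card (pencil P) \<le> card (solo P \<union> (line_through P ` (Off - {P}) \<union> line_through P ` Bad))"
    by (rule card_mono[OF _ cover]) (use finO finB in \<open>auto simp: solo_def\<close>)
  also have "\<dots> \<le> card (solo P) + (card (line_through P ` (Off - {P})) + card (line_through P ` Bad))"
    using card_Un_le[of "solo P" "line_through P ` (Off - {P}) \<union> line_through P ` Bad"] card_Un_le[of "line_through P ` (Off - {P})" "line_through P ` Bad"] by linarith
  also have "\<dots> \<le> card (solo P) + (card (Off - {P}) + card Bad)"
    using card_image_le[of "Off - {P}" "line_through P"] card_image_le[of Bad "line_through P"] finO finB by simp
  finally have "card (pencil P) \<le> card (solo P) + (card (Off - {P}) + card Bad)" .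
  moreover have "card (pencil P) = card (carrier R) + 1" using lines_through[OF PS(1)] by (simp add: pencil_def)
  moreover have "card (Off - {P}) + 1 = card Off" using card_Suc_Diff1[OF finO P] by linarith
  ultimately show ?thesis using B by linarith
qed

text \<open>A line has at most two points on the conic, so three disjoint 3-secants supply three
  points of \<open>Off\<close>. With r = |Off| the disjoint sets \<open>solo\<close> give at least r
  (q - 2 r) odd secants, which is at least 3 q - 6 r and exceeds 2 q because 17 r < 2 q.\<close>

theorem odd_lines_large:
  assumes L: "L' \<subseteq> special" "card L' \<ge> 3" "disjoint_lines L'"
  shows "card odd_lines \<ge> 2 * card (carrier R)"
proof (rule ccontr)
  assume "\<not> ?thesis"
  then have o: "card odd_lines < 2 * card (carrier R)" by simp
  have finO: "finite Off" using finS by (simp add: Off_def)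
  have "Off \<subseteq> {P \<in> S. card (tangents P) > 16}"
  proof
    fix P assume P: "P \<in> Off"
    then have "P \<in> S" "rbil M (rep P) (rep P) \<noteq> \<zero>" using SP by (auto simp: Off_def CC_def)
    moreover have "\<not> card (tangents P) \<le> 16" using low calculation by blast
    ultimately show "P \<in> {P \<in> S. card (tangents P) > 16}" by simp
  qed
  then have "card Off \<le> card {P \<in> S. card (tangents P) > 16}" using finS by (intro card_mono) auto
  then have r17: "17 * card Off < 2 * card (carrier R)" using low_points[OF o] by linarith
  have ex: "\<exists>P. P \<in> Off \<and> P \<subseteq> l" if l: "l \<in> L'" for l
  proof (rule ccontr)
    assume n: "\<not> ?thesis"
    have "l \<in> pg2_lines R" "card {P \<in> S. P \<subseteq> l} = 3" using l L(1) by (auto simp: special_def line_deg_def)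
    moreover have "card {P \<in> S. P \<subseteq> l} \<le> 2"
      by (rule card_line_le2[OF calculation(1)]) (use n in \<open>auto simp: Off_def\<close>)
    ultimately show False by simp
  qed
  define f where "f l = (SOME P. P \<in> Off \<and> P \<subseteq> l)" for l
  have f: "f l \<in> Off \<and> f l \<subseteq> l" if "l \<in> L'" for l unfolding f_def by (rule someI_ex[OF ex[OF that]])
  have "inj_on f L'"
  proof (rule inj_onI, rule ccontr)
    fix l l' assume h: "l \<in> L'" "l' \<in> L'" "f l = f l'" "l \<noteq> l'"
    have "f l \<in> S" using f[OF h(1)] by (simp add: Off_def)
    from L(3)[unfolded disjoint_lines_def, rule_format, OF h(1,2,4) this]
    show False using f[OF h(1)] f[OF h(2)] h(3) by simp
  qed
  then have "card L' \<le> card Off" by (rule card_inj_on_le) (use f finO in auto)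
  then have r3: "card Off \<ge> 3" using L(2) by simp
  have "card S = card Off + card (S \<inter> CC)"
    using card_Int_Diff[OF finS, of CC] by (simp add: Off_def)
  then have "card (S \<inter> CC) \<noteq> 0" using cS r17 by linarith
  then have ne: "S \<inter> CC \<noteq> {}" by auto
  have "card (\<Union>P\<in>Off. solo P) = (\<Sum>P\<in>Off. card (solo P))"
  proof (rule card_UN_disjoint[OF finO])
    show "\<forall>P\<in>Off. finite (solo P)" by (simp add: solo_def)
    show "\<forall>P\<in>Off. \<forall>Q\<in>Off. P \<noteq> Q \<longrightarrow> solo P \<inter> solo Q = {}" 
    proof (intro ballI impI equals0I)
      fix P Q l assume h: "P \<noteq> Q" "l \<in> solo P \<inter> solo Q"
      have l: "l \<in> solo P" "l \<in> solo Q" using h(2) by blast+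
      have "{Y \<in> Off. Y \<subseteq> l} = {P}" using l(1) by (simp add: solo_def)
      moreover have "{Y \<in> Off. Y \<subseteq> l} = {Q}" using l(2) by (simp add: solo_def)
      ultimately have "{P} = {Q}" by (rule trans[OF HOL.sym])
      then show False using h(1) by simp
    qed
  qed
  moreover have "card (\<Union>P\<in>Off. solo P) \<le> card odd_lines"
    by (rule card_mono) (use finL in \<open>auto simp: solo_def odd_lines_def pencil_def\<close>)
  ultimately have "(\<Sum>P\<in>Off. card (solo P)) \<le> card odd_lines" by simp
  moreover have "(\<Sum>P\<in>Off. card (carrier R) - 2 * card Off) \<le> (\<Sum>P\<in>Off. card (solo P))"
    by (rule sum_mono) (use card_solo[OF _ ne] in \<open>simp add: le_diff_conv\<close>)
  moreover have "(\<Sum>P\<in>Off. card (carrier R) - 2 * card Off) = card Off * (card (carrier R) - 2 * card Off)" by simp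
  moreover have "3 * (card (carrier R) - 2 * card Off) \<le> card Off * (card (carrier R) - 2 * card Off)" using r3 by simp
  ultimately show False using o r17 r3 by linarith
qed

end

section \<open>Counterexamples restated as certificates in vectors\<close>

context cring
begin

text \<open>The set \<open>S\<close> has disappeared: only field equations and inequalities between
  vectors remain, which pass to the ultraproduct one at a time. From index \<open>m\<close> on the
  sequences are padded, so only closure and the two incidences are asserted for all
  \<open>i\<close>.\<close>

definition vcert :: "nat \<Rightarrow> (nat \<Rightarrow> 'a vec3) \<Rightarrow> (nat \<Rightarrow> 'a vec3) \<Rightarrow> (nat \<Rightarrow> 'a vec3) \<Rightarrow> bool" where
  "vcert m v t s \<longleftrightarrow>
    (\<forall>i. v i \<in> V3 \<and> t i \<in> V3 \<and> s i \<in> V3 \<and> rdot (t i) (v i) = \<zero> \<and> rdot (s i) (v i) = \<zero>) \<and>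
    (\<forall>i<m. rcross (t i) (s i) \<noteq> zero3) \<and>
    (\<forall>i<m. \<forall>j<m. i \<noteq> j \<longrightarrow> rdot (t i) (v j) \<noteq> \<zero> \<and> rdot (s i) (v j) \<noteq> \<zero>) \<and>
    (\<forall>i<m. \<forall>j<m. \<forall>k<m. i \<noteq> j \<longrightarrow> j \<noteq> k \<longrightarrow> k \<noteq> i \<longrightarrow> rdet (v i) (v j) (v k) \<noteq> \<zero> \<and>
      (rdot (t i) (v k) \<otimes> rdot (s i) (v j)) \<otimes> (rdot (t j) (v i) \<otimes> rdot (s j) (v k)) \<otimes> (rdot (t k) (v j) \<otimes> rdot (s k) (v i)) =
      \<ominus> ((rdot (t i) (v j) \<otimes> rdot (s i) (v k)) \<otimes> (rdot (t j) (v k) \<otimes> rdot (s j) (v i)) \<otimes> (rdot (t k) (v i) \<otimes> rdot (s k) (v j))))"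

definition fprod :: "nat \<Rightarrow> (nat \<Rightarrow> 'a vec3) \<Rightarrow> 'a vec3 \<Rightarrow> 'a" where
  "fprod d g x = finprod R (\<lambda>j. rdot (g j) x) {..<d}"

text \<open>\<open>ex i\<close> stands for the 3-secant of index \<open>i\<close> passing through
  the point \<open>p\<close>; since these 3-secants are disjoint in \<open>S\<close>, this happens
  for at most one index below \<open>m\<close>.\<close>

definition vlow :: "nat \<Rightarrow> (nat \<Rightarrow> 'a vec3) \<Rightarrow> (nat \<Rightarrow> 'a vec3) \<Rightarrow> (nat \<Rightarrow> 'a vec3) \<Rightarrow> 'a vec3 \<Rightarrow>
    nat \<Rightarrow> (nat \<Rightarrow> 'a vec3) \<Rightarrow> (nat \<Rightarrow> 'a vec3) \<Rightarrow> (nat \<Rightarrow> bool) \<Rightarrow> bool" where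
  "vlow m v t s p d g k ex \<longleftrightarrow>
    (\<forall>j. g j \<in> V3 \<and> k j \<in> V3) \<and> (\<forall>j<d. rdot (g j) p = \<zero> \<and> rdot (k j) p = \<zero>) \<and>
    (\<forall>i<m. \<forall>j<m. ex i \<longrightarrow> ex j \<longrightarrow> i = j) \<and>
    (\<forall>i<m. \<not> ex i \<longrightarrow> fprod d k (v i) \<noteq> \<zero> \<and> fprod d g (v i) \<noteq> \<zero> \<and> rdot (t i) p \<noteq> \<zero> \<and> rdot (s i) p \<noteq> \<zero>) \<and>
    (\<forall>i<m. \<forall>l<m. \<not> ex i \<longrightarrow> \<not> ex l \<longrightarrow> i \<noteq> l \<longrightarrow>
      (fprod d g (v l) \<otimes> fprod d k (v i)) \<otimes> (rdot (t i) p \<otimes> rdot (s i) (v l)) \<otimes> (rdot (t l) (v i) \<otimes> rdot (s l) p) =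
      \<ominus> ((fprod d g (v i) \<otimes> fprod d k (v l)) \<otimes> (rdot (t i) (v l) \<otimes> rdot (s i) p) \<otimes> (rdot (t l) p \<otimes> rdot (s l) (v i))))"

definition symmetric_form :: "'a vec3 \<times> 'a vec3 \<times> 'a vec3 \<Rightarrow> bool" where
  "symmetric_form M \<longleftrightarrow> fst M \<in> V3 \<and> fst (snd M) \<in> V3 \<and> snd (snd M) \<in> V3 \<and>
    (\<forall>u\<in>V3. \<forall>w\<in>V3. rbil M u w = rbil M w u) \<and> rdet (fst M) (fst (snd M)) (snd (snd M)) \<noteq> \<zero>"

end

context segre
begin

text \<open>\<open>B\<close> consists of the points of \<open>S\<close> on at most 16 tangents. For
  n at least 18 there are three disjoint 3-secants, so by \<open>odd_lines_large\<close> no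
  nondegenerate conic contains \<open>B\<close>.\<close>

lemma witness:
  assumes o: "real (card odd_lines) < 2 * real (card (carrier R)) - real n"
  shows "\<exists>v t s B. vcert (n div 6) v t s \<and> B \<subseteq> V3 \<and> (\<forall>p\<in>B. \<exists>d g k ex. d \<le> 16 \<and> vlow (n div 6) v t s p d g k ex) \<and>
    (n \<ge> 18 \<longrightarrow> \<not> (\<exists>M. symmetric_form M \<and> (\<forall>p\<in>B. rbil M p p = \<zero>)))"
proof -
  define m where "m = n div 6"
  obtain c where c: "cert m c" using certificate[OF o] unfolding m_def by blast
  define A t s where "A i = fst (c i)" "t i = fst (snd (c i))" "s i = snd (snd (c i))" for i
  have all: "A i \<in> S \<and> t i \<in> pg2_lines R \<and> s i \<in> pg2_lines R \<and> A i \<subseteq> t i \<and> A i \<subseteq> s i \<and> t i \<noteq> s i \<and>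
      (\<forall>Q\<in>S. N (A i) Q = lval (t i) Q \<and> D (A i) Q = lval (s i) Q) \<and> (\<forall>Q\<in>S. Q \<noteq> A i \<longrightarrow> \<not> Q \<subseteq> s i \<longrightarrow> bis (A i) Q)" if "i < m" for i
    using conjunct1[OF c[unfolded cert_def], rule_format, OF that] unfolding A_t_s_def case_prod_beta .
  have disj: "\<not> (Q \<subseteq> s i \<and> Q \<subseteq> s j)" if "i < m" "j < m" "i \<noteq> j" "Q \<in> S" for i j Q
    using conjunct2[OF c[unfolded cert_def], rule_format, OF that] unfolding A_t_s_def by simp
  have in_: "A i \<in> S" "t i \<in> pg2_lines R" "s i \<in> pg2_lines R" "A i \<subseteq> t i" "A i \<subseteq> s i" "t i \<noteq> s i" if "i < m" for i
    using all[OF that] by simp_all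
  have ND: "N (A i) Q = lval (t i) Q" "D (A i) Q = lval (s i) Q" if "i < m" "Q \<in> S" for i Q
    using all[OF that(1)] that(2) by simp_all
  have b: "bis (A i) Q" "Q \<noteq> A i" if "i < m" "Q \<in> S" "\<not> Q \<subseteq> s i" for i Q
  proof -
    show ne: "Q \<noteq> A i" using in_(5)[OF that(1)] that(3) by metis
    from all[OF that(1)] have "\<forall>Q\<in>S. Q \<noteq> A i \<longrightarrow> \<not> Q \<subseteq> s i \<longrightarrow> bis (A i) Q" by (elim conjE)
    from this[rule_format, OF that(2) ne that(3)] show "bis (A i) Q" .
  qed
  have off: "\<not> A j \<subseteq> s i" if "i < m" "j < m" "i \<noteq> j" for i j
    using disj[OF that in_(1)[OF that(2)]] in_(5)[OF that(2)] by simp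
  have bA: "bis (A i) (A j)" "A j \<noteq> A i" if "i < m" "j < m" "i \<noteq> j" for i j
    using b[OF that(1) in_(1)[OF that(2)] off[OF that]] by simp_all
  define v where "v i = (if i < m then rep (A i) else zero3)" for i
  define t' where "t' i = (if i < m then lform (t i) else zero3)" for i
  define s' where "s' i = (if i < m then lform (s i) else zero3)" for i
  have lv: "rdot (t' i) (rep Q) = lval (t i) Q" "rdot (s' i) (rep Q) = lval (s i) Q" if "i < m" for i Q
    using that by (simp_all add: t'_def s'_def lval_def)
  have lvv: "rdot (t' i) (v j) = N (A i) (A j)" "rdot (s' i) (v j) = D (A i) (A j)" if "i < m" "j < m" for i j
    using lv[OF that(1), of "A j"] ND[OF that(1) in_(1)[OF that(2)]] that by (simp_all add: v_def)
  have lvp: "rdot (t' i) (rep Q) = N (A i) Q" "rdot (s' i) (rep Q) = D (A i) Q" if "i < m" "Q \<in> S" for i Q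
    using lv[OF that(1), of Q] ND[OF that] by simp_all
  have "vcert m v t' s'"
    unfolding vcert_def
  proof (intro conjI allI impI)
    show V: "v i \<in> V3" "t' i \<in> V3" "s' i \<in> V3" for i using repS(1) in_ lform(1) by (simp_all add: v_def t'_def s'_def)
    show "rdot (t' i) (v i) = \<zero>" "rdot (s' i) (v i) = \<zero>" for i
    proof (atomize (full), cases "i < m")
      case True
      have "lval (t i) (A i) = \<zero>" "lval (s i) (A i) = \<zero>"
        using lval_0[OF in_(1)[OF True]] in_[OF True] by blast+
      then show "rdot (t' i) (v i) = \<zero> \<and> rdot (s' i) (v i) = \<zero>" using lv[OF True, of "A i"] True by (simp add: v_def)
    qed (simp add: v_def t'_def s'_def rdot_zero3)
    show "rcross (t' i) (s' i) \<noteq> zero3" if "i < m" for i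
      using forms_independent[OF in_(2,3,6)[OF that]] that by (simp add: t'_def s'_def)
    show "rdot (t' i) (v j) \<noteq> \<zero>" "rdot (s' i) (v j) \<noteq> \<zero>" if h: "i < m" "j < m" "i \<noteq> j" for i j
      unfolding lvv[OF h(1,2)] by (rule N_nz[OF in_(1)[OF h(1)] in_(1)[OF h(2)] bA(2)[OF h, symmetric]], rule D_nz[OF bA(1)[OF h]])
  next
    fix i j k assume h: "i < m" "j < m" "k < m" "i \<noteq> j" "j \<noteq> k" "k \<noteq> i"
    have "\<not> A k \<subseteq> line_through (A i) (A j)"
      using bis_only[OF bA(1)[OF h(1,2,4)] in_(1)[OF h(3)]] bA(2)[OF h(1,3) h(6)[symmetric]] bA(2)[OF h(2,3,5)] by blast
    from det_nz[OF in_(1)[OF h(1)] in_(1)[OF h(2)] in_(1)[OF h(3)] bA(2)[OF h(1,2,4), symmetric] this]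
    show "rdet (v i) (v j) (v k) \<noteq> \<zero>" using h by (simp add: v_def)
    show "(rdot (t' i) (v k) \<otimes> rdot (s' i) (v j)) \<otimes> (rdot (t' j) (v i) \<otimes> rdot (s' j) (v k)) \<otimes> (rdot (t' k) (v j) \<otimes> rdot (s' k) (v i)) =
      \<ominus> ((rdot (t' i) (v j) \<otimes> rdot (s' i) (v k)) \<otimes> (rdot (t' j) (v k) \<otimes> rdot (s' j) (v i)) \<otimes> (rdot (t' k) (v i) \<otimes> rdot (s' k) (v j)))"
      unfolding lvv[OF h(1,2)] lvv[OF h(1,3)] lvv[OF h(2,1)] lvv[OF h(2,3)] lvv[OF h(3,1)] lvv[OF h(3,2)]
      by (rule segre[OF bA(1)[OF h(1,2,4)] bA(1)[OF h(2,3,5)] bA(1)[OF h(3,1,6)]])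
  qed
  moreover have "\<exists>d g k ex. d \<le> 16 \<and> vlow m v t' s' (rep P) d g k ex" if P: "P \<in> S" "card (tangents P) \<le> 16" for P
  proof -
    define d where "d = card (tangents P)"
    have "\<exists>g. (\<forall>j. g j \<in> V3) \<and> (\<forall>j<d. rdot (g j) (rep P) = \<zero>) \<and>
        (\<forall>Q\<in>S. finprod R (\<lambda>l. lval l Q) (tangents P) = finprod R (\<lambda>j. rdot (g j) (rep Q)) {..<d})"
      by (rule enumerate_forms[OF P(1) _ d_def[symmetric]]) (simp_all add: tangents_def finL)
    then obtain g where g: "\<forall>j. g j \<in> V3" "\<forall>j<d. rdot (g j) (rep P) = \<zero>"
        "\<forall>Q\<in>S. finprod R (\<lambda>l. lval l Q) (tangents P) = finprod R (\<lambda>j. rdot (g j) (rep Q)) {..<d}"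
      by (elim exE conjE) (rule that)
    have cU: "card (U P) = d" using U(2)[OF P(1)] by (simp add: d_def)
    have Ul: "line_through P y \<in> pg2_lines R \<and> P \<subseteq> line_through P y" if "y \<in> U P" for y
      using line_through(1,2)[OF P(1), of y] U(1)[OF P(1)] that by blast
    have "\<exists>k. (\<forall>j. k j \<in> V3) \<and> (\<forall>j<d. rdot (k j) (rep P) = \<zero>) \<and>
        (\<forall>Q\<in>S. finprod R (\<lambda>y. lval (line_through P y) Q) (U P) = finprod R (\<lambda>j. rdot (k j) (rep Q)) {..<d})"
      by (rule enumerate_forms[OF P(1) finite_U[OF P(1)] cU Ul])
    then obtain k where k: "\<forall>j. k j \<in> V3" "\<forall>j<d. rdot (k j) (rep P) = \<zero>"
        "\<forall>Q\<in>S. finprod R (\<lambda>y. lval (line_through P y) Q) (U P) = finprod R (\<lambda>j. rdot (k j) (rep Q)) {..<d}"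
      by (elim exE conjE) (rule that)
    have fp: "fprod d g (v i) = N P (A i)" "fprod d k (v i) = D P (A i)" if "i < m" for i
      using g(3)[rule_format, OF in_(1)[OF that]] k(3)[rule_format, OF in_(1)[OF that]] that
      by (simp_all add: fprod_def v_def N_def D_def)
    define ex where "ex i \<longleftrightarrow> P \<subseteq> s i" for i
    have "vlow m v t' s' (rep P) d g k ex"
      unfolding vlow_def
    proof (intro conjI allI impI)
      show "g j \<in> V3" "k j \<in> V3" for j using g k by blast+
      show "rdot (g j) (rep P) = \<zero>" "rdot (k j) (rep P) = \<zero>" if "j < d" for j using g k that by blast+
      show "i = j" if "i < m" "j < m" "ex i" "ex j" for i j using disj[OF that(1,2) _ P(1)] that(3,4) by (auto simp: ex_def)
      fix i assume h: "i < m" "\<not> ex i"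
      note bi = b[OF h(1) P(1) h(2)[unfolded ex_def]]
      show "fprod d g (v i) \<noteq> \<zero>" "fprod d k (v i) \<noteq> \<zero>" "rdot (t' i) (rep P) \<noteq> \<zero>" "rdot (s' i) (rep P) \<noteq> \<zero>"
        unfolding fp[OF h(1)] lvp[OF h(1) P(1)]
        by (rule N_nz[OF P(1) in_(1)[OF h(1)] bi(2)], rule D_nz[OF bis_sym[OF bi(1)]],
            rule N_nz[OF in_(1)[OF h(1)] P(1) bi(2)[symmetric]], rule D_nz[OF bi(1)])
    next
      fix i l assume h: "i < m" "l < m" "\<not> ex i" "\<not> ex l" "i \<noteq> l"
      note bi = b[OF h(1) P(1) h(3)[unfolded ex_def]] b[OF h(2) P(1) h(4)[unfolded ex_def]]
      show "(fprod d g (v l) \<otimes> fprod d k (v i)) \<otimes> (rdot (t' i) (rep P) \<otimes> rdot (s' i) (v l)) \<otimes> (rdot (t' l) (v i) \<otimes> rdot (s' l) (rep P)) =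
        \<ominus> ((fprod d g (v i) \<otimes> fprod d k (v l)) \<otimes> (rdot (t' i) (v l) \<otimes> rdot (s' i) (rep P)) \<otimes> (rdot (t' l) (rep P) \<otimes> rdot (s' l) (v i)))"
        unfolding fp[OF h(1)] fp[OF h(2)] lvp[OF h(1) P(1)] lvp[OF h(2) P(1)] lvv[OF h(1,2)] lvv[OF h(2,1)]
        by (rule segre[OF bis_sym[OF bi(1)] bA(1)[OF h(1,2,5)] bi(3)])
    qed
    then show ?thesis using P(2) unfolding d_def by blast
  qed
  moreover have "\<not> (\<exists>M. symmetric_form M \<and> (\<forall>p\<in>rep ` {P \<in> S. card (tangents P) \<le> 16}. rbil M p p = \<zero>))" if n18: "n \<ge> 18"
  proof (intro notI, elim exE conjE)
    fix M assume M: "symmetric_form M" and z: "\<forall>p\<in>rep ` {P \<in> S. card (tangents P) \<le> 16}. rbil M p p = \<zero>"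
    have "real (card odd_lines) < 2 * real (card (carrier R)) - 6 * real 3" using o n18 by linarith
    from matching[OF card_nuclei this] obtain L' where L': "L' \<subseteq> special" "card L' \<ge> 3" "disjoint_lines L'" by blast
    interpret conic_cover R S M
      by unfold_locales (use M z in \<open>auto simp: symmetric_form_def\<close>)
    have "card odd_lines \<ge> 2 * card (carrier R)" by (rule odd_lines_large[OF L'])
    then show False using o by linarith
  qed
  ultimately show ?thesis
    unfolding m_def[symmetric]
    by (intro exI[of _ v] exI[of _ t'] exI[of _ s'] exI[of _ "rep ` {P \<in> S. card (tangents P) \<le> 16}"] conjI)
      (auto simp: repS(1) simp del: split_paired_Ex split_paired_All)
qed

end

section \<open>The ultraproduct of the counterexamples\<close>

text \<open>Segre's relation as it comes from \<open>segre\<close>, before the scaling that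
  \<open>low_point_data\<close> presupposes; \<open>cross_relation\<close> passes from one to the
  other.\<close>

definition raw_low ::
    "(nat \<Rightarrow> 'a::field vec3) \<Rightarrow> (nat \<Rightarrow> 'a vec3) \<Rightarrow> (nat \<Rightarrow> 'a vec3) \<Rightarrow> 'a vec3 \<Rightarrow>
      nat set \<Rightarrow> nat \<Rightarrow> (nat \<Rightarrow> 'a vec3) \<Rightarrow> (nat \<Rightarrow> 'a vec3) \<Rightarrow> bool" where
  "raw_low v t s p E d g k \<longleftrightarrow> finite E \<and> (\<forall>j<d. vdot (g j) p = 0 \<and> vdot (k j) p = 0) \<and>
     (\<forall>i. i \<notin> E \<longrightarrow> (\<Prod>j<d. vdot (k j) (v i)) \<noteq> 0 \<and> (\<Prod>j<d. vdot (g j) (v i)) \<noteq> 0 \<and>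
        vdot (t i) p \<noteq> 0 \<and> vdot (s i) p \<noteq> 0) \<and>
     (\<forall>i l. i \<notin> E \<longrightarrow> l \<notin> E \<longrightarrow> i \<noteq> l \<longrightarrow>
        ((\<Prod>j<d. vdot (g j) (v l)) * (\<Prod>j<d. vdot (k j) (v i))) * (vdot (t i) p * vdot (s i) (v l)) *
          (vdot (t l) (v i) * vdot (s l) p) =
        - (((\<Prod>j<d. vdot (g j) (v i)) * (\<Prod>j<d. vdot (k j) (v l))) * (vdot (t i) (v l) * vdot (s i) p) *
          (vdot (t l) p * vdot (s l) (v i))))"

lemma cross_relation:
  fixes a b e f ci cl :: "'a::field"
  assumes "gl * ki * (x * e) * (f * y) = - (gi * kl * (a * z) * (w * b))"
    and "ci * a * b = - (e * (cl * f))" "cl * f \<noteq> 0" "e \<noteq> 0" "ci \<noteq> 0" "cl \<noteq> 0"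
  shows "gi * kl * ((cl * w) * z) = gl * ki * ((ci * x) * y)"
proof -
  have "(e * (cl * f)) * (gl * ki * ((ci * x) * y)) = ci * cl * (gl * ki * (x * e) * (f * y))" by (simp add: algebra_simps)
  also have "\<dots> = - (gi * kl * ((cl * w) * z) * (ci * a * b))" unfolding assms(1) by (simp add: algebra_simps)
  also have "\<dots> = (e * (cl * f)) * (gi * kl * ((cl * w) * z))" unfolding assms(2) by (simp add: algebra_simps)
  finally show ?thesis using assms(3,4) by simp
qed

text \<open>The factor \<open>c i\<close> is chosen so that the relation of \<open>config\<close>
  holds between \<open>i\<close> and 0. Segre's lemma for 0, \<open>i\<close>, \<open>j\<close> then
  yields it between \<open>i\<close> and \<open>j\<close>.\<close>

lemma raw_conic:
  fixes v t s :: "nat \<Rightarrow> 'a::field vec3"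
  assumes two: "(2 :: 'a) \<noteq> 0"
    and self: "\<And>i. vdot (t i) (v i) = 0" "\<And>i. vdot (s i) (v i) = 0"
    and nz: "\<And>i j. i \<noteq> j \<Longrightarrow> vdot (t i) (v j) \<noteq> 0" "\<And>i j. i \<noteq> j \<Longrightarrow> vdot (s i) (v j) \<noteq> 0"
    and indep: "\<And>i. vcross (t i) (s i) \<noteq> 0"
    and arc: "\<And>i j k. i \<noteq> j \<Longrightarrow> i \<noteq> k \<Longrightarrow> j \<noteq> k \<Longrightarrow> vdet (v i) (v j) (v k) \<noteq> 0"
    and tri: "\<And>i j k. i \<noteq> j \<Longrightarrow> j \<noteq> k \<Longrightarrow> k \<noteq> i \<Longrightarrow>
      (vdot (t i) (v k) * vdot (s i) (v j)) * (vdot (t j) (v i) * vdot (s j) (v k)) * (vdot (t k) (v j) * vdot (s k) (v i)) =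
      - ((vdot (t i) (v j) * vdot (s i) (v k)) * (vdot (t j) (v k) * vdot (s j) (v i)) * (vdot (t k) (v i) * vdot (s k) (v j)))"
  shows "\<exists>M. (\<forall>u w. bil M u w = bil M w u) \<and> vdet (fst M) (fst (snd M)) (snd (snd M)) \<noteq> 0 \<and>
    (\<forall>p E d g k. raw_low v t s p E d g k \<longrightarrow> bil M p p = 0)"
proof -
  define c where "c i = (if i = 0 then 1 else - (vdot (s i) (v 0) * vdot (t 0) (v i)) / (vdot (t i) (v 0) * vdot (s 0) (v i)))" for i
  have c0: "c i \<noteq> 0" for i using nz[of i 0] nz[of 0 i] by (simp add: c_def)
  define t' where "t' i = vscale (c i) (t i)" for i
  have t': "vdot (t' i) x = c i * vdot (t i) x" for i x by (simp add: t'_def vdot_scale)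
  have rel: "c i * vdot (t i) (v j) * vdot (s j) (v i) = - (vdot (s i) (v j) * (c j * vdot (t j) (v i)))" if ij: "i \<noteq> j" for i j
  proof -
    consider "i = 0" | "j = 0" "i \<noteq> 0" | "i \<noteq> 0" "j \<noteq> 0" by blast
    then show ?thesis
    proof cases
      case 3
      define a b e f where "a = vdot (t i) (v 0)" "b = vdot (s 0) (v i)" "e = vdot (s i) (v 0)" "f = vdot (t 0) (v i)"
      define a' b' e' f' where "a' = vdot (t j) (v 0)" "b' = vdot (s 0) (v j)" "e' = vdot (s j) (v 0)" "f' = vdot (t 0) (v j)"
      define x y z w where "x = vdot (t i) (v j)" "y = vdot (s j) (v i)" "z = vdot (s i) (v j)" "w = vdot (t j) (v i)"
      have n: "a \<noteq> 0" "b \<noteq> 0" "a' \<noteq> 0" "b' \<noteq> 0" using nz 3 by (auto simp: a_b_e_f_def a'_b'_e'_f'_def)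
      have "(f' * b) * (a * z) * (w * e') = - ((f * b') * (x * e) * (a' * y))"
        using tri[of 0 i j] 3 ij by (simp add: a_b_e_f_def a'_b'_e'_f'_def x_y_z_w_def)
      then have "(e * f) * x * y * (a' * b') = - (z * w * (e' * f') * (a * b))" by (simp add: algebra_simps)
      moreover have "c i * (a * b) = - (e * f)" "c j * (a' * b') = - (e' * f')"
        using 3 n by (simp_all add: c_def a_b_e_f_def[symmetric] a'_b'_e'_f'_def[symmetric])
      ultimately have "(c i * (a * b)) * x * y * (a' * b') = - (z * w * (c j * (a' * b')) * (a * b))" by simp
      then have "(a * b * a' * b') * (c i * x * y) = (a * b * a' * b') * (- (z * (c j * w)))" by (simp add: algebra_simps)
      moreover have "a * b * a' * b' \<noteq> 0" using n by simp
      ultimately have "c i * x * y = - (z * (c j * w))" using mult_left_cancel by blast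
      then show ?thesis by (simp add: x_y_z_w_def)
    qed (use ij nz in \<open>auto simp: c_def\<close>)
  qed
  have "config v t' s"
  proof (unfold_locales, unfold t')
    show "vcross (t' i) (s i) \<noteq> 0" for i using indep[of i] c0 by (simp add: t'_def vcross_scale vscale_eq_0)
    show "c i * vdot (t i) (v j) * vdot (s j) (v i) + vdot (s i) (v j) * (c j * vdot (t j) (v i)) = 0" if "i \<noteq> j" for i j
      using rel[OF that] by simp
  qed (use two self nz arc c0 in auto)
  from config.conic_exists[OF this] obtain M where M: "\<forall>u w. bil M u w = bil M w u"
    "vdet (fst M) (fst (snd M)) (snd (snd M)) \<noteq> 0" "\<forall>p. low_point v t' s p \<longrightarrow> bil M p p = 0"
    unfolding conic_conclusion_def by blast
  have "low_point v t' s p" if L: "raw_low v t s p E d g k" for p E d g k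
  proof -
    have "low_point_data v t' s p E d g k"
      unfolding low_point_data_def
    proof (intro conjI allI impI)
      fix i l assume h: "i \<notin> E" "l \<notin> E" "i \<noteq> l"
      show "(\<Prod>j<d. vdot (g j) (v i)) * (\<Prod>j<d. vdot (k j) (v l)) * (vdot (t' l) p * vdot (s i) p) =
          (\<Prod>j<d. vdot (g j) (v l)) * (\<Prod>j<d. vdot (k j) (v i)) * (vdot (t' i) p * vdot (s l) p)"
        unfolding t'
        by (rule cross_relation[OF _ rel[OF h(3)]]) (use L h nz c0 in \<open>auto simp: raw_low_def\<close>)
    qed (use L c0 in \<open>auto simp: raw_low_def t'\<close>)
    then show ?thesis unfolding low_point_def by blast
  qed
  then show ?thesis using M by blast
qed

section \<open>The ultraproduct of the fields of the counterexamples\<close>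

definition cex :: "nat \<Rightarrow> nat ring \<Rightarrow> nat vec3 set set \<Rightarrow> bool" where
  "cex n F S \<longleftrightarrow> segre F S \<and> real (card (odd_secants F S)) < 2 * real (card (carrier F)) - real n"

lemma nat_field_exists: "\<exists>F :: nat ring. field F"
proof -
  interpret residues_prime 3 "residue_ring 3" by unfold_locales simp_all
  show ?thesis using finite_field_nat_copy[OF is_field finite] by blast
qed

text \<open>The type of the ultraproduct cannot depend on the assumption of a proof by
  contradiction. So a field is chosen for every \<open>n\<close> unconditionally, and it carries a
  counterexample whenever some field does.\<close>

definition Fs :: "nat \<Rightarrow> nat ring" where
  "Fs n = (SOME F. field F \<and> ((\<exists>G S. cex n G S) \<longrightarrow> (\<exists>S. cex n F S)))"

lemma Fs: "field (Fs n) \<and> ((\<exists>G S. cex n G S) \<longrightarrow> (\<exists>S. cex n (Fs n) S))"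
  unfolding Fs_def
proof (rule someI_ex, cases "\<exists>G S. cex n G S")
  case True
  then obtain G S where "cex n G S" by blast
  then show "\<exists>F. field F \<and> ((\<exists>G S. cex n G S) \<longrightarrow> (\<exists>S. cex n F S))"
    unfolding cex_def segre_def fin_field_def by blast
next
  case False
  then show "\<exists>F. field F \<and> ((\<exists>G S. cex n G S) \<longrightarrow> (\<exists>S. cex n F S))" using nat_field_exists by blast
qed

lemma field_Fs: "field (Fs n)" using Fs by blast

interpretation FF: cring "Fs n" for n by (rule fieldE(1)[OF field_Fs])

text \<open>Representatives in the ultraproduct are arbitrary sequences of numbers; entries outside
  the carrier count as zero.\<close>

definition nf :: "nat \<Rightarrow> nat \<Rightarrow> nat" where "nf n x = (if x \<in> carrier (Fs n) then x else \<zero>\<^bsub>Fs n\<^esub>)"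

lemma nf_in [simp]: "nf n x \<in> carrier (Fs n)" by (simp add: nf_def)
lemma nf_id [simp]: "x \<in> carrier (Fs n) \<Longrightarrow> nf n x = x" by (simp add: nf_def)

lemma field_inv: "x \<in> carrier (Fs n) \<Longrightarrow> x \<noteq> \<zero>\<^bsub>Fs n\<^esub> \<Longrightarrow> inv\<^bsub>Fs n\<^esub> x \<in> carrier (Fs n) \<and> inv\<^bsub>Fs n\<^esub> x \<otimes>\<^bsub>Fs n\<^esub> x = \<one>\<^bsub>Fs n\<^esub>"
proof -
  assume x: "x \<in> carrier (Fs n)" "x \<noteq> \<zero>\<^bsub>Fs n\<^esub>"
  interpret F: field "Fs n" by (rule field_Fs)
  show ?thesis using x by (simp add: F.field_Units)
qed

lemma zero_neq_one_Fs [simp]: "\<zero>\<^bsub>Fs n\<^esub> \<noteq> \<one>\<^bsub>Fs n\<^esub>" "\<one>\<^bsub>Fs n\<^esub> \<noteq> \<zero>\<^bsub>Fs n\<^esub>"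
  using domain.one_not_zero[OF field.axioms(1)[OF field_Fs[of n]]] by auto

quotient_type upf = "nat \<Rightarrow> nat" / "\<lambda>f g. eventually (\<lambda>n. nf n (f n) = nf n (g n)) ultra"
proof (rule equivpI)
  show "reflp (\<lambda>f g. eventually (\<lambda>n. nf n (f n) = nf n (g n)) ultra)" by (simp add: reflp_def)
  show "symp (\<lambda>f g. eventually (\<lambda>n. nf n (f n) = nf n (g n)) ultra)" by (simp add: symp_def eq_commute)
  show "transp (\<lambda>f g. eventually (\<lambda>n. nf n (f n) = nf n (g n)) ultra)"
    unfolding transp_def by (intro allI impI) (erule (1) eventually_elim2, simp)
qed

lift_definition kc :: "(nat \<Rightarrow> nat) \<Rightarrow> upf" is "\<lambda>f. f" .

instantiation upf :: field
begin
lift_definition zero_upf :: upf is "\<lambda>n. \<zero>\<^bsub>Fs n\<^esub>" .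
lift_definition one_upf :: upf is "\<lambda>n. \<one>\<^bsub>Fs n\<^esub>" .
lift_definition plus_upf :: "upf \<Rightarrow> upf \<Rightarrow> upf" is "\<lambda>f g n. nf n (f n) \<oplus>\<^bsub>Fs n\<^esub> nf n (g n)"
  by (erule (1) eventually_elim2) simp
lift_definition times_upf :: "upf \<Rightarrow> upf \<Rightarrow> upf" is "\<lambda>f g n. nf n (f n) \<otimes>\<^bsub>Fs n\<^esub> nf n (g n)"
  by (erule (1) eventually_elim2) simp
lift_definition minus_upf :: "upf \<Rightarrow> upf \<Rightarrow> upf" is "\<lambda>f g n. nf n (f n) \<ominus>\<^bsub>Fs n\<^esub> nf n (g n)"
  by (erule (1) eventually_elim2) simp
lift_definition uminus_upf :: "upf \<Rightarrow> upf" is "\<lambda>f n. \<ominus>\<^bsub>Fs n\<^esub> nf n (f n)"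
  by (erule eventually_mono) simp
lift_definition inverse_upf :: "upf \<Rightarrow> upf" is
  "\<lambda>f n. if nf n (f n) = \<zero>\<^bsub>Fs n\<^esub> then \<zero>\<^bsub>Fs n\<^esub> else inv\<^bsub>Fs n\<^esub> (nf n (f n))"
  by (erule eventually_mono) simp
definition divide_upf :: "upf \<Rightarrow> upf \<Rightarrow> upf" where "divide_upf x y = x * inverse y"
instance
proof
  fix a b c :: upf
  show "a * b * c = a * (b * c)" by transfer (simp add: FF.m_assoc)
  show "a * b = b * a" by transfer (simp add: FF.m_comm)
  show "1 * a = a" by transfer simp
  show "a + b + c = a + (b + c)" by transfer (simp add: FF.a_assoc)
  show "a + b = b + a" by transfer (simp add: FF.a_comm)
  show "0 + a = a" by transfer simp
  show "- a + a = 0" by transfer (simp add: FF.l_neg)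
  show "a - b = a + - b" by transfer (simp add: FF.minus_eq)
  show "(a + b) * c = a * c + b * c" by transfer (simp add: FF.l_distr)
  show "(0 :: upf) \<noteq> 1" by transfer (simp add: ultra_neq_bot trivial_limit_def[symmetric])
  show "a \<noteq> 0 \<Longrightarrow> inverse a * a = 1"
    by transfer (auto simp: ultra_not[symmetric] field_inv elim!: eventually_mono)
  show "a div b = a * inverse b" by (simp add: divide_upf_def)
  show "inverse (0 :: upf) = 0" by transfer simp
qed
end

lemma kc_arith:
  assumes "\<And>n. f n \<in> carrier (Fs n)" "\<And>n. g n \<in> carrier (Fs n)"
  shows kc_add: "kc f + kc g = kc (\<lambda>n. f n \<oplus>\<^bsub>Fs n\<^esub> g n)"
    and kc_mult: "kc f * kc g = kc (\<lambda>n. f n \<otimes>\<^bsub>Fs n\<^esub> g n)"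
    and kc_diff: "kc f - kc g = kc (\<lambda>n. f n \<ominus>\<^bsub>Fs n\<^esub> g n)"
    and kc_eq: "kc f = kc g \<longleftrightarrow> eventually (\<lambda>n. f n = g n) ultra"
  using assms by (transfer; simp)+

lemma kc_uminus: "(\<And>n. f n \<in> carrier (Fs n)) \<Longrightarrow> - kc f = kc (\<lambda>n. \<ominus>\<^bsub>Fs n\<^esub> f n)"
  by (transfer; simp)

lemma kc_1: "kc (\<lambda>n. \<one>\<^bsub>Fs n\<^esub>) = 1" and kc_0: "kc (\<lambda>n. \<zero>\<^bsub>Fs n\<^esub>) = 0"
  by (transfer; simp)+

lemma kc_eq_0: "(\<And>n. f n \<in> carrier (Fs n)) \<Longrightarrow> kc f = 0 \<longleftrightarrow> eventually (\<lambda>n. f n = \<zero>\<^bsub>Fs n\<^esub>) ultra"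
  using kc_eq[of f "\<lambda>n. \<zero>\<^bsub>Fs n\<^esub>"] by (simp add: kc_0)

lemma kc_surj: "\<exists>f. (\<forall>n. f n \<in> carrier (Fs n)) \<and> x = kc f"
proof (transfer)
  fix x :: "nat \<Rightarrow> nat"
  show "\<exists>f. (\<forall>n. f n \<in> carrier (Fs n)) \<and> eventually (\<lambda>n. nf n (x n) = nf n (f n)) ultra"
    by (rule exI[of _ "\<lambda>n. nf n (x n)"]) simp
qed

abbreviation "fdot n \<equiv> cring.rdot (Fs n)"
abbreviation "fcross n \<equiv> cring.rcross (Fs n)"
abbreviation "fdet n \<equiv> cring.rdet (Fs n)"
abbreviation "fzero n \<equiv> cring.zero3 (Fs n)"
abbreviation "fV n \<equiv> cring.V3 (Fs n)"

definition vk :: "(nat \<Rightarrow> nat vec3) \<Rightarrow> upf vec3" where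
  "vk x = (kc (\<lambda>n. fst (x n)), kc (\<lambda>n. fst (snd (x n))), kc (\<lambda>n. snd (snd (x n))))"

lemma fV_comp: "x \<in> fV n \<Longrightarrow> fst x \<in> carrier (Fs n)" "x \<in> fV n \<Longrightarrow> fst (snd x) \<in> carrier (Fs n)"
  "x \<in> fV n \<Longrightarrow> snd (snd x) \<in> carrier (Fs n)"
  by (auto simp: FF.V3_def)

lemma vk_dot:
  assumes "\<And>n. x n \<in> fV n" "\<And>n. y n \<in> fV n"
  shows "vdot (vk x) (vk y) = kc (\<lambda>n. fdot n (x n) (y n))"
  unfolding vdot_def vk_def FF.rdot_def using fV_comp[OF assms(1)] fV_comp[OF assms(2)]
  by (simp add: kc_mult kc_add)

lemma vk_cross:
  assumes "\<And>n. x n \<in> fV n" "\<And>n. y n \<in> fV n"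
  shows "vcross (vk x) (vk y) = vk (\<lambda>n. fcross n (x n) (y n))"
  unfolding vcross_def vk_def FF.rcross_def using fV_comp[OF assms(1)] fV_comp[OF assms(2)]
  by (simp add: kc_mult kc_diff)

lemma vk_det:
  assumes "\<And>n. x n \<in> fV n" "\<And>n. y n \<in> fV n" "\<And>n. z n \<in> fV n"
  shows "vdet (vk x) (vk y) (vk z) = kc (\<lambda>n. fdet n (x n) (y n) (z n))"
  unfolding vdet_def FF.rdet_def vk_cross[OF assms(1,2)] by (rule vk_dot) (use assms FF.rvec_closed in auto)

lemma vk_eq_0:
  assumes "\<And>n. x n \<in> fV n"
  shows "vk x = 0 \<longleftrightarrow> eventually (\<lambda>n. x n = fzero n) ultra"
  unfolding vk_def zero_prod_def prod.inject using fV_comp[OF assms]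
  by (simp add: kc_eq_0 eventually_conj_iff[symmetric] FF.zero3_def prod_eq_iff)

lemma vk_surj: "\<exists>f. (\<forall>n. f n \<in> fV n) \<and> x = vk f"
proof -
  obtain f g h where "\<forall>n. f n \<in> carrier (Fs n)" "fst x = kc f" "\<forall>n. g n \<in> carrier (Fs n)" "fst (snd x) = kc g"
    "\<forall>n. h n \<in> carrier (Fs n)" "snd (snd x) = kc h"
    using kc_surj[of "fst x"] kc_surj[of "fst (snd x)"] kc_surj[of "snd (snd x)"] by blast
  then show ?thesis
    by (intro exI[of _ "\<lambda>n. (f n, g n, h n)"]) (simp add: vk_def FF.V3_def prod_eq_iff)
qed

lemma kc_prod:
  fixes f :: "nat \<Rightarrow> nat \<Rightarrow> nat"
  assumes "\<And>n j. f j n \<in> carrier (Fs n)"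
  shows "(\<Prod>j<d. kc (f j)) = kc (\<lambda>n. finprod (Fs n) (\<lambda>j. f j n) {..<d})"
proof (induction d)
  case (Suc d)
  have c: "finprod (Fs n) (\<lambda>j. f j n) {..<d} \<in> carrier (Fs n)" for n by (rule FF.finprod_closed) (use assms in auto)
  have "finprod (Fs n) (\<lambda>j. f j n) {..<Suc d} = finprod (Fs n) (\<lambda>j. f j n) {..<d} \<otimes>\<^bsub>Fs n\<^esub> f d n" for n
    unfolding lessThan_Suc using FF.finprod_insert[of "{..<d}" d "\<lambda>j. f j n" n] assms c[of n] by (simp add: Pi_def FF.m_comm)
  then show ?case using Suc kc_mult[of "\<lambda>n. finprod (Fs n) (\<lambda>j. f j n) {..<d}" "f d"] c assms by simp
qed (simp add: kc_1)

text \<open>An ultrafilter cannot avoid each of finitely many values. The application is to the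
  degrees of the low points, which are at most 16.\<close>

lemma ultra_bounded_const:
  assumes "\<And>n. d n \<le> (m :: nat)"
  shows "\<exists>e. eventually (\<lambda>n. d n = e) ultra"
proof (rule ccontr)
  assume "\<not> ?thesis"
  then have "eventually (\<lambda>n. d n \<noteq> e) ultra" for e unfolding ultra_not by blast
  then have "eventually (\<lambda>n. \<forall>e\<in>{..m}. d n \<noteq> e) ultra" by (subst eventually_ball_finite_distrib) auto
  then have "eventually (\<lambda>n. False) ultra" by (rule eventually_mono) (use assms in auto)
  then show False using ultra_neq_bot by (simp add: trivial_limit_def)
qed

lemma (in segre) witness_odd_secants:
  assumes "real (card (odd_secants R S)) < 2 * real (card (carrier R)) - real n"
  shows "\<exists>v t s B. vcert (n div 6) v t s \<and> B \<subseteq> V3 \<and> (\<forall>p\<in>B. \<exists>d g k ex. d \<le> 16 \<and> vlow (n div 6) v t s p d g k ex) \<and>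
    (n \<ge> 18 \<longrightarrow> \<not> (\<exists>M. symmetric_form M \<and> (\<forall>p\<in>B. rbil M p p = \<zero>)))"
proof -
  have "odd_lines = odd_secants R S" by (simp add: odd_lines_def line_deg_def odd_secants_def)
  then show ?thesis using witness assms by simp
qed

definition witness_at :: "nat \<Rightarrow> (nat \<Rightarrow> nat vec3) \<Rightarrow> (nat \<Rightarrow> nat vec3) \<Rightarrow> (nat \<Rightarrow> nat vec3) \<Rightarrow> nat vec3 set \<Rightarrow> bool" where
  "witness_at n v t s B \<longleftrightarrow> cring.vcert (Fs n) (n div 6) v t s \<and> B \<subseteq> fV n \<and>
    (\<forall>p\<in>B. \<exists>d g k ex. d \<le> 16 \<and> cring.vlow (Fs n) (n div 6) v t s p d g k ex) \<and>
    (n \<ge> 18 \<longrightarrow> \<not> (\<exists>M. cring.symmetric_form (Fs n) M \<and> (\<forall>p\<in>B. cring.rbil (Fs n) M p p = \<zero>\<^bsub>Fs n\<^esub>)))"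

lemma kc_nonzero:
  "(\<And>n. f n \<in> carrier (Fs n)) \<Longrightarrow> eventually (\<lambda>n. f n \<noteq> \<zero>\<^bsub>Fs n\<^esub>) ultra \<Longrightarrow> kc f \<noteq> 0"
  using kc_eq_0[of f] ultra_not[of "\<lambda>n. f n = \<zero>\<^bsub>Fs n\<^esub>"] by simp

lemma fdot_closed [simp]: "x \<in> fV n \<Longrightarrow> y \<in> fV n \<Longrightarrow> fdot n x y \<in> carrier (Fs n)"
  by (rule FF.rvec_closed)

lemma fprod_closed: "(\<And>j. g j \<in> fV n) \<Longrightarrow> x \<in> fV n \<Longrightarrow> cring.fprod (Fs n) d g x \<in> carrier (Fs n)"
  unfolding FF.fprod_def by (rule FF.finprod_closed) auto

lemma vk_fprod:
  assumes "\<And>n j. g n j \<in> fV n" "\<And>n. x n \<in> fV n"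
  shows "(\<Prod>j<d. vdot (vk (\<lambda>n. g n j)) (vk x)) = kc (\<lambda>n. cring.fprod (Fs n) d (g n) (x n))"
proof -
  have "(\<Prod>j<d. vdot (vk (\<lambda>n. g n j)) (vk x)) = (\<Prod>j<d. kc (\<lambda>n. fdot n (g n j) (x n)))"
    using assms by (simp add: vk_dot)
  also have "\<dots> = kc (\<lambda>n. finprod (Fs n) (\<lambda>j. fdot n (g n j) (x n)) {..<d})"
    by (rule kc_prod) (use assms in simp)
  finally show ?thesis by (simp add: FF.fprod_def)
qed

lemma fV_triple: "x \<in> carrier (Fs n) \<Longrightarrow> y \<in> carrier (Fs n) \<Longrightarrow> z \<in> carrier (Fs n) \<Longrightarrow> (x, y, z) \<in> fV n"
  by (simp add: FF.V3_def)

lemma rmulv_closed: "a \<in> fV n \<Longrightarrow> b \<in> fV n \<Longrightarrow> c \<in> fV n \<Longrightarrow> y \<in> fV n \<Longrightarrow> cring.rmulv (Fs n) (a, b, c) y \<in> fV n"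
  unfolding FF.rmulv_def by (rule fV_triple) simp_all

lemma vk_bil:
  assumes M: "fst M = vk a" "fst (snd M) = vk b" "snd (snd M) = vk c"
    and V: "\<And>n. a n \<in> fV n" "\<And>n. b n \<in> fV n" "\<And>n. c n \<in> fV n" "\<And>n. x n \<in> fV n" "\<And>n. y n \<in> fV n"
  shows "bil M (vk x) (vk y) = kc (\<lambda>n. cring.rbil (Fs n) (a n, b n, c n) (x n) (y n))"
proof -
  have m: "cring.rmulv (Fs n) (a n, b n, c n) (y n) \<in> fV n" for n
    by (rule rmulv_closed) (rule V)+
  have "mulv M (vk y) = vk (\<lambda>n. cring.rmulv (Fs n) (a n, b n, c n) (y n))"
    unfolding mulv_def M using V by (simp add: vk_dot FF.rmulv_def) (simp add: vk_def)
  then show ?thesis unfolding bil_def FF.rbil_def using vk_dot[OF V(4) m] by simp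
qed

lemma ultra_index: "eventually (\<lambda>n. i < n div 6) ultra"
proof (rule eventually_mono[OF ultra_ge[of "6 * i + 6"]])
  fix n assume "6 * i + 6 \<le> n"
  then have "(6 * i + 6) div 6 \<le> n div 6" by (rule div_le_mono)
  then show "i < n div 6" by simp
qed

text \<open>The coefficients of the conic in the ultraproduct are represented by sequences
  \<open>a\<close>, \<open>b\<close>, \<open>c\<close>. For almost every index they form a
  nondegenerate symmetric form whose conic contains \<open>B n\<close>, against the witness once n
  is at least 18. The two universal statements among these are obtained by choosing a violation at
  each index where there is one and passing to its class.\<close>

theorem no_counterexamples:
  assumes all: "\<And>n. \<exists>G S. cex n G S"
  shows False
proof -
  have "\<exists>S. cex n (Fs n) S" for n using Fs[of n] all[of n] by blast
  then have seg: "\<exists>S. segre (Fs n) S \<and> real (card (odd_secants (Fs n) S)) < 2 * real (card (carrier (Fs n))) - real n" for n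
    unfolding cex_def .
  have "\<exists>v t s B. witness_at n v t s B" for n
    using seg[of n] segre.witness_odd_secants[of "Fs n" _ n] unfolding witness_at_def by (elim exE conjE) blast
  then have "\<forall>n. \<exists>x. witness_at n (fst x) (fst (snd x)) (fst (snd (snd x))) (snd (snd (snd x)))" by simp
  then obtain x where "\<forall>n. witness_at n (fst (x n)) (fst (snd (x n))) (fst (snd (snd (x n)))) (snd (snd (snd (x n))))"
    by (rule choice[THEN exE])
  then obtain v t s B where w: "\<And>n. witness_at n (v n) (t n) (s n) (B n)"
    using that[of "\<lambda>n. fst (x n)" "\<lambda>n. fst (snd (x n))" "\<lambda>n. fst (snd (snd (x n)))" "\<lambda>n. snd (snd (snd (x n)))"] by blast
  have cert: "cring.vcert (Fs n) (n div 6) (v n) (t n) (s n)" and BV: "B n \<subseteq> fV n"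
    and lowB: "\<And>p. p \<in> B n \<Longrightarrow> \<exists>d g k ex. d \<le> 16 \<and> cring.vlow (Fs n) (n div 6) (v n) (t n) (s n) p d g k ex"
    and noM: "n \<ge> 18 \<Longrightarrow> \<not> (\<exists>M. cring.symmetric_form (Fs n) M \<and> (\<forall>p\<in>B n. cring.rbil (Fs n) M p p = \<zero>\<^bsub>Fs n\<^esub>))" for n
    using w[of n] unfolding witness_at_def by blast+
  note cc = cert[unfolded FF.vcert_def]
  have V [simp]: "v n i \<in> fV n" "t n i \<in> fV n" "s n i \<in> fV n" and self: "fdot n (t n i) (v n i) = \<zero>\<^bsub>Fs n\<^esub>" "fdot n (s n i) (v n i) = \<zero>\<^bsub>Fs n\<^esub>" for n i
    using conjunct1[OF cc[of n], rule_format, of i] by simp_all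
  have cr: "fcross n (t n i) (s n i) \<noteq> fzero n" if "i < n div 6" for n i
    using conjunct1[OF conjunct2[OF cc[of n]], rule_format, OF that] .
  have nz: "fdot n (t n i) (v n j) \<noteq> \<zero>\<^bsub>Fs n\<^esub>" "fdot n (s n i) (v n j) \<noteq> \<zero>\<^bsub>Fs n\<^esub>" if "i < n div 6" "j < n div 6" "i \<noteq> j" for n i j
    using conjunct1[OF conjunct2[OF conjunct2[OF cc[of n]]], rule_format, OF that] by simp_all
  note tri = conjunct2[OF conjunct2[OF conjunct2[OF cc]], rule_format]
  define vv where "vv i = vk (\<lambda>n. v n i)" for i
  define tt where "tt i = vk (\<lambda>n. t n i)" for i
  define ss where "ss i = vk (\<lambda>n. s n i)" for i
  have dot: "vdot (tt i) (vv j) = kc (\<lambda>n. fdot n (t n i) (v n j))" "vdot (ss i) (vv j) = kc (\<lambda>n. fdot n (s n i) (v n j))" for i j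
    unfolding vv_def tt_def ss_def by (rule vk_dot; simp)+
  have "\<exists>M. (\<forall>u w. bil M u w = bil M w u) \<and> vdet (fst M) (fst (snd M)) (snd (snd M)) \<noteq> 0 \<and>
    (\<forall>p E d g k. raw_low vv tt ss p E d g k \<longrightarrow> bil M p p = 0)"
  proof (rule raw_conic)
    have "\<one>\<^bsub>Fs n\<^esub> \<oplus>\<^bsub>Fs n\<^esub> \<one>\<^bsub>Fs n\<^esub> \<noteq> \<zero>\<^bsub>Fs n\<^esub>" for n using seg[of n] segre.two_neq_zero by blast
    then have "kc (\<lambda>n. \<one>\<^bsub>Fs n\<^esub> \<oplus>\<^bsub>Fs n\<^esub> \<one>\<^bsub>Fs n\<^esub>) \<noteq> 0" by (intro kc_nonzero) simp_all
    then have "(1 :: upf) + 1 \<noteq> 0" unfolding kc_1[symmetric] by (simp add: kc_add)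
    then show "(2 :: upf) \<noteq> 0" by simp
    show "vdot (tt i) (vv i) = 0" "vdot (ss i) (vv i) = 0" for i unfolding dot self by (rule kc_0)+
    show "vdot (tt i) (vv j) \<noteq> 0" "vdot (ss i) (vv j) \<noteq> 0" if "i \<noteq> j" for i j
      unfolding dot
      by (rule kc_nonzero, simp, rule eventually_mono[OF eventually_conj[OF ultra_index[of i] ultra_index[of j]]], use nz that in blast)+
    show "vcross (tt i) (ss i) \<noteq> 0" for i
    proof -
      have c: "fcross n (t n i) (s n i) \<in> fV n" for n by (rule FF.rvec_closed) simp_all
      have "eventually (\<lambda>n. \<not> fcross n (t n i) (s n i) = fzero n) ultra"
        by (rule eventually_mono[OF ultra_index[of i]]) (use cr in blast)
      then show ?thesis unfolding tt_def ss_def ultra_not by (simp add: vk_cross vk_eq_0 c)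
    qed
    show "vdet (vv i) (vv j) (vv k) \<noteq> 0" if "i \<noteq> j" "i \<noteq> k" "j \<noteq> k" for i j k
    proof -
      have "vdet (vv i) (vv j) (vv k) = kc (\<lambda>n. fdet n (v n i) (v n j) (v n k))" unfolding vv_def by (rule vk_det; simp)
      also have "\<dots> \<noteq> 0"
        by (rule kc_nonzero, rule FF.rvec_closed, simp, simp, simp,
            rule eventually_mono[OF eventually_conj[OF ultra_index[of i] eventually_conj[OF ultra_index[of j] ultra_index[of k]]]],
            use tri that in blast)
      finally show ?thesis .
    qed
    show "(vdot (tt i) (vv k) * vdot (ss i) (vv j)) * (vdot (tt j) (vv i) * vdot (ss j) (vv k)) * (vdot (tt k) (vv j) * vdot (ss k) (vv i)) =
      - ((vdot (tt i) (vv j) * vdot (ss i) (vv k)) * (vdot (tt j) (vv k) * vdot (ss j) (vv i)) * (vdot (tt k) (vv i) * vdot (ss k) (vv j)))"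
      if "i \<noteq> j" "j \<noteq> k" "k \<noteq> i" for i j k
    proof -
      have "eventually (\<lambda>n. (fdot n (t n i) (v n k) \<otimes>\<^bsub>Fs n\<^esub> fdot n (s n i) (v n j)) \<otimes>\<^bsub>Fs n\<^esub>
          (fdot n (t n j) (v n i) \<otimes>\<^bsub>Fs n\<^esub> fdot n (s n j) (v n k)) \<otimes>\<^bsub>Fs n\<^esub> (fdot n (t n k) (v n j) \<otimes>\<^bsub>Fs n\<^esub> fdot n (s n k) (v n i)) =
        \<ominus>\<^bsub>Fs n\<^esub> ((fdot n (t n i) (v n j) \<otimes>\<^bsub>Fs n\<^esub> fdot n (s n i) (v n k)) \<otimes>\<^bsub>Fs n\<^esub>
          (fdot n (t n j) (v n k) \<otimes>\<^bsub>Fs n\<^esub> fdot n (s n j) (v n i)) \<otimes>\<^bsub>Fs n\<^esub> (fdot n (t n k) (v n i) \<otimes>\<^bsub>Fs n\<^esub> fdot n (s n k) (v n j)))) ultra"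
        by (rule eventually_mono[OF eventually_conj[OF ultra_index[of i] eventually_conj[OF ultra_index[of j] ultra_index[of k]]]])
          (use tri that in blast)
      then show ?thesis unfolding dot by (simp add: kc_mult kc_uminus kc_eq)
    qed
  qed
  then obtain M where M0: "\<forall>u w. bil M u w = bil M w u" "vdet (fst M) (fst (snd M)) (snd (snd M)) \<noteq> 0"
    "\<forall>p E d g k. raw_low vv tt ss p E d g k \<longrightarrow> bil M p p = 0" by (elim exE conjE) (rule that)
  note M = M0(1)[THEN spec, THEN spec] M0(2) M0(3)[THEN spec, THEN spec, THEN spec, THEN spec, THEN spec, THEN mp]
  obtain a b c where abc: "\<forall>n. a n \<in> fV n" "fst M = vk a" "\<forall>n. b n \<in> fV n" "fst (snd M) = vk b" "\<forall>n. c n \<in> fV n" "snd (snd M) = vk c"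
    using vk_surj[of "fst M"] vk_surj[of "fst (snd M)"] vk_surj[of "snd (snd M)"] by (elim exE conjE) (rule that)
  have abcV [simp]: "a n \<in> fV n" "b n \<in> fV n" "c n \<in> fV n" for n using abc(1,3,5) by simp_all
  define m where "m n = (a n, b n, c n)" for n
  have bilM: "bil M (vk f) (vk g) = kc (\<lambda>n. cring.rbil (Fs n) (m n) (f n) (g n))" if "\<And>n. f n \<in> fV n" "\<And>n. g n \<in> fV n" for f g
    unfolding m_def by (rule vk_bil[OF abc(2,4,6)]) (simp_all add: that)
  have rbc: "cring.rbil (Fs n) (m n) y z \<in> carrier (Fs n)" if "y \<in> fV n" "z \<in> fV n" for n y z
    unfolding FF.rbil_def m_def by (rule fdot_closed[OF that(1) rmulv_closed[OF _ _ _ that(2)]]) simp_all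
  have zV: "fzero n \<in> fV n" for n by (rule FF.rvec_closed)
  have det: "eventually (\<lambda>n. fdet n (a n) (b n) (c n) \<noteq> \<zero>\<^bsub>Fs n\<^esub>) ultra"
  proof -
    have e: "vdet (fst M) (fst (snd M)) (snd (snd M)) = kc (\<lambda>n. fdet n (a n) (b n) (c n))"
      unfolding abc(2,4,6) by (rule vk_det; simp)
    have "fdet n (a n) (b n) (c n) \<in> carrier (Fs n)" for n by (rule FF.rvec_closed; simp)
    then show ?thesis using M(2) unfolding e ultra_not by (simp add: kc_eq_0)
  qed
  have sym: "eventually (\<lambda>n. \<forall>u\<in>fV n. \<forall>w\<in>fV n. cring.rbil (Fs n) (m n) u w = cring.rbil (Fs n) (m n) w u) ultra" (is "eventually ?sym ultra")
  proof (rule ccontr)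
    assume n: "\<not> ?thesis"
    \<comment> \<open>At indices where symmetry holds any pair of vectors will do, which keeps the
      choice total.\<close>
    define bad where "bad n y \<longleftrightarrow> fst y \<in> fV n \<and> snd y \<in> fV n \<and>
      (\<not> ?sym n \<longrightarrow> cring.rbil (Fs n) (m n) (fst y) (snd y) \<noteq> cring.rbil (Fs n) (m n) (snd y) (fst y))" for n y
    have "\<exists>y. bad n y" for n
    proof (cases "?sym n")
      case True
      then show ?thesis unfolding bad_def by (intro exI[of _ "(fzero n, fzero n)"]) (simp add: zV)
    next
      case False
      then obtain u w where "u \<in> fV n" "w \<in> fV n" "cring.rbil (Fs n) (m n) u w \<noteq> cring.rbil (Fs n) (m n) w u" by blast
      then show ?thesis unfolding bad_def by (intro exI[of _ "(u, w)"]) simp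
    qed
    then have "\<forall>n. \<exists>y. bad n y" by (rule allI)
    then obtain y where y: "\<forall>n. bad n (y n)" by (rule choice[THEN exE])
    have yV: "fst (y n) \<in> fV n" "snd (y n) \<in> fV n" for n using y[rule_format, of n] by (simp_all add: bad_def)
    have "kc (\<lambda>n. cring.rbil (Fs n) (m n) (fst (y n)) (snd (y n))) = kc (\<lambda>n. cring.rbil (Fs n) (m n) (snd (y n)) (fst (y n)))"
      using M(1)[of "vk (\<lambda>n. fst (y n))" "vk (\<lambda>n. snd (y n))"] yV by (simp add: bilM)
    then have "eventually (\<lambda>n. cring.rbil (Fs n) (m n) (fst (y n)) (snd (y n)) = cring.rbil (Fs n) (m n) (snd (y n)) (fst (y n))) ultra"
      using kc_eq rbc yV by simp
    then have "eventually ?sym ultra"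
    proof (rule eventually_mono)
      fix n assume e: "cring.rbil (Fs n) (m n) (fst (y n)) (snd (y n)) = cring.rbil (Fs n) (m n) (snd (y n)) (fst (y n))"
      show "?sym n"
      proof (rule ccontr)
        assume "\<not> ?sym n"
        then show False using y[rule_format, of n, unfolded bad_def] e by blast
      qed
    qed
    then show False using n by blast
  qed
  have low: "eventually (\<lambda>n. \<forall>p\<in>B n. cring.rbil (Fs n) (m n) p p = \<zero>\<^bsub>Fs n\<^esub>) ultra" (is "eventually ?low ultra")
  proof (rule ccontr)
    assume n: "\<not> ?thesis"
    then have nlow: "eventually (\<lambda>n. \<not> ?low n) ultra" unfolding ultra_not .
    \<comment> \<open>The same choice for a point of \<open>B n\<close> off the conic, together with
      the lines through it that \<open>vlow\<close> asks for.\<close>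
    define P where "P n y \<longleftrightarrow> (case y of (p, d, g, k, ex) \<Rightarrow> p \<in> fV n \<and> d \<le> 16 \<and> (\<forall>j. g j \<in> fV n \<and> k j \<in> fV n) \<and>
      (\<not> ?low n \<longrightarrow> cring.rbil (Fs n) (m n) p p \<noteq> \<zero>\<^bsub>Fs n\<^esub> \<and> cring.vlow (Fs n) (n div 6) (v n) (t n) (s n) p d g k ex))"
      for n and y :: "nat vec3 \<times> nat \<times> (nat \<Rightarrow> nat vec3) \<times> (nat \<Rightarrow> nat vec3) \<times> (nat \<Rightarrow> bool)"
    have "\<exists>y. P n y" for n
    proof (cases "?low n")
      case True
      then show ?thesis unfolding P_def
        by (intro exI[of _ "(fzero n, 0, \<lambda>_. fzero n, \<lambda>_. fzero n, \<lambda>_. False)"]) (simp add: zV)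
    next
      case False
      then obtain p where p: "p \<in> B n" "cring.rbil (Fs n) (m n) p p \<noteq> \<zero>\<^bsub>Fs n\<^esub>" by blast
      obtain d g k ex where l: "d \<le> 16" "cring.vlow (Fs n) (n div 6) (v n) (t n) (s n) p d g k ex"
        using lowB[OF p(1)] by (elim exE conjE) (rule that)
      have pV: "p \<in> fV n" using BV p(1) by blast
      have gk: "\<forall>j. g j \<in> fV n \<and> k j \<in> fV n" using conjunct1[OF l(2)[unfolded FF.vlow_def]] .
      show ?thesis unfolding P_def
        by (rule exI[of _ "(p, d, g, k, ex)"], unfold prod.case) (intro conjI impI pV l gk p(2))
    qed
    then have "\<forall>n. \<exists>y. P n y" by (rule allI)
    then obtain y where y: "\<forall>n. P n (y n)" by (rule choice[THEN exE])
    define p d g k ex where "p n = fst (y n)" "d n = fst (snd (y n))" "g n = fst (snd (snd (y n)))"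
      "k n = fst (snd (snd (snd (y n))))" "ex n = snd (snd (snd (snd (y n))))" for n
    have y': "p n \<in> fV n \<and> d n \<le> 16 \<and> (\<forall>j. g n j \<in> fV n \<and> k n j \<in> fV n) \<and>
      (\<not> ?low n \<longrightarrow> cring.rbil (Fs n) (m n) (p n) (p n) \<noteq> \<zero>\<^bsub>Fs n\<^esub> \<and> cring.vlow (Fs n) (n div 6) (v n) (t n) (s n) (p n) (d n) (g n) (k n) (ex n))" for n
      using y[rule_format, of n] unfolding P_def p_d_g_k_ex_def case_prod_beta .
    have pV [simp]: "p n \<in> fV n" "g n j \<in> fV n" "k n j \<in> fV n" and d16: "d n \<le> 16" for n j using y'[of n] by simp_all
    obtain e where e: "eventually (\<lambda>n. d n = e) ultra" using ultra_bounded_const[of d 16] d16 by blast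
    have L: "eventually (\<lambda>n. cring.vlow (Fs n) (n div 6) (v n) (t n) (s n) (p n) e (g n) (k n) (ex n)) ultra"
      by (rule eventually_mono[OF eventually_conj[OF nlow e]]) (use y' in blast)
    \<comment> \<open>The indices that stay exceptional in the limit. Two of them would be
      exceptional together at a single \<open>n\<close>, which \<open>vlow\<close> forbids.\<close>
    define E where "E = {i. eventually (\<lambda>n. ex n i) ultra}"
    have E1: "i = j" if "i \<in> E" "j \<in> E" for i j
    proof -
      have "eventually (\<lambda>n. ex n i) ultra" "eventually (\<lambda>n. ex n j) ultra" using that by (simp_all add: E_def)
      with L ultra_index[of i] ultra_index[of j] have "eventually (\<lambda>n. i = j) ultra"
        by eventually_elim (auto simp: FF.vlow_def)
      then show ?thesis using ultra_neq_bot by (simp add: eventually_const)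
    qed
    have "finite E"
    proof (cases "E = {}")
      case False
      then obtain i where "i \<in> E" by blast
      then have "E \<subseteq> {i}" using E1 by blast
      then show ?thesis using finite_subset by blast
    qed simp
    have notE: "eventually (\<lambda>n. \<not> ex n i) ultra" if "i \<notin> E" for i using that unfolding E_def ultra_not by simp
    have pr: "(\<Prod>j<e. vdot (vk (\<lambda>n. g n j)) (vv i)) = kc (\<lambda>n. cring.fprod (Fs n) e (g n) (v n i))"
      "(\<Prod>j<e. vdot (vk (\<lambda>n. k n j)) (vv i)) = kc (\<lambda>n. cring.fprod (Fs n) e (k n) (v n i))" for i
      unfolding vv_def by (rule vk_fprod; simp)+
    have fc [simp]: "cring.fprod (Fs n) e (g n) (v n i) \<in> carrier (Fs n)" "cring.fprod (Fs n) e (k n) (v n i) \<in> carrier (Fs n)" for n i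
      by (rule fprod_closed; simp)+
    have dp: "vdot (tt i) (vk p) = kc (\<lambda>n. fdot n (t n i) (p n))" "vdot (ss i) (vk p) = kc (\<lambda>n. fdot n (s n i) (p n))" for i
      unfolding tt_def ss_def by (rule vk_dot; simp)+
    have "raw_low vv tt ss (vk p) E e (\<lambda>j. vk (\<lambda>n. g n j)) (\<lambda>j. vk (\<lambda>n. k n j))"
      unfolding raw_low_def
    proof (intro conjI allI impI)
      show "finite E" by fact
      fix j assume j: "j < e"
      have "eventually (\<lambda>n. fdot n (g n j) (p n) = \<zero>\<^bsub>Fs n\<^esub>) ultra" "eventually (\<lambda>n. fdot n (k n j) (p n) = \<zero>\<^bsub>Fs n\<^esub>) ultra"
        by (rule eventually_mono[OF L], use j in \<open>simp add: FF.vlow_def\<close>)+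
      then show "vdot (vk (\<lambda>n. g n j)) (vk p) = 0" "vdot (vk (\<lambda>n. k n j)) (vk p) = 0" by (simp_all add: vk_dot kc_eq_0)
    next
      fix i assume i: "i \<notin> E"
      have A: "eventually (\<lambda>n. cring.fprod (Fs n) e (k n) (v n i) \<noteq> \<zero>\<^bsub>Fs n\<^esub> \<and> cring.fprod (Fs n) e (g n) (v n i) \<noteq> \<zero>\<^bsub>Fs n\<^esub> \<and>
          fdot n (t n i) (p n) \<noteq> \<zero>\<^bsub>Fs n\<^esub> \<and> fdot n (s n i) (p n) \<noteq> \<zero>\<^bsub>Fs n\<^esub>) ultra"
        using L notE[OF i] ultra_index[of i] by eventually_elim (simp add: FF.vlow_def)
      show "(\<Prod>j<e. vdot (vk (\<lambda>n. k n j)) (vv i)) \<noteq> 0" "(\<Prod>j<e. vdot (vk (\<lambda>n. g n j)) (vv i)) \<noteq> 0"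
        "vdot (tt i) (vk p) \<noteq> 0" "vdot (ss i) (vk p) \<noteq> 0"
        unfolding pr dp by (rule kc_nonzero, simp, rule eventually_mono[OF A], simp)+
    next
      fix i l assume h: "i \<notin> E" "l \<notin> E" "i \<noteq> l"
      have A: "eventually (\<lambda>n. (cring.fprod (Fs n) e (g n) (v n l) \<otimes>\<^bsub>Fs n\<^esub> cring.fprod (Fs n) e (k n) (v n i)) \<otimes>\<^bsub>Fs n\<^esub>
          (fdot n (t n i) (p n) \<otimes>\<^bsub>Fs n\<^esub> fdot n (s n i) (v n l)) \<otimes>\<^bsub>Fs n\<^esub> (fdot n (t n l) (v n i) \<otimes>\<^bsub>Fs n\<^esub> fdot n (s n l) (p n)) =
        \<ominus>\<^bsub>Fs n\<^esub> ((cring.fprod (Fs n) e (g n) (v n i) \<otimes>\<^bsub>Fs n\<^esub> cring.fprod (Fs n) e (k n) (v n l)) \<otimes>\<^bsub>Fs n\<^esub>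
          (fdot n (t n i) (v n l) \<otimes>\<^bsub>Fs n\<^esub> fdot n (s n i) (p n)) \<otimes>\<^bsub>Fs n\<^esub> (fdot n (t n l) (p n) \<otimes>\<^bsub>Fs n\<^esub> fdot n (s n l) (v n i)))) ultra"
        using L notE[OF h(1)] notE[OF h(2)] ultra_index[of i] ultra_index[of l]
        by eventually_elim (use h(3) in \<open>simp add: FF.vlow_def\<close>)
      show "((\<Prod>j<e. vdot (vk (\<lambda>n. g n j)) (vv l)) * (\<Prod>j<e. vdot (vk (\<lambda>n. k n j)) (vv i))) * (vdot (tt i) (vk p) * vdot (ss i) (vv l)) *
          (vdot (tt l) (vv i) * vdot (ss l) (vk p)) =
        - (((\<Prod>j<e. vdot (vk (\<lambda>n. g n j)) (vv i)) * (\<Prod>j<e. vdot (vk (\<lambda>n. k n j)) (vv l))) * (vdot (tt i) (vv l) * vdot (ss i) (vk p)) *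
          (vdot (tt l) (vk p) * vdot (ss l) (vv i)))"
        unfolding pr dp dot using A by (simp add: kc_mult kc_uminus kc_eq)
    qed
    from M(3)[OF this] have "kc (\<lambda>n. cring.rbil (Fs n) (m n) (p n) (p n)) = 0" by (simp add: bilM)
    then have "eventually (\<lambda>n. cring.rbil (Fs n) (m n) (p n) (p n) = \<zero>\<^bsub>Fs n\<^esub>) ultra" by (simp add: kc_eq_0 rbc)
    with nlow have "eventually (\<lambda>n. False) ultra" by eventually_elim (use y' in blast)
    then show False using ultra_neq_bot by (simp add: trivial_limit_def)
  qed
  have "eventually (\<lambda>n. n \<ge> 18 \<and> cring.symmetric_form (Fs n) (m n) \<and> (\<forall>p\<in>B n. cring.rbil (Fs n) (m n) p p = \<zero>\<^bsub>Fs n\<^esub>)) ultra"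
    using ultra_ge[of 18] det sym low by eventually_elim (simp add: FF.symmetric_form_def m_def)
  then obtain n where "n \<ge> 18" "cring.symmetric_form (Fs n) (m n)" "\<forall>p\<in>B n. cring.rbil (Fs n) (m n) p p = \<zero>\<^bsub>Fs n\<^esub>"
    using eventually_happens'[OF ultra_neq_bot] by blast
  then show False using noM by blast
qed

theorem theorem1:
  shows "\<exists>c :: real. \<forall>q :: nat. primepow q \<and> odd q \<longrightarrow>
    (\<forall>F :: nat ring. field F \<and> card (carrier F) = q \<longrightarrow>
      (\<forall>S. S \<subseteq> pg2_points F \<and> card S = q + 2 \<longrightarrow>
        real (card (odd_secants F S)) \<ge> 2 * real q - c))"
proof (rule ccontr)
  assume n: "\<not> ?thesis"
  have "\<exists>G S. cex n G S" for n
  proof -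
    obtain q :: nat and F :: "nat ring" and S where F: "odd q" "field F" "card (carrier F) = q" "S \<subseteq> pg2_points F" "card S = q + 2"
      "real (card (odd_secants F S)) < 2 * real q - real n"
      using n[unfolded not_ex, rule_format, of "real n"] unfolding not_all not_imp not_le by blast
    \<comment> \<open>An infinite carrier would have cardinality 0, which is not odd.\<close>
    have "finite (carrier F)" by (rule card_ge_0_finite) (use F(1,3) in \<open>auto elim: oddE\<close>)
    then have "segre F S"
      by (intro segre.intro fin_field.intro fin_field_axioms.intro segre_axioms.intro) (use F in simp_all)
    then show ?thesis using F unfolding cex_def by blast
  qed
  then show False by (rule no_counterexamples)
qed

end
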